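(* The categories $\mathrm{VSA}_2(\varphi^+,\varphi^-)$, $\mathrm{VSA}_2(\varphi^{(1)},\varphi^{(2)})$, $\mathrm{VSA}_2(\varphi)$, and $\mathrm{VSA}_2$ are all isomorphic to each other. In addition, for any $c\in\mathbb{C}$, the subcategories $\mathrm{VOSA}_2(\varphi^+,\varphi^-,c)$, $\mathrm{VOSA}_2(\varphi^{(1)},\varphi^{(2)},c)$, $\mathrm{VOSA}_2(\varphi,c)$ and $\mathrm{VOSA}_2(c)$ are all isomorphic to each other.
   Context: Grassmann algebra: $\bigwedge_L$ ($L\in\mathbb{N}$) is the exterior algebra over $\mathbb{C}$ on $L$ generators, $\bigwedge_L\subset\bigwedge_{L+1}$, $\bigwedge_\infty=\bigcup_L\bigwedge_L$; $\bigwedge_*$ is one of these, with even and odd parts $\bigwedge_*^0,\bigwedge_*^1$. For $V=V^0\oplus V^1$ write $\eta(v)=j$ if $v\in V^j$; $[A,B]=AB-(-1)^{\eta(A)\eta(B)}BA$ is the supercommutator. Variables $x,x_0,x_1,x_2$ are even (commute with everything); all variables $\varphi,\varphi_i,\varphi^\pm,\varphi_i^\pm,\varphi^{(j)},\varphi^{(j)}_i$ are odd (commute with even variables and even elements; anticommute with each other, with $\bigwedge_*^1$ and with odd endomorphisms; squares vanish). $\delta(x)=\sum_{n\in\mathbb{Z}}x^n$; products of odd variables are treated by Taylor expansion about the even variables, and powers of a sum of two even variables are expanded in nonnegative powers of the second one. Common vertex axioms. In each of the four settings an $N=2$ vertex superalgebra over $\bigwedge_*$ has a $\mathbb{Z}_2$-graded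 $\bigwedge_*$-module $V=V^0\oplus V^1$, a linear map $v\mapsto Y(v,X)$ and $\mathbf{1}\in V$, where $X$ is $(x,\varphi^+,\varphi^-)$, $(x,\varphi^{(1)},\varphi^{(2)})$, $(x,\varphi)$ or $x$ respectively, $Y(v,X)\in(\mathrm{End}\,V)[[x,x^{-1}]][\text{odd variables of }X]$, and $Y(v,X)$ has total parity $\eta(v)$ for homogeneous $v$ (the coefficients of the monomials of even degree in the odd variables have parity $\eta(v)$, those of odd degree parity $\eta(v)+1$). One requires: truncation, $Y(u,X)v\in V((x))[\text{odd variables}]$; vacuum, $Y(\mathbf{1},X)=\mathrm{id}_V$; creation, $Y(v,X)\mathbf{1}\in V[[x]][\text{odd variables}]$ with value $v$ at $X=0$; and, for homogeneous $u,v$, the Jacobi identity $$x_0^{-1}\delta\Big(\tfrac{x_1-x_2-\nu}{x_0}\Big)Y(u,X_1)Y(v,X_2)-(-1)^{\eta(u)\eta(v)}x_0^{-1}\delta\Big(\tfrac{x_2-x_1+\nu}{-x_0}\Big)Y(v,X_2)Y(u,X_1)=x_2^{-1}\delta\Big(\tfrac{x_1-x_0-\nu}{x_2}\Big)Y(Y(u,X_{0})v,X_2),$$ where $X_i$ has variables indexed by $i$ ($i=1,2$), $X_0$ has even variable $x_0$ and odd variables the differences of those of $X_1$ and $X_2$, and $\nu=\varphi_1^+\varphi_2^-+\varphi_1^-\varphi_2^+$, $\nu=\varphi_1^{(1)}\varphi_2^{(1)}+\varphi_1^{(2)}\varphi_2^{(2)}$, $\nu=\varphi_1\varphi_2$,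 $\nu=0$ respectively. Components: $Y(v,(x,\varphi^+,\varphi^-))=\sum_n(v_n+\varphi^+v^+_{n-1/2}+\varphi^-v^-_{n-1/2}+\varphi^+\varphi^-v^{+-}_{n-1})x^{-n-1}$; $Y(v,(x,\varphi^{(1)},\varphi^{(2)}))=\sum_n(v_n+\varphi^{(1)}v^{(1)}_{n-1/2}+\varphi^{(2)}v^{(2)}_{n-1/2}+\varphi^{(1)}\varphi^{(2)}v^{(1,2)}_{n-1})x^{-n-1}$; $Y(v,(x,\varphi))=\sum_n(v_n+\varphi v_{n-1/2})x^{-n-1}$; $Y(v,x)=\sum_nv_nx^{-n-1}$. Objects of $\mathrm{VSA}_2(\varphi^+,\varphi^-)$ ($N=2$ vertex superalgebras with two odd formal variables) and of $\mathrm{VSA}_2(\varphi^{(1)},\varphi^{(2)})$ (in the nonhomogeneous coordinate system): triples $(V,Y,\mathbf{1})$ satisfying the common axioms in the respective variables. Objects of $\mathrm{VSA}_2(\varphi)$ ($N=2$ vertex superalgebras with one odd formal variable): $(V,Y(\cdot,(x,\varphi)),\mathbf{1},\mathcal{D}^{(1)},\mathcal{D}^{(2)})$ satisfying the common axioms in variables $(x,\varphi)$, where $\mathcal{D}^{(1)}v=v_{-3/2}\mathbf{1}$ and $\mathcal{D}^{(2)}\in(\mathrm{End}\,V)^1$ satisfies $[\mathcal{D}^{(j)},\mathcal{D}^{(k)}]=2\delta_{j,k}\mathcal{D}$ with $\mathcal{D}=(\mathcal{D}^{(1)})^2$, and $[\mathcal{D}^{(2)},Y(v,(x,\varphi))]=Y(\mathcal{D}^{(2)}v,(x,\varphi))$.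 Objects of $\mathrm{VSA}_2$ ($N=2$ vertex superalgebras without odd formal variables): $(V,Y(\cdot,x),\mathbf{1},\mathcal{D}^+,\mathcal{D}^-)$ satisfying the common axioms in the variable $x$, where, with $\mathcal{D}(v)=v_{-2}\mathbf{1}$, $\mathcal{D}^\pm\in(\mathrm{End}\,V)^1$ satisfy $[\mathcal{D}^+,\mathcal{D}^-]=2\mathcal{D}$, $[\mathcal{D}^\pm,\mathcal{D}^\pm]=0$ and $[\mathcal{D}^\pm,Y(v,x)]=Y(\mathcal{D}^\pm v,x)$. Morphisms in the $\mathrm{VSA}$ categories are $\mathbb{Z}_2$-graded $\bigwedge_\infty$-module homomorphisms $\gamma:V_1\to V_2$ (objects over $\bigwedge_L$ being extended to $\bigwedge_\infty$) with $\gamma(Y_1(u,X)v)=Y_2(\gamma(u),X)\gamma(v)$, $\gamma(\mathbf{1}_1)=\mathbf{1}_2$, and compatible with the specified operators: $\gamma\mathcal{D}^{(j)}_1=\mathcal{D}^{(j)}_2\gamma$, resp. $\gamma\mathcal{D}^\pm_1=\mathcal{D}^\pm_2\gamma$, where these are part of the data. $N=2$ Neveu-Schwarz relations (for $m,n\in\mathbb{Z}$). Homogeneous: $[L(m),L(n)]=(m-n)L(m+n)+\frac1{12}(m^3-m)\delta_{m+n,0}c$, $[J(m),J(n)]=\frac13m\delta_{m+n,0}c$, $[L(m),J(n)]=-nJ(m+n)$, $[L(m),G^\pm(n+\frac12)]=(\frac m2-n-\frac12)G^\pm(m+n+\frac12)$, $[J(m),G^\pm(n+\frac12)]=\pm G^\pm(m+n+\frac12)$,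 $[G^\pm(m+\frac12),G^\pm(n+\frac12)]=0$, $[G^+(m+\frac12),G^-(n-\frac12)]=2L(m+n)+(m-n+1)J(m+n)+\frac13(m^2+m)\delta_{m+n,0}c$. Nonhomogeneous: the same relations among $L,J$, and for $j=1,2$: $[L(m),G^{(j)}(n+\frac12)]=(\frac m2-n-\frac12)G^{(j)}(m+n+\frac12)$, $[J(m),G^{(1)}(n+\frac12)]=-iG^{(2)}(m+n+\frac12)$, $[J(m),G^{(2)}(n+\frac12)]=iG^{(1)}(m+n+\frac12)$, $[G^{(j)}(m+\frac12),G^{(j)}(n-\frac12)]=2L(m+n)+\frac13(m^2+m)\delta_{m+n,0}c$, $[G^{(1)}(m+\frac12),G^{(2)}(n-\frac12)]=-i(m-n+1)J(m+n)$. $N=2$ Neveu-Schwarz vertex operator superalgebras of central charge $c$. In each setting $V=\coprod_{n\in\frac12\mathbb{Z}}V_{(n)}$ is a $\frac12\mathbb{Z}$-graded $\bigwedge_*$-module with each $V_{(n)}$ finite dimensional and $V_{(n)}=0$ for $n$ sufficiently negative, equipped with an $N=2$ vertex superalgebra structure of the corresponding kind and distinguished vectors such that $L(0)v=nv$ for $v\in V_{(n)}$, $V_{(n)}$ is a direct sum of eigenspaces of $J(0)$, and $J(0)v=kv$ with $0\ne v\in V_{(n)}$ implies $k\equiv2n\bmod2$; and additionally: - $\mathrm{VOSA}_2(\varphi^+,\varphi^-,c)$: $\mu\in V_{(1)}^0$ such that $J(n)=\mu_n$, $\mp G^\pm(n-\frac12)=\mu^\pm_{n-1/2}$, $-2L(n)=\mu^{+-}_n$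 satisfy the homogeneous relations, and $(\frac{\partial}{\partial\varphi^\pm}+\varphi^\mp\frac{\partial}{\partial x})Y(v,X)=Y(G^\pm(-\frac12)v,X)$. - $\mathrm{VOSA}_2(\varphi^{(1)},\varphi^{(2)},c)$: $\mu\in V_{(1)}^0$ such that $J(n)=\mu_n$, $iG^{(2)}(n-\frac12)=\mu^{(1)}_{n-1/2}$, $-iG^{(1)}(n-\frac12)=\mu^{(2)}_{n-1/2}$, $2iL(n)=\mu^{(1,2)}_n$ satisfy the nonhomogeneous relations, and $(\frac{\partial}{\partial\varphi^{(j)}}+\varphi^{(j)}\frac{\partial}{\partial x})Y(v,X)=Y(G^{(j)}(-\frac12)v,X)$, $j=1,2$. - $\mathrm{VOSA}_2(\varphi,c)$: $\tau^1,\tau^2\in V_{(3/2)}^1$ such that the nonhomogeneous relations hold for endomorphisms $L(n),J(n),G^{(j)}(n+\frac12)$ with $Y(\tau^1,(x,\varphi))=\sum_n(G^{(1)}(n+\frac12)+2\varphi L(n))x^{-n-2}$, $Y(\tau^2,(x,\varphi))=\sum_n(G^{(2)}(n+\frac12)+i(n+1)\varphi J(n))x^{-n-2}$, and $G^{(j)}(-\frac12)=\mathcal{D}^{(j)}$. - $\mathrm{VOSA}_2(c)$: $\tau^{(\pm)}\in V_{(3/2)}^1$ such that the homogeneous relations hold for endomorphisms $L(n),J(n),G^\pm(n-\frac12)$ with $Y(\tau^{(\pm)},x)=\sum_nG^\pm(n+\frac12)x^{-n-2}$, and $G^\pm(-\frac12)=\mathcal{D}^\pm$. Morphisms are vertex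 superalgebra morphisms preserving the distinguished vectors ($\gamma(\mu_1)=\mu_2$, resp. $\gamma(\tau^j_1)=\tau^j_2$, resp. $\gamma(\tau^{(\pm)}_1)=\tau^{(\pm)}_2$). *)

theory Defs
  imports
    Complex_Main
    "HOL-Library.Extended_Nat"
    "HOL-Library.FuncSet"
    "HOL-Library.Function_Algebras"
    "HOL-Library.Groups_Big_Fun"
begin

section \<open>Exterior algebras\<close>

text \<open>
  The exterior algebra over the complex numbers on generators indexed by a linear order:
  an element is given by its coefficients with respect to the monomials
  \<open>g\<^bsub>s1\<^esub> \<dots> g\<^bsub>sk\<^esub>\<close>, where \<open>s1 < \<dots> < sk\<close> are the elements of a finite set.
\<close>

typedef 'g grassmann =
  "{f :: 'g set \<Rightarrow> complex. finite {S. f S \<noteq> 0} \<and> (\<forall>S. f S \<noteq> 0 \<longrightarrow> finite S)}"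
  morphisms coeff Abs_grassmann
  by (rule exI[of _ "\<lambda>_. 0"]) simp

setup_lifting type_definition_grassmann

text \<open>
  Multiplying the monomial of \<open>A\<close> by the monomial of a disjoint set \<open>B\<close> gives the monomial
  of \<open>A \<union> B\<close> up to the parity of the following number of inversions.
\<close>

definition inversions :: "'g::linorder set \<Rightarrow> 'g set \<Rightarrow> nat" where
  "inversions A B = card {(a, b). a \<in> A \<and> b \<in> B \<and> b < a}"

lemma inversions_Un_left:
  assumes "finite A" "finite B" "finite C" "A \<inter> B = {}"
  shows "inversions (A \<union> B) C = inversions A C + inversions B C"
proof -
  let ?I = "\<lambda>A. {(a, b). a \<in> A \<and> b \<in> C \<and> b < a}"
  have "?I (A \<union> B) = ?I A \<union> ?I B" by auto
  moreover have "finite (?I A)"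
    by (rule finite_subset[of _ "A \<times> C"]) (use assms in auto)
  moreover have "finite (?I B)"
    by (rule finite_subset[of _ "B \<times> C"]) (use assms in auto)
  moreover have "?I A \<inter> ?I B = {}" using assms by auto
  ultimately show ?thesis unfolding inversions_def by (simp add: card_Un_disjoint)
qed

lemma inversions_Un_right:
  assumes "finite A" "finite B" "finite C" "A \<inter> B = {}"
  shows "inversions C (A \<union> B) = inversions C A + inversions C B"
proof -
  let ?I = "\<lambda>A. {(a, b). a \<in> C \<and> b \<in> A \<and> b < a}"
  have "?I (A \<union> B) = ?I A \<union> ?I B" by auto
  moreover have "finite (?I A)"
    by (rule finite_subset[of _ "C \<times> A"]) (use assms in auto)
  moreover have "finite (?I B)"
    by (rule finite_subset[of _ "C \<times> B"]) (use assms in auto)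
  moreover have "?I A \<inter> ?I B = {}" using assms by auto
  ultimately show ?thesis unfolding inversions_def by (simp add: card_Un_disjoint)
qed

lemma inversions_empty [simp]: "inversions {} B = 0" "inversions A {} = 0"
  by (simp_all add: inversions_def)

instantiation grassmann :: (linorder) ring_1
begin

lift_definition zero_grassmann :: "'a grassmann" is "\<lambda>_. 0" by simp

lift_definition one_grassmann :: "'a grassmann" is "\<lambda>S. if S = {} then 1 else 0" by simp

lift_definition plus_grassmann :: "'a grassmann \<Rightarrow> 'a grassmann \<Rightarrow> 'a grassmann"
  is "\<lambda>f g S. f S + g S"
proof (intro conjI, goal_cases)
  case (1 f g)
  then show ?case
    by (intro finite_subset[of "{S. f S + g S \<noteq> 0}" "{S. f S \<noteq> 0} \<union> {S. g S \<noteq> 0}"]) auto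
next
  case (2 f g)
  then show ?case by (metis add.right_neutral)
qed

lift_definition uminus_grassmann :: "'a grassmann \<Rightarrow> 'a grassmann" is "\<lambda>f S. - f S" by simp

lift_definition minus_grassmann :: "'a grassmann \<Rightarrow> 'a grassmann \<Rightarrow> 'a grassmann"
  is "\<lambda>f g S. f S - g S"
proof (intro conjI, goal_cases)
  case (1 f g)
  then show ?case
    by (intro finite_subset[of "{S. f S - g S \<noteq> 0}" "{S. f S \<noteq> 0} \<union> {S. g S \<noteq> 0}"]) auto
next
  case (2 f g)
  then show ?case by (metis diff_zero)
qed

lift_definition times_grassmann :: "'a grassmann \<Rightarrow> 'a grassmann \<Rightarrow> 'a grassmann"
  is "\<lambda>f g S. \<Sum>T\<in>Pow S. (-1) ^ inversions T (S - T) * f T * g (S - T)"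
proof (intro conjI, goal_cases)
  case (1 f g)
  let ?h = "\<lambda>S. \<Sum>T\<in>Pow S. (-1) ^ inversions T (S - T) * f T * g (S - T)"
  have "{S. ?h S \<noteq> 0} \<subseteq> (\<lambda>(T, U). T \<union> U) ` ({S. f S \<noteq> 0} \<times> {S. g S \<noteq> 0})"
  proof
    fix S assume "S \<in> {S. ?h S \<noteq> 0}"
    then have "?h S \<noteq> 0" by simp
    then obtain T where T: "T \<in> Pow S" "(-1) ^ inversions T (S - T) * f T * g (S - T) \<noteq> 0"
      by (meson sum.neutral)
    then have "f T \<noteq> 0" "g (S - T) \<noteq> 0" "S = T \<union> (S - T)" by auto
    then show "S \<in> (\<lambda>(T, U). T \<union> U) ` ({S. f S \<noteq> 0} \<times> {S. g S \<noteq> 0})"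
      by (intro image_eqI[of _ _ "(T, S - T)"]) auto
  qed
  moreover have "finite ((\<lambda>(T, U). T \<union> U) ` ({S. f S \<noteq> 0} \<times> {S. g S \<noteq> 0}))"
    using 1 by blast
  ultimately show ?case by (rule finite_subset)
next
  case (2 f g)
  show ?case
  proof (intro allI impI)
    fix S
    assume h: "(\<Sum>T\<in>Pow S. (-1) ^ inversions T (S - T) * f T * g (S - T)) \<noteq> 0"
    then show "finite S"
      by (metis finite_Pow_iff sum.infinite)
  qed
qed

instance
proof
  fix a b c :: "'a grassmann"
  show "a + b + c = a + (b + c)" by transfer (simp add: add.assoc)
  show "a + b = b + a" by transfer (simp add: add.commute)
  show "0 + a = a" by transfer simp
  show "- a + a = 0" by transfer simp
  show "a - b = a + - b" by transfer simp
  show "(a + b) * c = a * c + b * c"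
    by transfer (simp add: algebra_simps sum.distrib)
  show "a * (b + c) = a * b + a * c"
    by transfer (simp add: algebra_simps sum.distrib)
  show "(0::'a grassmann) \<noteq> 1"
    by transfer (auto simp: fun_eq_iff intro!: exI[of _ "{}"])
  show "1 * a = a"
  proof (transfer, rule ext, goal_cases)
    case (1 a S)
    show ?case
    proof (cases "finite S")
      case True
      have "(\<Sum>T\<in>Pow S. (-1) ^ inversions T (S - T) * (if T = {} then 1 else 0) * a (S - T))
          = (\<Sum>T\<in>Pow S. if T = {} then a S else 0)"
        by (intro sum.cong) auto
      then show ?thesis using True by (simp add: sum.delta)
    next
      case False
      then show ?thesis using 1 by auto
    qed
  qed
  show "a * 1 = a"
  proof (transfer, rule ext, goal_cases)
    case (1 a S)
    show ?case
    proof (cases "finite S")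
      case True
      have "(\<Sum>T\<in>Pow S. (-1) ^ inversions T (S - T) * a T * (if S - T = {} then 1 else 0))
          = (\<Sum>T\<in>Pow S. if T = S then a S else 0)"
        by (intro sum.cong) auto
      then show ?thesis using True by (simp add: sum.delta)
    next
      case False
      then show ?thesis using 1 by auto
    qed
  qed
  show "a * b * c = a * (b * c)"
  proof (transfer, rule ext, goal_cases)
    case (1 a b c S)
    show ?case
    proof (cases "finite S")
      case fin: True
      have "(\<Sum>T\<in>Pow S. (-1) ^ inversions T (S - T) *
              (\<Sum>U\<in>Pow T. (-1) ^ inversions U (T - U) * a U * b (T - U)) * c (S - T))
          = (\<Sum>(T, U)\<in>Sigma (Pow S) Pow. (-1) ^ inversions T (S - T) *
              ((-1) ^ inversions U (T - U) * a U * b (T - U)) * c (S - T))"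
        using fin by (subst sum.Sigma[symmetric])
          (auto simp: sum_distrib_left sum_distrib_right finite_subset)
      also have "\<dots> = (\<Sum>(U, W)\<in>Sigma (Pow S) (\<lambda>U. Pow (S - U)).
              (-1) ^ inversions U (S - U) * a U *
              ((-1) ^ inversions W (S - U - W) * b W * c (S - U - W)))"
      proof (rule sum.reindex_bij_witness[of _ "\<lambda>(U, W). (U \<union> W, U)" "\<lambda>(T, U). (U, T - U)"],
          goal_cases)
        case (5 x)
        then obtain T U where x: "x = (T, U)" "T \<subseteq> S" "U \<subseteq> T" by auto
        define W R where "W = T - U" and "R = S - T"
        have eqs: "T = U \<union> W" "S - U = W \<union> R" "S - U - W = R" "U \<inter> W = {}" "W \<inter> R = {}"
          and f: "finite U" "finite W" "finite R"
          using x fin by (auto simp: W_def R_def intro: finite_subset)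
        have "inversions T R + inversions U W = inversions U (S - U) + inversions W R"
          unfolding eqs(1,2) using f eqs
          by (simp add: inversions_Un_left inversions_Un_right)
        then have "(-1::complex) ^ inversions T R * (-1) ^ inversions U W
            = (-1) ^ inversions U (S - U) * (-1) ^ inversions W R"
          by (simp add: power_add[symmetric])
        then show ?case
          using x eqs(3) unfolding W_def R_def by (simp add: algebra_simps)
      qed auto
      also have "\<dots> = (\<Sum>T\<in>Pow S. (-1) ^ inversions T (S - T) * a T *
            (\<Sum>U\<in>Pow (S - T). (-1) ^ inversions U (S - T - U) * b U * c (S - T - U)))"
        using fin by (subst sum.Sigma[symmetric])
          (auto simp: sum_distrib_left sum_distrib_right finite_subset)
      finally show ?thesis .
    next
      case False
      then show ?thesis by simp
    qed
  qed
qed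

end

lift_definition gconst :: "complex \<Rightarrow> 'g grassmann" is "\<lambda>z S. if S = {} then z else 0"
  by simp

lift_definition gen :: "'g \<Rightarrow> 'g grassmann" is "\<lambda>i S. if S = {i} then 1 else 0"
  by simp

definition has_parity :: "nat \<Rightarrow> 'g grassmann \<Rightarrow> bool" where
  "has_parity p a \<longleftrightarrow> (\<forall>S. coeff a S \<noteq> 0 \<longrightarrow> even (card S + p))"

text \<open>
  The type \<open>nat grassmann\<close> is the algebra \<open>\<And>\<^sub>\<infinity>\<close>; its subalgebra \<open>\<And>\<^sub>L\<close> is generated by the
  first \<open>L\<close> generators, and \<open>L = \<infinity>\<close> gives everything.
\<close>

definition inner_gens :: "enat \<Rightarrow> nat set" where
  "inner_gens L = {i. enat i < L}"

definition Lambda :: "enat \<Rightarrow> nat grassmann set" where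
  "Lambda L = {a. \<forall>S. coeff a S \<noteq> 0 \<longrightarrow> S \<subseteq> inner_gens L}"

section \<open>Graded modules over Grassmann algebras\<close>

text \<open>\<open>sg k v\<close> is \<open>(-1)\<^sup>k v\<close>.\<close>

definition sg :: "nat \<Rightarrow> 'v::ab_group_add \<Rightarrow> 'v" where
  "sg k v = (if even k then v else - v)"

text \<open>
  The data \<open>(V, Y, 1)\<close>, where \<open>V\<close> is a module over \<open>\<And>\<^sub>L\<close> with \<open>L = lev M\<close> whose additive group
  is a subgroup of an ambient abelian group. The vertex operator is recorded by its coefficients,
  the odd variables being collected on the left in increasing order:
  \<open>Y(v, X) = \<Sum>\<^sub>n \<Sum>\<^sub>S \<phi>\<^sup>S (Ymode M v n S) x\<^sup>-\<^sup>n\<^sup>-\<^sup>1\<close>.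
  The odd variables of \<open>X\<close> are numbered 0 and 1: the variables \<open>\<phi>\<^sup>+, \<phi>\<^sup>-\<close>, respectively
  \<open>\<phi>\<^sup>(\<^sup>1\<^sup>), \<phi>\<^sup>(\<^sup>2\<^sup>)\<close>, have numbers 0, 1, and a single variable \<open>\<phi>\<close> has number 0. Hence
  \<open>v\<^sub>n = Ymode M v n {}\<close>, \<open>v\<^sup>+\<^sub>n\<^sub>-\<^sub>1\<^sub>/\<^sub>2 = Ymode M v n {0}\<close>, \<open>v\<^sup>-\<^sub>n\<^sub>-\<^sub>1\<^sub>/\<^sub>2 = Ymode M v n {1}\<close> and
  \<open>v\<^sup>+\<^sup>-\<^sub>n\<^sub>-\<^sub>1 = Ymode M v n {0, 1}\<close>.
\<close>

record 'v vsa =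
  carr :: "'v set"
  Ev :: "'v set"
  Od :: "'v set"
  scal :: "nat grassmann \<Rightarrow> 'v \<Rightarrow> 'v"
  lev :: enat
  Ymode :: "'v \<Rightarrow> int \<Rightarrow> nat set \<Rightarrow> 'v \<Rightarrow> 'v"
  vac :: 'v

definition gr :: "('v, 'm) vsa_scheme \<Rightarrow> nat \<Rightarrow> 'v set" where
  "gr M p = (if even p then Ev M else Od M)"

definition cs :: "('v, 'm) vsa_scheme \<Rightarrow> complex \<Rightarrow> 'v \<Rightarrow> 'v" where
  "cs M z v = scal M (gconst z) v"

definition subgrp :: "'v::ab_group_add set \<Rightarrow> bool" where
  "subgrp W \<longleftrightarrow> 0 \<in> W \<and> (\<forall>v\<in>W. \<forall>w\<in>W. v + w \<in> W) \<and> (\<forall>v\<in>W. - v \<in> W)"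

definition submod :: "('v::ab_group_add, 'm) vsa_scheme \<Rightarrow> 'v set \<Rightarrow> bool" where
  "submod M W \<longleftrightarrow> subgrp W \<and> W \<subseteq> carr M \<and> (\<forall>a\<in>Lambda (lev M). \<forall>v\<in>W. scal M a v \<in> W)"

definition direct_sum :: "'v::ab_group_add set \<Rightarrow> ('i \<Rightarrow> 'v set) \<Rightarrow> bool" where
  "direct_sum W U \<longleftrightarrow> (\<forall>i. subgrp (U i) \<and> U i \<subseteq> W) \<and>
     (\<forall>v\<in>W. \<exists>!f. (\<forall>i. f i \<in> U i) \<and> finite {i. f i \<noteq> 0} \<and> v = Sum_any f)"

definition graded_module :: "('v::ab_group_add, 'm) vsa_scheme \<Rightarrow> bool" where
  "graded_module M \<longleftrightarrow> submod M (carr M) \<and>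
     (\<forall>a\<in>Lambda (lev M). \<forall>b\<in>Lambda (lev M). \<forall>v\<in>carr M. \<forall>w\<in>carr M.
        scal M a (v + w) = scal M a v + scal M a w \<and>
        scal M (a + b) v = scal M a v + scal M b v \<and>
        scal M (a * b) v = scal M a (scal M b v) \<and>
        scal M 1 v = v) \<and>
     direct_sum (carr M) (\<lambda>odd::bool. if odd then Od M else Ev M) \<and>
     (\<forall>p q. \<forall>a\<in>Lambda (lev M). \<forall>v\<in>gr M q. has_parity p a \<longrightarrow> scal M a v \<in> gr M (p + q))"

text \<open>
  Homogeneous elements of \<open>(End V)\<^sup>p\<close>: additive maps that are linear over \<open>\<And>\<^sub>*\<close> in the graded
  sense \<open>A (a v) = (-1)\<^bsup>\<eta>(A) \<eta>(a)\<^esup> a (A v)\<close>.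
\<close>

definition endo :: "('v::ab_group_add, 'm) vsa_scheme \<Rightarrow> nat \<Rightarrow> ('v \<Rightarrow> 'v) \<Rightarrow> bool" where
  "endo M p A \<longleftrightarrow>
     (\<forall>v\<in>carr M. A v \<in> carr M) \<and>
     (\<forall>v\<in>carr M. \<forall>w\<in>carr M. A (v + w) = A v + A w) \<and>
     (\<forall>q. \<forall>v\<in>gr M q. A v \<in> gr M (p + q)) \<and>
     (\<forall>r. \<forall>a\<in>Lambda (lev M). \<forall>v\<in>carr M. has_parity r a \<longrightarrow>
        A (scal M a v) = sg (p * r) (scal M a (A v)))"

text \<open>The supercommutator of endomorphisms of parities \<open>p\<close> and \<open>q\<close>.\<close>

definition scomm :: "nat \<Rightarrow> nat \<Rightarrow> ('v \<Rightarrow> 'v) \<Rightarrow> ('v \<Rightarrow> 'v) \<Rightarrow> 'v \<Rightarrow> 'v::ab_group_add" where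
  "scomm p q A B v = A (B v) - sg (p * q) (B (A v))"

section \<open>Formal calculus with odd variables\<close>

text \<open>
  Elements of \<open>V[odd variables]\<close> are functions \<open>F\<close> from sets of (numbers of) odd variables to \<open>V\<close>,
  standing for \<open>\<Sum>\<^sub>R \<phi>\<^sup>R F(R)\<close>. In the Jacobi identity the \<open>j\<close>th odd variable of \<open>X\<^sub>i\<close> has
  number \<open>2 i + j\<close>, so that complex polynomials in the odd variables are again elements of
  \<open>nat grassmann\<close>; this use of the type is unrelated to the scalars \<open>\<And>\<^sub>*\<close> acting on \<open>V\<close>.
\<close>

definition ovar :: "nat \<Rightarrow> nat \<Rightarrow> nat grassmann" where
  "ovar i j = gen (2 * i + j)"

definition omonom :: "(nat \<Rightarrow> nat grassmann) \<Rightarrow> nat set \<Rightarrow> nat grassmann" where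
  "omonom \<phi> S = prod_list (map \<phi> (sorted_list_of_set S))"

definition omul ::
  "('v::ab_group_add, 'm) vsa_scheme \<Rightarrow> nat grassmann \<Rightarrow> (nat set \<Rightarrow> 'v) \<Rightarrow> nat set \<Rightarrow> 'v" where
  "omul M g F R = (\<Sum>T\<in>Pow R. sg (inversions T (R - T)) (cs M (coeff g T) (F (R - T))))"

definition oconst :: "'v::zero \<Rightarrow> nat set \<Rightarrow> 'v" where
  "oconst w R = (if R = {} then w else 0)"

text \<open>
  The coefficient of \<open>x\<^sub>i\<^sup>-\<^sup>n\<^sup>-\<^sup>1\<close> in \<open>Y(u, X\<^sub>i) F\<close>, for \<open>u\<close> of parity \<open>p\<close>. The coefficient of \<open>\<phi>\<^sub>i\<^sup>S\<close> in
  \<open>Y(u, X\<^sub>i)\<close> has parity \<open>p + |S|\<close>; moving it past \<open>\<phi>\<^sup>R\<close> produces the sign.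
\<close>

definition Yop :: "('v::ab_group_add, 'm) vsa_scheme \<Rightarrow> nat set \<Rightarrow> nat \<Rightarrow> nat \<Rightarrow> 'v \<Rightarrow> int \<Rightarrow>
    (nat set \<Rightarrow> 'v) \<Rightarrow> nat set \<Rightarrow> 'v" where
  "Yop M K i p u n F R =
     (\<Sum>S\<in>Pow K. omul M (omonom (ovar i) S)
        (\<lambda>R'. sg ((p + card S) * card R') (Ymode M u n S (F R'))) R)"

text \<open>
  Series in \<open>x\<^sub>0, x\<^sub>1, x\<^sub>2\<close>: \<open>f a b c\<close> is the coefficient of \<open>x\<^sub>0\<^sup>a x\<^sub>1\<^sup>b x\<^sub>2\<^sup>c\<close>.
  \<open>Y_Y\<close>, \<open>Y_Y'\<close> and \<open>Y_iter\<close> are \<open>Y(u, X\<^sub>1) Y(v, X\<^sub>2) w\<close>, \<open>Y(v, X\<^sub>2) Y(u, X\<^sub>1) w\<close> and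
  \<open>Y(Y(u, X\<^sub>0) v, X\<^sub>2) w\<close> for \<open>u\<close>, \<open>v\<close> of parities \<open>p\<close>, \<open>q\<close>. In the last one
  \<open>Y(\<phi>\<^sub>0\<^sup>S v', X\<^sub>2) = \<phi>\<^sub>0\<^sup>S Y(v', X\<^sub>2)\<close>, where the odd variables of \<open>X\<^sub>0\<close> are the differences
  of those of \<open>X\<^sub>1\<close> and \<open>X\<^sub>2\<close>.
\<close>

definition Y_Y :: "('v::ab_group_add, 'm) vsa_scheme \<Rightarrow> nat set \<Rightarrow> nat \<Rightarrow> 'v \<Rightarrow> nat \<Rightarrow> 'v \<Rightarrow> 'v \<Rightarrow>
    int \<Rightarrow> int \<Rightarrow> int \<Rightarrow> nat set \<Rightarrow> 'v" where
  "Y_Y M K p u q v w a b c =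
     (if a = 0 then Yop M K 1 p u (- b - 1) (Yop M K 2 q v (- c - 1) (oconst w)) else (\<lambda>_. 0))"

definition Y_Y' :: "('v::ab_group_add, 'm) vsa_scheme \<Rightarrow> nat set \<Rightarrow> nat \<Rightarrow> 'v \<Rightarrow> nat \<Rightarrow> 'v \<Rightarrow> 'v \<Rightarrow>
    int \<Rightarrow> int \<Rightarrow> int \<Rightarrow> nat set \<Rightarrow> 'v" where
  "Y_Y' M K p u q v w a b c =
     (if a = 0 then Yop M K 2 q v (- c - 1) (Yop M K 1 p u (- b - 1) (oconst w)) else (\<lambda>_. 0))"

definition Y_iter :: "('v::ab_group_add, 'm) vsa_scheme \<Rightarrow> nat set \<Rightarrow> nat \<Rightarrow> 'v \<Rightarrow> nat \<Rightarrow> 'v \<Rightarrow> 'v \<Rightarrow>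
    int \<Rightarrow> int \<Rightarrow> int \<Rightarrow> nat set \<Rightarrow> 'v" where
  "Y_iter M K p u q v w a b c =
     (if b = 0 then
        (\<lambda>R. \<Sum>S\<in>Pow K. omul M (omonom (\<lambda>j. ovar 1 j - ovar 2 j) S)
           (Yop M K 2 (p + card S + q) (Ymode M u (- a - 1) S v) (- c - 1) (oconst w)) R)
      else (\<lambda>_. 0))"

text \<open>
  The coefficient of \<open>y\<^sup>i z\<^sup>j\<close> in
  \<open>(y - z - \<nu>)\<^sup>n = \<Sum>\<^sub>k (n choose k) (y - z)\<^sup>n\<^sup>-\<^sup>k (-\<nu>)\<^sup>k\<close> (Taylor expansion in the even nilpotent
  element \<open>\<nu>\<close>), where \<open>(y - z)\<^sup>n\<^sup>-\<^sup>k\<close> is expanded in nonnegative powers of \<open>z\<close>.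
\<close>

definition expand :: "nat grassmann \<Rightarrow> int \<Rightarrow> int \<Rightarrow> int \<Rightarrow> nat grassmann" where
  "expand \<nu> n i j =
     (if 0 \<le> j \<and> i + j \<le> n then
        let k = nat (n - i - j) in
          gconst ((of_int n gchoose k) * (of_int (n - int k) gchoose nat j) * (- 1) ^ nat j) * (- \<nu>) ^ k
      else 0)"

text \<open>
  The series \<open>x\<^sub>0\<^sup>-\<^sup>1\<delta>((x\<^sub>1 - x\<^sub>2 - \<nu>)/x\<^sub>0)\<close>, \<open>x\<^sub>0\<^sup>-\<^sup>1\<delta>((x\<^sub>2 - x\<^sub>1 + \<nu>)/(-x\<^sub>0))\<close> and
  \<open>x\<^sub>2\<^sup>-\<^sup>1\<delta>((x\<^sub>1 - x\<^sub>0 - \<nu>)/x\<^sub>2)\<close>; e.g. the first one is \<open>\<Sum>\<^sub>n x\<^sub>0\<^sup>-\<^sup>n\<^sup>-\<^sup>1 (x\<^sub>1 - x\<^sub>2 - \<nu>)\<^sup>n\<close>.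
\<close>

definition delta1 :: "nat grassmann \<Rightarrow> int \<Rightarrow> int \<Rightarrow> int \<Rightarrow> nat grassmann" where
  "delta1 \<nu> a b c = expand \<nu> (- a - 1) b c"

definition delta2 :: "nat grassmann \<Rightarrow> int \<Rightarrow> int \<Rightarrow> int \<Rightarrow> nat grassmann" where
  "delta2 \<nu> a b c = (if even (a + 1) then 1 else - 1) * expand (- \<nu>) (- a - 1) c b"

definition delta3 :: "nat grassmann \<Rightarrow> int \<Rightarrow> int \<Rightarrow> int \<Rightarrow> nat grassmann" where
  "delta3 \<nu> a b c = expand \<nu> (- c - 1) b a"

text \<open>
  Product of series; for the products in the Jacobi identity only finitely many summands are
  nonzero, by truncation.
\<close>

definition series_mul :: "('v::ab_group_add, 'm) vsa_scheme \<Rightarrow>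
    (int \<Rightarrow> int \<Rightarrow> int \<Rightarrow> nat grassmann) \<Rightarrow> (int \<Rightarrow> int \<Rightarrow> int \<Rightarrow> nat set \<Rightarrow> 'v) \<Rightarrow>
    int \<Rightarrow> int \<Rightarrow> int \<Rightarrow> nat set \<Rightarrow> 'v" where
  "series_mul M d f a b c R =
     Sum_any (\<lambda>(a', b', c'). omul M (d a' b' c') (f (a - a') (b - b') (c - c')) R)"

section \<open>Vertex superalgebras\<close>

text \<open>
  The common axioms, for the set \<open>K\<close> of numbers of odd variables and the shift \<open>\<nu>\<close>.
  The first conjunct after \<open>graded_module M\<close> fixes the irrelevant values of \<open>Ymode M\<close>.
\<close>

definition vertex_axioms :: "nat set \<Rightarrow> nat grassmann \<Rightarrow> ('v::ab_group_add, 'm) vsa_scheme \<Rightarrow> bool" where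
  "vertex_axioms K \<nu> M \<longleftrightarrow> graded_module M \<and>
     (\<forall>v n S w. \<not> (v \<in> carr M \<and> S \<subseteq> K \<and> w \<in> carr M) \<longrightarrow> Ymode M v n S w = 0) \<and>
     \<comment> \<open>\<open>v \<mapsto> Y(v, X)\<close> is linear; \<open>a \<phi>\<^sup>S = (-1)\<^bsup>\<eta>(a) |S|\<^esup> \<phi>\<^sup>S a\<close>\<close>
     (\<forall>u\<in>carr M. \<forall>v\<in>carr M. \<forall>n S. \<forall>w\<in>carr M.
        Ymode M (u + v) n S w = Ymode M u n S w + Ymode M v n S w) \<and>
     (\<forall>r. \<forall>a\<in>Lambda (lev M). \<forall>v\<in>carr M. \<forall>n S. \<forall>w\<in>carr M. has_parity r a \<longrightarrow>
        Ymode M (scal M a v) n S w = sg (r * card S) (scal M a (Ymode M v n S w))) \<and>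
     \<comment> \<open>coefficients and total parity\<close>
     (\<forall>p. \<forall>v\<in>gr M p. \<forall>n S. S \<subseteq> K \<longrightarrow> endo M (p + card S) (Ymode M v n S)) \<and>
     \<comment> \<open>truncation\<close>
     (\<forall>u\<in>carr M. \<forall>v\<in>carr M. \<exists>N. \<forall>n\<ge>N. \<forall>S. Ymode M u n S v = 0) \<and>
     \<comment> \<open>vacuum\<close>
     vac M \<in> carr M \<and>
     (\<forall>n S. \<forall>w\<in>carr M. S \<subseteq> K \<longrightarrow>
        Ymode M (vac M) n S w = (if n = - 1 \<and> S = {} then w else 0)) \<and>
     \<comment> \<open>creation\<close>
     (\<forall>v\<in>carr M. (\<forall>n\<ge>0. \<forall>S. Ymode M v n S (vac M) = 0) \<and> Ymode M v (- 1) {} (vac M) = v) \<and>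
     \<comment> \<open>Jacobi identity\<close>
     (\<forall>p q. \<forall>u\<in>gr M p. \<forall>v\<in>gr M q. \<forall>w\<in>carr M. \<forall>a b c R.
        series_mul M (delta1 \<nu>) (Y_Y M K p u q v w) a b c R
        - sg (p * q) (series_mul M (delta2 \<nu>) (Y_Y' M K p u q v w) a b c R)
        = series_mul M (delta3 \<nu>) (Y_iter M K p u q v w) a b c R)"

definition nu_pm :: "nat grassmann" where
  "nu_pm = ovar 1 0 * ovar 2 1 + ovar 1 1 * ovar 2 0"

definition nu_12 :: "nat grassmann" where
  "nu_12 = ovar 1 0 * ovar 2 0 + ovar 1 1 * ovar 2 1"

definition nu_1 :: "nat grassmann" where
  "nu_1 = ovar 1 0 * ovar 2 0"

definition is_vsa_pm :: "'v::ab_group_add vsa \<Rightarrow> bool" where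
  "is_vsa_pm M \<longleftrightarrow> vertex_axioms {0, 1} nu_pm M"

definition is_vsa_12 :: "'v::ab_group_add vsa \<Rightarrow> bool" where
  "is_vsa_12 M \<longleftrightarrow> vertex_axioms {0, 1} nu_12 M"

text \<open>
  \<open>[D, Y(v, X)] = Y(D v, X)\<close> for odd \<open>D\<close>, coefficientwise; the first sign comes from moving \<open>D\<close>
  past \<open>\<phi>\<^sup>S\<close>.
\<close>

definition commutes_with_Y :: "nat set \<Rightarrow> ('v::ab_group_add, 'm) vsa_scheme \<Rightarrow> ('v \<Rightarrow> 'v) \<Rightarrow> bool" where
  "commutes_with_Y K M D \<longleftrightarrow>
     (\<forall>p. \<forall>v\<in>gr M p. \<forall>n S. \<forall>w\<in>carr M. S \<subseteq> K \<longrightarrow>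
        sg (card S) (D (Ymode M v n S w)) - sg p (Ymode M v n S (D w)) = Ymode M (D v) n S w)"

text \<open>Operators on \<open>V\<close> are represented by functions vanishing outside \<open>V\<close>.\<close>

definition zero_outside :: "('v::ab_group_add, 'm) vsa_scheme \<Rightarrow> ('v \<Rightarrow> 'v) \<Rightarrow> bool" where
  "zero_outside M D \<longleftrightarrow> (\<forall>v. v \<notin> carr M \<longrightarrow> D v = 0)"

definition is_vsa_1 :: "'v::ab_group_add vsa \<times> ('v \<Rightarrow> 'v) \<times> ('v \<Rightarrow> 'v) \<Rightarrow> bool" where
  "is_vsa_1 = (\<lambda>(M, D1, D2). vertex_axioms {0} nu_1 M \<and>
     zero_outside M D1 \<and> zero_outside M D2 \<and>
     (\<forall>v\<in>carr M. D1 v = Ymode M v (- 1) {0} (vac M)) \<and>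
     endo M 1 D2 \<and>
     (let D = D1 \<circ> D1 in
       \<forall>v\<in>carr M.
         scomm 1 1 D1 D1 v = cs M 2 (D v) \<and> scomm 1 1 D2 D2 v = cs M 2 (D v) \<and>
         scomm 1 1 D1 D2 v = 0 \<and> scomm 1 1 D2 D1 v = 0) \<and>
     commutes_with_Y {0} M D2)"

definition is_vsa_0 :: "'v::ab_group_add vsa \<times> ('v \<Rightarrow> 'v) \<times> ('v \<Rightarrow> 'v) \<Rightarrow> bool" where
  "is_vsa_0 = (\<lambda>(M, Dp, Dm). vertex_axioms {} 0 M \<and>
     zero_outside M Dp \<and> zero_outside M Dm \<and>
     endo M 1 Dp \<and> endo M 1 Dm \<and>
     (let D = (\<lambda>v. Ymode M v (- 2) {} (vac M)) in
       \<forall>v\<in>carr M.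
         scomm 1 1 Dp Dm v = cs M 2 (D v) \<and>
         scomm 1 1 Dp Dp v = 0 \<and> scomm 1 1 Dm Dm v = 0) \<and>
     commutes_with_Y {} M Dp \<and> commutes_with_Y {} M Dm)"

section \<open>Neveu-Schwarz vertex operator superalgebras\<close>

text \<open>\<open>L n\<close> and \<open>J n\<close> are \<open>L(n)\<close> and \<open>J(n)\<close>, while \<open>G n\<close> is \<open>G(n + 1/2)\<close>.\<close>

definition NS_LJ :: "('v::ab_group_add, 'm) vsa_scheme \<Rightarrow> complex \<Rightarrow>
    (int \<Rightarrow> 'v \<Rightarrow> 'v) \<Rightarrow> (int \<Rightarrow> 'v \<Rightarrow> 'v) \<Rightarrow> bool" where
  "NS_LJ M c L J \<longleftrightarrow> (\<forall>m n. \<forall>v\<in>carr M.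
     scomm 0 0 (L m) (L n) v = cs M (of_int (m - n)) (L (m + n) v)
       + cs M (if m + n = 0 then of_int (m ^ 3 - m) / 12 * c else 0) v \<and>
     scomm 0 0 (J m) (J n) v = cs M (if m + n = 0 then of_int m / 3 * c else 0) v \<and>
     scomm 0 0 (L m) (J n) v = cs M (of_int (- n)) (J (m + n) v))"

definition NS_pm :: "('v::ab_group_add, 'm) vsa_scheme \<Rightarrow> complex \<Rightarrow>
    (int \<Rightarrow> 'v \<Rightarrow> 'v) \<Rightarrow> (int \<Rightarrow> 'v \<Rightarrow> 'v) \<Rightarrow> (int \<Rightarrow> 'v \<Rightarrow> 'v) \<Rightarrow> (int \<Rightarrow> 'v \<Rightarrow> 'v) \<Rightarrow> bool" where
  "NS_pm M c L J Gp Gm \<longleftrightarrow>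
     (\<forall>n. endo M 0 (L n) \<and> endo M 0 (J n) \<and> endo M 1 (Gp n) \<and> endo M 1 (Gm n)) \<and>
     NS_LJ M c L J \<and>
     (\<forall>m n. \<forall>v\<in>carr M.
       scomm 0 1 (L m) (Gp n) v = cs M (of_int m / 2 - of_int n - 1 / 2) (Gp (m + n) v) \<and>
       scomm 0 1 (L m) (Gm n) v = cs M (of_int m / 2 - of_int n - 1 / 2) (Gm (m + n) v) \<and>
       scomm 0 1 (J m) (Gp n) v = Gp (m + n) v \<and>
       scomm 0 1 (J m) (Gm n) v = - Gm (m + n) v \<and>
       scomm 1 1 (Gp m) (Gp n) v = 0 \<and>
       scomm 1 1 (Gm m) (Gm n) v = 0 \<and>
       scomm 1 1 (Gp m) (Gm (n - 1)) v = cs M 2 (L (m + n) v)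
         + cs M (of_int (m - n + 1)) (J (m + n) v)
         + cs M (if m + n = 0 then of_int (m\<^sup>2 + m) / 3 * c else 0) v)"

definition NS_12 :: "('v::ab_group_add, 'm) vsa_scheme \<Rightarrow> complex \<Rightarrow>
    (int \<Rightarrow> 'v \<Rightarrow> 'v) \<Rightarrow> (int \<Rightarrow> 'v \<Rightarrow> 'v) \<Rightarrow> (int \<Rightarrow> 'v \<Rightarrow> 'v) \<Rightarrow> (int \<Rightarrow> 'v \<Rightarrow> 'v) \<Rightarrow> bool" where
  "NS_12 M c L J G1 G2 \<longleftrightarrow>
     (\<forall>n. endo M 0 (L n) \<and> endo M 0 (J n) \<and> endo M 1 (G1 n) \<and> endo M 1 (G2 n)) \<and>
     NS_LJ M c L J \<and>
     (\<forall>m n. \<forall>v\<in>carr M.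
       scomm 0 1 (L m) (G1 n) v = cs M (of_int m / 2 - of_int n - 1 / 2) (G1 (m + n) v) \<and>
       scomm 0 1 (L m) (G2 n) v = cs M (of_int m / 2 - of_int n - 1 / 2) (G2 (m + n) v) \<and>
       scomm 0 1 (J m) (G1 n) v = cs M (- \<i>) (G2 (m + n) v) \<and>
       scomm 0 1 (J m) (G2 n) v = cs M \<i> (G1 (m + n) v) \<and>
       scomm 1 1 (G1 m) (G1 (n - 1)) v = cs M 2 (L (m + n) v)
         + cs M (if m + n = 0 then of_int (m\<^sup>2 + m) / 3 * c else 0) v \<and>
       scomm 1 1 (G2 m) (G2 (n - 1)) v = cs M 2 (L (m + n) v)
         + cs M (if m + n = 0 then of_int (m\<^sup>2 + m) / 3 * c else 0) v \<and>
       scomm 1 1 (G1 m) (G2 (n - 1)) v = cs M (- \<i> * of_int (m - n + 1)) (J (m + n) v))"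

text \<open>
  Finite dimensionality of a module over \<open>\<And>\<^sub>*\<close>: it is spanned over \<open>\<And>\<^sub>*\<close> by finitely many
  elements. Over \<open>\<And>\<^sub>L\<close> with \<open>L\<close> finite this amounts to finite dimension over the complex numbers.
\<close>

definition fin_dim :: "('v::ab_group_add, 'm) vsa_scheme \<Rightarrow> 'v set \<Rightarrow> bool" where
  "fin_dim M W \<longleftrightarrow> (\<exists>B. finite B \<and> B \<subseteq> W \<and>
     (\<forall>v\<in>W. \<exists>a. (\<forall>b\<in>B. a b \<in> Lambda (lev M)) \<and> v = (\<Sum>b\<in>B. scal M (a b) b)))"

definition eigenspace :: "('v, 'm) vsa_scheme \<Rightarrow> ('v \<Rightarrow> 'v) \<Rightarrow> 'v set \<Rightarrow> complex \<Rightarrow> 'v set" where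
  "eigenspace M A W k = {v \<in> W. A v = cs M k v}"

text \<open>The weights are doubled: \<open>wt k\<close> is \<open>V\<^sub>(\<^sub>k\<^sub>/\<^sub>2\<^sub>)\<close>.\<close>

definition NS_grading :: "('v::ab_group_add, 'm) vsa_scheme \<Rightarrow> (int \<Rightarrow> 'v set) \<Rightarrow>
    (int \<Rightarrow> 'v \<Rightarrow> 'v) \<Rightarrow> (int \<Rightarrow> 'v \<Rightarrow> 'v) \<Rightarrow> bool" where
  "NS_grading M wt L J \<longleftrightarrow>
     (\<forall>k. submod M (wt k)) \<and> direct_sum (carr M) wt \<and>
     (\<forall>k. fin_dim M (wt k)) \<and>
     (\<exists>N. \<forall>k<N. wt k = {0}) \<and>
     (\<forall>k. \<forall>v\<in>wt k. L 0 v = cs M (of_int k / 2) v) \<and>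
     (\<forall>k. direct_sum (wt k) (eigenspace M (J 0) (wt k))) \<and>
     (\<forall>k z. \<forall>v\<in>wt k. v \<noteq> 0 \<and> J 0 v = cs M z v \<longrightarrow> (\<exists>j. z = of_int j \<and> even (j - k)))"

text \<open>
  The coefficient of \<open>\<phi>\<^sup>S x\<^sup>-\<^sup>n\<^sup>-\<^sup>1\<close> in \<open>(\<partial>/\<partial>\<phi>\<^sub>i + \<phi>\<^sub>j \<partial>/\<partial>x) Y(v, X) w\<close>, where \<open>\<phi>\<^sub>i\<close> is the odd
  variable of \<open>X\<close> with number \<open>i\<close>.
\<close>

definition odd_deriv :: "nat \<Rightarrow> nat \<Rightarrow> ('v::ab_group_add, 'm) vsa_scheme \<Rightarrow>
    'v \<Rightarrow> int \<Rightarrow> nat set \<Rightarrow> 'v \<Rightarrow> 'v" where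
  "odd_deriv i j M v n S w =
     (if i \<in> S then 0 else sg (inversions {i} S) (Ymode M v n (insert i S) w))
     + (if j \<in> S then
          sg (inversions {j} (S - {j})) (cs M (of_int (- n)) (Ymode M v (n - 1) (S - {j}) w))
        else 0)"

definition odd_deriv_property :: "nat \<Rightarrow> nat \<Rightarrow> ('v::ab_group_add, 'm) vsa_scheme \<Rightarrow> ('v \<Rightarrow> 'v) \<Rightarrow> bool" where
  "odd_deriv_property i j M G \<longleftrightarrow>
     (\<forall>v\<in>carr M. \<forall>n S. \<forall>w\<in>carr M. S \<subseteq> {0, 1} \<longrightarrow>
        odd_deriv i j M v n S w = Ymode M (G v) n S w)"

definition is_vosa_pm ::
  "complex \<Rightarrow> 'v::ab_group_add vsa \<times> (int \<Rightarrow> 'v set) \<times> 'v \<Rightarrow> bool" where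
  "is_vosa_pm c = (\<lambda>(M, wt, \<mu>). is_vsa_pm M \<and> \<mu> \<in> wt 2 \<inter> Ev M \<and>
     (let J = (\<lambda>n. Ymode M \<mu> n {});
          Gp = (\<lambda>n v. - Ymode M \<mu> (n + 1) {0} v);
          Gm = (\<lambda>n. Ymode M \<mu> (n + 1) {1});
          L = (\<lambda>n v. cs M (- 1 / 2) (Ymode M \<mu> (n + 1) {0, 1} v))
      in NS_pm M c L J Gp Gm \<and> NS_grading M wt L J \<and>
         odd_deriv_property 0 1 M (Gp (- 1)) \<and> odd_deriv_property 1 0 M (Gm (- 1))))"

definition is_vosa_12 ::
  "complex \<Rightarrow> 'v::ab_group_add vsa \<times> (int \<Rightarrow> 'v set) \<times> 'v \<Rightarrow> bool" where
  "is_vosa_12 c = (\<lambda>(M, wt, \<mu>). is_vsa_12 M \<and> \<mu> \<in> wt 2 \<inter> Ev M \<and>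
     (let J = (\<lambda>n. Ymode M \<mu> n {});
          G2 = (\<lambda>n v. cs M (1 / \<i>) (Ymode M \<mu> (n + 1) {0} v));
          G1 = (\<lambda>n v. cs M (- 1 / \<i>) (Ymode M \<mu> (n + 1) {1} v));
          L = (\<lambda>n v. cs M (1 / (2 * \<i>)) (Ymode M \<mu> (n + 1) {0, 1} v))
      in NS_12 M c L J G1 G2 \<and> NS_grading M wt L J \<and>
         odd_deriv_property 0 0 M (G1 (- 1)) \<and> odd_deriv_property 1 1 M (G2 (- 1))))"

definition is_vosa_1 :: "complex \<Rightarrow>
    ('v::ab_group_add vsa \<times> ('v \<Rightarrow> 'v) \<times> ('v \<Rightarrow> 'v)) \<times> (int \<Rightarrow> 'v set) \<times> 'v \<times> 'v \<Rightarrow> bool" where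
  "is_vosa_1 c = (\<lambda>((M, D1, D2), wt, \<tau>1, \<tau>2). is_vsa_1 (M, D1, D2) \<and>
     \<tau>1 \<in> wt 3 \<inter> Od M \<and> \<tau>2 \<in> wt 3 \<inter> Od M \<and>
     (\<exists>L J G1 G2. NS_12 M c L J G1 G2 \<and> NS_grading M wt L J \<and>
        (\<forall>n. \<forall>v\<in>carr M.
           Ymode M \<tau>1 (n + 1) {} v = G1 n v \<and>
           Ymode M \<tau>1 (n + 1) {0} v = cs M 2 (L n v) \<and>
           Ymode M \<tau>2 (n + 1) {} v = G2 n v \<and>
           Ymode M \<tau>2 (n + 1) {0} v = cs M (\<i> * of_int (n + 1)) (J n v)) \<and>
        (\<forall>v\<in>carr M. G1 (- 1) v = D1 v \<and> G2 (- 1) v = D2 v)))"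

definition is_vosa_0 :: "complex \<Rightarrow>
    ('v::ab_group_add vsa \<times> ('v \<Rightarrow> 'v) \<times> ('v \<Rightarrow> 'v)) \<times> (int \<Rightarrow> 'v set) \<times> 'v \<times> 'v \<Rightarrow> bool" where
  "is_vosa_0 c = (\<lambda>((M, Dp, Dm), wt, \<tau>p, \<tau>m). is_vsa_0 (M, Dp, Dm) \<and>
     \<tau>p \<in> wt 3 \<inter> Od M \<and> \<tau>m \<in> wt 3 \<inter> Od M \<and>
     (\<exists>L J Gp Gm. NS_pm M c L J Gp Gm \<and> NS_grading M wt L J \<and>
        (\<forall>n. \<forall>v\<in>carr M.
           Ymode M \<tau>p (n + 1) {} v = Gp n v \<and> Ymode M \<tau>m (n + 1) {} v = Gm n v) \<and>
        (\<forall>v\<in>carr M. Gp (- 1) v = Dp v \<and> Gm (- 1) v = Dm v)))"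

section \<open>Extension of scalars and morphisms\<close>

text \<open>
  For \<open>V\<close> over \<open>\<And>\<^sub>L\<close>, the \<open>\<And>\<^sub>\<infinity>\<close>-module obtained by extension of scalars is
  \<open>\<And>\<^sub>\<infinity> \<otimes> V\<close> (over \<open>\<And>\<^sub>L\<close>). As \<open>\<And>\<^sub>\<infinity>\<close> is free over \<open>\<And>\<^sub>L\<close> on the monomials \<open>\<zeta>\<^sup>T\<close> in the remaining
  generators, its elements are uniquely \<open>\<Sum>\<^sub>T \<zeta>\<^sup>T F(T)\<close> with \<open>F(T) \<in> V\<close>, and are represented by \<open>F\<close>.
  For \<open>L = \<infinity>\<close> only \<open>T = {}\<close> occurs. The operations on the extension are the ones forced by
  the sign rules:
  \<^item> if \<open>a\<close> has the coefficient \<open>a\<^bsub>S \<union> T\<^esub>\<close> at \<open>\<zeta>\<^sup>S \<zeta>\<^sup>T\<close> (\<open>S\<close> among the first \<open>L\<close> generators, \<open>T\<close> among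
    the remaining ones), then \<open>\<zeta>\<^sup>S \<zeta>\<^sup>T \<zeta>\<^sup>U v = (-1)\<^bsup>|S| (|T| + |U|)\<^esup> \<zeta>\<^sup>T \<zeta>\<^sup>U (\<zeta>\<^sup>S v)\<close>;
  \<^item> \<open>Y(\<zeta>\<^sup>T v, X) (\<zeta>\<^sup>U w)\<close> has at \<open>\<phi>\<^sup>S x\<^sup>-\<^sup>n\<^sup>-\<^sup>1\<close> the coefficient
    \<open>(-1)\<^bsup>|T| |S| + |U| (\<eta>(v) + |S|)\<^esup> \<zeta>\<^sup>T \<zeta>\<^sup>U (Ymode M v n S w)\<close>, where \<open>(-1)\<^bsup>\<eta>(v)\<^esup> v\<close> is the parity
    involution.
\<close>

definition pinv :: "('v::ab_group_add, 'm) vsa_scheme \<Rightarrow> nat \<Rightarrow> 'v \<Rightarrow> 'v" where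
  "pinv M k v = (THE v'. \<exists>v0\<in>Ev M. \<exists>v1\<in>Od M. v = v0 + v1 \<and> v' = v0 + sg k v1)"

lift_definition inner_part :: "enat \<Rightarrow> nat set \<Rightarrow> nat \<Rightarrow> nat grassmann \<Rightarrow> nat grassmann"
  is "\<lambda>L T k a S. if S \<subseteq> inner_gens L then (- 1) ^ (card S * k) * a (S \<union> T) else 0"
proof (intro conjI, goal_cases)
  case (1 L T k a)
  have "{S. (if S \<subseteq> inner_gens L then (- 1) ^ (card S * k) * a (S \<union> T) else 0) \<noteq> 0}
      \<subseteq> (\<Union>R\<in>{R. a R \<noteq> 0}. Pow R)"
    by (force split: if_splits)
  moreover have "finite (\<Union>R\<in>{R. a R \<noteq> 0}. Pow R)" using 1 by auto
  ultimately show ?case by (rule finite_subset)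
next
  case (2 L T k a)
  then show ?case by (auto split: if_splits)
qed

definition ext_scalars :: "('v::ab_group_add, 'm) vsa_scheme \<Rightarrow> (nat set \<Rightarrow> 'v) vsa" where
  "ext_scalars M =
    (let mono = (\<lambda>T. finite T \<and> T \<inter> inner_gens (lev M) = {});
         fam = (\<lambda>W. {F. (\<forall>T. F T \<in> W T) \<and> (\<forall>T. F T \<noteq> 0 \<longrightarrow> mono T) \<and> finite {T. F T \<noteq> 0}})
     in \<lparr>carr = fam (\<lambda>_. carr M),
         Ev = fam (\<lambda>T. gr M (card T)),
         Od = fam (\<lambda>T. gr M (card T + 1)),
         scal = (\<lambda>a F R. if mono R then
             (\<Sum>U\<in>Pow R. sg (inversions (R - U) U)
                (scal M (inner_part (lev M) (R - U) (card R) a) (F U))) else 0),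
         lev = \<infinity>,
         Ymode = (\<lambda>F n S G R. if mono R then
             (\<Sum>T\<in>Pow R. sg (inversions T (R - T) + card R * card S)
                (Ymode M (pinv M (card (R - T)) (F T)) n S (G (R - T)))) else 0),
         vac = (\<lambda>T. if T = {} then vac M else 0)\<rparr>)"

text \<open>The extension of an odd operator, and of a vector.\<close>

definition ext_odd :: "('v \<Rightarrow> 'v) \<Rightarrow> (nat set \<Rightarrow> 'v) \<Rightarrow> nat set \<Rightarrow> 'v::ab_group_add" where
  "ext_odd D F T = sg (card T) (D (F T))"

definition ext_vec :: "'v::zero \<Rightarrow> nat set \<Rightarrow> 'v" where
  "ext_vec v T = (if T = {} then v else 0)"

definition vsa_hom :: "nat set \<Rightarrow> 'v::ab_group_add vsa \<Rightarrow> 'v vsa \<Rightarrow>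
    ((nat set \<Rightarrow> 'v) \<Rightarrow> nat set \<Rightarrow> 'v) set" where
  "vsa_hom K M1 M2 = (let E1 = ext_scalars M1; E2 = ext_scalars M2 in
     {\<gamma>. \<gamma> \<in> extensional (carr E1) \<and> \<gamma> ` carr E1 \<subseteq> carr E2 \<and>
         (\<forall>v\<in>carr E1. \<forall>w\<in>carr E1. \<gamma> (v + w) = \<gamma> v + \<gamma> w) \<and>
         (\<forall>a. \<forall>v\<in>carr E1. \<gamma> (scal E1 a v) = scal E2 a (\<gamma> v)) \<and>
         \<gamma> ` Ev E1 \<subseteq> Ev E2 \<and> \<gamma> ` Od E1 \<subseteq> Od E2 \<and>
         (\<forall>u\<in>carr E1. \<forall>v\<in>carr E1. \<forall>n S. S \<subseteq> K \<longrightarrow>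
            \<gamma> (Ymode E1 u n S v) = Ymode E2 (\<gamma> u) n S (\<gamma> v)) \<and>
         \<gamma> (vac E1) = vac E2})"

definition intertwines :: "'v::ab_group_add vsa \<Rightarrow> ((nat set \<Rightarrow> 'v) \<Rightarrow> nat set \<Rightarrow> 'v) \<Rightarrow>
    ('v \<Rightarrow> 'v) \<Rightarrow> ('v \<Rightarrow> 'v) \<Rightarrow> bool" where
  "intertwines M \<gamma> D D' \<longleftrightarrow>
     (\<forall>v\<in>carr (ext_scalars M). \<gamma> (ext_odd D v) = ext_odd D' (\<gamma> v))"

definition vsa_op_hom :: "nat set \<Rightarrow>
    'v::ab_group_add vsa \<times> ('v \<Rightarrow> 'v) \<times> ('v \<Rightarrow> 'v) \<Rightarrow> 'v vsa \<times> ('v \<Rightarrow> 'v) \<times> ('v \<Rightarrow> 'v) \<Rightarrow>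
    ((nat set \<Rightarrow> 'v) \<Rightarrow> nat set \<Rightarrow> 'v) set" where
  "vsa_op_hom K = (\<lambda>(M1, A1, B1) (M2, A2, B2).
     {\<gamma> \<in> vsa_hom K M1 M2. intertwines M1 \<gamma> A1 A2 \<and> intertwines M1 \<gamma> B1 B2})"

section \<open>Categories\<close>

record ('o, 'm) cat =
  Obj :: "'o set"
  Hom :: "'o \<Rightarrow> 'o \<Rightarrow> 'm set"
  Ident :: "'o \<Rightarrow> 'm"
  Comp :: "'o \<Rightarrow> 'o \<Rightarrow> 'o \<Rightarrow> 'm \<Rightarrow> 'm \<Rightarrow> 'm"

text \<open>\<open>Comp \<C> A B C g f\<close> is \<open>g \<circ> f\<close> for \<open>f : A \<rightarrow> B\<close> and \<open>g : B \<rightarrow> C\<close>.\<close>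

definition is_category :: "('o, 'm) cat \<Rightarrow> bool" where
  "is_category \<C> \<longleftrightarrow>
     (\<forall>A\<in>Obj \<C>. Ident \<C> A \<in> Hom \<C> A A) \<and>
     (\<forall>A\<in>Obj \<C>. \<forall>B\<in>Obj \<C>. \<forall>C\<in>Obj \<C>. \<forall>f\<in>Hom \<C> A B. \<forall>g\<in>Hom \<C> B C.
        Comp \<C> A B C g f \<in> Hom \<C> A C) \<and>
     (\<forall>A\<in>Obj \<C>. \<forall>B\<in>Obj \<C>. \<forall>f\<in>Hom \<C> A B.
        Comp \<C> A A B f (Ident \<C> A) = f \<and> Comp \<C> A B B (Ident \<C> B) f = f) \<and>
     (\<forall>A\<in>Obj \<C>. \<forall>B\<in>Obj \<C>. \<forall>C\<in>Obj \<C>. \<forall>D\<in>Obj \<C>.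
        \<forall>f\<in>Hom \<C> A B. \<forall>g\<in>Hom \<C> B C. \<forall>h\<in>Hom \<C> C D.
        Comp \<C> A B D (Comp \<C> B C D h g) f = Comp \<C> A C D h (Comp \<C> A B C g f))"

definition is_functor :: "('o, 'm) cat \<Rightarrow> ('o', 'm') cat \<Rightarrow> ('o \<Rightarrow> 'o') \<Rightarrow>
    ('o \<Rightarrow> 'o \<Rightarrow> 'm \<Rightarrow> 'm') \<Rightarrow> bool" where
  "is_functor \<C> \<D> Fo Fm \<longleftrightarrow>
     (\<forall>A\<in>Obj \<C>. Fo A \<in> Obj \<D> \<and> Fm A A (Ident \<C> A) = Ident \<D> (Fo A)) \<and>
     (\<forall>A\<in>Obj \<C>. \<forall>B\<in>Obj \<C>. \<forall>f\<in>Hom \<C> A B. Fm A B f \<in> Hom \<D> (Fo A) (Fo B)) \<and>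
     (\<forall>A\<in>Obj \<C>. \<forall>B\<in>Obj \<C>. \<forall>C\<in>Obj \<C>. \<forall>f\<in>Hom \<C> A B. \<forall>g\<in>Hom \<C> B C.
        Fm A C (Comp \<C> A B C g f) = Comp \<D> (Fo A) (Fo B) (Fo C) (Fm B C g) (Fm A B f))"

definition isomorphic_cats :: "('o, 'm) cat \<Rightarrow> ('o', 'm') cat \<Rightarrow> bool" where
  "isomorphic_cats \<C> \<D> \<longleftrightarrow> is_category \<C> \<and> is_category \<D> \<and>
     (\<exists>Fo Fm Go Gm. is_functor \<C> \<D> Fo Fm \<and> is_functor \<D> \<C> Go Gm \<and>
        (\<forall>A\<in>Obj \<C>. Go (Fo A) = A) \<and> (\<forall>A\<in>Obj \<D>. Fo (Go A) = A) \<and>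
        (\<forall>A\<in>Obj \<C>. \<forall>B\<in>Obj \<C>. \<forall>f\<in>Hom \<C> A B. Gm (Fo A) (Fo B) (Fm A B f) = f) \<and>
        (\<forall>A\<in>Obj \<D>. \<forall>B\<in>Obj \<D>. \<forall>f\<in>Hom \<D> A B. Fm (Go A) (Go B) (Gm A B f) = f))"

text \<open>
  Categories whose morphisms are maps between underlying sets: \<open>P\<close> singles out the objects and
  \<open>U A\<close> is the underlying set of \<open>A\<close>.
\<close>

definition concrete_cat :: "('o \<Rightarrow> bool) \<Rightarrow> ('o \<Rightarrow> 'a set) \<Rightarrow> ('o \<Rightarrow> 'o \<Rightarrow> ('a \<Rightarrow> 'a) set) \<Rightarrow>
    ('o, 'a \<Rightarrow> 'a) cat" where
  "concrete_cat P U H =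
     \<lparr>Obj = {A. P A}, Hom = H, Ident = (\<lambda>A. restrict (\<lambda>v. v) (U A)),
      Comp = (\<lambda>A B C g f. compose (U A) g f)\<rparr>"

text \<open>
  The type argument is the ambient abelian group that contains the underlying
  groups of all objects.
\<close>

definition VSA_pm :: "'v::ab_group_add itself \<Rightarrow>
    ('v vsa, (nat set \<Rightarrow> 'v) \<Rightarrow> (nat set \<Rightarrow> 'v)) cat" where
  "VSA_pm _ = concrete_cat is_vsa_pm (\<lambda>M. carr (ext_scalars M)) (vsa_hom {0, 1})"

definition VSA_12 :: "'v::ab_group_add itself \<Rightarrow>
    ('v vsa, (nat set \<Rightarrow> 'v) \<Rightarrow> (nat set \<Rightarrow> 'v)) cat" where
  "VSA_12 _ = concrete_cat is_vsa_12 (\<lambda>M. carr (ext_scalars M)) (vsa_hom {0, 1})"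

definition VSA_1 :: "'v::ab_group_add itself \<Rightarrow>
    ('v vsa \<times> ('v \<Rightarrow> 'v) \<times> ('v \<Rightarrow> 'v), (nat set \<Rightarrow> 'v) \<Rightarrow> (nat set \<Rightarrow> 'v)) cat" where
  "VSA_1 _ = concrete_cat is_vsa_1 (\<lambda>(M, _). carr (ext_scalars M)) (vsa_op_hom {0})"

definition VSA_0 :: "'v::ab_group_add itself \<Rightarrow>
    ('v vsa \<times> ('v \<Rightarrow> 'v) \<times> ('v \<Rightarrow> 'v), (nat set \<Rightarrow> 'v) \<Rightarrow> (nat set \<Rightarrow> 'v)) cat" where
  "VSA_0 _ = concrete_cat is_vsa_0 (\<lambda>(M, _). carr (ext_scalars M)) (vsa_op_hom {})"

definition VOSA_pm :: "'v::ab_group_add itself \<Rightarrow> complex \<Rightarrow>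
    ('v vsa \<times> (int \<Rightarrow> 'v set) \<times> 'v, (nat set \<Rightarrow> 'v) \<Rightarrow> (nat set \<Rightarrow> 'v)) cat" where
  "VOSA_pm _ c = concrete_cat (is_vosa_pm c) (\<lambda>(M, _). carr (ext_scalars M))
     (\<lambda>(M1, _, \<mu>1) (M2, _, \<mu>2). {\<gamma> \<in> vsa_hom {0, 1} M1 M2. \<gamma> (ext_vec \<mu>1) = ext_vec \<mu>2})"

definition VOSA_12 :: "'v::ab_group_add itself \<Rightarrow> complex \<Rightarrow>
    ('v vsa \<times> (int \<Rightarrow> 'v set) \<times> 'v, (nat set \<Rightarrow> 'v) \<Rightarrow> (nat set \<Rightarrow> 'v)) cat" where
  "VOSA_12 _ c = concrete_cat (is_vosa_12 c) (\<lambda>(M, _). carr (ext_scalars M))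
     (\<lambda>(M1, _, \<mu>1) (M2, _, \<mu>2). {\<gamma> \<in> vsa_hom {0, 1} M1 M2. \<gamma> (ext_vec \<mu>1) = ext_vec \<mu>2})"

definition VOSA_1 :: "'v::ab_group_add itself \<Rightarrow> complex \<Rightarrow>
    (('v vsa \<times> ('v \<Rightarrow> 'v) \<times> ('v \<Rightarrow> 'v)) \<times> (int \<Rightarrow> 'v set) \<times> 'v \<times> 'v,
     (nat set \<Rightarrow> 'v) \<Rightarrow> (nat set \<Rightarrow> 'v)) cat" where
  "VOSA_1 _ c = concrete_cat (is_vosa_1 c) (\<lambda>((M, _), _). carr (ext_scalars M))
     (\<lambda>(A1, _, \<sigma>1, \<tau>1) (A2, _, \<sigma>2, \<tau>2). {\<gamma> \<in> vsa_op_hom {0} A1 A2.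
        \<gamma> (ext_vec \<sigma>1) = ext_vec \<sigma>2 \<and> \<gamma> (ext_vec \<tau>1) = ext_vec \<tau>2})"

definition VOSA_0 :: "'v::ab_group_add itself \<Rightarrow> complex \<Rightarrow>
    (('v vsa \<times> ('v \<Rightarrow> 'v) \<times> ('v \<Rightarrow> 'v)) \<times> (int \<Rightarrow> 'v set) \<times> 'v \<times> 'v,
     (nat set \<Rightarrow> 'v) \<Rightarrow> (nat set \<Rightarrow> 'v)) cat" where
  "VOSA_0 _ c = concrete_cat (is_vosa_0 c) (\<lambda>((M, _), _). carr (ext_scalars M))
     (\<lambda>(A1, _, \<sigma>1, \<tau>1) (A2, _, \<sigma>2, \<tau>2). {\<gamma> \<in> vsa_op_hom {} A1 A2.
        \<gamma> (ext_vec \<sigma>1) = ext_vec \<sigma>2 \<and> \<gamma> (ext_vec \<tau>1) = ext_vec \<tau>2})"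

end

theory Submission
  imports Defs
begin

text \<open>
  The odd part of the vertex operators is determined by the odd operators \<open>D\<^sub>i\<close> with
  \<open>D\<^sub>i v = v\<^bsup>{i}\<^esup>\<^bsub>-1\<^esub> 1\<close>: by the Jacobi identity for \<open>v = 1\<close>, one has
  \<open>Y(v, (x, \<phi>)) = Y(e\<^bsup>\<Sum> \<phi>\<^sub>i D\<^sub>i\<^esup> v, x)\<close>. Conversely, given odd derivations \<open>D\<^sub>i\<close> of a vertex superalgebra
  without odd variables such that \<open>D\<^sub>i D\<^sub>j + D\<^sub>j D\<^sub>i = 2 g\<^bsub>ij\<^esub> d/dx\<close>, this formula defines vertex operators that
  satisfy the Jacobi identity with the shift \<open>\<nu> = \<Sum>\<^bsub>i,j\<^esub> g\<^bsub>ij\<^esub> \<phi>\<^sub>1\<^sup>i \<phi>\<^sub>2\<^sup>j\<close>. The kinds of vertex superalgebras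
  differ only in the symmetric matrix \<open>g\<close>, and the homogeneous and the nonhomogeneous one are
  related by a linear change of the \<open>D\<^sub>i\<close>. For vertex operator superalgebras,
  \<open>\<mu> = \<tau>\<^sup>(\<^sup>+\<^sup>)\<^sub>1 \<tau>\<^sup>(\<^sup>-\<^sup>) / 2\<close> and \<open>\<tau>\<^sup>(\<^sup>\<plusminus>\<^sup>) = \<mp>D\<^sup>\<plusminus> \<mu>\<close> translate the distinguished vectors into each other.
\<close>

section \<open>Scalars, signs and modules\<close>

text \<open>The obstacle is the Jacobi identity of the lifted operators. In Y(Y(u, X_0) v, X_2) the
  odd variables enter through e^{\<phi>_2 D} outside, through e^{(\<phi>_1 - \<phi>_2) D} inside,
  and through \<nu> in the delta function. Moving the outer exponential across the product yields
  e^{\<phi>_1 D} u and e^{\<phi>_2 D} v at the price of e^{\<nu> T} on u, T being translation: this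
  is the Clifford relation of the D's. Since T acts as d/dx, the price is a shift by \<nu>, and it
  matches the shifts in the delta functions. As \<nu> is quadratic in four odd variables, \<nu>^3 =
  0; hence only sixteen monomials and the powers \<nu>^0, \<nu>^1, \<nu>^2 have to be compared.

  The setting without odd variables serves as the hub. All functors keep the module and act as the
  identity on maps, so beyond bijections of objects one needs equality of Hom-sets: preserving the
  odd modes is the same as intertwining the D's. As objects are compared by equality of records,
  values outside V have to be reproduced as well.\<close>

lemma gconst_in_Lambda [simp]: "gconst z \<in> Lambda L"
  unfolding Lambda_def by (auto simp: gconst.rep_eq)

lemma has_parity_gconst [simp]: "has_parity 0 (gconst z)"
  unfolding has_parity_def by (auto simp: gconst.rep_eq)

lemma one_in_Lambda [simp]: "1 \<in> Lambda L"
  unfolding Lambda_def by (auto simp: one_grassmann.rep_eq)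

lemma coeff_infinite: "infinite S \<Longrightarrow> coeff a S = 0"
  using coeff[of a] by auto

lemma coeff_gconst_mult: "coeff (gconst z * a) S = z * coeff a S"
proof (cases "finite S")
  case True
  have "coeff (gconst z * a) S =
      (\<Sum>T\<in>Pow S. (-1) ^ inversions T (S - T) * (if T = {} then z else 0) * coeff a (S - T))"
    by (simp add: times_grassmann.rep_eq gconst.rep_eq)
  also have "\<dots> = (\<Sum>T\<in>Pow S. if T = {} then z * coeff a S else 0)"
    by (intro sum.cong) auto
  finally show ?thesis using True by (simp add: sum.delta)
qed (simp add: coeff_infinite)

lemma gconst_simps:
  "gconst (z + w) = gconst z + gconst w" "gconst (z * w) = gconst z * gconst w"
  "gconst 1 = 1" "gconst 0 = 0"
  by (auto simp: coeff_inject[symmetric] fun_eq_iff coeff_gconst_mult gconst.rep_eq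
      plus_grassmann.rep_eq one_grassmann.rep_eq zero_grassmann.rep_eq)

lemma gconst_commute: "gconst z * a = a * gconst z"
proof -
  have "coeff (a * gconst z) S = z * coeff a S" for S
  proof (cases "finite S")
    case True
    have "coeff (a * gconst z) S =
        (\<Sum>T\<in>Pow S. (-1) ^ inversions T (S - T) * coeff a T * (if S - T = {} then z else 0))"
      by (simp add: times_grassmann.rep_eq gconst.rep_eq)
    also have "\<dots> = (\<Sum>T\<in>Pow S. if T = S then z * coeff a S else 0)"
      by (intro sum.cong) auto
    finally show ?thesis using True by (simp add: sum.delta)
  qed (simp add: coeff_infinite)
  then show ?thesis by (simp add: coeff_inject[symmetric] fun_eq_iff coeff_gconst_mult)
qed

lemma coeff_mult_empty: "coeff (a * b) {} = coeff a {} * coeff b {}"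
  by (simp add: times_grassmann.rep_eq)

lemma coeff_power_empty: "coeff (a ^ k) {} = coeff a {} ^ k"
  by (induction k) (simp_all add: coeff_mult_empty one_grassmann.rep_eq)

lemma sg_0 [simp]: "sg 0 v = v"
  and sg_1 [simp]: "sg 1 v = - v"
  and sg_Suc_0 [simp]: "sg (Suc 0) v = - v"
  and sg_zero [simp]: "sg k 0 = 0"
  and sg_sg: "sg k (sg l v) = sg (k + l) v"
  and sg_add: "sg k (v + w) = sg k v + sg k w"
  and sg_diff: "sg k (v - w) = sg k v - sg k w"
  and sg_minus: "sg k (- v) = - sg k v"
  and sg_Suc: "sg (Suc k) v = - sg k v"
  and sg_eq_0_iff [simp]: "sg k v = 0 \<longleftrightarrow> v = 0"
  by (auto simp: sg_def)

lemma sg_cong: "even (k + l) \<Longrightarrow> sg k v = sg l v"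
  by (auto simp: sg_def)

lemma sg_even: "even k \<Longrightarrow> sg k v = v"
  and sg_odd: "odd k \<Longrightarrow> sg k v = - v"
  by (auto simp: sg_def)

lemma sg_sum: "sg k (sum f A) = (\<Sum>x\<in>A. sg k (f x))"
  by (simp add: sg_def sum_negf)

lemma gr_Suc_Suc: "gr M (Suc (Suc p)) = gr M p"
  by (simp add: gr_def)

locale gmodule =
  fixes M :: "'v::ab_group_add vsa"
  assumes graded: "graded_module M"
begin

lemma submod_carr: "submod M (carr M)"
  using graded unfolding graded_module_def by blast

lemma subgrp_carr: "subgrp (carr M)"
  using submod_carr unfolding submod_def by blast

lemma carr_0 [simp]: "0 \<in> carr M"
  and carr_add [simp]: "v \<in> carr M \<Longrightarrow> w \<in> carr M \<Longrightarrow> v + w \<in> carr M"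
  and carr_minus [simp]: "v \<in> carr M \<Longrightarrow> - v \<in> carr M"
  using subgrp_carr unfolding subgrp_def by auto

lemma carr_diff [simp]: "v \<in> carr M \<Longrightarrow> w \<in> carr M \<Longrightarrow> v - w \<in> carr M"
  using carr_add[of v "- w"] by simp

lemma carr_sg [simp]: "v \<in> carr M \<Longrightarrow> sg k v \<in> carr M"
  by (simp add: sg_def)

lemma carr_sum [simp]: "(\<And>x. x \<in> A \<Longrightarrow> f x \<in> carr M) \<Longrightarrow> sum f A \<in> carr M"
  by (induction A rule: infinite_finite_induct) auto

lemma carr_scal [simp]: "a \<in> Lambda (lev M) \<Longrightarrow> v \<in> carr M \<Longrightarrow> scal M a v \<in> carr M"
  using submod_carr unfolding submod_def by auto

lemma scal_add: "a \<in> Lambda (lev M) \<Longrightarrow> v \<in> carr M \<Longrightarrow> w \<in> carr M \<Longrightarrow>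
    scal M a (v + w) = scal M a v + scal M a w"
  and scal_add_left: "a \<in> Lambda (lev M) \<Longrightarrow> b \<in> Lambda (lev M) \<Longrightarrow> v \<in> carr M \<Longrightarrow>
    scal M (a + b) v = scal M a v + scal M b v"
  and scal_mult: "a \<in> Lambda (lev M) \<Longrightarrow> b \<in> Lambda (lev M) \<Longrightarrow> v \<in> carr M \<Longrightarrow>
    scal M (a * b) v = scal M a (scal M b v)"
  and scal_1: "v \<in> carr M \<Longrightarrow> scal M 1 v = v"
  using graded one_in_Lambda unfolding graded_module_def by blast+

lemma scal_parity: "a \<in> Lambda (lev M) \<Longrightarrow> v \<in> gr M q \<Longrightarrow> has_parity p a \<Longrightarrow>
    scal M a v \<in> gr M (p + q)"
  using graded unfolding graded_module_def by blast

lemma scal_zero [simp]: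
  assumes "a \<in> Lambda (lev M)"
  shows "scal M a 0 = 0"
  using scal_add[OF assms carr_0 carr_0] by simp

lemma carr_cs [simp]: "v \<in> carr M \<Longrightarrow> cs M z v \<in> carr M"
  by (simp add: cs_def)

lemma cs_add: "v \<in> carr M \<Longrightarrow> w \<in> carr M \<Longrightarrow> cs M z (v + w) = cs M z v + cs M z w"
  and cs_add_left: "v \<in> carr M \<Longrightarrow> cs M (z + z') v = cs M z v + cs M z' v"
  and cs_cs: "v \<in> carr M \<Longrightarrow> cs M z (cs M z' v) = cs M (z * z') v"
  and cs_1 [simp]: "v \<in> carr M \<Longrightarrow> cs M 1 v = v"
  and cs_zero [simp]: "cs M z 0 = 0"
  by (simp_all add: cs_def gconst_simps scal_add scal_add_left scal_mult scal_1)

lemma cs_scal: "a \<in> Lambda (lev M) \<Longrightarrow> v \<in> carr M \<Longrightarrow> cs M z (scal M a v) = scal M a (cs M z v)"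
  by (simp add: cs_def scal_mult[symmetric] gconst_commute)

lemma cs_0 [simp]: "v \<in> carr M \<Longrightarrow> cs M 0 v = 0"
  using cs_add_left[of v 0 0] by simp

lemma cs_minus: "v \<in> carr M \<Longrightarrow> cs M z (- v) = - cs M z v"
  using cs_add[of v "- v" z] by (simp add: add_eq_0_iff)

lemma cs_minus_left: "v \<in> carr M \<Longrightarrow> cs M (- z) v = - cs M z v"
  using cs_add_left[of v z "- z"] by (simp add: add_eq_0_iff)

lemma cs_diff: "v \<in> carr M \<Longrightarrow> w \<in> carr M \<Longrightarrow> cs M z (v - w) = cs M z v - cs M z w"
  using cs_add[of v "- w" z] by (simp add: cs_minus)

lemma cs_diff_left: "v \<in> carr M \<Longrightarrow> cs M (z - z') v = cs M z v - cs M z' v"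
  using cs_add_left[of v z "- z'"] by (simp add: cs_minus_left)

lemma cs_sg: "v \<in> carr M \<Longrightarrow> cs M z (sg k v) = sg k (cs M z v)"
  by (simp add: sg_def cs_minus)

lemma cs_sum: "(\<And>x. x \<in> A \<Longrightarrow> f x \<in> carr M) \<Longrightarrow> cs M z (sum f A) = (\<Sum>x\<in>A. cs M z (f x))"
  by (induction A rule: infinite_finite_induct) (auto simp: cs_add)

lemma cs_sum_left: "v \<in> carr M \<Longrightarrow> cs M (sum f A) v = (\<Sum>x\<in>A. cs M (f x) v)"
  by (induction A rule: infinite_finite_induct) (auto simp: cs_add_left)

lemma cs_2: "v \<in> carr M \<Longrightarrow> cs M 2 v = v + v"
  using cs_add_left[of v 1 1] by simp

lemma cs_sign_power: "v \<in> carr M \<Longrightarrow> cs M ((- 1) ^ k * z) v = sg k (cs M z v)"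
  by (simp add: sg_def cs_minus_left)

lemma cs_cancel: "v \<in> carr M \<Longrightarrow> w \<in> carr M \<Longrightarrow> z \<noteq> 0 \<Longrightarrow> cs M z v = cs M z w \<longleftrightarrow> v = w"
  by (metis cs_cs cs_1 left_inverse)

lemma cs_eq_0_iff: "v \<in> carr M \<Longrightarrow> cs M z v = 0 \<longleftrightarrow> z = 0 \<or> v = 0"
  using cs_cancel[of v 0 z] by auto

lemma direct_sum_Ev_Od: "direct_sum (carr M) (\<lambda>odd::bool. if odd then Od M else Ev M)"
  using graded unfolding graded_module_def by blast

lemma subgrp_gr: "subgrp (gr M p)"
  and gr_subset_carr: "gr M p \<subseteq> carr M"
  using direct_sum_Ev_Od unfolding direct_sum_def gr_def by (metis (full_types))+

lemma gr_carr: "v \<in> gr M p \<Longrightarrow> v \<in> carr M"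
  using gr_subset_carr by blast

lemma gr_0 [simp]: "0 \<in> gr M p"
  and gr_add: "v \<in> gr M p \<Longrightarrow> w \<in> gr M p \<Longrightarrow> v + w \<in> gr M p"
  and gr_minus: "v \<in> gr M p \<Longrightarrow> - v \<in> gr M p"
  using subgrp_gr unfolding subgrp_def by auto

lemma gr_diff: "v \<in> gr M p \<Longrightarrow> w \<in> gr M p \<Longrightarrow> v - w \<in> gr M p"
  using gr_add[of v p "- w"] by (simp add: gr_minus)

lemma gr_cs: "v \<in> gr M p \<Longrightarrow> cs M z v \<in> gr M p"
  using scal_parity[of "gconst z" v p 0] by (simp add: cs_def)

text \<open>The index type \<open>bool\<close> is finite, so the finite-support clause of
  \<open>direct_sum\<close> is automatic and \<open>Sum_any\<close> is a sum of two terms.\<close>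

lemma gr_decompose:
  assumes "v \<in> carr M"
  shows "\<exists>!(f :: bool \<Rightarrow> 'v). f False \<in> gr M 0 \<and> f True \<in> gr M 1 \<and> v = f False + f True"
proof -
  have "Sum_any f = f False + f True" for f :: "bool \<Rightarrow> 'v"
    by (subst Sum_any.expand_superset[of UNIV]) (auto simp: UNIV_bool add.commute)
  then have "\<exists>!f. (\<forall>i. f i \<in> (if i then Od M else Ev M)) \<and> finite {i. f i \<noteq> 0} \<and>
      v = f False + f True"
    using direct_sum_Ev_Od assms unfolding direct_sum_def by auto
  moreover have "(\<forall>i. f i \<in> (if i then Od M else Ev M)) \<and> finite {i. f i \<noteq> 0} \<longleftrightarrow>
      f False \<in> gr M 0 \<and> f True \<in> gr M 1" for f :: "bool \<Rightarrow> 'v"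
    unfolding gr_def by (auto intro: finite_subset[of _ UNIV] split: if_splits)
  ultimately show ?thesis by (simp only: conj_assoc[symmetric])
qed

lemma gr_decomposeE:
  assumes "v \<in> carr M"
  obtains v0 v1 where "v0 \<in> gr M 0" "v1 \<in> gr M 1" "v = v0 + v1"
  using gr_decompose[OF assms] by blast

lemma gr_decompose_unique:
  assumes "v0 \<in> gr M 0" "v1 \<in> gr M 1" "v0' \<in> gr M 0" "v1' \<in> gr M 1" "v0 + v1 = v0' + v1'"
  shows "v0 = v0'" "v1 = v1'"
proof -
  let ?f = "\<lambda>b::bool. if b then v1 else v0" and ?g = "\<lambda>b::bool. if b then v1' else v0'"
  have "v0 + v1 \<in> carr M" using assms by (metis carr_add gr_carr)
  from gr_decompose[OF this] have "?f = ?g"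
    by (rule ex1E) (use assms in \<open>metis (full_types)\<close>)
  then show "v0 = v0'" "v1 = v1'" by (metis (full_types))+
qed

text \<open>Parity, derivation and Jacobi axioms speak about homogeneous vectors only. An identity
  that is additive in a vector is carried to all of V by this rule.\<close>

lemma gr_induct [consumes 1, case_names homogeneous add]:
  assumes "v \<in> carr M" "\<And>p v. v \<in> gr M p \<Longrightarrow> P v"
    "\<And>v w. v \<in> carr M \<Longrightarrow> w \<in> carr M \<Longrightarrow> P v \<Longrightarrow> P w \<Longrightarrow> P (v + w)"
  shows "P v"
  using gr_decomposeE[OF assms(1)] assms(2,3) gr_carr by metis

lemma endoD:
  assumes "endo M p A"
  shows "v \<in> carr M \<Longrightarrow> A v \<in> carr M"
    and "v \<in> carr M \<Longrightarrow> w \<in> carr M \<Longrightarrow> A (v + w) = A v + A w"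
    and "v \<in> gr M q \<Longrightarrow> A v \<in> gr M (p + q)"
    and "a \<in> Lambda (lev M) \<Longrightarrow> v \<in> carr M \<Longrightarrow> has_parity r a \<Longrightarrow>
      A (scal M a v) = sg (p * r) (scal M a (A v))"
  using assms unfolding endo_def by blast+

lemma endo_additive:
  assumes "endo M p A"
  shows "A 0 = 0"
    and "v \<in> carr M \<Longrightarrow> A (- v) = - A v"
    and "v \<in> carr M \<Longrightarrow> w \<in> carr M \<Longrightarrow> A (v - w) = A v - A w"
    and "v \<in> carr M \<Longrightarrow> A (sg k v) = sg k (A v)"
    and "v \<in> carr M \<Longrightarrow> A (cs M z v) = cs M z (A v)"
proof -
  note ad = endoD(2)[OF assms]
  show 0: "A 0 = 0" using ad[of 0 0] by simp
  show m: "A (- v) = - A v" if "v \<in> carr M" for v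
    using ad[of v "- v"] that 0 by (simp add: add_eq_0_iff)
  show "A (v - w) = A v - A w" if "v \<in> carr M" "w \<in> carr M"
    using ad[of v "- w"] that m by simp
  show "A (sg k v) = sg k (A v)" if "v \<in> carr M" using that m by (simp add: sg_def)
  show "A (cs M z v) = cs M z (A v)" if "v \<in> carr M"
    using endoD(4)[OF assms, of "gconst z" v 0] that by (simp add: cs_def)
qed

end

text \<open>All constructions below replace only the vertex operators on a fixed graded module;
  these notions do not see the replacement.\<close>

lemma module_update [simp]:
  "graded_module (M\<lparr>Ymode := f\<rparr>) = graded_module M"
  "cs (M\<lparr>Ymode := f\<rparr>) = cs M"
  "gr (M\<lparr>Ymode := f\<rparr>) = gr M"
  "endo (M\<lparr>Ymode := f\<rparr>) = endo M"
  "submod (M\<lparr>Ymode := f\<rparr>) = submod M"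
  "omul (M\<lparr>Ymode := f\<rparr>) = omul M"
  "fin_dim (M\<lparr>Ymode := f\<rparr>) = fin_dim M"
  "zero_outside (M\<lparr>Ymode := f\<rparr>) = zero_outside M"
  "NS_pm (M\<lparr>Ymode := f\<rparr>) = NS_pm M"
  "NS_12 (M\<lparr>Ymode := f\<rparr>) = NS_12 M"
  "NS_grading (M\<lparr>Ymode := f\<rparr>) = NS_grading M"
  for M :: "'v::ab_group_add vsa"
proof -
  let ?M = "M\<lparr>Ymode := f\<rparr>"
  show cs: "cs ?M = cs M" and gr: "gr ?M = gr M" by (simp_all add: fun_eq_iff cs_def gr_def)
  show sm: "submod ?M = submod M" by (simp add: fun_eq_iff submod_def)
  show en: "endo ?M = endo M" by (simp add: fun_eq_iff endo_def gr)
  show "graded_module ?M = graded_module M" by (simp add: graded_module_def sm gr cong: if_cong)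
  show "omul ?M = omul M" by (simp add: fun_eq_iff omul_def cs)
  show fd: "fin_dim ?M = fin_dim M" by (simp add: fun_eq_iff fin_dim_def)
  show "zero_outside ?M = zero_outside M" by (simp add: fun_eq_iff zero_outside_def)
  have LJ: "NS_LJ ?M = NS_LJ M" by (simp add: fun_eq_iff NS_LJ_def cs)
  show "NS_pm ?M = NS_pm M" by (simp add: fun_eq_iff NS_pm_def cs en LJ)
  show "NS_12 ?M = NS_12 M" by (simp add: fun_eq_iff NS_12_def cs en LJ)
  have "eigenspace ?M = eigenspace M" by (intro ext) (simp add: eigenspace_def cs)
  then show "NS_grading ?M = NS_grading M"
    by (intro ext) (simp add: NS_grading_def cs sm fd)
qed

section \<open>Multiplication by polynomials in the odd variables\<close>

text \<open>Left multiplication by the odd variable with number \<open>r\<close>; the sign sorts it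
  past the smaller variables of the monomial. Products of variables become iterated
  \<open>lmul\<close>, which can be evaluated on explicit finite sets.\<close>

definition lmul :: "nat \<Rightarrow> (nat set \<Rightarrow> 'v::ab_group_add) \<Rightarrow> nat set \<Rightarrow> 'v" where
  "lmul r F R = (if r \<in> R then sg (card (R \<inter> {..<r})) (F (R - {r})) else 0)"

lemma omul_infinite: "infinite R \<Longrightarrow> omul M g F R = 0"
  unfolding omul_def by simp

context gmodule begin

lemma carr_omul [simp]: "(\<And>T. F T \<in> carr M) \<Longrightarrow> omul M g F R \<in> carr M"
  unfolding omul_def by auto

lemma omul_diff: "(\<And>T. F T \<in> carr M) \<Longrightarrow> (\<And>T. G T \<in> carr M) \<Longrightarrow>
    omul M g (\<lambda>T. F T - G T) R = omul M g F R - omul M g G R"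
  unfolding omul_def by (simp add: cs_diff sg_diff sum_subtractf)

lemma omul_zero [simp]: "omul M g (\<lambda>T. 0) R = 0"
  unfolding omul_def by simp

lemma omul_sum: "(\<And>x T. x \<in> A \<Longrightarrow> F x T \<in> carr M) \<Longrightarrow>
    omul M g (\<lambda>T. \<Sum>x\<in>A. F x T) R = (\<Sum>x\<in>A. omul M g (F x) R)"
  unfolding omul_def
  by (simp add: cs_sum sg_sum sum.swap[of _ A])

lemma omul_cs: "(\<And>T. F T \<in> carr M) \<Longrightarrow> omul M g (\<lambda>T. cs M z (F T)) R = cs M z (omul M g F R)"
  unfolding omul_def by (simp add: cs_cs cs_sum cs_sg mult.commute)

lemma omul_sg: "(\<And>T. F T \<in> carr M) \<Longrightarrow> omul M g (\<lambda>T. sg k (F T)) R = sg k (omul M g F R)"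
  unfolding omul_def by (simp add: cs_sg sg_sum sg_sg add.commute)

lemma omul_add_left: "(\<And>T. F T \<in> carr M) \<Longrightarrow> omul M (g + h) F R = omul M g F R + omul M h F R"
  unfolding omul_def by (simp add: plus_grassmann.rep_eq cs_add_left sg_add sum.distrib)

lemma omul_minus_left: "(\<And>T. F T \<in> carr M) \<Longrightarrow> omul M (- g) F R = - omul M g F R"
  unfolding omul_def by (simp add: uminus_grassmann.rep_eq cs_minus_left sg_minus sum_negf)

lemma omul_diff_left: "(\<And>T. F T \<in> carr M) \<Longrightarrow> omul M (g - h) F R = omul M g F R - omul M h F R"
  using omul_add_left[of F g "- h"] by (simp add: omul_minus_left)

lemma omul_0_left [simp]: "(\<And>T. F T \<in> carr M) \<Longrightarrow> omul M 0 F R = 0"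
  unfolding omul_def by (simp add: zero_grassmann.rep_eq)

lemma omul_1 [simp]:
  assumes "finite R" "\<And>T. F T \<in> carr M"
  shows "omul M 1 F R = F R"
proof -
  have "omul M 1 F R = (\<Sum>T\<in>Pow R. if T = {} then F R else 0)"
    unfolding omul_def using assms by (intro sum.cong) (auto simp: one_grassmann.rep_eq)
  then show ?thesis using assms by (simp add: sum.delta)
qed

lemma omul_gconst:
  assumes "\<And>T. F T \<in> carr M"
  shows "omul M (gconst z * g) F R = cs M z (omul M g F R)"
  unfolding omul_def using assms
  by (simp add: coeff_gconst_mult cs_cs[symmetric] cs_sum cs_sg)

lemma omul_gen:
  assumes "finite R" "\<And>T. F T \<in> carr M"
  shows "omul M (gen r) F R = lmul r F R"
proof -
  have "{(a, b). a \<in> {r} \<and> b \<in> R - {r} \<and> b < a} = Pair r ` (R \<inter> {..<r})" by auto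
  then have "inversions {r} (R - {r}) = card (R \<inter> {..<r})"
    unfolding inversions_def by (simp add: card_image inj_on_def)
  then have "omul M (gen r) F R = (\<Sum>T\<in>Pow R. if T = {r} then sg (card (R \<inter> {..<r})) (F (R - {r})) else 0)"
    unfolding omul_def using assms by (intro sum.cong) (auto simp: gen.rep_eq)
  then show ?thesis using assms by (simp add: sum.delta lmul_def)
qed

text \<open>The same computation as associativity of the exterior algebra: pairs U \<subseteq> T
  \<subseteq> R are reindexed by the disjoint parts U and T - U, and the signs agree because
  \<open>inversions\<close> is additive in disjoint unions on either side.\<close>

lemma omul_mult:
  assumes "finite R" "\<And>T. F T \<in> carr M"
  shows "omul M (g * h) F R = omul M g (omul M h F) R"
proof -
  have "omul M (g * h) F R = (\<Sum>(T, U)\<in>Sigma (Pow R) Pow. sg (inversions T (R - T))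
      (cs M ((-1) ^ inversions U (T - U) * coeff g U * coeff h (T - U)) (F (R - T))))"
    unfolding omul_def times_grassmann.rep_eq using assms
    by (subst sum.Sigma[symmetric]) (auto simp: cs_sum_left sg_sum finite_subset)
  also have "\<dots> = (\<Sum>(U, W)\<in>Sigma (Pow R) (\<lambda>U. Pow (R - U)). sg (inversions U (R - U))
      (cs M (coeff g U) (sg (inversions W (R - U - W)) (cs M (coeff h W) (F (R - U - W))))))"
  proof (rule sum.reindex_bij_witness[of _ "\<lambda>(U, W). (U \<union> W, U)" "\<lambda>(T, U). (U, T - U)"], goal_cases)
    case (5 x)
    then obtain T U where x: "x = (T, U)" "T \<subseteq> R" "U \<subseteq> T" by auto
    define W Q where "W = T - U" and "Q = R - T"
    have eqs: "T = U \<union> W" "R - U = W \<union> Q" "R - U - W = Q" "U \<inter> W = {}" "W \<inter> Q = {}" "T - U = W" "R - T = Q"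
      and f: "finite U" "finite W" "finite Q"
      using x assms by (auto simp: W_def Q_def intro: finite_subset)
    have "inversions T Q + inversions U W = inversions U (R - U) + inversions W Q"
      unfolding eqs(1,2) using f eqs
      by (simp add: inversions_Un_left inversions_Un_right)
    then show ?case
      using x(1) assms(2) by (simp only: prod.case eqs(3,6,7))
        (simp add: cs_sign_power mult.assoc cs_sg cs_cs sg_sg)
  qed auto
  also have "\<dots> = omul M g (omul M h F) R"
    unfolding omul_def using assms
    by (subst sum.Sigma[symmetric]) (auto simp: cs_sum sg_sum)
  finally show ?thesis .
qed

lemma omul_gen_mult:
  assumes "finite R" "\<And>T. F T \<in> carr M"
  shows "omul M (gen r * g) F R = lmul r (omul M g F) R"
  using assms by (simp add: omul_mult omul_gen)

lemma omul_empty: "omul M g F {} = cs M (coeff g {}) (F {})"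
  by (simp add: omul_def)

end

section \<open>The products in the Jacobi identity\<close>

text \<open>
  The products with the three delta series for \<open>\<nu> = 0\<close>; the general ones are the Taylor
  expansions \<open>e\<^bsup>\<nu> \<partial>/\<partial>x\<^sub>0\<^esup> Jprod1\<close>, \<open>e\<^bsup>\<nu> \<partial>/\<partial>x\<^sub>0\<^esup> Jprod2\<close>, \<open>e\<^bsup>- \<nu> \<partial>/\<partial>x\<^sub>1\<^esup> Jprod3\<close>.
\<close>

definition Jprod1 :: "'v::ab_group_add vsa \<Rightarrow> (int \<Rightarrow> int \<Rightarrow> nat set \<Rightarrow> 'v) \<Rightarrow> int \<Rightarrow> int \<Rightarrow> int \<Rightarrow> nat set \<Rightarrow> 'v" where
  "Jprod1 M G a b c R = Sum_any (\<lambda>j::nat.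
     cs M ((of_int (- a - 1) gchoose j) * (- 1) ^ j) (G (b + a + 1 + int j) (c - int j) R))"

definition Jprod2 :: "'v::ab_group_add vsa \<Rightarrow> (int \<Rightarrow> int \<Rightarrow> nat set \<Rightarrow> 'v) \<Rightarrow> int \<Rightarrow> int \<Rightarrow> int \<Rightarrow> nat set \<Rightarrow> 'v" where
  "Jprod2 M G a b c R = Sum_any (\<lambda>j::nat.
     cs M ((if even (a + 1) then 1 else - 1) * (of_int (- a - 1) gchoose j) * (- 1) ^ j)
       (G (b - int j) (c + a + 1 + int j) R))"

definition Jprod3 :: "'v::ab_group_add vsa \<Rightarrow> (int \<Rightarrow> int \<Rightarrow> nat set \<Rightarrow> 'v) \<Rightarrow> int \<Rightarrow> int \<Rightarrow> int \<Rightarrow> nat set \<Rightarrow> 'v" where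
  "Jprod3 M H a b c R = Sum_any (\<lambda>j::nat.
     cs M ((of_int (b + int j) gchoose j) * (- 1) ^ j) (H (a - int j) (c + b + 1 + int j) R))"

text \<open>Parametrizes the support of \<open>expand\<close>: \<open>k\<close> is the power of
  \<nu> and \<open>j\<close> the power of the second even variable, the first one getting the
  rest.\<close>

lemma expand_at:
  "expand \<nu> n (n - int k - int j) (int j) =
     gconst ((of_int n gchoose k) * (of_int (n - int k) gchoose j) * (- 1) ^ j) * (- \<nu>) ^ k"
  unfolding expand_def by (simp add: Let_def)

lemma expand_eq_0:
  assumes "\<And>k j. i = n - int k - int j \<Longrightarrow> l = int j \<Longrightarrow> False"
  shows "expand \<nu> n i l = 0"
proof (cases "0 \<le> l \<and> i + l \<le> n")
  case True
  then show ?thesis using assms[of "nat (n - i - l)" "nat l"] by simp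
qed (auto simp: expand_def)

lemma Sum_any_reindex_finite:
  assumes "inj h" "finite A" "\<And>x. x \<notin> h ` A \<Longrightarrow> f x = 0"
  shows "Sum_any f = (\<Sum>y\<in>A. f (h y))"
proof -
  have "Sum_any f = sum f (h ` A)"
    by (rule Sum_any.expand_superset) (use assms in auto)
  then show ?thesis using assms(1) by (simp add: sum.reindex inj_on_subset)
qed

lemma Sum_any_lessThan:
  "(\<And>j. j \<ge> J \<Longrightarrow> f j = 0) \<Longrightarrow> Sum_any f = sum f {..<J::nat}"
  by (rule Sum_any.expand_superset) (auto simp: not_less[symmetric])

lemma gbinomial_neg: "(of_int (- a - 1) gchoose k :: complex) = (- 1) ^ k * (of_int (a + int k) gchoose k)"
  by (subst gbinomial_negated_upper) (simp add: algebra_simps)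

context gmodule begin

lemma omul_neg_power:
  assumes "\<And>T. F T \<in> carr M"
  shows "omul M ((- \<nu>) ^ k) F R = sg k (omul M (\<nu> ^ k) F R)"
  using assms by (simp add: uminus_power_if sg_def omul_minus_left)

lemma Jprod1_finite:
  assumes "\<And>j b. j \<ge> J \<Longrightarrow> G b (c - int j) R = 0"
  shows "Jprod1 M G a b c R = (\<Sum>j<J. cs M ((of_int (- a - 1) gchoose j) * (- 1) ^ j)
    (G (b + a + 1 + int j) (c - int j) R))"
  unfolding Jprod1_def by (rule Sum_any_lessThan) (simp add: assms)

lemma Jprod2_finite:
  assumes "\<And>j c. j \<ge> J \<Longrightarrow> G (b - int j) c R = 0"
  shows "Jprod2 M G a b c R = (\<Sum>j<J. cs M ((if even (a + 1) then 1 else - 1) *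
    (of_int (- a - 1) gchoose j) * (- 1) ^ j) (G (b - int j) (c + a + 1 + int j) R))"
  unfolding Jprod2_def by (rule Sum_any_lessThan) (simp add: assms)

lemma Jprod3_finite:
  assumes "\<And>j c. j \<ge> J \<Longrightarrow> H (a - int j) c R = 0"
  shows "Jprod3 M H a b c R = (\<Sum>j<J. cs M ((of_int (b + int j) gchoose j) * (- 1) ^ j)
    (H (a - int j) (c + b + 1 + int j) R))"
  unfolding Jprod3_def by (rule Sum_any_lessThan) (simp add: assms)

text \<open>\<open>h\<close> lists the exponents at which a delta series can be nonzero. Nilpotency
  bounds the power \<open>k\<close> of \<epsilon>, truncation bounds the expansion index
  \<open>j\<close>, so that \<open>Sum_any\<close> over all integer triples is a finite double
  sum.\<close>

lemma series_mul_explicit: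
  fixes h :: "nat \<times> nat \<Rightarrow> int \<times> int \<times> int" and \<nu> :: "nat grassmann"
  assumes "inj h"
    and d: "\<And>k j. (case h (k, j) of (a', b', c') \<Rightarrow> d a' b' c' = gconst (\<alpha> k j) * \<epsilon> ^ k)"
    and d0: "\<And>a' b' c'. (a', b', c') \<notin> range h \<Longrightarrow> omul M (d a' b' c') (f (a - a') (b - b') (c - c')) R = 0"
    and F: "\<And>k j. (case h (k, j) of (a', b', c') \<Rightarrow> f (a - a') (b - b') (c - c')) = F (int k + int j) j"
    and carr: "\<And>i j T. F i j T \<in> carr M"
    and trunc: "\<And>i j T. j \<ge> J \<Longrightarrow> F i j T = 0"
    and nil: "\<epsilon> ^ 3 = 0"
  shows "series_mul M d f a b c R =
    (\<Sum>k<3. \<Sum>j<J. cs M (\<alpha> k j) (omul M (\<epsilon> ^ k) (F (int k + int j) j) R))"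
proof -
  let ?f = "\<lambda>(a', b', c'). omul M (d a' b' c') (f (a - a') (b - b') (c - c')) R"
  have at: "?f (h (k, j)) = cs M (\<alpha> k j) (omul M (\<epsilon> ^ k) (F (int k + int j) j) R)" for k j
  proof -
    obtain a' b' c' where h: "h (k, j) = (a', b', c')" by (metis prod_cases3)
    with d[of k j] F[of k j] show ?thesis by (simp add: omul_gconst carr)
  qed
  have nil': "\<epsilon> ^ k = 0" if "k \<ge> 3" for k
    using that nil by (metis le_add_diff_inverse power_add mult_zero_left)
  have "series_mul M d f a b c R = (\<Sum>y\<in>{..<3} \<times> {..<J}. ?f (h y))"
    unfolding series_mul_def
  proof (rule Sum_any_reindex_finite[OF assms(1)])
    fix x assume x: "x \<notin> h ` ({..<3} \<times> {..<J})"
    show "?f x = 0"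
    proof (cases "x \<in> range h")
      case True
      then obtain k j where kj: "x = h (k, j)" by auto
      with x consider "k \<ge> 3" | "j \<ge> J" by force
      then show ?thesis unfolding kj at
      proof cases
        case 1
        then show "cs M (\<alpha> k j) (omul M (\<epsilon> ^ k) (F (int k + int j) j) R) = 0"
          by (simp add: nil' carr)
      next
        case 2
        then have "F (int k + int j) j = (\<lambda>T. 0)" by (simp add: trunc fun_eq_iff)
        then show "cs M (\<alpha> k j) (omul M (\<epsilon> ^ k) (F (int k + int j) j) R) = 0" by simp
      qed
    next
      case False
      then show ?thesis using d0 by (cases x) auto
    qed
  qed simp
  also have "\<dots> = (\<Sum>k<3. \<Sum>j<J. ?f (h (k, j)))" by (simp add: sum.cartesian_product)
  finally show ?thesis by (simp only: at)
qed

text \<open>The coefficient of x_0^a in (1/k!) \<nu>^k (d/dx_0)^k is binom(a + k, k) \<nu>^k times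
  the coefficient of x_0^(a + k). The sign from negating the upper index of the binomial cancels the
  sign of (-\<nu>)^k.\<close>

lemma series_mul_delta1:
  assumes carr: "\<And>b c T. G b c T \<in> carr M"
    and trunc: "\<And>j b T. j \<ge> J \<Longrightarrow> G b (c - int j) T = 0"
    and nil: "\<nu> ^ 3 = 0"
  shows "series_mul M (delta1 \<nu>) (\<lambda>a b c. if a = 0 then G b c else (\<lambda>_. 0)) a b c R =
    (\<Sum>k<3. cs M (of_int (a + int k) gchoose k) (omul M (\<nu> ^ k) (Jprod1 M G (a + int k) b c) R))"
    (is "?l = ?r")
proof -
  let ?c = "\<lambda>k j. (of_int (- a - 1) gchoose k) * (of_int (- a - 1 - int k) gchoose j) * (- 1) ^ j :: complex"
  have "?l = (\<Sum>k<3. \<Sum>j<J. cs M (?c k j) (omul M ((- \<nu>) ^ k)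
      ((\<lambda>i j. G (b + a + 1 + i) (c - int j)) (int k + int j) j) R))"
  proof (rule series_mul_explicit[where h = "\<lambda>(k, j). (a, - a - 1 - int k - int j, int j)"
        and F = "\<lambda>i j. G (b + a + 1 + i) (c - int j)" and \<alpha> = ?c and \<epsilon> = "- \<nu>"])
    show "inj (\<lambda>(k, j). (a, - a - 1 - int k - int j, int j))" by (auto simp: inj_on_def)
    fix a' b' c'
    assume out: "(a', b', c') \<notin> range (\<lambda>(k, j). (a, - a - 1 - int k - int j, int j))"
    show "omul M (delta1 \<nu> a' b' c') (if a - a' = 0 then G (b - b') (c - c') else (\<lambda>_. 0)) R = 0"
    proof (cases "a' = a")
      case True
      have "delta1 \<nu> a' b' c' = 0" unfolding delta1_def
        by (rule expand_eq_0) (use out True in \<open>auto simp: image_iff\<close>)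
      then show ?thesis by (simp add: carr)
    qed auto
  next
    fix k j
    show "(case case (k, j) of (k, j) \<Rightarrow> (a, - a - 1 - int k - int j, int j) of (a', b', c') \<Rightarrow>
        (if a - a' = 0 then G (b - b') (c - c') else (\<lambda>_. 0))) = G (b + a + 1 + (int k + int j)) (c - int j)"
      by (simp add: algebra_simps)
  qed (use assms in \<open>auto simp: delta1_def expand_at uminus_power_if\<close>)
  also have "\<dots> = (\<Sum>k<3. \<Sum>j<J. cs M (of_int (a + int k) gchoose k) (omul M (\<nu> ^ k)
      (\<lambda>T. cs M ((of_int (- (a + int k) - 1) gchoose j) * (- 1) ^ j)
        (G (b + (a + int k) + 1 + int j) (c - int j) T)) R))"
  proof (intro sum.cong refl, goal_cases)
    case (1 k j)
    have "?c k j = (- 1) ^ k * ((of_int (a + int k) gchoose k) *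
        ((of_int (- (a + int k) - 1) gchoose j) * (- 1) ^ j))"
      by (subst gbinomial_neg) (simp add: algebra_simps)
    moreover have "b + a + 1 + (int k + int j) = b + (a + int k) + 1 + int j" by simp
    ultimately show ?case
      by (simp only:) (simp add: omul_neg_power omul_cs carr cs_cs cs_sg[symmetric] cs_sign_power sg_sg sg_even)
  qed
  also have "\<dots> = ?r"
  proof (rule sum.cong[OF refl], goal_cases)
    case (1 k)
    have "Jprod1 M G (a + int k) b c = (\<lambda>T. \<Sum>j<J. cs M ((of_int (- (a + int k) - 1) gchoose j) * (- 1) ^ j)
        (G (b + (a + int k) + 1 + int j) (c - int j) T))"
      by (rule ext, rule Jprod1_finite, rule trunc)
    then show ?case by (simp only:) (simp add: omul_sum cs_sum carr)
  qed
  finally show ?thesis .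
qed

lemma series_mul_delta2:
  assumes carr: "\<And>b c T. G b c T \<in> carr M"
    and trunc: "\<And>j c T. j \<ge> J \<Longrightarrow> G (b - int j) c T = 0"
    and nil: "\<nu> ^ 3 = 0"
  shows "series_mul M (delta2 \<nu>) (\<lambda>a b c. if a = 0 then G b c else (\<lambda>_. 0)) a b c R =
    (\<Sum>k<3. cs M (of_int (a + int k) gchoose k) (omul M (\<nu> ^ k) (Jprod2 M G (a + int k) b c) R))"
    (is "?l = ?r")
proof -
  let ?s = "\<lambda>a::int. if even (a + 1) then 1 else - 1 :: complex"
  let ?c = "\<lambda>k j. ?s a * (of_int (- a - 1) gchoose k) * (of_int (- a - 1 - int k) gchoose j) * (- 1) ^ j :: complex"
  have "?l = (\<Sum>k<3. \<Sum>j<J. cs M (?c k j) (omul M (\<nu> ^ k)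
      ((\<lambda>i j. G (b - int j) (c + a + 1 + i)) (int k + int j) j) R))"
  proof (rule series_mul_explicit[where h = "\<lambda>(k, j). (a, int j, - a - 1 - int k - int j)"
        and F = "\<lambda>i j. G (b - int j) (c + a + 1 + i)" and \<alpha> = ?c and \<epsilon> = \<nu>])
    show "inj (\<lambda>(k, j). (a, int j, - a - 1 - int k - int j))" by (auto simp: inj_on_def)
    fix a' b' c'
    assume out: "(a', b', c') \<notin> range (\<lambda>(k, j). (a, int j, - a - 1 - int k - int j))"
    show "omul M (delta2 \<nu> a' b' c') (if a - a' = 0 then G (b - b') (c - c') else (\<lambda>_. 0)) R = 0"
    proof (cases "a' = a")
      case True
      have "expand (- \<nu>) (- a' - 1) c' b' = 0"
        by (rule expand_eq_0) (use out True in \<open>auto simp: image_iff\<close>)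
      then have "delta2 \<nu> a' b' c' = 0" by (simp add: delta2_def)
      then show ?thesis by (simp add: carr)
    qed auto
  next
    fix k j
    show "(case case (k, j) of (k, j) \<Rightarrow> (a, int j, - a - 1 - int k - int j) of (a', b', c') \<Rightarrow>
        (if a - a' = 0 then G (b - b') (c - c') else (\<lambda>_. 0))) = G (b - int j) (c + a + 1 + (int k + int j))"
      by (simp add: algebra_simps)
    have gm: "gconst (- z) = - gconst z" for z :: complex
      using gconst_simps(1)[of z "- z"] by (simp add: gconst_simps add_eq_0_iff)
    show "case case (k, j) of (k, j) \<Rightarrow> (a, int j, - a - 1 - int k - int j) of (a', b', c') \<Rightarrow>
        delta2 \<nu> a' b' c' = gconst (?c k j) * \<nu> ^ k"
      by (simp add: delta2_def expand_at mult.assoc gm)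
  qed (use assms in auto)
  also have "\<dots> = (\<Sum>k<3. \<Sum>j<J. cs M (of_int (a + int k) gchoose k) (omul M (\<nu> ^ k)
      (\<lambda>T. cs M (?s (a + int k) * (of_int (- (a + int k) - 1) gchoose j) * (- 1) ^ j)
        (G (b - int j) (c + (a + int k) + 1 + int j) T)) R))"
  proof (intro sum.cong refl, goal_cases)
    case (1 k j)
    \<comment> \<open>Here \<nu> occurs with a plus sign, so the (-1)^k of the reflected binomial
      does not cancel; it turns the sign at \<open>a\<close> into the one that \<open>Jprod2\<close>
      has at \<open>a + k\<close>.\<close>
    have s: "?s a * (- 1) ^ k = ?s (a + int k)" by simp
    have "?c k j = (?s a * (- 1) ^ k) * ((of_int (a + int k) gchoose k) *
        ((of_int (- (a + int k) - 1) gchoose j) * (- 1) ^ j))"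
      by (subst gbinomial_neg) (simp add: algebra_simps)
    moreover have "c + a + 1 + (int k + int j) = c + (a + int k) + 1 + int j" by simp
    ultimately show ?case unfolding s
      by (simp only:) (simp add: omul_cs carr cs_cs mult.left_commute mult.assoc)
  qed
  also have "\<dots> = ?r"
  proof (rule sum.cong[OF refl], goal_cases)
    case (1 k)
    have "Jprod2 M G (a + int k) b c = (\<lambda>T. \<Sum>j<J. cs M (?s (a + int k) * (of_int (- (a + int k) - 1) gchoose j) * (- 1) ^ j)
        (G (b - int j) (c + (a + int k) + 1 + int j) T))"
      by (rule ext, rule Jprod2_finite, rule trunc)
    then show ?case by (simp only:) (simp add: omul_sum cs_sum carr del: even_add)
  qed
  finally show ?thesis .
qed

text \<open>Kept as an explicit double sum: in the comparison for the lift the index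
  \<open>j\<close> is shifted by \<open>k\<close>, which packing the inner sum into
  \<open>Jprod3\<close> would hide.\<close>

lemma series_mul_delta3:
  assumes carr: "\<And>a c T. H a c T \<in> carr M"
    and trunc: "\<And>j c T. j \<ge> J \<Longrightarrow> H (a - int j) c T = 0"
    and nil: "\<nu> ^ 3 = 0"
  shows "series_mul M (delta3 \<nu>) (\<lambda>a b c. if b = 0 then H a c else (\<lambda>_. 0)) a b c R =
    (\<Sum>k<3. \<Sum>j<J. cs M ((of_int (b + int k + int j) gchoose k) * (of_int (b + int j) gchoose j) * (- 1) ^ j * (- 1) ^ k)
       (omul M (\<nu> ^ k) (H (a - int j) (c + b + 1 + int k + int j)) R))"
    (is "?l = ?r")
proof -
  let ?c = "\<lambda>k j. (of_int (b + int k + int j) gchoose k) * (of_int (b + int j) gchoose j) * (- 1) ^ j :: complex"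
  have "?l = (\<Sum>k<3. \<Sum>j<J. cs M (?c k j) (omul M ((- \<nu>) ^ k)
      ((\<lambda>i j. H (a - int j) (c + b + 1 + i)) (int k + int j) j) R))"
  proof (rule series_mul_explicit[where h = "\<lambda>(k, j). (int j, b, - 1 - b - int k - int j)"
        and F = "\<lambda>i j. H (a - int j) (c + b + 1 + i)" and \<alpha> = ?c and \<epsilon> = "- \<nu>"])
    show "inj (\<lambda>(k, j). (int j, b, - 1 - b - int k - int j))" by (auto simp: inj_on_def)
    fix a' b' c'
    assume out: "(a', b', c') \<notin> range (\<lambda>(k, j). (int j, b, - 1 - b - int k - int j))"
    show "omul M (delta3 \<nu> a' b' c') (if b - b' = 0 then H (a - a') (c - c') else (\<lambda>_. 0)) R = 0"
    proof (cases "b' = b")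
      case True
      have "delta3 \<nu> a' b' c' = 0" unfolding delta3_def
      proof (rule expand_eq_0)
        fix k j
        assume kj: "b' = - c' - 1 - int k - int j" "a' = int j"
        have "(a', b', c') = (\<lambda>(k, j). (int j, b, - 1 - b - int k - int j)) (k, j)"
          using kj True by simp
        then show False using out by blast
      qed
      then show ?thesis by (simp add: carr)
    qed auto
  next
    fix k j
    show "(case case (k, j) of (k, j) \<Rightarrow> (int j, b, - 1 - b - int k - int j) of (a', b', c') \<Rightarrow>
        (if b - b' = 0 then H (a - a') (c - c') else (\<lambda>_. 0))) = H (a - int j) (c + b + 1 + (int k + int j))"
      by (simp add: algebra_simps)
    have e: "b + int k + int j - int k - int j = b" "b + int k + int j - int k = b + int j" by simp_all
    have "expand \<nu> (b + int k + int j) b (int j) = gconst (?c k j) * (- \<nu>) ^ k"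
      using expand_at[of \<nu> "b + int k + int j" k j] by (simp only: e add_diff_cancel_right')
    moreover have "- (- 1 - b - int k - int j) - 1 = b + int k + int j" by simp
    ultimately have "delta3 \<nu> (int j) b (- 1 - b - int k - int j) = gconst (?c k j) * (- \<nu>) ^ k"
      unfolding delta3_def by (simp only:)
    then show "case case (k, j) of (k, j) \<Rightarrow> (int j, b, - 1 - b - int k - int j) of (a', b', c') \<Rightarrow>
        delta3 \<nu> a' b' c' = gconst (?c k j) * (- \<nu>) ^ k"
      by (simp only: prod.case)
  qed (use assms in \<open>auto simp: uminus_power_if\<close>)
  also have "\<dots> = ?r"
  proof (intro sum.cong refl, goal_cases)
    case (1 k j)
    have "?c k j * (- 1) ^ k = (- 1) ^ k * ?c k j" by simp
    then show ?case
      by (simp only: omul_neg_power[OF carr]) (simp add: carr cs_sign_power cs_sg sg_sg algebra_simps)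
  qed
  finally show ?thesis .
qed

end

section \<open>Degrees of polynomials in the odd variables; nilpotency of the shift\<close>

definition homog :: "nat set \<Rightarrow> nat \<Rightarrow> nat grassmann \<Rightarrow> bool" where
  "homog A d a \<longleftrightarrow> (\<forall>S. coeff a S \<noteq> 0 \<longrightarrow> S \<subseteq> A \<and> card S = d)"

lemma homog_mult:
  assumes "homog A d a" "homog A e b"
  shows "homog A (d + e) (a * b)"
  unfolding homog_def
proof (intro allI impI)
  fix S assume S: "coeff (a * b) S \<noteq> 0"
  then have fin: "finite S" using coeff_infinite by blast
  from S obtain T where T: "T \<in> Pow S" "(-1) ^ inversions T (S - T) * coeff a T * coeff b (S - T) \<noteq> 0"
    unfolding times_grassmann.rep_eq by (meson sum.neutral)
  then have "T \<subseteq> A" "card T = d" "S - T \<subseteq> A" "card (S - T) = e" "T \<subseteq> S"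
    using assms unfolding homog_def by auto
  moreover have "card S = card T + card (S - T)"
    using fin \<open>T \<subseteq> S\<close> by (metis card_Diff_subset card_mono finite_subset le_add_diff_inverse)
  ultimately show "S \<subseteq> A \<and> card S = d + e" by auto
qed

lemma homog_add: "homog A d a \<Longrightarrow> homog A d b \<Longrightarrow> homog A d (a + b)"
  unfolding homog_def plus_grassmann.rep_eq by (metis add.right_neutral)

lemma homog_simps:
  "homog A 0 1" "homog A 0 (gconst z)" "r \<in> A \<Longrightarrow> homog A 1 (gen r)"
  unfolding homog_def
  by (auto simp: one_grassmann.rep_eq gconst.rep_eq gen.rep_eq split: if_splits)

lemma homog_power: "homog A d a \<Longrightarrow> homog A (k * d) (a ^ k)"
  by (induction k) (auto simp: homog_simps homog_mult)

text \<open>A monomial of degree \<open>d\<close> needs \<open>d\<close> distinct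
  generators.\<close>

lemma homog_eq_0:
  assumes "homog A d a" "finite A" "card A < d"
  shows "a = 0"
proof -
  have "coeff a S = 0" for S
    using assms card_mono[of A S] unfolding homog_def by (metis leD)
  then show ?thesis by (simp add: coeff_inject[symmetric] fun_eq_iff zero_grassmann.rep_eq)
qed

lemma omul_homog_outside:
  assumes "homog A d g" "\<And>T. \<not> T \<subseteq> A \<Longrightarrow> F T = 0" "\<not> R \<subseteq> A" "\<And>T. F T \<in> carr M" "gmodule M"
  shows "omul M g F R = 0"
  unfolding omul_def
proof (intro sum.neutral ballI)
  interpret gmodule M by fact
  fix T assume "T \<in> Pow R"
  with assms(3) have "\<not> T \<subseteq> A \<or> \<not> R - T \<subseteq> A" by blast
  then have "coeff g T = 0 \<or> F (R - T) = 0" using assms(1,2) unfolding homog_def by blast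
  then show "sg (inversions T (R - T)) (cs M (coeff g T) (F (R - T))) = 0"
    using assms(4) by auto
qed

text \<open>
  The shift \<open>\<nu> = \<Sum>\<^bsub>i,j\<^esub> g\<^bsub>ij\<^esub> \<phi>\<^sub>1\<^sup>i \<phi>\<^sub>2\<^sup>j\<close>. All four settings are the case of two odd variables with a
  suitable matrix \<open>g\<close>: fewer odd variables amount to vanishing modes and entries of \<open>g\<close>.
\<close>

definition nu :: "(nat \<Rightarrow> nat \<Rightarrow> complex) \<Rightarrow> nat grassmann" where
  "nu g = gconst (g 0 0) * (ovar 1 0 * ovar 2 0) + gconst (g 0 1) * (ovar 1 0 * ovar 2 1)
    + (gconst (g 1 0) * (ovar 1 1 * ovar 2 0) + gconst (g 1 1) * (ovar 1 1 * ovar 2 1))"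

text \<open>The numbers 2 i + j: the odd variables of X_1 are 2 and 3, those of X_2 are 4 and
  5.\<close>

abbreviation ovars :: "nat set" where "ovars \<equiv> {2, 3, 4, 5}"

lemma homog_nu: "homog ovars 2 (nu g)"
proof -
  have "homog ovars (0 + (1 + 1)) (gconst z * (gen r * gen s))" if "r \<in> ovars" "s \<in> ovars" for z r s
    using that by (intro homog_mult homog_simps)
  then have "homog ovars 2 (gconst z * (gen r * gen s))" if "r \<in> ovars" "s \<in> ovars" for z r s
    using that by (metis add_0 one_add_one)
  then show ?thesis unfolding nu_def ovar_def by (intro homog_add) simp_all
qed

text \<open>The cube has degree 6 in four anticommuting variables. The square need not
  vanish.\<close>

lemma nu_cubed: "nu g ^ 3 = 0"
  by (rule homog_eq_0[OF homog_power[OF homog_nu]]) auto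

lemma sum_Pow_01: "(\<Sum>S\<in>Pow {0, 1::nat}. f S) = f {} + f {0} + f {1} + f {0, 1}"
proof -
  have "Pow {0, 1::nat} = {{}, {0}, {1}, {0, 1}}" by (auto simp: Pow_insert)
  moreover have "{0, 1} \<noteq> {0::nat}" "{0, 1} \<noteq> {1::nat}" by auto
  ultimately show ?thesis by (simp add: add.assoc)
qed

lemma subset_01_cases:
  assumes "S \<subseteq> {0, 1::nat}"
  obtains "S = {}" | "S = {0}" | "S = {1}" | "S = {0, 1}"
proof -
  have "S \<in> Pow {0, 1}" using assms by simp
  also have "Pow {0, 1::nat} = {{}, {0}, {1}, {0, 1}}" by (auto simp: Pow_insert)
  finally show thesis using that by blast
qed

lemma omonom_simps:
  "omonom \<phi> {} = 1" "omonom \<phi> {i} = \<phi> i" "omonom \<phi> {0, 1} = \<phi> 0 * \<phi> 1"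
  by (simp_all add: omonom_def)

section \<open>Splitting the axioms; reduction to two odd variables\<close>

definition Yiter :: "'v::ab_group_add vsa \<Rightarrow> nat set \<Rightarrow> nat \<Rightarrow> 'v \<Rightarrow> nat \<Rightarrow> 'v \<Rightarrow> 'v \<Rightarrow> int \<Rightarrow> int \<Rightarrow> nat set \<Rightarrow> 'v" where
  "Yiter M K p u q v w a c R = (\<Sum>S\<in>Pow K. omul M (omonom (\<lambda>j. ovar 1 j - ovar 2 j) S)
     (Yop M K 2 (p + card S + q) (Ymode M u (- a - 1) S v) (- c - 1) (oconst w)) R)"

definition jacobi :: "nat set \<Rightarrow> nat grassmann \<Rightarrow> 'v::ab_group_add vsa \<Rightarrow> bool" where
  "jacobi K \<nu> M \<longleftrightarrow> (\<forall>p q. \<forall>u\<in>gr M p. \<forall>v\<in>gr M q. \<forall>w\<in>carr M. \<forall>a b c R.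
     series_mul M (delta1 \<nu>) (Y_Y M K p u q v w) a b c R
     - sg (p * q) (series_mul M (delta2 \<nu>) (Y_Y' M K p u q v w) a b c R)
     = series_mul M (delta3 \<nu>) (Y_iter M K p u q v w) a b c R)"

text \<open>Collects the clauses that involve neither \<nu> nor the module axioms, so that they can
  be treated apart from the Jacobi identity.\<close>

definition pre_vertex :: "nat set \<Rightarrow> 'v::ab_group_add vsa \<Rightarrow> bool" where
  "pre_vertex K M \<longleftrightarrow>
     (\<forall>v n S w. \<not> (v \<in> carr M \<and> S \<subseteq> K \<and> w \<in> carr M) \<longrightarrow> Ymode M v n S w = 0) \<and>
     (\<forall>u\<in>carr M. \<forall>v\<in>carr M. \<forall>n S. \<forall>w\<in>carr M.
        Ymode M (u + v) n S w = Ymode M u n S w + Ymode M v n S w) \<and>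
     (\<forall>r. \<forall>a\<in>Lambda (lev M). \<forall>v\<in>carr M. \<forall>n S. \<forall>w\<in>carr M. has_parity r a \<longrightarrow>
        Ymode M (scal M a v) n S w = sg (r * card S) (scal M a (Ymode M v n S w))) \<and>
     (\<forall>p. \<forall>v\<in>gr M p. \<forall>n S. S \<subseteq> K \<longrightarrow> endo M (p + card S) (Ymode M v n S)) \<and>
     (\<forall>u\<in>carr M. \<forall>v\<in>carr M. \<exists>N. \<forall>n\<ge>N. \<forall>S. Ymode M u n S v = 0) \<and>
     vac M \<in> carr M \<and>
     (\<forall>n S. \<forall>w\<in>carr M. S \<subseteq> K \<longrightarrow>
        Ymode M (vac M) n S w = (if n = - 1 \<and> S = {} then w else 0)) \<and>
     (\<forall>v\<in>carr M. (\<forall>n\<ge>0. \<forall>S. Ymode M v n S (vac M) = 0) \<and> Ymode M v (- 1) {} (vac M) = v)"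

lemma vertex_axioms_iff: "vertex_axioms K \<nu> M \<longleftrightarrow> graded_module M \<and> pre_vertex K M \<and> jacobi K \<nu> M"
  for M :: "'v::ab_group_add vsa"
  unfolding vertex_axioms_def pre_vertex_def jacobi_def by (simp only: conj_assoc)

lemma pre_vertexD:
  assumes "pre_vertex K M"
  shows "\<not> (v \<in> carr M \<and> S \<subseteq> K \<and> w \<in> carr M) \<Longrightarrow> Ymode M v n S w = 0"
    and "u \<in> carr M \<Longrightarrow> v \<in> carr M \<Longrightarrow> w \<in> carr M \<Longrightarrow>
      Ymode M (u + v) n S w = Ymode M u n S w + Ymode M v n S w"
    and "a \<in> Lambda (lev M) \<Longrightarrow> v \<in> carr M \<Longrightarrow> w \<in> carr M \<Longrightarrow> has_parity r a \<Longrightarrow>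
      Ymode M (scal M a v) n S w = sg (r * card S) (scal M a (Ymode M v n S w))"
    and "v \<in> gr M p \<Longrightarrow> S \<subseteq> K \<Longrightarrow> endo M (p + card S) (Ymode M v n S)"
    and "u \<in> carr M \<Longrightarrow> v \<in> carr M \<Longrightarrow> \<exists>N. \<forall>n\<ge>N. \<forall>S. Ymode M u n S v = 0"
    and "vac M \<in> carr M"
    and "w \<in> carr M \<Longrightarrow> S \<subseteq> K \<Longrightarrow>
      Ymode M (vac M) n S w = (if n = - 1 \<and> S = {} then w else 0)"
    and "v \<in> carr M \<Longrightarrow> n \<ge> 0 \<Longrightarrow> Ymode M v n S (vac M) = 0"
    and "v \<in> carr M \<Longrightarrow> Ymode M v (- 1) {} (vac M) = v"
proof -
  note A = assms[unfolded pre_vertex_def]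
  show "\<not> (v \<in> carr M \<and> S \<subseteq> K \<and> w \<in> carr M) \<Longrightarrow> Ymode M v n S w = 0"
    using A[THEN conjunct1] by blast
  show "u \<in> carr M \<Longrightarrow> v \<in> carr M \<Longrightarrow> w \<in> carr M \<Longrightarrow>
      Ymode M (u + v) n S w = Ymode M u n S w + Ymode M v n S w"
    using A[THEN conjunct2, THEN conjunct1] by blast
  show "a \<in> Lambda (lev M) \<Longrightarrow> v \<in> carr M \<Longrightarrow> w \<in> carr M \<Longrightarrow> has_parity r a \<Longrightarrow>
      Ymode M (scal M a v) n S w = sg (r * card S) (scal M a (Ymode M v n S w))"
    using A[THEN conjunct2, THEN conjunct2, THEN conjunct1] by blast
  show "v \<in> gr M p \<Longrightarrow> S \<subseteq> K \<Longrightarrow> endo M (p + card S) (Ymode M v n S)"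
    using A[THEN conjunct2, THEN conjunct2, THEN conjunct2, THEN conjunct1] by blast
  show "u \<in> carr M \<Longrightarrow> v \<in> carr M \<Longrightarrow> \<exists>N. \<forall>n\<ge>N. \<forall>S. Ymode M u n S v = 0"
    using A[THEN conjunct2, THEN conjunct2, THEN conjunct2, THEN conjunct2, THEN conjunct1] by blast
  show "vac M \<in> carr M"
    using A[THEN conjunct2, THEN conjunct2, THEN conjunct2, THEN conjunct2, THEN conjunct2, THEN conjunct1] by assumption
  show "w \<in> carr M \<Longrightarrow> S \<subseteq> K \<Longrightarrow>
      Ymode M (vac M) n S w = (if n = - 1 \<and> S = {} then w else 0)"
    using A[THEN conjunct2, THEN conjunct2, THEN conjunct2, THEN conjunct2, THEN conjunct2, THEN conjunct2, THEN conjunct1] by blast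
  show "v \<in> carr M \<Longrightarrow> n \<ge> 0 \<Longrightarrow> Ymode M v n S (vac M) = 0"
    using A[THEN conjunct2, THEN conjunct2, THEN conjunct2, THEN conjunct2, THEN conjunct2, THEN conjunct2, THEN conjunct2] by blast
  show "v \<in> carr M \<Longrightarrow> Ymode M v (- 1) {} (vac M) = v"
    using A[THEN conjunct2, THEN conjunct2, THEN conjunct2, THEN conjunct2, THEN conjunct2, THEN conjunct2, THEN conjunct2] by blast
qed

lemma pre_vertexI:
  assumes "\<And>v n S w. \<not> (v \<in> carr M \<and> S \<subseteq> K \<and> w \<in> carr M) \<Longrightarrow> Ymode M v n S w = 0"
    and "\<And>u v w n S. u \<in> carr M \<Longrightarrow> v \<in> carr M \<Longrightarrow> w \<in> carr M \<Longrightarrow>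
      Ymode M (u + v) n S w = Ymode M u n S w + Ymode M v n S w"
    and "\<And>a v w r n S. a \<in> Lambda (lev M) \<Longrightarrow> v \<in> carr M \<Longrightarrow> w \<in> carr M \<Longrightarrow> has_parity r a \<Longrightarrow>
      Ymode M (scal M a v) n S w = sg (r * card S) (scal M a (Ymode M v n S w))"
    and "\<And>v p n S. v \<in> gr M p \<Longrightarrow> S \<subseteq> K \<Longrightarrow> endo M (p + card S) (Ymode M v n S)"
    and "\<And>u v. u \<in> carr M \<Longrightarrow> v \<in> carr M \<Longrightarrow> \<exists>N. \<forall>n\<ge>N. \<forall>S. Ymode M u n S v = 0"
    and "vac M \<in> carr M"
    and "\<And>w n S. w \<in> carr M \<Longrightarrow> S \<subseteq> K \<Longrightarrow>
      Ymode M (vac M) n S w = (if n = - 1 \<and> S = {} then w else 0)"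
    and "\<And>v n S. v \<in> carr M \<Longrightarrow> n \<ge> 0 \<Longrightarrow> Ymode M v n S (vac M) = 0"
    and "\<And>v. v \<in> carr M \<Longrightarrow> Ymode M v (- 1) {} (vac M) = v"
  shows "pre_vertex K M"
  unfolding pre_vertex_def
  by (intro conjI allI ballI impI) (rule assms; assumption)+

lemma (in gmodule) endo_zero: "endo M p (\<lambda>w. 0)"
  unfolding endo_def by (intro conjI allI ballI impI) simp_all

text \<open>For S outside \<open>K\<close> the modes are zero. The zero map is an endomorphism of
  every parity, and such S is nonempty, so the parity and vacuum clauses hold for it too.\<close>

lemma pre_vertex_extend:
  fixes M :: "'v::ab_group_add vsa"
  assumes "gmodule M" "K \<subseteq> {0, 1}"
  shows "pre_vertex K M \<longleftrightarrow> pre_vertex {0, 1} M \<and> (\<forall>v n S w. \<not> S \<subseteq> K \<longrightarrow> Ymode M v n S w = 0)"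
    (is "_ \<longleftrightarrow> _ \<and> ?van")
proof
  interpret gmodule M by fact
  assume K: "pre_vertex K M"
  note D = pre_vertexD[OF K]
  have van: "?van" using D(1) by blast
  have endo: "endo M (p + card S) (Ymode M v n S)" if "v \<in> gr M p" "S \<subseteq> {0, 1}" for p v n S
  proof (cases "S \<subseteq> K")
    case True
    then show ?thesis using D(4) that by blast
  next
    case False
    then have "Ymode M v n S = (\<lambda>w. 0)" using van by (intro ext) blast
    then show ?thesis by (simp only: endo_zero)
  qed
  have vacuum: "Ymode M (vac M) n S w = (if n = - 1 \<and> S = {} then w else 0)"
    if "w \<in> carr M" "S \<subseteq> {0, 1}" for n S w
  proof (cases "S \<subseteq> K")
    case True
    then show ?thesis using D(7) that by blast
  next
    case False
    then have "S \<noteq> {}" "Ymode M (vac M) n S w = 0" using van by blast+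
    then show ?thesis by simp
  qed
  have out: "Ymode M v n S w = 0" if "\<not> (v \<in> carr M \<and> S \<subseteq> {0, 1} \<and> w \<in> carr M)" for v n S w
    by (rule D(1)) (use that assms(2) in blast)
  have "pre_vertex {0, 1} M"
    by (rule pre_vertexI) (fact out D endo vacuum)+
  then show "pre_vertex {0, 1} M \<and> ?van" using van by simp
next
  assume *: "pre_vertex {0, 1} M \<and> ?van"
  note 1 = conjunct1[OF *] and van = conjunct2[OF *]
  note D = pre_vertexD[OF 1]
  have endo: "endo M (p + card S) (Ymode M v n S)" if "v \<in> gr M p" "S \<subseteq> K" for p v n S
    by (rule D(4)) (use that assms(2) in auto)
  have vacuum: "Ymode M (vac M) n S w = (if n = - 1 \<and> S = {} then w else 0)"
    if "w \<in> carr M" "S \<subseteq> K" for n S w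
    by (rule D(7)) (use that assms(2) in auto)
  have out: "Ymode M v n S w = 0" if "\<not> (v \<in> carr M \<and> S \<subseteq> K \<and> w \<in> carr M)" for v n S w
    using that van D(1)[of v S w n] assms(2) by blast
  show "pre_vertex K M"
    by (rule pre_vertexI) (fact out D endo vacuum)+
qed

locale prevertex = gmodule +
  assumes pre: "pre_vertex {0, 1} M"
begin

lemma vac_carr [simp]: "vac M \<in> carr M"
  by (rule pre_vertexD(6)[OF pre])

lemma Y_outside: "\<not> (v \<in> carr M \<and> S \<subseteq> {0, 1} \<and> w \<in> carr M) \<Longrightarrow> Ymode M v n S w = 0"
  by (rule pre_vertexD(1)[OF pre])

lemma Y_add_left: "u \<in> carr M \<Longrightarrow> v \<in> carr M \<Longrightarrow>
    Ymode M (u + v) n S w = Ymode M u n S w + Ymode M v n S w"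
  by (cases "w \<in> carr M") (simp_all add: pre_vertexD(2)[OF pre] Y_outside)

lemma Y_endo: "v \<in> gr M p \<Longrightarrow> endo M (p + card S) (Ymode M v n S)"
proof (cases "S \<subseteq> {0, 1}")
  case True
  moreover assume "v \<in> gr M p"
  ultimately show ?thesis by (intro pre_vertexD(4)[OF pre])
next
  case False
  then have "Ymode M v n S = (\<lambda>w. 0)" using Y_outside by (intro ext) blast
  then show ?thesis by (simp only: endo_zero)
qed

lemma Y_carr [simp]: "Ymode M v n S w \<in> carr M"
proof (cases "v \<in> carr M \<and> S \<subseteq> {0, 1} \<and> w \<in> carr M")
  case True
  then have "v \<in> carr M" by blast
  then show ?thesis
  proof (induction v rule: gr_induct)
    case (homogeneous p v)
    show ?case using endoD(1)[OF Y_endo[OF homogeneous]] True by blast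
  qed (simp add: Y_add_left)
qed (simp add: Y_outside)

lemma Y_add_right: "v \<in> carr M \<Longrightarrow> w \<in> carr M \<Longrightarrow>
    Ymode M u n S (v + w) = Ymode M u n S v + Ymode M u n S w"
proof (cases "u \<in> carr M \<and> S \<subseteq> {0, 1}")
  case True
  assume vw: "v \<in> carr M" "w \<in> carr M"
  from True have "u \<in> carr M" by blast
  then show ?thesis
  proof (induction u rule: gr_induct)
    case (homogeneous p u)
    show ?case using endoD(2)[OF Y_endo[OF homogeneous]] vw by blast
  qed (simp add: Y_add_left)
qed (auto simp: Y_outside)

lemma Y_zero_left [simp]: "Ymode M 0 n S w = 0"
  using Y_add_left[of 0 0 n S w] by simp

lemma Y_zero_right [simp]: "Ymode M v n S 0 = 0"
  using Y_add_right[of 0 0 v n S] by simp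

lemma Y_minus_left: "v \<in> carr M \<Longrightarrow> Ymode M (- v) n S w = - Ymode M v n S w"
  using Y_add_left[of v "- v" n S w] by (simp add: add_eq_0_iff)

lemma Y_minus_right: "w \<in> carr M \<Longrightarrow> Ymode M v n S (- w) = - Ymode M v n S w"
  using Y_add_right[of w "- w" v n S] by (simp add: add_eq_0_iff)

lemma Y_diff_left: "u \<in> carr M \<Longrightarrow> v \<in> carr M \<Longrightarrow>
    Ymode M (u - v) n S w = Ymode M u n S w - Ymode M v n S w"
  using Y_add_left[of u "- v" n S w] by (simp add: Y_minus_left)

lemma Y_diff_right: "v \<in> carr M \<Longrightarrow> w \<in> carr M \<Longrightarrow>
    Ymode M u n S (v - w) = Ymode M u n S v - Ymode M u n S w"
  using Y_add_right[of v "- w" u n S] by (simp add: Y_minus_right)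

lemma Y_sg_left: "v \<in> carr M \<Longrightarrow> Ymode M (sg k v) n S w = sg k (Ymode M v n S w)"
  by (simp add: sg_def Y_minus_left)

lemma Y_cs_left: "v \<in> carr M \<Longrightarrow> Ymode M (cs M z v) n S w = cs M z (Ymode M v n S w)"
proof (cases "w \<in> carr M")
  case True
  assume "v \<in> carr M"
  then show ?thesis
    using pre_vertexD(3)[OF pre, of "gconst z" v w 0 n S] True by (simp add: cs_def)
qed (simp add: Y_outside)

lemma Y_cs_right: "w \<in> carr M \<Longrightarrow> Ymode M v n S (cs M z w) = cs M z (Ymode M v n S w)"
proof (cases "v \<in> carr M \<and> S \<subseteq> {0, 1}")
  case True
  assume w: "w \<in> carr M"
  from True have "v \<in> carr M" by blast
  then show ?thesis
  proof (induction v rule: gr_induct)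
    case (homogeneous p v)
    show ?case using endo_additive(5)[OF Y_endo[OF homogeneous]] w by blast
  qed (simp add: Y_add_left cs_add)
qed (auto simp: Y_outside)

lemma Y_parity: "v \<in> gr M p \<Longrightarrow> w \<in> gr M q \<Longrightarrow> Ymode M v n S w \<in> gr M (p + card S + q)"
  using endoD(3)[OF Y_endo] by blast

lemma Y_trunc: "\<exists>N. \<forall>n\<ge>N. \<forall>S. Ymode M u n S v = 0"
  using pre_vertexD(5)[OF pre] Y_outside[of u _ v] by (cases "u \<in> carr M \<and> v \<in> carr M") auto

lemma vacuum: "w \<in> carr M \<Longrightarrow> Ymode M (vac M) n S w = (if n = - 1 \<and> S = {} then w else 0)"
proof (cases "S \<subseteq> {0, 1}")
  case True
  moreover assume "w \<in> carr M"
  ultimately show ?thesis by (intro pre_vertexD(7)[OF pre])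
next
  case False
  then have "S \<noteq> {}" by blast
  then show ?thesis using Y_outside False by simp
qed

lemma creation: "v \<in> carr M \<Longrightarrow> Ymode M v (- 1) {} (vac M) = v"
  and creation_0: "n \<ge> 0 \<Longrightarrow> Ymode M v n S (vac M) = 0"
  using pre_vertexD(8,9)[OF pre] Y_outside[of v S "vac M" n] by blast+

lemma gr_disjoint:
  assumes "v \<in> gr M p" "v \<in> gr M (Suc p)"
  shows "v = 0"
proof -
  have "v \<in> gr M 0" "v \<in> gr M 1" using assms by (auto simp: gr_def split: if_splits)
  then show ?thesis using gr_decompose_unique(1)[of v 0 0 v] by simp
qed

text \<open>The parity of the vacuum is not among the axioms. Write 1 = e + f with e even and f odd.
  As 1_{-1} is the identity, f_{-1} maps a homogeneous vector to one lying in both parities, hence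
  to 0; creation then gives f = f_{-1} 1 = 0.\<close>

lemma vac_even: "vac M \<in> gr M 0"
proof -
  obtain e f where ef: "e \<in> gr M 0" "f \<in> gr M 1" "vac M = e + f"
    using gr_decomposeE[OF vac_carr] by blast
  note c = ef(1,2)[THEN gr_carr]
  have "Ymode M f (- 1) {} w = 0" if "w \<in> gr M q" for w q
  proof -
    have w: "w \<in> carr M" using that by (rule gr_carr)
    have "w = Ymode M e (- 1) {} w + Ymode M f (- 1) {} w"
      using vacuum[OF w, of "- 1" "{}"] c by (simp add: ef(3) Y_add_left)
    moreover have "Ymode M e (- 1) {} w \<in> gr M q" "Ymode M f (- 1) {} w \<in> gr M (Suc q)"
      using Y_parity[OF ef(1) that, of "- 1" "{}"] Y_parity[OF ef(2) that, of "- 1" "{}"] by simp_all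
    ultimately have "Ymode M e (- 1) {} w - w = - Ymode M f (- 1) {} w"
      and "Ymode M e (- 1) {} w - w \<in> gr M q" "- Ymode M f (- 1) {} w \<in> gr M (Suc q)"
      using that by (auto simp: gr_diff gr_minus algebra_simps)
    then show ?thesis using gr_disjoint[of "- Ymode M f (- 1) {} w" q] by simp
  qed
  then have "Ymode M f (- 1) {} (e + f) = 0" using ef(1,2) c by (simp add: Y_add_right)
  then have "f = 0" using creation[OF c(2)] ef(3) by simp
  then show ?thesis using ef by simp
qed

section \<open>Coefficients of products and iterates at each odd monomial\<close>

lemma Yop_expand:
  assumes "finite R" "\<And>T. F T \<in> carr M"
  shows "Yop M {0, 1} i p u n F R = sg (p * card R) (Ymode M u n {} (F R))
    + lmul (2 * i) (\<lambda>T. sg (Suc p * card T) (Ymode M u n {0} (F T))) R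
    + lmul (2 * i + 1) (\<lambda>T. sg (Suc p * card T) (Ymode M u n {1} (F T))) R
    + lmul (2 * i) (lmul (2 * i + 1) (\<lambda>T. sg (p * card T) (Ymode M u n {0, 1} (F T)))) R"
proof -
  have [simp]: "sg (Suc (Suc p) * k) v = sg (p * k) v" for k and v :: 'a
    by (rule sg_cong) auto
  have [simp]: "card {0, 1::nat} = 2" by simp
  show ?thesis
    unfolding Yop_def sum_Pow_01 omonom_simps using assms
    by (simp add: ovar_def omul_gen_mult omul_gen lmul_def del: mult_Suc mult_Suc_right)
qed

lemmas Yop_expand_Suc = Yop_expand[unfolded One_nat_def]

lemma Yop_infinite: "infinite R \<Longrightarrow> Yop M K i p u n F R = 0"
  unfolding Yop_def by (simp add: omul_infinite)

lemma Yop_carr [simp]: "(\<And>T. F T \<in> carr M) \<Longrightarrow> Yop M K i p u n F R \<in> carr M"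
  unfolding Yop_def by simp

lemma oconst_carr [simp]: "w \<in> carr M \<Longrightarrow> oconst w R \<in> carr M"
  unfolding oconst_def by simp

end

text \<open>The numbers of the odd variables of \<open>X\<^sub>i\<close> that occur in the monomial \<open>\<phi>\<^sup>R\<close>.\<close>

definition sel :: "nat \<Rightarrow> nat set \<Rightarrow> nat set" where
  "sel i R = (if 2 * i \<in> R then (if 2 * i + 1 \<in> R then {0, 1} else {0})
    else if 2 * i + 1 \<in> R then {1} else {})"

lemma subset_ovars_cases:
  assumes "R \<subseteq> ovars"
  shows "R \<in> {{}, {2}, {3}, {4}, {5}, {2, 3}, {2, 4}, {2, 5}, {3, 4}, {3, 5}, {4, 5},
    {2, 3, 4}, {2, 3, 5}, {2, 4, 5}, {3, 4, 5}, {2, 3, 4, 5}}"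
proof -
  have "R \<in> Pow ovars" using assms by simp
  also have "Pow ovars = {{}, {2}, {3}, {4}, {5}, {2, 3}, {2, 4}, {2, 5}, {3, 4}, {3, 5}, {4, 5},
    {2, 3, 4}, {2, 3, 5}, {2, 4, 5}, {3, 4, 5}, {2, 3, 4, 5}}"
    by (simp add: Pow_insert insert_commute Un_insert_left Un_insert_right)
  finally show ?thesis .
qed

context prevertex begin

lemma Yop_oconst:
  assumes "finite R" "w \<in> carr M"
  shows "Yop M {0, 1} i p v n (oconst w) R =
    (if R \<subseteq> {2 * i, 2 * i + 1} then Ymode M v n (sel i R) w else 0)"
proof (cases "R \<subseteq> {2 * i, 2 * i + 1}")
  case True
  then have "R \<in> Pow {2 * i, 2 * i + 1}" by simp
  also have "\<dots> = {{}, {2 * i}, {2 * i + 1}, {2 * i, 2 * i + 1}}" by (auto simp: Pow_insert)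
  finally consider "R = {}" | "R = {2 * i}" | "R = {2 * i + 1}" | "R = {2 * i, 2 * i + 1}" by blast
  then show ?thesis
    using assms by cases (simp_all add: Yop_expand_Suc lmul_def oconst_def sel_def)
next
  case False
  then have "R \<noteq> {}" "R - {2 * i} \<noteq> {}" "R - {2 * i + 1} \<noteq> {}" "R - {2 * i} - {2 * i + 1} \<noteq> {}" by auto
  then show ?thesis
    using assms False by (simp add: Yop_expand_Suc lmul_def oconst_def)
qed

lemmas Yop_oconst_Suc = Yop_oconst[unfolded One_nat_def]

text \<open>The sign comes from moving the coefficient of u, of parity p + |\<open>sel 1 R\<close>|,
  past the odd variables of X_2. Outside the sixteen subsets of \<open>ovars\<close> nothing can
  occur.\<close>

lemma YY_explicit:
  assumes "w \<in> carr M"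
  shows "Yop M {0, 1} 1 p u b (Yop M {0, 1} 2 q v c (oconst w)) R =
    (if R \<subseteq> ovars then sg ((p + card (sel 1 R)) * card (sel 2 R))
      (Ymode M u b (sel 1 R) (Ymode M v c (sel 2 R) w)) else 0)"
proof (cases "finite R")
  case fin: True
  show ?thesis
  proof (cases "R \<subseteq> ovars")
    case True
    show ?thesis
      by (subst Yop_expand[OF fin], simp add: assms)
        (insert subset_ovars_cases[OF True] assms, elim insertE,
          simp_all add: Yop_oconst_Suc lmul_def sel_def sg_def insert_Diff_if)
  next
    case False
    then have "\<not> R \<subseteq> {4, 5}" "\<not> R - {2} \<subseteq> {4, 5}" "\<not> R - {3} \<subseteq> {4, 5}" "\<not> R - {2} - {3} \<subseteq> {4, 5}"
      by auto
    then show ?thesis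
      by (subst Yop_expand[OF fin], simp add: assms)
        (use assms False fin in \<open>simp add: Yop_oconst_Suc lmul_def\<close>)
  qed
next
  case False
  then have "\<not> R \<subseteq> ovars" using finite_subset by blast
  then show ?thesis using False by (simp add: Yop_infinite)
qed

text \<open>Two signs combine, with S = \<open>sel 1 R\<close> and S' = \<open>sel 2 R\<close>:
  moving the coefficient of v past \<phi>_1^S gives (q + |S'|) |S|, and sorting \<phi>_2^S'
  \<phi>_1^S gives |S| |S'|. Modulo 2 this leaves q |S|.\<close>

lemma YY'_explicit:
  assumes "w \<in> carr M"
  shows "Yop M {0, 1} 2 q v c (Yop M {0, 1} 1 p u b (oconst w)) R =
    (if R \<subseteq> ovars then sg (q * card (sel 1 R))
      (Ymode M v c (sel 2 R) (Ymode M u b (sel 1 R) w)) else 0)"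
proof (cases "finite R")
  case fin: True
  show ?thesis
  proof (cases "R \<subseteq> ovars")
    case True
    show ?thesis
      by (subst Yop_expand[OF fin], simp add: assms)
        (insert subset_ovars_cases[OF True] assms, elim insertE,
          simp_all add: Yop_oconst_Suc lmul_def sel_def sg_def insert_Diff_if)
  next
    case False
    then have "\<not> R \<subseteq> {2, 3}" "\<not> R - {4} \<subseteq> {2, 3}" "\<not> R - {5} \<subseteq> {2, 3}" "\<not> R - {4} - {5} \<subseteq> {2, 3}"
      by auto
    then show ?thesis
      by (subst Yop_expand[OF fin], simp add: assms)
        (use assms False fin in \<open>simp add: Yop_oconst_Suc lmul_def\<close>)
  qed
next
  case False
  then have "\<not> R \<subseteq> ovars" using finite_subset by blast
  then show ?thesis using False by (simp add: Yop_infinite)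
qed

text \<open>The components of \<open>Y(Y(u, X\<^sub>0) v, X\<^sub>2) w\<close>, for \<open>m S T = Y(u\<^sup>S v)\<^sup>T w\<close>.\<close>

definition Ycomp :: "(nat set \<Rightarrow> nat set \<Rightarrow> 'a) \<Rightarrow> nat set \<Rightarrow> 'a" where
  "Ycomp m R =
    (let T = sel 2 R; z = (\<lambda>S. sel 1 R = S \<and> R \<subseteq> ovars) in
      if z {} then m {} T + (if T = {0} then - m {0} {} else if T = {1} then - m {1} {}
        else if T = {0, 1} then m {0, 1} {} - m {0} {1} + m {1} {0} else 0)
      else if z {0} then m {0} T + (if T = {1} then - m {0, 1} {}
        else if T = {0, 1} then m {0, 1} {0} else 0)
      else if z {1} then m {1} T + (if T = {0} then m {0, 1} {}
        else if T = {0, 1} then m {0, 1} {1} else 0)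
      else if z {0, 1} then m {0, 1} T else 0)"

text \<open>Expanding the products of the differences \<phi>_1 - \<phi>_2: each factor contributes a
  variable of X_1 or minus one of X_2. The latter choice lets modes of u with larger S contribute to
  a given monomial; these are the correction terms in \<open>Ycomp\<close>.\<close>

lemma Yiter_explicit:
  assumes "w \<in> carr M"
  shows "Yiter M {0, 1} p u q v w a c R =
    Ycomp (\<lambda>S T. Ymode M (Ymode M u (- a - 1) S v) (- c - 1) T w) R"
proof (cases "finite R")
  case fin: True
  have eq: "Yiter M {0, 1} p u q v w a c R =
      (let m = (\<lambda>S R. if R \<subseteq> {4, 5} then Ymode M (Ymode M u (- a - 1) S v) (- c - 1) (sel 2 R) w else 0)
       in m {} R + (lmul 2 (m {0}) R - lmul 4 (m {0}) R) + (lmul 3 (m {1}) R - lmul 5 (m {1}) R)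
        + (lmul 2 (lmul 3 (m {0, 1})) R - lmul 2 (lmul 5 (m {0, 1})) R
          - lmul 4 (lmul 3 (m {0, 1})) R + lmul 4 (lmul 5 (m {0, 1})) R))"
    unfolding Yiter_def sum_Pow_01 omonom_simps using assms fin
    by (simp add: ovar_def omul_diff_left left_diff_distrib right_diff_distrib
        omul_gen_mult omul_gen lmul_def Yop_oconst_Suc Let_def)
  show ?thesis
  proof (cases "R \<subseteq> ovars")
    case True
    then show ?thesis unfolding eq
      using subset_ovars_cases[OF True]
      by (elim insertE) (simp_all add: lmul_def sel_def Ycomp_def Let_def insert_Diff_if)
  next
    case False
    then have "\<not> R \<subseteq> {4, 5}" "\<not> R - {2} \<subseteq> {4, 5}" "\<not> R - {3} \<subseteq> {4, 5}" "\<not> R - {4} \<subseteq> {4, 5}" "\<not> R - {5} \<subseteq> {4, 5}"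
      "\<not> R - {2} - {3} \<subseteq> {4, 5}" "\<not> R - {2} - {5} \<subseteq> {4, 5}" "\<not> R - {4} - {3} \<subseteq> {4, 5}" "\<not> R - {4} - {5} \<subseteq> {4, 5}"
      by auto
    then show ?thesis unfolding eq using False by (simp add: lmul_def Ycomp_def Let_def)
  qed
next
  case False
  then have "\<not> R \<subseteq> ovars" using finite_subset by blast
  then show ?thesis using False by (simp add: Yiter_def omul_infinite Ycomp_def)
qed

end

lemma Sum_any_sg: "Sum_any (\<lambda>j. sg k (f j)) = sg k (Sum_any f)"
  by (simp add: Sum_any.expand_set sg_sum)

lemma Sum_any_single:
  assumes "\<And>j. j \<noteq> i \<Longrightarrow> f j = 0"
  shows "Sum_any f = f i"
proof -
  have "Sum_any f = sum f {i}" by (rule Sum_any.expand_superset) (use assms in auto)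
  then show ?thesis by simp
qed

lemma sum_lessThan_3: "(\<Sum>k<3. f k) = f 0 + f 1 + f (2::nat)"
  by (simp add: eval_nat_numeral)

text \<open>This makes the coefficient of x_1^{-1} useful: in the third product only j = 0 survives
  there.\<close>

lemma gbinomial_minus_one_self: "j > 0 \<Longrightarrow> (of_int (int j - 1) gchoose j :: complex) = 0"
proof -
  assume "j > 0"
  then have "(of_int (int j - 1) :: complex) = of_nat (j - 1)" by (simp add: of_nat_diff)
  then show "(of_int (int j - 1) gchoose j :: complex) = 0"
    using \<open>j > 0\<close> by (simp only: binomial_gbinomial[symmetric]) simp
qed

section \<open>The Jacobi identity in components\<close>

context prevertex begin

lemma omul_nu:
  assumes "finite R" "\<And>T. F T \<in> carr M"
  shows "omul M (nu g) F R = cs M (g 0 0) (lmul 2 (lmul 4 F) R) + cs M (g 0 1) (lmul 2 (lmul 5 F) R)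
    + (cs M (g 1 0) (lmul 3 (lmul 4 F) R) + cs M (g 1 1) (lmul 3 (lmul 5 F) R))"
proof -
  have "omul M (gconst z * (gen r * gen s)) F R = cs M z (lmul r (lmul s F) R)" for z r s
    using assms by (simp add: omul_gconst omul_gen_mult omul_gen lmul_def)
  then show ?thesis unfolding nu_def using assms by (simp add: omul_add_left ovar_def)
qed

lemma omul_nu_power2:
  "finite R \<Longrightarrow> (\<And>T. F T \<in> carr M) \<Longrightarrow> omul M (nu g ^ 2) F R = omul M (nu g) (omul M (nu g) F) R"
  by (simp add: power2_eq_square omul_mult)

lemma coeff_nu_empty [simp]: "coeff (nu g) {} = 0"
  using homog_nu[of g] unfolding homog_def by auto

lemma omul_power_outside:
  assumes "\<not> R \<subseteq> ovars" "\<And>T. \<not> T \<subseteq> ovars \<Longrightarrow> F T = 0" "\<And>T. F T \<in> carr M"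
  shows "omul M (nu g ^ k) F R = 0"
  by (rule omul_homog_outside[OF homog_power[OF homog_nu] assms(2,1,3)]) (simp, unfold_locales)

text \<open>The left-hand side of the Borcherds identity for the modes \<open>u\<^sup>S\<close> and \<open>v\<^sup>T\<close>.\<close>

definition Jlhs :: "nat \<Rightarrow> nat \<Rightarrow> 'a \<Rightarrow> nat set \<Rightarrow> 'a \<Rightarrow> nat set \<Rightarrow> 'a \<Rightarrow> int \<Rightarrow> int \<Rightarrow> int \<Rightarrow> 'a" where
  "Jlhs p q u S v T w a b c =
     Jprod1 M (\<lambda>b c _. Ymode M u (- b - 1) S (Ymode M v (- c - 1) T w)) a b c {}
     - sg ((p + card S) * (q + card T))
       (Jprod2 M (\<lambda>b c _. Ymode M v (- c - 1) T (Ymode M u (- b - 1) S w)) a b c {})"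

text \<open>The Jacobi identity for the modes without odd variables and without shift; all four
  settings share it.\<close>

definition borcherds :: bool where
  "borcherds \<longleftrightarrow> (\<forall>p q. \<forall>u\<in>gr M p. \<forall>v\<in>gr M q. \<forall>w\<in>carr M. \<forall>a b c.
     Jlhs p q u {} v {} w a b c =
     Jprod3 M (\<lambda>a c _. Ymode M (Ymode M u (- a - 1) {} v) (- c - 1) {} w) a b c {})"

lemma Jprod1_carr [simp]: "(\<And>b c T. G b c T \<in> carr M) \<Longrightarrow> Jprod1 M G a b c R \<in> carr M"
  and Jprod2_carr [simp]: "(\<And>b c T. G b c T \<in> carr M) \<Longrightarrow> Jprod2 M G a b c R \<in> carr M"
  by (simp_all add: Jprod1_def Jprod2_def Sum_any.expand_set)

lemma Jlhs_carr [simp]: "Jlhs p q u S v T w a b c \<in> carr M"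
  by (simp add: Jlhs_def)

lemma Ycomp_carr [simp]: "(\<And>S T. m S T \<in> carr M) \<Longrightarrow> Ycomp m R \<in> carr M"
  by (simp add: Ycomp_def Let_def)

text \<open>Both orders can be given a common sign: with S = \<open>sel 1 T\<close> and S' =
  \<open>sel 2 T\<close>, the numbers p q + q |S| and (p + |S|) |S'| + (p + |S|) (q + |S'|) have the
  same parity. What remains is the left side of a Borcherds identity for modes of parities p + |S|
  and q + |S'|.\<close>

lemma series_lhs:
  assumes w: "w \<in> carr M"
  shows "series_mul M (delta1 (nu g)) (Y_Y M {0, 1} p u q v w) a b c R
      - sg (p * q) (series_mul M (delta2 (nu g)) (Y_Y' M {0, 1} p u q v w) a b c R)
    = (\<Sum>k<3. cs M (of_int (a + int k) gchoose k) (omul M (nu g ^ k) (\<lambda>T. if T \<subseteq> ovars then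
        sg ((p + card (sel 1 T)) * card (sel 2 T))
          (Jlhs p q u (sel 1 T) v (sel 2 T) w (a + int k) b c) else 0) R))"
proof -
  define G where "G = (\<lambda>b c. Yop M {0, 1} 1 p u (- b - 1) (Yop M {0, 1} 2 q v (- c - 1) (oconst w)))"
  define G' where "G' = (\<lambda>b c. Yop M {0, 1} 2 q v (- c - 1) (Yop M {0, 1} 1 p u (- b - 1) (oconst w)))"
  have Ge: "G b c T = (if T \<subseteq> ovars then sg ((p + card (sel 1 T)) * card (sel 2 T))
      (Ymode M u (- b - 1) (sel 1 T) (Ymode M v (- c - 1) (sel 2 T) w)) else 0)" for b c T
    unfolding G_def by (rule YY_explicit[OF w])
  have Ge': "G' b c T = (if T \<subseteq> ovars then sg (q * card (sel 1 T))
      (Ymode M v (- c - 1) (sel 2 T) (Ymode M u (- b - 1) (sel 1 T) w)) else 0)" for b c T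
    unfolding G'_def by (rule YY'_explicit[OF w])
  have c: "G b c T \<in> carr M" "G' b c T \<in> carr M" for b c T
    by (simp_all add: Ge Ge')
  obtain N where N: "\<And>n S. n \<ge> N \<Longrightarrow> Ymode M v n S w = 0" using Y_trunc by blast
  obtain N' where N': "\<And>n S. n \<ge> N' \<Longrightarrow> Ymode M u n S w = 0" using Y_trunc by blast
  have t: "G b (c - int j) T = 0" if "j \<ge> nat (N + c + 1)" for j b T
    using that by (simp add: Ge N)
  have t': "G' (b - int j) c T = 0" if "j \<ge> nat (N' + b + 1)" for j c T
    using that by (simp add: Ge' N')
  have YY: "Y_Y M {0, 1} p u q v w = (\<lambda>a b c. if a = 0 then G b c else (\<lambda>_. 0))"
    "Y_Y' M {0, 1} p u q v w = (\<lambda>a b c. if a = 0 then G' b c else (\<lambda>_. 0))"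
    by (simp_all add: fun_eq_iff Y_Y_def Y_Y'_def G_def G'_def)
  have J1: "Jprod1 M G a b c T = (if T \<subseteq> ovars then sg ((p + card (sel 1 T)) * card (sel 2 T))
      (Jprod1 M (\<lambda>b c _. Ymode M u (- b - 1) (sel 1 T) (Ymode M v (- c - 1) (sel 2 T) w)) a b c {}) else 0)" for a T
    by (simp add: Jprod1_def Ge Sum_any_sg[symmetric] cs_sg)
  have J2: "Jprod2 M G' a b c T = (if T \<subseteq> ovars then sg (q * card (sel 1 T))
      (Jprod2 M (\<lambda>b c _. Ymode M v (- c - 1) (sel 2 T) (Ymode M u (- b - 1) (sel 1 T) w)) a b c {}) else 0)" for a T
    by (simp add: Jprod2_def Ge' Sum_any_sg[symmetric] cs_sg)
  have J: "Jprod1 M G a b c T - sg (p * q) (Jprod2 M G' a b c T) = (if T \<subseteq> ovars then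
        sg ((p + card (sel 1 T)) * card (sel 2 T))
          (Jlhs p q u (sel 1 T) v (sel 2 T) w a b c) else 0)" for a T
  proof -
    have "sg (p * q) (sg (q * card (sel 1 T)) x) = sg ((p + card (sel 1 T)) * card (sel 2 T))
        (sg ((p + card (sel 1 T)) * (q + card (sel 2 T))) x)" for x :: 'a
      unfolding sg_sg by (rule sg_cong) auto
    then show ?thesis unfolding J1 J2 by (simp add: Jlhs_def sg_diff)
  qed
  have "series_mul M (delta1 (nu g)) (Y_Y M {0, 1} p u q v w) a b c R
      - sg (p * q) (series_mul M (delta2 (nu g)) (Y_Y' M {0, 1} p u q v w) a b c R)
    = (\<Sum>k<3. cs M (of_int (a + int k) gchoose k) (omul M (nu g ^ k)
       (\<lambda>T. Jprod1 M G (a + int k) b c T - sg (p * q) (Jprod2 M G' (a + int k) b c T)) R))"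
  proof -
    have 1: "series_mul M (delta1 (nu g)) (Y_Y M {0, 1} p u q v w) a b c R =
        (\<Sum>k<3. cs M (of_int (a + int k) gchoose k) (omul M (nu g ^ k) (Jprod1 M G (a + int k) b c) R))"
      unfolding YY by (rule series_mul_delta1[where G = G, OF c(1) t nu_cubed])
    have 2: "series_mul M (delta2 (nu g)) (Y_Y' M {0, 1} p u q v w) a b c R =
        (\<Sum>k<3. cs M (of_int (a + int k) gchoose k) (omul M (nu g ^ k) (Jprod2 M G' (a + int k) b c) R))"
      unfolding YY by (rule series_mul_delta2[where G = G', OF c(2) t' nu_cubed])
    show ?thesis unfolding 1 2
      by (simp add: omul_diff omul_sg c cs_diff cs_sg sum_subtractf sg_sum)
  qed
  then show ?thesis by (simp only: J)
qed

lemma series_rhs: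
  assumes w: "w \<in> carr M" and J: "\<And>j S. j \<ge> J \<Longrightarrow> Ymode M u (int j - a - 1) S v = 0"
  shows "series_mul M (delta3 (nu g)) (Y_iter M {0, 1} p u q v w) a b c R
    = (\<Sum>k<3. \<Sum>j<J. cs M ((of_int (b + int k + int j) gchoose k) * (of_int (b + int j) gchoose j) * (- 1) ^ j * (- 1) ^ k)
       (omul M (nu g ^ k) (Ycomp (\<lambda>S T. Ymode M (Ymode M u (int j - a - 1) S v)
          (- (c + b + 1 + int k + int j) - 1) T w)) R))"
proof -
  define H where "H = (\<lambda>a c. Yiter M {0, 1} p u q v w a c)"
  have He: "H a c = Ycomp (\<lambda>S T. Ymode M (Ymode M u (- a - 1) S v) (- c - 1) T w)" for a c
    unfolding H_def by (rule ext, rule Yiter_explicit[OF w])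
  have c: "H a c T \<in> carr M" for a c T by (simp add: He)
  have i: "- (a - int j) - 1 = int j - a - 1" for j by simp
  have t: "H (a - int j) c T = 0" if "j \<ge> J" for j c T
    unfolding He i J[OF that] by (simp add: Ycomp_def Let_def)
  have Y: "Y_iter M {0, 1} p u q v w = (\<lambda>a b c. if b = 0 then H a c else (\<lambda>_. 0))"
    by (simp add: fun_eq_iff Y_iter_def H_def Yiter_def)
  show ?thesis unfolding Y by (subst series_mul_delta3[where H = H, OF c t nu_cubed]) (simp_all only: He i)
qed

lemma trunc_J: "\<exists>J. \<forall>j\<ge>J. \<forall>S. Ymode M u (int j - a - 1) S v = 0"
proof -
  obtain N where N: "\<And>n S. n \<ge> N \<Longrightarrow> Ymode M u n S v = 0" using Y_trunc by blast
  then have "\<forall>j\<ge>nat (N + a + 1). \<forall>S. Ymode M u (int j - a - 1) S v = 0" by auto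
  then show ?thesis by blast
qed

lemma sel_empty [simp]: "sel i {} = {}"
  by (simp add: sel_def)

lemma Ycomp_empty [simp]: "Ycomp m {} = m {} {}"
  by (simp add: Ycomp_def Let_def)

lemma jacobi_explicit:
  assumes "jacobi {0, 1} (nu g) M" "u \<in> gr M p" "v \<in> gr M q" and w: "w \<in> carr M"
    and J: "\<And>j S. j \<ge> J \<Longrightarrow> Ymode M u (int j - a - 1) S v = 0"
  shows "(\<Sum>k<3. cs M (of_int (a + int k) gchoose k) (omul M (nu g ^ k) (\<lambda>T. if T \<subseteq> ovars then
        sg ((p + card (sel 1 T)) * card (sel 2 T))
          (Jlhs p q u (sel 1 T) v (sel 2 T) w (a + int k) b c) else 0) R))
    = (\<Sum>k<3. \<Sum>j<J. cs M ((of_int (b + int k + int j) gchoose k) * (of_int (b + int j) gchoose j) * (- 1) ^ j * (- 1) ^ k)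
       (omul M (nu g ^ k) (Ycomp (\<lambda>S T. Ymode M (Ymode M u (int j - a - 1) S v)
          (- (c + b + 1 + int k + int j) - 1) T w)) R))"
proof -
  have "series_mul M (delta1 (nu g)) (Y_Y M {0, 1} p u q v w) a b c R
      - sg (p * q) (series_mul M (delta2 (nu g)) (Y_Y' M {0, 1} p u q v w) a b c R)
      = series_mul M (delta3 (nu g)) (Y_iter M {0, 1} p u q v w) a b c R"
    using assms(1-4) unfolding jacobi_def by blast
  then show ?thesis by (simp only: series_lhs[OF w] series_rhs[OF w J])
qed

text \<open>Read off the empty monomial: \<nu> has no constant term, so only the summands with k = 0
  contribute, whatever g is.\<close>

lemma jacobi_borcherds:
  assumes "jacobi {0, 1} (nu g) M"
  shows borcherds
  unfolding borcherds_def
proof (intro allI ballI)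
  fix p q u v w a b c
  assume uvw: "u \<in> gr M p" "v \<in> gr M q" "w \<in> carr M"
  obtain J where J: "\<And>j S. j \<ge> J \<Longrightarrow> Ymode M u (int j - a - 1) S v = 0" using trunc_J by blast
  have "Jlhs p q u {} v {} w a b c = (\<Sum>j<J. cs M ((of_int (b + int j) gchoose j) * (- 1) ^ j)
      (Ymode M (Ymode M u (int j - a - 1) {} v) (- (c + b + 1 + int j) - 1) {} w))"
    using jacobi_explicit[where J = J and a = a and b = b and c = c and R = "{}", OF assms uvw] J
    unfolding sum_lessThan_3 omul_empty by (simp add: coeff_power_empty one_grassmann.rep_eq)
  also have "\<dots> = Jprod3 M (\<lambda>a c _. Ymode M (Ymode M u (- a - 1) {} v) (- c - 1) {} w) a b c {}"
  proof -
    have i: "- (a - int j) - 1 = int j - a - 1" for j by simp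
    show ?thesis by (subst Jprod3_finite[where J = J]) (simp_all add: i J)
  qed
  finally show "Jlhs p q u {} v {} w a b c =
    Jprod3 M (\<lambda>a c _. Ymode M (Ymode M u (- a - 1) {} v) (- c - 1) {} w) a b c {}" .
qed

lemma sel_nonempty: "R \<subseteq> ovars \<Longrightarrow> R \<noteq> {} \<Longrightarrow> sel 1 R \<noteq> {} \<or> sel 2 R \<noteq> {}"
  unfolding sel_def by auto

text \<open>If the odd modes and \<nu> vanish, both sides are zero at every nonempty monomial, and
  the empty one is \<open>borcherds\<close>.\<close>

lemma borcherds_jacobi_0:
  assumes borcherds and van: "\<And>v n S w. S \<noteq> {} \<Longrightarrow> Ymode M v n S w = 0"
  shows "jacobi {0, 1} (nu (\<lambda>_ _. 0)) M"
  unfolding jacobi_def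
proof (intro allI ballI)
  fix p q u v w a b c R
  assume uvw: "u \<in> gr M p" "v \<in> gr M q" "w \<in> carr M"
  obtain J where J: "\<And>j S. j \<ge> J \<Longrightarrow> Ymode M u (int j - a - 1) S v = 0" using trunc_J by blast
  have 0: "nu (\<lambda>_ _. 0) ^ k = (if k = 0 then 1 else 0)" for k
    by (simp add: nu_def gconst_simps power_0_left)
  have i: "- (a - int j) - 1 = int j - a - 1" for j by simp
  let ?F = "\<lambda>T. if T \<subseteq> ovars then sg ((p + card (sel 1 T)) * card (sel 2 T))
      (Jlhs p q u (sel 1 T) v (sel 2 T) w a b c) else 0"
  let ?m = "\<lambda>j S T. Ymode M (Ymode M u (int j - a - 1) S v) (- (c + b + 1 + int j) - 1) T w"
  let ?d = "\<lambda>j. (of_int (b + int j) gchoose j) * (- 1) ^ j :: complex"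
  have lhs: "series_mul M (delta1 (nu (\<lambda>_ _. 0))) (Y_Y M {0, 1} p u q v w) a b c R
      - sg (p * q) (series_mul M (delta2 (nu (\<lambda>_ _. 0))) (Y_Y' M {0, 1} p u q v w) a b c R) = omul M 1 ?F R"
    unfolding series_lhs[OF uvw(3)] 0 sum_lessThan_3 of_nat_0 add_0_right by simp
  have rhs: "series_mul M (delta3 (nu (\<lambda>_ _. 0))) (Y_iter M {0, 1} p u q v w) a b c R =
      (\<Sum>j<J. cs M (?d j) (omul M 1 (Ycomp (?m j)) R))"
    by (subst series_rhs[OF uvw(3) J]) (simp_all only: 0 sum_lessThan_3, simp)
  have "omul M 1 ?F R = (\<Sum>j<J. cs M (?d j) (omul M 1 (Ycomp (?m j)) R))"
  proof (cases "R = {}")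
    case True
    have "?F {} = Jprod3 M (\<lambda>a c _. Ymode M (Ymode M u (- a - 1) {} v) (- c - 1) {} w) a b c {}"
      using assms(1) uvw unfolding borcherds_def by simp
    also have "\<dots> = (\<Sum>j<J. cs M (?d j) (?m j {} {}))"
      by (subst Jprod3_finite[where J = J]) (simp_all add: i J)
    finally show ?thesis using True by simp
  next
    case False
    show ?thesis
    proof (cases "finite R")
      case True
      have "?F R = 0"
      proof (cases "R \<subseteq> ovars")
        case True
        with False consider "sel 1 R \<noteq> {}" | "sel 2 R \<noteq> {}" using sel_nonempty by blast
        then have "Jlhs p q u (sel 1 R) v (sel 2 R) w a b c = 0"
          by cases (simp_all add: Jlhs_def Jprod1_def Jprod2_def van)
        then show ?thesis by simp
      qed simp
      moreover have "Ycomp (?m j) R = 0" for j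
      proof (cases "R \<subseteq> ovars")
        case True
        then show ?thesis using False subset_ovars_cases[OF True]
          by (elim insertE) (simp_all add: Ycomp_def Let_def van sel_def)
      qed (simp add: Ycomp_def Let_def)
      ultimately show ?thesis using True by simp
    qed (simp add: omul_infinite)
  qed
  then show "series_mul M (delta1 (nu (\<lambda>_ _. 0))) (Y_Y M {0, 1} p u q v w) a b c R
      - sg (p * q) (series_mul M (delta2 (nu (\<lambda>_ _. 0))) (Y_Y' M {0, 1} p u q v w) a b c R)
      = series_mul M (delta3 (nu (\<lambda>_ _. 0))) (Y_iter M {0, 1} p u q v w) a b c R"
    unfolding lhs rhs .
qed

text \<open>As Y(1, x) is the identity, the coefficient of x_1^{-1} is Y(u, x_2 + x_0) w; the last
  two claims are its terms at x_0^0 and x_0^1. For x_0^0 the two sums cover c \<ge> 0 and c < 0; for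
  x_0^1 the exponent c = -1 left uncovered has coefficient 0.\<close>

lemma Jlhs_vac_right:
  assumes "u \<in> carr M" "w \<in> carr M"
  shows "T \<noteq> {} \<Longrightarrow> Jlhs p q u S (vac M) T w a b c = 0"
    and "Jlhs p 0 u S (vac M) {} w 0 (- 1) c = Ymode M u (- c - 1) S w"
    and "Jlhs p 0 u S (vac M) {} w 1 (- 1) c = cs M (of_int (c + 1)) (Ymode M u (- c - 2) S w)"
proof -
  show "Jlhs p q u S (vac M) T w a b c = 0" if "T \<noteq> {}"
    using that assms by (simp add: Jlhs_def Jprod1_def Jprod2_def vacuum)
  have J1: "Jprod1 M (\<lambda>b c _. Ymode M u (- b - 1) S (Ymode M (vac M) (- c - 1) {} w)) a (- 1) c {} =
      (if c \<ge> 0 then cs M ((of_int (- a - 1) gchoose nat c) * (- 1) ^ nat c) (Ymode M u (- a - c - 1) S w) else 0)" for a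
  proof (cases "c \<ge> 0")
    case True
    then show ?thesis unfolding Jprod1_def using assms
      by (subst Sum_any_single[of "nat c"]) (auto simp: vacuum)
  next
    case False
    then show ?thesis unfolding Jprod1_def using assms by (simp add: vacuum)
  qed
  have ac: "- c - a - 1 = - a - c - 1" for a by simp
  have J2: "Jprod2 M (\<lambda>b c _. Ymode M (vac M) (- c - 1) {} (Ymode M u (- b - 1) S w)) a (- 1) c {} =
      (if c + a + 1 \<le> 0 then cs M ((if even (a + 1) then 1 else - 1) * (of_int (- a - 1) gchoose nat (- c - a - 1)) * (- 1) ^ nat (- c - a - 1))
        (Ymode M u (- a - c - 1) S w) else 0)" for a
  proof (cases "c + a + 1 \<le> 0")
    case True
    then show ?thesis unfolding Jprod2_def using assms
      by (subst Sum_any_single[of "nat (- c - a - 1)"]) (auto simp: vacuum ac)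
  next
    case False
    then show ?thesis unfolding Jprod2_def using assms by (simp add: vacuum)
  qed
  have b0: "(of_int (- 0 - 1) gchoose n :: complex) = (- 1) ^ n" for n
    by (subst gbinomial_neg) (simp add: binomial_gbinomial[symmetric])
  have b1: "(of_int (- 1 - 1) gchoose n :: complex) = (- 1) ^ n * (of_nat n + 1)" for n
  proof -
    have "(of_int (1 + int n) :: complex) = of_nat (Suc n)" by simp
    then show ?thesis by (subst gbinomial_neg) (simp only: binomial_gbinomial[symmetric], simp)
  qed
  have ee: "(- 1) ^ n * (- 1) ^ n = (1 :: complex)" for n
    by (cases "even n") simp_all
  show "Jlhs p 0 u S (vac M) {} w 0 (- 1) c = Ymode M u (- c - 1) S w"
    unfolding Jlhs_def J1 J2 b0 mult.assoc ee by (auto simp: cs_minus_left)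
  show "Jlhs p 0 u S (vac M) {} w 1 (- 1) c = cs M (of_int (c + 1)) (Ymode M u (- c - 2) S w)"
  proof -
    have e: "(- 1) ^ n * (of_nat n + 1) * (- 1) ^ n = (of_nat n + 1 :: complex)" for n
      by (cases "even n") simp_all
    consider "c \<ge> 0" | "c = - 1" | "c \<le> - 2" by linarith
    then show ?thesis
    proof cases
      case 1
      then show ?thesis unfolding Jlhs_def J1 J2 b1 e by (simp add: add.commute)
    next
      case 2
      then show ?thesis unfolding Jlhs_def J1 J2 b1 e by simp
    next
      case 3
      have n: "(1 :: complex) * ((- 1) ^ n * (of_nat n + 1)) * (- 1) ^ n = of_nat n + 1" for n
        using e[of n] by simp
      have "(of_nat (nat (- c - 1 - 1)) + 1 :: complex) = - of_int (c + 1)" using 3 by simp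
      moreover have "- 1 - c - 1 = - c - 2" by simp
      ultimately have "Jlhs p 0 u S (vac M) {} w 1 (- 1) c = - cs M (- of_int (c + 1)) (Ymode M u (- c - 2) S w)"
        unfolding Jlhs_def J1 J2 b1 using 3 by (cases "even (nat (- 2 - c))") (simp_all add: algebra_simps)
      then show ?thesis by (simp add: cs_minus_left del: of_int_add)
    qed
  qed
qed

end

section \<open>From vertex superalgebras with odd variables to those without\<close>

definition transl :: "'v vsa \<Rightarrow> 'v \<Rightarrow> 'v" where
  "transl M v = Ymode M v (- 2) {} (vac M)"

context prevertex begin

lemma transl_carr [simp]: "transl M v \<in> carr M"
  by (simp add: transl_def)

lemma transl_add: "u \<in> carr M \<Longrightarrow> v \<in> carr M \<Longrightarrow> transl M (u + v) = transl M u + transl M v"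
  by (simp add: transl_def Y_add_left)

lemma transl_parity: "v \<in> gr M p \<Longrightarrow> transl M v \<in> gr M p"
  using Y_parity[OF _ vac_even, of v p "- 2" "{}"] by (simp add: transl_def)

text \<open>The formula Y(T u, x) = d/dx Y(u, x): compare coefficients of x_0^1 x_1^{-1} in the
  identity for u and the vacuum.\<close>

lemma Y_transl_left:
  assumes borcherds
  shows "Ymode M (transl M u) n {} w = cs M (of_int (- n)) (Ymode M u (n - 1) {} w)"
proof (cases "u \<in> carr M \<and> w \<in> carr M")
  case True
  then have "u \<in> carr M" and w: "w \<in> carr M" by blast+
  then show ?thesis
  proof (induction u rule: gr_induct)
    case (homogeneous p u)
    have u: "u \<in> carr M" using homogeneous(1) by (rule gr_carr)
    let ?c = "- n - 1"
    have "cs M (of_int (?c + 1)) (Ymode M u (- ?c - 2) {} w) =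
        Jprod3 M (\<lambda>a c _. Ymode M (Ymode M u (- a - 1) {} (vac M)) (- c - 1) {} w) 1 (- 1) ?c {}"
      using assms homogeneous vac_even w unfolding borcherds_def
      by (subst Jlhs_vac_right(3)[OF u w, symmetric]) blast
    also have "\<dots> = Ymode M (transl M u) n {} w"
    proof -
      have "(of_int (- 1 + int j) gchoose j :: complex) = 0" if "j > 0" for j
        using gbinomial_minus_one_self[OF that] by (simp add: algebra_simps)
      then show ?thesis unfolding Jprod3_def transl_def
        by (subst Sum_any_single[of 0]) (simp_all del: of_int_add)
    qed
    finally show ?case by simp
  qed (simp add: transl_add Y_add_left cs_add)
qed (auto simp: Y_outside transl_def)

end

definition dop :: "'v vsa \<Rightarrow> nat \<Rightarrow> 'v \<Rightarrow> 'v" where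
  "dop M i v = Ymode M v (- 1) {i} (vac M)"

locale supervertex = prevertex +
  fixes g :: "nat \<Rightarrow> nat \<Rightarrow> complex"
  assumes jacobi: "jacobi {0, 1} (nu g) M"
begin

abbreviation "Dop \<equiv> dop M"

lemma Dop_carr [simp]: "Dop i v \<in> carr M"
  by (simp add: dop_def)

lemma Dop_add: "u \<in> carr M \<Longrightarrow> v \<in> carr M \<Longrightarrow> Dop i (u + v) = Dop i u + Dop i v"
  by (simp add: dop_def Y_add_left)

lemma Dop_outside: "v \<notin> carr M \<Longrightarrow> Dop i v = 0"
  by (simp add: dop_def Y_outside)

lemma Dop_parity: "v \<in> gr M p \<Longrightarrow> Dop i v \<in> gr M (1 + p)"
  using Y_parity[OF _ vac_even, of v p "- 1" "{i}"] by (simp add: dop_def)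

lemma Dop_endo: "endo M 1 (Dop i)"
  unfolding endo_def
proof (intro conjI allI ballI impI)
  fix r a v assume a: "a \<in> Lambda (lev M)" "v \<in> carr M" "has_parity r a"
  show "Dop i (scal M a v) = sg (1 * r) (scal M a (Dop i v))"
    using pre_vertexD(3)[OF pre a(1,2) vac_carr a(3), of "- 1" "{i}"] by (simp add: dop_def)
qed (use Dop_add Dop_parity in simp_all)

lemma borcherds: borcherds
  using jacobi by (rule jacobi_borcherds)

text \<open>
  The Jacobi identity for \<open>v = 1\<close> and the coefficient of \<open>x\<^sub>0\<^sup>0 x\<^sub>1\<^sup>-\<^sup>1\<close>: this is
  \<open>Y(Y(u, (0, \<phi>\<^sub>1 - \<phi>\<^sub>2)) 1, (x, \<phi>\<^sub>2)) = Y(u, (x + \<nu>, \<phi>\<^sub>1))\<close>.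
\<close>

lemma taylor:
  fixes c :: int
  assumes u: "u \<in> gr M p" and w: "w \<in> carr M"
  defines "E \<equiv> \<lambda>k T. if T \<subseteq> ovars \<and> sel 2 T = {} then Jlhs p 0 u (sel 1 T) (vac M) {} w (int k) (- 1) c else 0"
  shows "omul M 1 (E 0) R + omul M (nu g) (E 1) R + omul M (nu g ^ 2) (E 2) R =
    omul M 1 (Ycomp (\<lambda>S T. Ymode M (Ymode M u (- 1) S (vac M)) (- c - 1) T w)) R"
proof -
  have uc: "u \<in> carr M" using u by (rule gr_carr)
  have E: "(\<lambda>T. if T \<subseteq> ovars then sg ((p + card (sel 1 T)) * card (sel 2 T))
      (Jlhs p 0 u (sel 1 T) (vac M) (sel 2 T) w (int k) (- 1) c) else 0) = E k" for k
    unfolding E_def by (rule ext) (auto simp: Jlhs_vac_right(1)[OF uc w])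
  have kk: "(of_int (0 + int k) gchoose k :: complex) = 1" for k
    by (simp add: binomial_gbinomial[symmetric])
  \<comment> \<open>At x_1^{-1} the power \<nu>^k on the right carries binom(k - 1, k), which is 0
    for k > 0. Hence \<nu> survives on the left only.\<close>
  have z: "(of_int (- 1 + int 1 + int 0) gchoose 1 :: complex) = 0"
    "(of_int (- 1 + int 2 + int 0) gchoose 2 :: complex) = 0"
    by (simp_all add: gbinomial_prod_rev numeral_2_eq_2)
  have J: "Ymode M u (int j - 0 - 1) S (vac M) = 0" if "j \<ge> 1" for j S
    using that by (simp add: creation_0)
  have c: "E k T \<in> carr M" for k T by (simp add: E_def)
  have "(\<Sum>k<3. cs M (of_int (0 + int k) gchoose k) (omul M (nu g ^ k) (E k) R)) =
     (\<Sum>k<3. \<Sum>j<1. cs M ((of_int (- 1 + int k + int j) gchoose k) * (of_int (- 1 + int j) gchoose j) * (- 1) ^ j * (- 1) ^ k)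
       (omul M (nu g ^ k) (Ycomp (\<lambda>S T. Ymode M (Ymode M u (int j - 0 - 1) S (vac M))
          (- (c + - 1 + 1 + int k + int j) - 1) T w)) R))"
    using jacobi_explicit[where J = 1 and a = 0 and b = "- 1" and c = c and R = R, OF jacobi u vac_even w J]
    by (simp only: E add_0)
  moreover have "(\<Sum>k<3. cs M (of_int (0 + int k) gchoose k) (omul M (nu g ^ k) (E k) R)) =
    omul M 1 (E 0) R + omul M (nu g) (E 1) R + omul M (nu g ^ 2) (E 2) R"
    unfolding sum_lessThan_3 kk using c by simp
  moreover have "(\<Sum>k<3. \<Sum>j<1. cs M ((of_int (- 1 + int k + int j) gchoose k) * (of_int (- 1 + int j) gchoose j) * (- 1) ^ j * (- 1) ^ k)
       (omul M (nu g ^ k) (Ycomp (\<lambda>S T. Ymode M (Ymode M u (int j - 0 - 1) S (vac M))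
          (- (c + - 1 + 1 + int k + int j) - 1) T w)) R)) =
    omul M 1 (Ycomp (\<lambda>S T. Ymode M (Ymode M u (- 1) S (vac M)) (- c - 1) T w)) R"
    unfolding sum_lessThan_3 lessThan_Suc One_nat_def lessThan_0 sum.insert_if
    using z by (simp del: of_int_add add: algebra_simps)
  ultimately show ?thesis by simp
qed

text \<open>Each claim is one coefficient of \<open>taylor\<close>. Monomials in the variables of
  X_1 alone do not feel \<nu> and express u^S through u^S_{-1} 1. Monomials with one variable of
  each of X_1 and X_2 pick out one entry of g together with a derivative.\<close>

lemma Y_modes_homogeneous:
  assumes u: "u \<in> gr M p" and w: "w \<in> carr M"
  shows "Ymode M (Ymode M u (- 1) S (vac M)) n {} w = Ymode M u n S w" (is ?Y)
    and "Ymode M (Dop 0 u) n {0} w = cs M (g 0 0 * of_int (- n)) (Ymode M u (n - 1) {} w)"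
    and "Ymode M (Dop 0 u) n {1} w - Ymode M (Ymode M u (- 1) {0, 1} (vac M)) n {} w
      = cs M (g 0 1 * of_int (- n)) (Ymode M u (n - 1) {} w)"
    and "Ymode M (Dop 1 u) n {0} w + Ymode M (Ymode M u (- 1) {0, 1} (vac M)) n {} w
      = cs M (g 1 0 * of_int (- n)) (Ymode M u (n - 1) {} w)"
    and "Ymode M (Dop 1 u) n {1} w = cs M (g 1 1 * of_int (- n)) (Ymode M u (n - 1) {} w)"
proof -
  have uc: "u \<in> carr M" using u by (rule gr_carr)
  have n: "- (- n - 1) - 1 = n" "- (- n - 1) - 2 = n - 1" "- n - 1 + 1 = - n" by simp_all
  note V = Jlhs_vac_right(2,3)[OF uc w, where c = "- n - 1", unfolded n]
  note T = taylor[OF u w, where c = "- n - 1", unfolded n]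
  note simps = lmul_def sel_def Ycomp_def Let_def V omul_nu omul_nu_power2 insert_Diff_if cs_cs
  have 0: "S = {0} \<Longrightarrow> ?Y" using T[of "{2}"] by (simp add: simps)
  have 1: "S = {1} \<Longrightarrow> ?Y" using T[of "{3}"] by (simp add: simps)
  have 2: "S = {0, 1} \<Longrightarrow> ?Y" using T[of "{2, 3}"] by (simp add: simps)
  show ?Y
  proof (cases "S \<subseteq> {0, 1}")
    case True
    then show ?thesis using 0 1 2 creation[OF uc] by (cases rule: subset_01_cases) auto
  qed (simp add: Y_outside)
  show "Ymode M (Dop 0 u) n {0} w = cs M (g 0 0 * of_int (- n)) (Ymode M u (n - 1) {} w)"
    using T[of "{2, 4}"] by (simp add: simps dop_def)
  show "Ymode M (Dop 0 u) n {1} w - Ymode M (Ymode M u (- 1) {0, 1} (vac M)) n {} w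
      = cs M (g 0 1 * of_int (- n)) (Ymode M u (n - 1) {} w)"
    using T[of "{2, 5}"] by (simp add: simps dop_def)
  show "Ymode M (Dop 1 u) n {0} w + Ymode M (Ymode M u (- 1) {0, 1} (vac M)) n {} w
      = cs M (g 1 0 * of_int (- n)) (Ymode M u (n - 1) {} w)"
    using T[of "{3, 4}"] by (simp add: simps dop_def)
  show "Ymode M (Dop 1 u) n {1} w = cs M (g 1 1 * of_int (- n)) (Ymode M u (n - 1) {} w)"
    using T[of "{3, 5}"] by (simp add: simps dop_def)
qed

lemma Y_mode: "Ymode M (Ymode M u (- 1) S (vac M)) n {} w = Ymode M u n S w"
proof (cases "u \<in> carr M \<and> w \<in> carr M")
  case True
  then have "u \<in> carr M" by blast
  then show ?thesis using True
  proof (induction u rule: gr_induct)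
    case (homogeneous p u)
    then show ?case by (intro Y_modes_homogeneous(1)) auto
  qed (simp add: Y_add_left)
qed (auto simp: Y_outside)

text \<open>The relations of \<open>Y_modes_homogeneous\<close> at n = -1 on the vacuum, where
  creation turns modes into vectors. The two mixed ones contain the component at {0, 1} with
  opposite signs, so their sum is the anticommutator.\<close>

lemma Dop_relations:
  assumes "u \<in> carr M"
  shows "Dop 0 (Dop 0 u) = cs M (g 0 0) (transl M u)"
    and "Dop 1 (Dop 1 u) = cs M (g 1 1) (transl M u)"
    and "Dop 1 (Dop 0 u) = Ymode M u (- 1) {0, 1} (vac M) + cs M (g 0 1) (transl M u)"
    and "Dop 0 (Dop 1 u) = cs M (g 1 0) (transl M u) - Ymode M u (- 1) {0, 1} (vac M)"
proof -
  have "Dop 0 (Dop 0 u) = cs M (g 0 0) (transl M u) \<and> Dop 1 (Dop 1 u) = cs M (g 1 1) (transl M u) \<and>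
    Dop 1 (Dop 0 u) = Ymode M u (- 1) {0, 1} (vac M) + cs M (g 0 1) (transl M u) \<and>
    Dop 0 (Dop 1 u) = cs M (g 1 0) (transl M u) - Ymode M u (- 1) {0, 1} (vac M)"
    using assms
  proof (induction u rule: gr_induct)
    case (homogeneous p u)
    note H = Y_modes_homogeneous(2-5)[OF homogeneous vac_carr, where n = "- 1"]
    have c: "Ymode M (Ymode M u (- 1) {0, 1} (vac M)) (- 1) {} (vac M) = Ymode M u (- 1) {0, 1} (vac M)"
      by (simp add: creation)
    show ?case
      using H unfolding c by (simp add: dop_def transl_def algebra_simps)
  next
    case (add v w)
    then show ?case
      by (simp add: Dop_add transl_add cs_add Y_add_left)
  qed
  then show "Dop 0 (Dop 0 u) = cs M (g 0 0) (transl M u)" "Dop 1 (Dop 1 u) = cs M (g 1 1) (transl M u)"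
    "Dop 1 (Dop 0 u) = Ymode M u (- 1) {0, 1} (vac M) + cs M (g 0 1) (transl M u)"
    "Dop 0 (Dop 1 u) = cs M (g 1 0) (transl M u) - Ymode M u (- 1) {0, 1} (vac M)" by blast+
qed

text \<open>The coefficient of \<phi>_2^i at x_1^{-1} x_2^0, applied to the vacuum. On the left the
  opposite order dies by creation; on the right the inner difference \<phi>_1 - \<phi>_2 and the
  outer \<phi>_2 give the two remaining terms of the derivation rule.\<close>

lemma Dop_derivation:
  assumes u: "u \<in> gr M p" and v: "v \<in> carr M" and i: "i \<in> {0, 1}"
  shows "Dop i (Ymode M u n {} v) = Ymode M (Dop i u) n {} v + sg p (Ymode M u n {} (Dop i v))"
  using v
proof (induction v rule: gr_induct)
  case (homogeneous q v)
  let ?R = "{4 + i}"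
  let ?a = "- n - 1"
  have n: "- ?a - 1 = n" by simp
  have R: "?R \<subseteq> ovars" "sel 1 ?R = {}" "sel 2 ?R = {i}" using i by (auto simp: sel_def)
  have v: "v \<in> carr M" using homogeneous by (rule gr_carr)
  obtain J where "\<forall>j\<ge>J. \<forall>S. Ymode M u (int j - ?a - 1) S v = 0" using trunc_J by blast
  then have J: "Ymode M u (int j - ?a - 1) S v = 0" if "j \<ge> Suc J" for j S
    using that by simp
  let ?F = "\<lambda>k T. if T \<subseteq> ovars then sg ((p + card (sel 1 T)) * card (sel 2 T))
      (Jlhs p q u (sel 1 T) v (sel 2 T) (vac M) (?a + int k) (- 1) 0) else 0"
  let ?m = "\<lambda>k j. Ycomp (\<lambda>S T. Ymode M (Ymode M u (int j - ?a - 1) S v)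
          (- (0 + - 1 + 1 + int k + int j) - 1) T (vac M))"
  \<comment> \<open>Every monomial of \<nu> contains a variable of X_1, and \<open>?R\<close>
    contains none.\<close>
  have k0: "omul M (nu g ^ k) F ?R = 0" if "k > 0" "k < 3" "\<And>T. F T \<in> carr M" for k F
  proof -
    have "k = 1 \<or> k = 2" using that by auto
    then show ?thesis using i that(3) by (auto simp: omul_nu omul_nu_power2 lmul_def)
  qed
  have "(\<Sum>k<3. cs M (of_int (?a + int k) gchoose k) (omul M (nu g ^ k) (?F k) ?R)) =
     (\<Sum>k<3. \<Sum>j<Suc J. cs M ((of_int (- 1 + int k + int j) gchoose k) * (of_int (- 1 + int j) gchoose j) * (- 1) ^ j * (- 1) ^ k)
       (omul M (nu g ^ k) (?m k j) ?R))"
    by (rule jacobi_explicit[where J = "Suc J", OF jacobi u homogeneous vac_carr J])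
  also have "(\<Sum>k<3. cs M (of_int (?a + int k) gchoose k) (omul M (nu g ^ k) (?F k) ?R)) = ?F 0 ?R"
  proof -
    have "?F 1 T \<in> carr M" "?F 2 T \<in> carr M" for T by simp_all
    then have "omul M (nu g ^ 1) (?F 1) ?R = 0" "omul M (nu g ^ 2) (?F 2) ?R = 0"
      by (intro k0; simp)+
    then show ?thesis unfolding sum_lessThan_3 by simp
  qed
  also have "(\<Sum>k<3. \<Sum>j<Suc J. cs M ((of_int (- 1 + int k + int j) gchoose k) * (of_int (- 1 + int j) gchoose j) * (- 1) ^ j * (- 1) ^ k)
       (omul M (nu g ^ k) (?m k j) ?R)) = ?m 0 0 ?R"
  proof -
    have c: "?m k j T \<in> carr M" for k j T by simp
    have "omul M (nu g ^ 1) (?m 1 j) ?R = 0" "omul M (nu g ^ 2) (?m 2 j) ?R = 0" for j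
      by (rule k0; simp)+
    moreover have "(of_int (- 1 + int j) gchoose j :: complex) = 0" if "j > 0" for j
      using gbinomial_minus_one_self[OF that] by (simp add: algebra_simps)
    then have "(\<Sum>j<Suc J. cs M ((of_int (- 1 + int 0 + int j) gchoose 0) * (of_int (- 1 + int j) gchoose j) * (- 1) ^ j * (- 1) ^ 0)
       (omul M (nu g ^ 0) (?m 0 j) ?R)) = (\<Sum>j<Suc J. if j = 0 then ?m 0 0 ?R else 0)"
      by (intro sum.cong refl) (auto simp del: of_int_add)
    ultimately show ?thesis unfolding sum_lessThan_3 by (simp del: sum.lessThan_Suc)
  qed
  finally have eq: "?F 0 ?R = ?m 0 0 ?R" .
  have "Jlhs p q u {} v {i} (vac M) ?a (- 1) 0 = Ymode M u n {} (Dop i v)"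
  proof -
    have "Jprod1 M (\<lambda>b c _. Ymode M u (- b - 1) {} (Ymode M v (- c - 1) {i} (vac M))) ?a (- 1) 0 {} =
        Ymode M u n {} (Dop i v)"
      unfolding Jprod1_def
      by (subst Sum_any_single[of 0]) (auto simp: creation_0 dop_def)
    moreover have "Jprod2 M (\<lambda>b c _. Ymode M v (- c - 1) {i} (Ymode M u (- b - 1) {} (vac M))) ?a (- 1) 0 {} = 0"
      unfolding Jprod2_def by (simp add: creation_0)
    ultimately show ?thesis by (simp add: Jlhs_def)
  qed
  then have "?F 0 ?R = sg p (Ymode M u n {} (Dop i v))" using R by simp
  moreover have "?m 0 0 ?R = Dop i (Ymode M u n {} v) - Ymode M (Dop i u) n {} v"
  proof -
    have "Ymode M (Dop i u) n {} v = Ymode M u n {i} v"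
      unfolding dop_def by (rule Y_mode)
    then show ?thesis
      using i R by (auto simp: Ycomp_def Let_def creation dop_def)
  qed
  ultimately show ?case using eq by (simp add: algebra_simps)
next
  case (add v w)
  then show ?case by (simp add: Y_add_right Dop_add sg_add)
qed

end

context prevertex begin

text \<open>Again the coefficient of x_1^{-1} on the vacuum, now at x_2^1. Creation leaves j = 0 and
  j = 1 in the first product, that is v_{-2} 1 and v_{-1} 1; the second of them becomes the
  derivative of u by \<open>Y_transl_left\<close>.\<close>

lemma transl_derivation:
  assumes B: borcherds and u: "u \<in> carr M" and v: "v \<in> carr M"
  shows "transl M (Ymode M u n {} v) = Ymode M (transl M u) n {} v + Ymode M u n {} (transl M v)"
proof -
  have "transl M (Ymode M u n {} v) = Ymode M (transl M u) n {} v + Ymode M u n {} (transl M v)"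
    if u: "u \<in> gr M p" and v: "v \<in> gr M q" for u v p q
  proof -
    note c = u[THEN gr_carr] v[THEN gr_carr]
    let ?a = "- n - 1"
    have "Jprod3 M (\<lambda>a c _. Ymode M (Ymode M u (- a - 1) {} v) (- c - 1) {} (vac M)) ?a (- 1) 1 {} =
        transl M (Ymode M u n {} v)"
    proof -
      have "(of_int (- 1 + int j) gchoose j :: complex) = 0" if "j > 0" for j
        using gbinomial_minus_one_self[OF that] by (simp add: algebra_simps)
      then show ?thesis unfolding Jprod3_def transl_def
        by (subst Sum_any_single[of 0]) (simp_all del: of_int_add)
    qed
    moreover have "Jlhs p q u {} v {} (vac M) ?a (- 1) 1 =
        Ymode M (transl M u) n {} v + Ymode M u n {} (transl M v)"
    proof -
      have "Jprod1 M (\<lambda>b c _. Ymode M u (- b - 1) {} (Ymode M v (- c - 1) {} (vac M))) ?a (- 1) 1 {} =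
          (\<Sum>j<2. cs M ((of_int (- ?a - 1) gchoose j) * (- 1) ^ j)
            (Ymode M u (- (- 1 + ?a + 1 + int j) - 1) {} (Ymode M v (- (1 - int j) - 1) {} (vac M))))"
        by (rule Jprod1_finite) (simp add: creation_0)
      moreover have "Jprod2 M (\<lambda>b c _. Ymode M v (- c - 1) {} (Ymode M u (- b - 1) {} (vac M))) ?a (- 1) 1 {} = 0"
        unfolding Jprod2_def by (simp add: creation_0)
      ultimately show ?thesis using c
        by (simp add: Jlhs_def numeral_2_eq_2 Y_transl_left[OF B] creation cs_minus_left)
          (simp add: transl_def)
    qed
    ultimately show ?thesis using B u v unfolding borcherds_def by (metis vac_carr)
  qed note H = this
  from u v show ?thesis
  proof (induction u rule: gr_induct)
    case u: (homogeneous p u)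
    from u(2) show ?case
    proof (induction v rule: gr_induct)
      case (homogeneous q v)
      then show ?case using H u by blast
    next
      case (add v w)
      then show ?case by (simp add: Y_add_right transl_add)
    qed
  next
    case (add v w)
    then show ?case by (simp add: Y_add_left transl_add)
  qed
qed

end

section \<open>Forgetting the odd variables and restoring them from odd derivations\<close>

definition susy :: "(nat \<Rightarrow> nat \<Rightarrow> complex) \<Rightarrow> ('v \<Rightarrow> 'v) \<Rightarrow> ('v \<Rightarrow> 'v) \<Rightarrow> 'v::ab_group_add vsa \<Rightarrow> bool" where
  "susy g D0 D1 M \<longleftrightarrow> zero_outside M D0 \<and> zero_outside M D1 \<and> endo M 1 D0 \<and> endo M 1 D1 \<and>
     (\<forall>v\<in>carr M. D0 (D0 v) = cs M (g 0 0) (transl M v) \<and> D1 (D1 v) = cs M (g 1 1) (transl M v) \<and>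
        D0 (D1 v) + D1 (D0 v) = cs M (2 * g 0 1) (transl M v)) \<and>
     commutes_with_Y {} M D0 \<and> commutes_with_Y {} M D1"

definition forget :: "'v::ab_group_add vsa \<Rightarrow> 'v vsa" where
  "forget M = M\<lparr>Ymode := \<lambda>v n S w. if S = {} then Ymode M v n {} w else 0\<rparr>"

text \<open>The coefficients of \<open>e\<^bsup>\<Sum> \<phi>\<^sup>i D\<^sub>i\<^esup> v\<close>.\<close>

definition Bop :: "(nat \<Rightarrow> nat \<Rightarrow> complex) \<Rightarrow> ('v \<Rightarrow> 'v) \<Rightarrow> ('v \<Rightarrow> 'v) \<Rightarrow> 'v::ab_group_add vsa \<Rightarrow> nat set \<Rightarrow> 'v \<Rightarrow> 'v" where
  "Bop g D0 D1 M S v = (if S = {} then v else if S = {0} then D0 v else if S = {1} then D1 v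
     else D1 (D0 v) - cs M (g 0 1) (transl M v))"

definition lift :: "(nat \<Rightarrow> nat \<Rightarrow> complex) \<Rightarrow> ('v \<Rightarrow> 'v) \<Rightarrow> ('v \<Rightarrow> 'v) \<Rightarrow> 'v::ab_group_add vsa \<Rightarrow> 'v vsa" where
  "lift g D0 D1 M = M\<lparr>Ymode := \<lambda>v n S w. if S \<subseteq> {0, 1} then Ymode M (Bop g D0 D1 M S v) n {} w else 0\<rparr>"

lemma forget_simps [simp]:
  "carr (forget M) = carr M" "Ev (forget M) = Ev M" "Od (forget M) = Od M"
  "scal (forget M) = scal M" "lev (forget M) = lev M" "vac (forget M) = vac M"
  "cs (forget M) = cs M" "gr (forget M) = gr M" "endo (forget M) = endo M"
  "graded_module (forget M) = graded_module M" "zero_outside (forget M) = zero_outside M"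
  "transl (forget M) = transl M"
  "Ymode (forget M) v n S w = (if S = {} then Ymode M v n {} w else 0)"
  by (simp_all add: forget_def transl_def fun_eq_iff)

lemma lift_simps [simp]:
  "carr (lift g D0 D1 M) = carr M" "Ev (lift g D0 D1 M) = Ev M" "Od (lift g D0 D1 M) = Od M"
  "scal (lift g D0 D1 M) = scal M" "lev (lift g D0 D1 M) = lev M" "vac (lift g D0 D1 M) = vac M"
  "cs (lift g D0 D1 M) = cs M" "gr (lift g D0 D1 M) = gr M" "endo (lift g D0 D1 M) = endo M"
  "graded_module (lift g D0 D1 M) = graded_module M"
  "zero_outside (lift g D0 D1 M) = zero_outside M"
  "omul (lift g D0 D1 M) = omul M"
  "transl (lift g D0 D1 M) = transl M"
  "Ymode (lift g D0 D1 M) v n S w =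
    (if S \<subseteq> {0, 1} then Ymode M (Bop g D0 D1 M S v) n {} w else 0)"
  by (simp_all add: lift_def transl_def fun_eq_iff Bop_def)

lemma Bop_simps [simp]:
  "Bop g D0 D1 M {} v = v" "Bop g D0 D1 M {0} v = D0 v" "Bop g D0 D1 M {Suc 0} v = D1 v"
  by (simp_all add: Bop_def)

lemma Bop_01: "Bop g D0 D1 M {0, Suc 0} v = D1 (D0 v) - cs M (g 0 1) (transl M v)"
proof -
  have "{0, 1} \<noteq> {0::nat}" "{0, 1} \<noteq> {1::nat}" by auto
  then show ?thesis by (simp add: Bop_def)
qed

lemma vsa_eqI: "f = Ymode M \<Longrightarrow> M\<lparr>Ymode := f\<rparr> = M"
  by (cases M) simp

lemma Jprod_forget [simp]:
  "Jprod1 (forget M) = Jprod1 M" "Jprod2 (forget M) = Jprod2 M" "Jprod3 (forget M) = Jprod3 M"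
  by (simp_all add: fun_eq_iff Jprod1_def Jprod2_def Jprod3_def)

lemma Jprod_lift [simp]:
  "Jprod1 (lift g D0 D1 M) = Jprod1 M" "Jprod2 (lift g D0 D1 M) = Jprod2 M" "Jprod3 (lift g D0 D1 M) = Jprod3 M"
  by (simp_all add: fun_eq_iff Jprod1_def Jprod2_def Jprod3_def)

text \<open>The sums over subsets of \<open>K\<close> and of {0, 1} differ by summands containing
  vanishing modes.\<close>

lemma (in prevertex) jacobi_extend:
  assumes K: "K \<subseteq> {0, 1}" and van: "\<And>v n S w. \<not> S \<subseteq> K \<Longrightarrow> Ymode M v n S w = 0"
  shows "jacobi K \<nu> M \<longleftrightarrow> jacobi {0, 1} \<nu> M"
proof -
  have fin: "finite (Pow {0, 1::nat})" by simp
  have P: "Pow K \<subseteq> Pow {0, 1}" using K by blast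
  have Yop: "Yop M K = Yop M {0, 1}"
  proof (intro ext)
    fix i p u n F R
    show "Yop M K i p u n F R = Yop M {0, 1} i p u n F R"
      unfolding Yop_def by (rule sum.mono_neutral_left[OF fin P]) (auto simp: van)
  qed
  have Y0: "Yop M K' i p 0 n F = (\<lambda>R. 0)" for K' i p n F
    unfolding Yop_def by simp
  have "Y_iter M K = Y_iter M {0, 1}"
  proof (intro ext)
    fix p u q v w a b c R
    have "(\<Sum>S\<in>Pow K. omul M (omonom (\<lambda>j. ovar 1 j - ovar 2 j) S)
        (Yop M {0, 1} 2 (p + card S + q) (Ymode M u (- a - 1) S v) (- c - 1) (oconst w)) R) =
      (\<Sum>S\<in>Pow {0, 1}. omul M (omonom (\<lambda>j. ovar 1 j - ovar 2 j) S)
        (Yop M {0, 1} 2 (p + card S + q) (Ymode M u (- a - 1) S v) (- c - 1) (oconst w)) R)"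
    proof (rule sum.mono_neutral_left[OF fin P], rule ballI)
      fix S assume "S \<in> Pow {0, 1} - Pow K"
      then have "Ymode M u (- a - 1) S v = 0" using van by blast
      then show "omul M (omonom (\<lambda>j. ovar 1 j - ovar 2 j) S)
        (Yop M {0, 1} 2 (p + card S + q) (Ymode M u (- a - 1) S v) (- c - 1) (oconst w)) R = 0"
        by (simp only: Y0) simp
    qed
    then show "Y_iter M K p u q v w a b c R = Y_iter M {0, 1} p u q v w a b c R"
      unfolding Y_iter_def Yop by simp
  qed
  moreover have "Y_Y M K = Y_Y M {0, 1}" "Y_Y' M K = Y_Y' M {0, 1}"
    by (intro ext; simp only: Y_Y_def Y_Y'_def Yop)+
  ultimately show ?thesis unfolding jacobi_def by simp
qed

lemma vertex_axioms_extend: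
  fixes M :: "'v::ab_group_add vsa"
  assumes "K \<subseteq> {0, 1}"
  shows "vertex_axioms K \<nu> M \<longleftrightarrow>
    vertex_axioms {0, 1} \<nu> M \<and> (\<forall>v n S w. \<not> S \<subseteq> K \<longrightarrow> Ymode M v n S w = 0)"
proof (cases "graded_module M")
  case True
  then interpret gmodule M by unfold_locales
  let ?van = "\<forall>v n S w. \<not> S \<subseteq> K \<longrightarrow> Ymode M v n S w = 0"
  have pre: "pre_vertex K M \<longleftrightarrow> pre_vertex {0, 1} M \<and> ?van"
    by (rule pre_vertex_extend[OF gmodule_axioms assms])
  have "jacobi K \<nu> M \<longleftrightarrow> jacobi {0, 1} \<nu> M" if P: "pre_vertex {0, 1} M" and van: "?van"
  proof -
    interpret prevertex M by unfold_locales (rule P)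
    show ?thesis by (rule jacobi_extend[OF assms]) (use van in simp)
  qed
  then show ?thesis unfolding vertex_axioms_iff pre by iprover
qed (simp add: vertex_axioms_iff)

lemma nu_0: "nu (\<lambda>_ _. 0) = 0"
  by (simp add: nu_def gconst_simps)

locale vertex_base =
  fixes M :: "'a::ab_group_add vsa"
  assumes axioms: "vertex_axioms {} 0 M"

sublocale vertex_base \<subseteq> prevertex
proof
  show "graded_module M" "pre_vertex {0, 1} M"
    using axioms vertex_axioms_extend[of "{}" 0 M] by (auto simp: vertex_axioms_iff)
qed

context vertex_base begin

lemma Y_nonempty: "S \<noteq> {} \<Longrightarrow> Ymode M v n S w = 0"
  using axioms vertex_axioms_extend[of "{}" 0 M] by auto

lemma borcherds: borcherds
  using axioms vertex_axioms_extend[of "{}" 0 M] jacobi_borcherds[of "\<lambda>_ _. 0"]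
  by (auto simp: nu_0 vertex_axioms_iff)

end

lemma (in prevertex) vertex_base_I:
  assumes borcherds "\<And>v n S w. S \<noteq> {} \<Longrightarrow> Ymode M v n S w = 0"
  shows "vertex_base M"
proof
  show "vertex_axioms {} 0 M"
    using borcherds_jacobi_0[OF assms] assms(2) graded pre
      vertex_axioms_extend[of "{}" 0 M] by (auto simp: nu_0 vertex_axioms_iff)
qed

context supervertex begin

lemma prevertex_forget: "prevertex (forget M)"
proof
  show "graded_module (forget M)" using graded by simp
  show "pre_vertex {0, 1} (forget M)"
  proof (rule pre_vertexI)
    show "endo (forget M) (p + card S) (Ymode (forget M) v n S)" if "v \<in> gr (forget M) p" for p v n S
    proof (cases "S = {}")
      case True
      moreover have "Ymode (forget M) v n {} = Ymode M v n {}" by (simp add: fun_eq_iff)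
      ultimately show ?thesis using Y_endo[of v p "{}" n] that by simp
    next
      case False
      then have "Ymode (forget M) v n S = (\<lambda>w. 0)" by (simp add: fun_eq_iff)
      then show ?thesis by (simp add: endo_zero)
    qed
    show "\<exists>N. \<forall>n\<ge>N. \<forall>S. Ymode (forget M) u n S v = 0" for u v
      using Y_trunc[of u v] by (metis forget_simps(13))
    show "Ymode (forget M) (scal (forget M) a v) n S w = sg (r * card S) (scal (forget M) a (Ymode (forget M) v n S w))"
      if "a \<in> Lambda (lev (forget M))" "v \<in> carr (forget M)" "w \<in> carr (forget M)" "has_parity r a" for a v w r n S
      using that pre_vertexD(3)[OF pre, of a v w r n "{}"] by simp
  qed (auto simp: Y_outside Y_add_left vacuum creation creation_0)
qed

lemma vertex_base_forget: "vertex_base (forget M)"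
proof -
  interpret F: prevertex "forget M" by (rule prevertex_forget)
  have "F.borcherds"
    using borcherds unfolding F.borcherds_def borcherds_def F.Jlhs_def Jlhs_def by simp
  then show ?thesis by (rule F.vertex_base_I) simp
qed

text \<open>Symmetry of g turns the sum g_01 + g_10 of the two mixed relations into 2 g_01.\<close>

lemma susy_forget:
  assumes "g 1 0 = g 0 1"
  shows "susy g (Dop 0) (Dop 1) (forget M)"
proof -
  have c: "commutes_with_Y {} (forget M) (Dop i)" if "i \<in> {0, 1}" for i
    unfolding commutes_with_Y_def using Dop_derivation[OF _ _ that] by (simp add: algebra_simps)
  have r: "Dop 0 (Dop 1 v) + Dop 1 (Dop 0 v) = cs M (2 * g 0 1) (transl M v)" if "v \<in> carr M" for v
    unfolding Dop_relations(3,4)[OF that]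
    using assms cs_add_left[of "transl M v" "g 0 1" "g 0 1"] by simp
  show ?thesis
    unfolding susy_def forget_simps zero_outside_def
    by (intro conjI ballI allI impI;
      rule c r Dop_endo Dop_relations(1) Dop_relations(2) Dop_outside; (assumption | simp))
qed

text \<open>\<open>Dop_relations\<close> identify \<open>Bop\<close> at S with v^S_{-1} 1, and
  \<open>Y_mode\<close> recovers the odd modes from these vectors. Vectors outside the carrier are
  treated apart, since the records have to be equal.\<close>

lemma lift_forget: "lift g (Dop 0) (Dop 1) (forget M) = M"
proof -
  have B: "Bop g (Dop 0) (Dop 1) (forget M) S v = Ymode M v (- 1) S (vac M)" if "S \<subseteq> {0, 1}" "v \<in> carr M" for S v
    using that(1)
  proof (cases rule: subset_01_cases)
    case 4
    then show ?thesis using Dop_relations(3)[OF that(2)] by (simp add: Bop_01)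
  qed (use that creation in \<open>simp_all add: dop_def\<close>)
  have "Ymode (lift g (Dop 0) (Dop 1) (forget M)) v n S w = Ymode M v n S w" for v n S w
  proof (cases "S \<subseteq> {0, 1}")
    case True
    show ?thesis
    proof (cases "v \<in> carr M")
      case v: True
      then show ?thesis using True by (simp add: B Y_mode del: One_nat_def)
    next
      case False
      have "Bop g (Dop 0) (Dop 1) (forget M) S v = (if S = {} then v else 0)"
        using True False by (cases rule: subset_01_cases)
          (simp_all add: Bop_01 Dop_outside dop_def transl_def Y_outside)
      then show ?thesis using True False by (simp add: Y_outside)
    qed
  qed (auto simp: Y_outside)
  then have "Ymode (lift g (Dop 0) (Dop 1) (forget M)) = Ymode M" by (simp add: fun_eq_iff)
  moreover have "lift g (Dop 0) (Dop 1) (forget M) = M\<lparr>Ymode := Ymode (lift g (Dop 0) (Dop 1) (forget M))\<rparr>"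
    by (simp add: lift_def forget_def)
  ultimately show ?thesis by (metis vsa_eqI)
qed

end

section \<open>Calculus of D_0, D_1, translation and B\<close>

locale susy_base = vertex_base M for M :: "'a::ab_group_add vsa" +
  fixes g :: "nat \<Rightarrow> nat \<Rightarrow> complex" and D0 D1 :: "'a \<Rightarrow> 'a"
  assumes sym: "g 1 0 = g 0 1" and susy: "susy g D0 D1 M"
begin

abbreviation T where "T \<equiv> transl M"
text \<open>On the carrier this is (D_1 D_0 - D_0 D_1) / 2, the \<phi>^0 \<phi>^1 coefficient of the
  exponential; the anticommutator 2 g_01 T eliminates D_0 D_1.\<close>

definition B where "B v = D1 (D0 v) - cs M (g 0 1) (T v)"
abbreviation Y where "Y x n y \<equiv> Ymode M x n {} y"

lemma D_endo: "endo M 1 D0" "endo M 1 D1"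
  using susy by (auto simp: susy_def)

lemma D_carr [simp]: "D0 v \<in> carr M" "D1 v \<in> carr M"
  using susy endoD(1)[OF D_endo(1)] endoD(1)[OF D_endo(2)]
  unfolding susy_def zero_outside_def by (metis carr_0)+

lemma D_outside: "v \<notin> carr M \<Longrightarrow> D0 v = 0" "v \<notin> carr M \<Longrightarrow> D1 v = 0"
  using susy unfolding susy_def zero_outside_def by blast+

lemmas D_add = endoD(2)[OF D_endo(1)] endoD(2)[OF D_endo(2)]
lemmas D_parity = endoD(3)[OF D_endo(1)] endoD(3)[OF D_endo(2)]
lemmas D_linear = endo_additive[OF D_endo(1)] endo_additive[OF D_endo(2)] D_add

lemma D_square: "v \<in> carr M \<Longrightarrow> D0 (D0 v) = cs M (g 0 0) (T v)"
  "v \<in> carr M \<Longrightarrow> D1 (D1 v) = cs M (g 1 1) (T v)"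
  using susy by (auto simp: susy_def)

lemma D0_D1: "v \<in> carr M \<Longrightarrow> D0 (D1 v) = cs M (2 * g 0 1) (T v) - D1 (D0 v)"
  using susy by (auto simp: susy_def algebra_simps)

lemma D_derivation:
  assumes "x \<in> gr M p" "y \<in> carr M"
  shows "D0 (Y x n y) = Y (D0 x) n y + sg p (Y x n (D0 y))"
    and "D1 (Y x n y) = Y (D1 x) n y + sg p (Y x n (D1 y))"
proof -
  have "D (Y x n y) = Y (D x) n y + sg p (Y x n (D y))" if "commutes_with_Y {} M D" for D
  proof -
    have "sg 0 (D (Y x n y)) - sg p (Y x n (D y)) = Y (D x) n y"
      using that assms unfolding commutes_with_Y_def by fastforce
    then show ?thesis by (simp add: algebra_simps)
  qed
  then show "D0 (Y x n y) = Y (D0 x) n y + sg p (Y x n (D0 y))"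
    "D1 (Y x n y) = Y (D1 x) n y + sg p (Y x n (D1 y))"
    using susy unfolding susy_def by blast+
qed

text \<open>The derivation rule for 1 = 1_{-1} 1 reads D 1 = D 1 + D 1.\<close>

lemma D_vac: "D0 (vac M) = 0" "D1 (vac M) = 0"
proof -
  have "D (vac M) = 0" if "D (Y (vac M) (- 1) (vac M)) = Y (D (vac M)) (- 1) (vac M) + sg 0 (Y (vac M) (- 1) (D (vac M)))"
    "D (vac M) \<in> carr M" for D
    using that by (simp add: vacuum creation)
  then show "D0 (vac M) = 0" "D1 (vac M) = 0"
    using D_derivation[OF vac_even vac_carr] by auto
qed

lemma T_D:
  assumes "v \<in> carr M"
  shows "D0 (T v) = T (D0 v)" "D1 (T v) = T (D1 v)"
proof -
  have "D0 (T v) = T (D0 v) \<and> D1 (T v) = T (D1 v)"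
    using assms
  proof (induction v rule: gr_induct)
    case (homogeneous p v)
    then show ?case using D_derivation[OF homogeneous vac_carr] by (simp add: transl_def D_vac)
  next
    case (add v w)
    then show ?case by (simp add: transl_add D_add)
  qed
  then show "D0 (T v) = T (D0 v)" "D1 (T v) = T (D1 v)" by blast+
qed

lemma T_linear: "v \<in> carr M \<Longrightarrow> T (cs M z v) = cs M z (T v)"
  "v \<in> carr M \<Longrightarrow> w \<in> carr M \<Longrightarrow> T (v + w) = T v + T w"
  "v \<in> carr M \<Longrightarrow> w \<in> carr M \<Longrightarrow> T (v - w) = T v - T w"
  by (simp_all add: transl_def Y_cs_left Y_add_left Y_diff_left)

lemma T_derivation: "x \<in> carr M \<Longrightarrow> y \<in> carr M \<Longrightarrow> T (Y x n y) = Y (T x) n y + Y x n (T y)"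
  by (rule transl_derivation[OF borcherds])

lemma B_carr [simp]: "v \<in> carr M \<Longrightarrow> B v \<in> carr M"
  by (simp add: B_def)

text \<open>Clifford algebra computations with T central. In particular B^2 = - det(g) T^2.\<close>

lemma B_relations:
  assumes "v \<in> carr M"
  shows "B (D0 v) = cs M (g 0 0) (T (D1 v)) - cs M (g 0 1) (T (D0 v))"
    and "D0 (B v) = cs M (g 0 1) (T (D0 v)) - cs M (g 0 0) (T (D1 v))"
    and "B (D1 v) = cs M (g 0 1) (T (D1 v)) - cs M (g 1 1) (T (D0 v))"
    and "D1 (B v) = cs M (g 1 1) (T (D0 v)) - cs M (g 0 1) (T (D1 v))"
    and "B (B v) = cs M (g 0 1 * g 0 1 - g 0 0 * g 1 1) (T (T v))"
proof -
  note simps = B_def D_square D0_D1 T_D T_linear D_linear cs_cs cs_diff cs_add assms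
  have 2: "cs M (2 * z) w = cs M z w + cs M z w" if "w \<in> carr M" for z w
    using that by (simp add: cs_add_left[symmetric])
  show "B (D0 v) = cs M (g 0 0) (T (D1 v)) - cs M (g 0 1) (T (D0 v))"
    by (simp add: simps)
  show "D0 (B v) = cs M (g 0 1) (T (D0 v)) - cs M (g 0 0) (T (D1 v))"
    by (simp add: simps 2)
  show "B (D1 v) = cs M (g 0 1) (T (D1 v)) - cs M (g 1 1) (T (D0 v))"
    by (simp add: simps 2)
  show "D1 (B v) = cs M (g 1 1) (T (D0 v)) - cs M (g 0 1) (T (D1 v))"
    by (simp add: simps)
  show "B (B v) = cs M (g 0 1 * g 0 1 - g 0 0 * g 1 1) (T (T v))"
    by (simp add: simps 2 cs_diff_left mult.commute)
qed

text \<open>A composition of two odd derivations is a derivation up to cross terms; the translation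
  part of \<open>B\<close> adds none.\<close>

lemma B_derivation:
  assumes x: "x \<in> gr M p" and y: "y \<in> carr M"
  shows "B (Y x n y) = Y (B x) n y + Y x n (B y) + sg p (Y (D1 x) n (D0 y) - Y (D0 x) n (D1 y))"
proof -
  have "D1 (D0 (Y x n y)) = Y (D1 (D0 x)) n y + sg (1 + p) (Y (D0 x) n (D1 y))
      + sg p (Y (D1 x) n (D0 y) + sg p (Y x n (D1 (D0 y))))"
    using D_derivation[OF x y, of n] D_derivation(2)[OF D_parity(1)[OF x] y, of n]
      D_derivation(2)[OF x D_carr(1), of n]
    by (simp add: D_linear)
  moreover have "sg p (sg p v) = v" for v :: 'a by (simp add: sg_sg sg_even)
  ultimately show ?thesis
    using T_derivation[OF gr_carr[OF x] y, of n] gr_carr[OF x] y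
    by (simp add: B_def Y_diff_left Y_diff_right Y_cs_left Y_cs_right cs_add sg_add sg_diff sg_Suc)
qed

end

section \<open>Axioms of the lifted structure other than the Jacobi identity\<close>

context susy_base begin

abbreviation BS where "BS \<equiv> Bop g D0 D1 M"
abbreviation L where "L \<equiv> lift g D0 D1 M"

lemma BS_01 [simp]: "BS {0, Suc 0} v = B v"
  by (simp add: Bop_01 B_def)

lemma BS_carr [simp]: "v \<in> carr M \<Longrightarrow> BS S v \<in> carr M"
  by (simp add: Bop_def)

lemma BS_add: "v \<in> carr M \<Longrightarrow> w \<in> carr M \<Longrightarrow> BS S (v + w) = BS S v + BS S w"
  by (simp add: Bop_def D_linear T_linear cs_add)

lemma BS_outside: "v \<notin> carr M \<Longrightarrow> BS S v = (if S = {} then v else 0)"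
  by (simp add: Bop_def D_outside D_linear transl_def Y_outside)

lemma BS_vac: "BS S (vac M) = (if S = {} then vac M else 0)"
  by (simp add: Bop_def D_linear D_vac transl_def vacuum)

lemma BS_parity:
  assumes "S \<subseteq> {0, 1}" "v \<in> gr M p"
  shows "BS S v \<in> gr M (p + card S)"
  using assms(1)
proof (cases rule: subset_01_cases)
  case 4
  have "D1 (D0 v) \<in> gr M p" using D_parity(2)[OF D_parity(1)[OF assms(2)]] by (simp add: gr_Suc_Suc)
  moreover have "cs M (g 0 1) (T v) \<in> gr M p" by (intro gr_cs transl_parity assms)
  ultimately have "B v \<in> gr M p" unfolding B_def by (rule gr_diff)
  then show ?thesis using 4 by (simp add: gr_Suc_Suc)
qed (use D_parity[OF assms(2)] assms in simp_all)

lemma BS_scal: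
  assumes "S \<subseteq> {0, 1}" "a \<in> Lambda (lev M)" "v \<in> carr M" "has_parity r a"
  shows "BS S (scal M a v) = sg (r * card S) (scal M a (BS S v))"
  using assms(1)
proof (cases rule: subset_01_cases)
  case 4
  have T: "T (scal M a v) = scal M a (T v)"
    using pre_vertexD(3)[OF pre assms(2,3) vac_carr assms(4), of "- 2" "{}"] by (simp add: transl_def)
  have "D1 (D0 (scal M a v)) = scal M a (D1 (D0 v))"
    using endoD(4)[OF D_endo(1) assms(2,3,4)] endoD(4)[OF D_endo(2) assms(2) D_carr(1) assms(4), of v]
      assms by (simp add: D_linear sg_sg sg_even)
  moreover have "scal M a (x - y) = scal M a x - scal M a y" if "x \<in> carr M" "y \<in> carr M" for x y
    using scal_add[of a "x - y" y] assms that by (simp add: algebra_simps)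
  ultimately show ?thesis using 4 assms by (simp add: B_def T cs_scal sg_even)
qed (use assms endoD(4)[OF D_endo(1) assms(2,3,4)] endoD(4)[OF D_endo(2) assms(2,3,4)] in simp_all)

lemma Y_lift: "Ymode L v n S w = (if S \<subseteq> {0, 1} then Y (BS S v) n w else 0)"
  by (rule lift_simps)

lemma prevertex_lift: "prevertex L"
proof
  show "graded_module L" using graded by simp
  show "pre_vertex {0, 1} L"
  proof (rule pre_vertexI, unfold lift_simps(1-11))
    show "Ymode L v n S w = 0" if "\<not> (v \<in> carr M \<and> S \<subseteq> {0, 1} \<and> w \<in> carr M)" for v n S w
      using that unfolding Y_lift by (auto simp: Y_outside BS_outside)
    show "Ymode L (u + v) n S w = Ymode L u n S w + Ymode L v n S w"
      if "u \<in> carr M" "v \<in> carr M" for u v w n S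
      using that unfolding Y_lift by (simp add: BS_add Y_add_left)
    show "Ymode L (scal M a v) n S w = sg (r * card S) (scal M a (Ymode L v n S w))"
      if "a \<in> Lambda (lev M)" "v \<in> carr M" "w \<in> carr M" "has_parity r a" for a v w r n S
      using that pre_vertexD(3)[OF pre that(1) _ that(3,4), of "BS S v" n "{}"] unfolding Y_lift
      by (simp add: BS_scal Y_sg_left)
    show "endo M (p + card S) (Ymode L v n S)" if "v \<in> gr M p" "S \<subseteq> {0, 1}" for v p n S
    proof -
      have "Ymode L v n S = Ymode M (BS S v) n {}" using that by (simp add: fun_eq_iff Y_lift)
      then show ?thesis using Y_endo[OF BS_parity[OF that(2,1)], of "{}" n] by simp
    qed
    show "\<exists>N. \<forall>n\<ge>N. \<forall>S. Ymode L u n S v = 0" for u v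
    proof -
      have "\<exists>N. \<forall>n\<ge>N. Y (BS S u) n v = 0" for S
        using Y_trunc by blast
      then obtain N where N: "\<And>S n. n \<ge> N S \<Longrightarrow> Y (BS S u) n v = 0" by metis
      \<comment> \<open>Truncation asks for one bound for all S; the four bounds have a
        maximum.\<close>
      have "Ymode L u n S v = 0" if "n \<ge> Max (N ` Pow {0, 1})" for n S
      proof (cases "S \<subseteq> {0, 1}")
        case True
        then have "N S \<le> Max (N ` Pow {0, 1})" by (intro Max_ge) auto
        then show ?thesis using that N by (simp add: Y_lift)
      qed (simp add: Y_lift)
      then show ?thesis by blast
    qed
    show "Ymode L (vac M) n S w = (if n = - 1 \<and> S = {} then w else 0)"
      if "w \<in> carr M" "S \<subseteq> {0, 1}" for w n S
      using that unfolding Y_lift by (simp add: BS_vac vacuum)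
  qed (simp_all add: Y_lift creation creation_0)
qed

lemma Y_T: "Y (T x) n y = cs M (of_int (- n)) (Y x (n - 1) y)"
  by (rule Y_transl_left[OF borcherds])

lemma BS_T: "v \<in> carr M \<Longrightarrow> BS S (T v) = T (BS S v)"
  by (simp add: Bop_def T_D T_linear)

text \<open>The coefficients of e^{\<phi>_2 D} Y(e^{(\<phi>_1 - \<phi>_2) D} u, x) v = Y(e^{\<nu> T}
  e^{\<phi>_1 D} u, x) e^{\<phi>_2 D} v, one odd monomial at a time, with trivial ones omitted. They
  follow from the derivation rules and the Clifford relations.\<close>

lemma lift_products:
  assumes u: "u \<in> gr M p" and v: "v \<in> carr M"
  shows "D0 (Y u n v) - Y (D0 u) n v = sg p (Y u n (D0 v))"
    and "D1 (Y u n v) - Y (D1 u) n v = sg p (Y u n (D1 v))"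
    and "B (Y u n v) - D1 (Y (D0 u) n v) + D0 (Y (D1 u) n v) + Y (B u) n v = Y u n (B v)"
    and "D0 (Y (D0 u) n v) = - sg p (Y (D0 u) n (D0 v)) + cs M (g 0 0) (Y (T u) n v)"
    and "D1 (Y (D0 u) n v) - Y (B u) n v = - sg p (Y (D0 u) n (D1 v)) + cs M (g 0 1) (Y (T u) n v)"
    and "D0 (Y (D1 u) n v) + Y (B u) n v = - sg p (Y (D1 u) n (D0 v)) + cs M (g 0 1) (Y (T u) n v)"
    and "D1 (Y (D1 u) n v) = - sg p (Y (D1 u) n (D1 v)) + cs M (g 1 1) (Y (T u) n v)"
    and "B (Y (D0 u) n v) + D0 (Y (B u) n v) = Y (D0 u) n (B v)
      + sg p (cs M (g 0 0) (Y (T u) n (D1 v)) - cs M (g 0 1) (Y (T u) n (D0 v)))"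
    and "B (Y (D1 u) n v) + D1 (Y (B u) n v) = Y (D1 u) n (B v)
      + sg p (cs M (g 0 1) (Y (T u) n (D1 v)) - cs M (g 1 1) (Y (T u) n (D0 v)))"
    and "D0 (Y (B u) n v) = sg p (Y (B u) n (D0 v))
      + cs M (g 0 1) (Y (T (D0 u)) n v) - cs M (g 0 0) (Y (T (D1 u)) n v)"
    and "D1 (Y (B u) n v) = sg p (Y (B u) n (D1 v))
      + cs M (g 1 1) (Y (T (D0 u)) n v) - cs M (g 0 1) (Y (T (D1 u)) n v)"
    and "B (Y (B u) n v) = Y (B u) n (B v) + cs M (g 0 1 * g 0 1 - g 0 0 * g 1 1) (Y (T (T u)) n v)
      + sg p (cs M (g 1 1) (Y (T (D0 u)) n (D0 v)) - cs M (g 0 1) (Y (T (D1 u)) n (D0 v))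
        - cs M (g 0 1) (Y (T (D0 u)) n (D1 v)) + cs M (g 0 0) (Y (T (D1 u)) n (D1 v)))"
proof -
  have uc: "u \<in> carr M" using u by (rule gr_carr)
  have Bu: "B u \<in> gr M p"
    using BS_parity[of "{0, 1}" u p] u by (simp add: gr_Suc_Suc)
  note du = D_parity[OF u]
  note dd = D_derivation[OF u v] D_derivation[OF du(1) v] D_derivation[OF du(2) v] D_derivation[OF Bu v]
  note bb = B_derivation[OF u v] B_derivation[OF du(1) v] B_derivation[OF du(2) v] B_derivation[OF Bu v]
  have 2: "cs M (2 * z) w = cs M z w + cs M z w" if "w \<in> carr M" for z w
    using that by (simp add: cs_add_left[symmetric])
  have D0D1: "D0 (D1 u) = cs M (g 0 1) (T u) - B u" "D1 (D0 u) = B u + cs M (g 0 1) (T u)"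
    using uc by (simp_all add: B_def D0_D1 2)
  have Bc: "B u \<in> carr M" using uc by simp
  note lin = Y_add_left Y_diff_left Y_cs_left sg_add sg_diff sg_minus sg_Suc cs_sg uc v Bc
    D_square[OF uc] D0D1 B_relations[OF uc]
  show "D0 (Y u n v) - Y (D0 u) n v = sg p (Y u n (D0 v))" "D1 (Y u n v) - Y (D1 u) n v = sg p (Y u n (D1 v))"
    by (simp_all add: dd)
  show "B (Y u n v) - D1 (Y (D0 u) n v) + D0 (Y (D1 u) n v) + Y (B u) n v = Y u n (B v)"
    unfolding bb dd D0D1 by (simp add: lin algebra_simps)
  show "D0 (Y (D0 u) n v) = - sg p (Y (D0 u) n (D0 v)) + cs M (g 0 0) (Y (T u) n v)"
    "D1 (Y (D0 u) n v) - Y (B u) n v = - sg p (Y (D0 u) n (D1 v)) + cs M (g 0 1) (Y (T u) n v)"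
    "D0 (Y (D1 u) n v) + Y (B u) n v = - sg p (Y (D1 u) n (D0 v)) + cs M (g 0 1) (Y (T u) n v)"
    "D1 (Y (D1 u) n v) = - sg p (Y (D1 u) n (D1 v)) + cs M (g 1 1) (Y (T u) n v)"
    unfolding dd D0D1 D_square[OF uc] by (simp_all add: lin algebra_simps)
  show "B (Y (D0 u) n v) + D0 (Y (B u) n v) = Y (D0 u) n (B v)
      + sg p (cs M (g 0 0) (Y (T u) n (D1 v)) - cs M (g 0 1) (Y (T u) n (D0 v)))"
    unfolding bb dd D0D1 D_square[OF uc] B_relations[OF uc] by (simp add: lin algebra_simps)
  show "B (Y (D1 u) n v) + D1 (Y (B u) n v) = Y (D1 u) n (B v)
      + sg p (cs M (g 0 1) (Y (T u) n (D1 v)) - cs M (g 1 1) (Y (T u) n (D0 v)))"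
    unfolding bb dd D0D1 D_square[OF uc] B_relations[OF uc] by (simp add: lin algebra_simps)
  show "D0 (Y (B u) n v) = sg p (Y (B u) n (D0 v))
      + cs M (g 0 1) (Y (T (D0 u)) n v) - cs M (g 0 0) (Y (T (D1 u)) n v)"
    "D1 (Y (B u) n v) = sg p (Y (B u) n (D1 v))
      + cs M (g 1 1) (Y (T (D0 u)) n v) - cs M (g 0 1) (Y (T (D1 u)) n v)"
    unfolding dd B_relations[OF uc] by (simp_all add: lin algebra_simps)
  show "B (Y (B u) n v) = Y (B u) n (B v) + cs M (g 0 1 * g 0 1 - g 0 0 * g 1 1) (Y (T (T u)) n v)
      + sg p (cs M (g 1 1) (Y (T (D0 u)) n (D0 v)) - cs M (g 0 1) (Y (T (D1 u)) n (D0 v))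
        - cs M (g 0 1) (Y (T (D0 u)) n (D1 v)) + cs M (g 0 0) (Y (T (D1 u)) n (D1 v)))"
    unfolding bb B_relations[OF uc] by (simp add: lin algebra_simps)
qed

end

section \<open>The Jacobi identity of the lift\<close>

lemma sum_shift:
  fixes f :: "nat \<Rightarrow> 'v::ab_group_add"
  assumes "\<And>j. j \<ge> J \<Longrightarrow> f j = 0"
  shows "(\<Sum>j<J. f (j + k)) = (\<Sum>j<J. if k \<le> j then f j else 0)"
proof -
  have "(\<Sum>j<J. f (j + k)) = (\<Sum>i\<in>{k..<J + k}. f i)"
    by (rule sum.reindex_bij_witness[of _ "\<lambda>i. i - k" "\<lambda>j. j + k"]) auto
  also have "\<dots> = (\<Sum>i\<in>{k..<J}. f i)"
    by (rule sum.mono_neutral_right) (auto simp: assms)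
  also have "\<dots> = (\<Sum>j<J. if k \<le> j then f j else 0)"
    by (rule sum.mono_neutral_cong_left) auto
  finally show ?thesis .
qed

text \<open>The coefficient comparison that absorbs \<open>\<nu>\<close>; an instance of Vandermonde's identity.\<close>

lemma gbinomial_vandermonde_2:
  "((a :: complex) + 1 - of_nat j gchoose 1) + of_nat j = (a + 1 gchoose 1)"
  "((a :: complex) + 2 - of_nat j gchoose 2) + of_nat j * (a + 2 - of_nat j gchoose 1) + of_nat (j choose 2)
    = (a + 2 gchoose 2)"
proof -
  have c2: "(x gchoose 2) = x * (x - 1) / 2" for x :: complex
    by (simp add: gbinomial_prod_rev numeral_2_eq_2 atLeast0_lessThan_Suc mult.commute)
  have j2: "(of_nat (j choose 2) :: complex) = of_nat j * (of_nat j - 1) / 2"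
    by (simp add: binomial_gbinomial c2)
  show "(a + 1 - of_nat j gchoose 1) + of_nat j = (a + 1 gchoose 1)" by simp
  show "(a + 2 - of_nat j gchoose 2) + of_nat j * (a + 2 - of_nat j gchoose 1) + of_nat (j choose 2)
    = (a + 2 gchoose 2)"
    unfolding c2 j2 by (simp add: field_simps)
qed

text \<open>Trinomial revision. It rewrites the two binomials of the third delta series after
  \<open>j\<close> has been shifted by \<open>k\<close>.\<close>

lemma gbinomial_revision:
  assumes "k \<le> j"
  shows "((b :: complex) + of_nat j gchoose k) * (b + of_nat j - of_nat k gchoose (j - k)) =
    (b + of_nat j gchoose j) * of_nat (j choose k)"
  using gbinomial_trinomial_revision[OF assms, of "b + of_nat j"] assms
  by (simp add: binomial_gbinomial)

context susy_base begin

text \<open>The coefficient of \<phi>^Q in the modes of Y(Y(e^{\<phi>_1 D} u) e^{\<phi>_2 D} v) w,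
  with the same sign as in \<open>YY_explicit\<close>. Both sides of the Jacobi identity are brought
  to this form.\<close>

definition Pr :: "nat \<Rightarrow> 'a \<Rightarrow> int \<Rightarrow> 'a \<Rightarrow> int \<Rightarrow> 'a \<Rightarrow> nat set \<Rightarrow> 'a" where
  "Pr p u n v m w Q = (if Q \<subseteq> ovars then sg ((p + card (sel 1 Q)) * card (sel 2 Q))
     (Y (Y (BS (sel 1 Q) u) n (BS (sel 2 Q) v)) m w) else 0)"

lemma Pr_carr [simp]: "Pr p u n v m w Q \<in> carr M"
  by (simp add: Pr_def)

text \<open>The supertranslation identity: commuting e^{\<phi>_2 D} across the product costs
  e^{\<nu> T} = 1 + \<nu> T + \<nu>^2 T^2 / 2 on u. Each of the sixteen monomials is immediate or
  one item of \<open>lift_products\<close>; only the full monomial meets \<nu>^2.\<close>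

lemma Ycomp_lift_products:
  assumes u: "u \<in> gr M p" and v: "v \<in> carr M"
  shows "Ycomp (\<lambda>S S'. Y (BS S' (Y (BS S u) n v)) m w) R =
    omul M 1 (Pr p u n v m w) R + omul M (nu g) (Pr p (T u) n v m w) R
    + cs M (1 / 2) (omul M (nu g ^ 2) (Pr p (T (T u)) n v m w) R)"
proof (cases "R \<subseteq> ovars")
  case True
  have uc: "u \<in> carr M" using u by (rule gr_carr)
  have s: "g (Suc 0) 0 = g 0 (Suc 0)" using sym by simp
  note E = lift_products[OF u v, of n, THEN arg_cong[where f = "\<lambda>x. Y x m w"]]
  note S = Ycomp_def Let_def sel_def omul_nu omul_nu_power2 lmul_def insert_Diff_if Pr_def
    Y_add_left Y_diff_left Y_minus_left Y_sg_left Y_cs_left cs_cs cs_minus cs_add cs_diff uc v s T_D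
    sg_even sg_odd
  have half: "cs M (z / 2) x + cs M (z / 2) x = cs M z x"
    "cs M (z / 2) x + (cs M (z / 2) x + y) = cs M z x + y" if "x \<in> carr M" for z x y
    using cs_add_left[OF that, of "z / 2" "z / 2"] by (simp_all add: add.assoc[symmetric])
  from subset_ovars_cases[OF True] show ?thesis
  proof (elim insertE emptyE, goal_cases)
    case 1 then show ?case by (cases "even p") (simp_all add: S)
  next
    case 2 then show ?case by (cases "even p") (simp_all add: S)
  next
    case 3 then show ?case by (cases "even p") (simp_all add: S)
  next
    case 4 then show ?case using E(1) by (cases "even p") (simp_all add: S)
  next
    case 5 then show ?case using E(2) by (cases "even p") (simp_all add: S)
  next
    case 6 then show ?case by (cases "even p") (simp_all add: S)
  next
    case 7 then show ?case using E(4) by (cases "even p") (simp_all add: S)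
  next
    case 8 then show ?case using E(5) by (cases "even p") (simp_all add: S)
  next
    case 9 then show ?case using E(6) by (cases "even p") (simp_all add: S)
  next
    case 10 then show ?case using E(7) by (cases "even p") (simp_all add: S)
  next
    case 11 then show ?case using E(3) by (cases "even p") (simp_all add: S algebra_simps)
  next
    case 12 then show ?case using E(10) by (cases "even p") (simp_all add: S algebra_simps)
  next
    case 13 then show ?case using E(11) by (cases "even p") (simp_all add: S algebra_simps)
  next
    case 14 then show ?case using E(8) by (cases "even p") (simp_all add: S algebra_simps)
  next
    case 15 then show ?case using E(9) by (cases "even p") (simp_all add: S algebra_simps)
  next
    case 16 then show ?case using E(12) by (cases "even p") (simp_all add: S half cs_diff_left algebra_simps)
  qed
next
  case False
  then have "Ycomp (\<lambda>S S'. Y (BS S' (Y (BS S u) n v)) m w) R = 0"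
    by (simp add: Ycomp_def Let_def)
  moreover have "omul M (nu g ^ k) (Pr p x n v m w) R = 0" for k x
    by (rule omul_power_outside[OF False]) (simp_all add: Pr_def)
  from this[of 0] this[of 1] this[of 2] have "omul M 1 (Pr p u n v m w) R = 0"
    "omul M (nu g) (Pr p (T u) n v m w) R = 0" "omul M (nu g ^ 2) (Pr p (T (T u)) n v m w) R = 0"
    by simp_all
  ultimately show ?thesis by simp
qed

lemma Pr_T:
  assumes "u \<in> carr M" "v \<in> carr M"
  shows "Pr p (T u) n v m w Q = cs M (of_int (- n)) (Pr p u (n - 1) v m w Q)"
  using assms by (simp add: Pr_def BS_T Y_T Y_cs_left cs_sg)

text \<open>Each T on u lowers the mode n by one with the factor -n, so e^{\<nu> T} acts as e^{\<nu>
  d/dx}; the factors collect to binom(l - n - 1, l).\<close>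

lemma Ycomp_lift:
  assumes u: "u \<in> gr M p" and v: "v \<in> carr M"
  shows "Ycomp (\<lambda>S S'. Y (BS S' (Y (BS S u) n v)) m w) R =
    (\<Sum>l<3. cs M (of_int (int l - n - 1) gchoose l) (omul M (nu g ^ l) (Pr p u (n - int l) v m w) R))"
proof -
  have uc: "u \<in> carr M" using u by (rule gr_carr)
  have 1: "Pr p (T u) n v m w = (\<lambda>Q. cs M (of_int (- n)) (Pr p u (n - 1) v m w Q))"
    using uc v by (simp add: fun_eq_iff Pr_T)
  have 2: "Pr p (T (T u)) n v m w = (\<lambda>Q. cs M (of_int (- n) * of_int (- (n - 1))) (Pr p u (n - 2) v m w Q))"
    using uc v by (simp add: fun_eq_iff Pr_T cs_cs)
  have c2: "(of_int (int 2 - n - 1) gchoose 2 :: complex) = 1 / 2 * (of_int (- n) * of_int (- (n - 1)))"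
    by (simp add: gbinomial_prod_rev numeral_2_eq_2 atLeast0_lessThan_Suc)
  show ?thesis
    unfolding Ycomp_lift_products[OF u v] 1 2 sum_lessThan_3 c2
    by (simp add: omul_cs cs_cs)
qed

lemma sel_subset: "sel i R \<subseteq> {0, 1}"
  by (simp add: sel_def)

lemma Ycomp_cong:
  assumes "\<And>S S'. S \<subseteq> {0, 1} \<Longrightarrow> S' \<subseteq> {0, 1} \<Longrightarrow> m S S' = m' S S'"
  shows "Ycomp m = Ycomp m'"
  using assms sel_subset[of 2] by (intro ext) (simp add: Ycomp_def Let_def)

text \<open>Modes of the lift are even modes of \<open>M\<close>, so the left side is given by
  \<open>borcherds\<close> for the components of e^{\<phi>_1 D} u and e^{\<phi>_2 D} v. On the right
  \<open>Ycomp_lift\<close> produces further powers of \<nu>. Both sides are then combinations of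
  the same vectors, and the coefficients agree by binomial identities.\<close>

lemma jacobi_lift: "jacobi {0, 1} (nu g) L"
  unfolding jacobi_def
proof (intro allI ballI)
  fix p q u v w a b c R
  assume uvw: "u \<in> gr L p" "v \<in> gr L q" "w \<in> carr L"
  interpret L: prevertex L by (rule prevertex_lift)
  have u: "u \<in> gr M p" and v: "v \<in> gr M q" and w: "w \<in> carr M" and wL: "w \<in> carr L"
    using uvw by simp_all
  have vc: "v \<in> carr M" using v by (rule gr_carr)
  show "series_mul L (delta1 (nu g)) (Y_Y L {0, 1} p u q v w) a b c R -
      sg (p * q) (series_mul L (delta2 (nu g)) (Y_Y' L {0, 1} p u q v w) a b c R) =
      series_mul L (delta3 (nu g)) (Y_iter L {0, 1} p u q v w) a b c R"
  proof (cases "finite R")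
    case False
    then show ?thesis by (simp add: series_mul_def omul_infinite case_prod_beta)
  next
    case fin: True
    have "\<exists>N. \<forall>S\<in>Pow {0, 1}. \<forall>S'\<in>Pow {0, 1}. \<forall>n\<ge>N. Y (BS S u) n (BS S' v) = 0"
    proof -
      have "\<exists>N. \<forall>n\<ge>N. Y (BS S u) n (BS S' v) = 0" for S S'
        using Y_trunc by blast
      then obtain N where N: "\<And>S S' n. n \<ge> N S S' \<Longrightarrow> Y (BS S u) n (BS S' v) = 0" by metis
      let ?A = "(\<lambda>(S, S'). N S S') ` (Pow {0, 1} \<times> Pow {0, 1})"
      have "N S S' \<le> Max ?A" if "S \<in> Pow {0, 1}" "S' \<in> Pow {0, 1}" for S S'
        by (rule Max_ge) (use that in force)+
      then show ?thesis using N by (meson order_trans)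
    qed
    then obtain N where N: "\<And>S S' n. S \<subseteq> {0, 1} \<Longrightarrow> S' \<subseteq> {0, 1} \<Longrightarrow> n \<ge> N \<Longrightarrow> Y (BS S u) n (BS S' v) = 0"
      by blast
    \<comment> \<open>Large enough for every power \<nu>^m with m < 3 at once, as such a power
      lowers the relevant mode by m.\<close>
    define J where "J = nat (N + a + 4)"
    \<comment> \<open>\<open>m\<close> is the total power of \<nu>; the summands of both sides are
      multiples of the \<open>f m j\<close>.\<close>
    define f where "f = (\<lambda>m j. omul M (nu g ^ m) (Pr p u (int j - a - int m - 1) v (- (c + b + 1 + int j) - 1) w) R)"
    define d :: "nat \<Rightarrow> complex" where "d = (\<lambda>j. (of_int (b + int j) gchoose j) * (- 1) ^ j)"
    have f_carr [simp]: "f m j \<in> carr M" for m j by (simp add: f_def)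
    have f_0: "f m j = 0" if "m \<ge> 3 \<or> j \<ge> J" for m j
    proof (cases "m \<ge> 3")
      case True
      then have "nu g ^ m = 0"
        using nu_cubed[of g] by (metis le_add_diff_inverse power_add mult_zero_left)
      then show ?thesis by (simp add: f_def)
    next
      case False
      then have "N \<le> int j - a - int m - 1" using that by (auto simp: J_def)
      then have "Pr p u (int j - a - int m - 1) v (- (c + b + 1 + int j) - 1) w = (\<lambda>Q. 0)"
        using N[OF sel_subset sel_subset] by (simp add: Pr_def fun_eq_iff)
      then show ?thesis by (simp add: f_def)
    qed
    have lhs: "series_mul L (delta1 (nu g)) (Y_Y L {0, 1} p u q v w) a b c R -
        sg (p * q) (series_mul L (delta2 (nu g)) (Y_Y' L {0, 1} p u q v w) a b c R) =
        (\<Sum>k<3. \<Sum>j<J. cs M ((of_int (a + int k) gchoose k) * d j) (f k j))"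
    proof -
      have "(\<lambda>Q. if Q \<subseteq> ovars then sg ((p + card (sel 1 Q)) * card (sel 2 Q))
          (L.Jlhs p q u (sel 1 Q) v (sel 2 Q) w (a + int k) b c) else 0) =
        (\<lambda>Q. \<Sum>j<J. cs M (d j) (Pr p u (int j - a - int k - 1) v (- (c + b + 1 + int j) - 1) w Q))"
        if k: "k < 3" for k
      proof
        fix Q
        let ?S = "sel 1 Q" and ?S' = "sel 2 Q"
        \<comment> \<open>The parities p + |S| and q + |S'| in \<open>Jlhs\<close> are those of the
          vectors \<open>BS ?S u\<close> and \<open>BS ?S' v\<close>, so the even identity of
          \<open>M\<close> applies to them.\<close>
        have "L.Jlhs p q u ?S v ?S' w (a + int k) b c =
            Jlhs (p + card ?S) (q + card ?S') (BS ?S u) {} (BS ?S' v) {} w (a + int k) b c"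
          using sel_subset[of 1 Q] sel_subset[of 2 Q]
          unfolding L.Jlhs_def Jlhs_def Y_lift Jprod_lift by simp
        also have "\<dots> = Jprod3 M (\<lambda>a c _. Y (Y (BS ?S u) (- a - 1) (BS ?S' v)) (- c - 1) w) (a + int k) b c {}"
          using borcherds BS_parity[OF sel_subset u] BS_parity[OF sel_subset v] w
          unfolding borcherds_def by blast
        also have "\<dots> = (\<Sum>j<J. cs M (d j) (Y (Y (BS ?S u) (int j - a - int k - 1) (BS ?S' v)) (- (c + b + 1 + int j) - 1) w))"
        proof (subst Jprod3_finite[where J = J])
          fix j c assume "j \<ge> J"
          then have "N \<le> - (a + int k - int j) - 1" using k by (auto simp: J_def)
          then show "Y (Y (BS ?S u) (- (a + int k - int j) - 1) (BS ?S' v)) (- c - 1) w = 0"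
            using N[OF sel_subset sel_subset] by simp
        next
          have "- (a + int k - int j) - 1 = int j - a - int k - 1" for j by simp
          then show "(\<Sum>j<J. cs M ((of_int (b + int j) gchoose j) * (- 1) ^ j)
              (Y (Y (BS ?S u) (- (a + int k - int j) - 1) (BS ?S' v)) (- (c + b + 1 + int j) - 1) w)) =
            (\<Sum>j<J. cs M (d j) (Y (Y (BS ?S u) (int j - a - int k - 1) (BS ?S' v)) (- (c + b + 1 + int j) - 1) w))"
            by (simp only: d_def)
        qed
        finally show "(if Q \<subseteq> ovars then sg ((p + card ?S) * card ?S')
            (L.Jlhs p q u ?S v ?S' w (a + int k) b c) else 0) =
          (\<Sum>j<J. cs M (d j) (Pr p u (int j - a - int k - 1) v (- (c + b + 1 + int j) - 1) w Q))"
          by (simp add: Pr_def sg_sum cs_sg)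
      qed
      then show ?thesis
        unfolding L.series_lhs[OF wL] lift_simps
        by (intro sum.cong refl) (simp add: omul_sum omul_cs cs_sum cs_cs f_def)
    qed
    have rhs: "series_mul L (delta3 (nu g)) (Y_iter L {0, 1} p u q v w) a b c R =
        (\<Sum>k<3. \<Sum>j<J. \<Sum>l<3. cs M ((of_int (b + int k + int j) gchoose k) * (of_int (b + int j) gchoose j) * (- 1) ^ j * (- 1) ^ k
          * (of_int (a - int j + int l) gchoose l)) (f (k + l) (j + k)))"
    proof (subst L.series_rhs[OF wL, where J = J])
      fix j S assume "j \<ge> J"
      then have "N \<le> int j - a - 1" by (auto simp: J_def)
      then show "Ymode L u (int j - a - 1) S v = 0"
        using N[of S "{}"] by (simp add: Y_lift)
    next
      have "omul M (nu g ^ k) (Ycomp (\<lambda>S S'. Ymode L (Ymode L u (int j - a - 1) S v)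
            (- (c + b + 1 + int k + int j) - 1) S' w)) R =
          (\<Sum>l<3. cs M (of_int (a - int j + int l) gchoose l) (f (k + l) (j + k)))" for k j
      proof -
        have "Ycomp (\<lambda>S S'. Ymode L (Ymode L u (int j - a - 1) S v) (- (c + b + 1 + int k + int j) - 1) S' w) =
            Ycomp (\<lambda>S S'. Y (BS S' (Y (BS S u) (int j - a - 1) v)) (- (c + b + 1 + int k + int j) - 1) w)"
          by (rule Ycomp_cong) (simp add: Y_lift)
        also have "\<dots> = (\<lambda>Q. \<Sum>l<3. cs M (of_int (a - int j + int l) gchoose l)
            (omul M (nu g ^ l) (Pr p u (int j - a - 1 - int l) v (- (c + b + 1 + int k + int j) - 1) w) Q))"
        proof -
          have "int l - (int j - a - 1) - 1 = a - int j + int l" for l by simp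
          then show ?thesis by (intro ext) (simp only: Ycomp_lift[OF u vc])
        qed
        finally have eq: "Ycomp (\<lambda>S S'. Ymode L (Ymode L u (int j - a - 1) S v) (- (c + b + 1 + int k + int j) - 1) S' w) = \<dots>" .
        have i: "int (j + k) - a - int (k + l) - 1 = int j - a - 1 - int l"
          "c + b + 1 + int (j + k) = c + b + 1 + int k + int j" for l by simp_all
        have "omul M (nu g ^ k) (\<lambda>Q. \<Sum>l<3. cs M (of_int (a - int j + int l) gchoose l)
            (omul M (nu g ^ l) (Pr p u (int j - a - 1 - int l) v (- (c + b + 1 + int k + int j) - 1) w) Q)) R =
          (\<Sum>l<3. cs M (of_int (a - int j + int l) gchoose l) (omul M (nu g ^ k)
            (omul M (nu g ^ l) (Pr p u (int j - a - 1 - int l) v (- (c + b + 1 + int k + int j) - 1) w)) R))"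
          by (simp add: omul_sum omul_cs)
        also have "\<dots> = (\<Sum>l<3. cs M (of_int (a - int j + int l) gchoose l) (f (k + l) (j + k)))"
          unfolding f_def i power_add using fin by (simp add: omul_mult)
        finally show ?thesis unfolding eq .
      qed
      then show "(\<Sum>k<3. \<Sum>j<J. cs L ((of_int (b + int k + int j) gchoose k) * (of_int (b + int j) gchoose j) * (- 1) ^ j * (- 1) ^ k)
          (omul L (nu g ^ k) (Ycomp (\<lambda>S S'. Ymode L (Ymode L u (int j - a - 1) S v)
            (- (c + b + 1 + int k + int j) - 1) S' w)) R)) =
        (\<Sum>k<3. \<Sum>j<J. \<Sum>l<3. cs M ((of_int (b + int k + int j) gchoose k) * (of_int (b + int j) gchoose j) * (- 1) ^ j * (- 1) ^ k
          * (of_int (a - int j + int l) gchoose l)) (f (k + l) (j + k)))"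
        unfolding lift_simps by (simp only:) (simp add: cs_sum cs_cs)
    qed
    \<comment> \<open>Shifting \<open>j\<close> by \<open>k\<close> brings the summand to
      \<open>f (k + l) j\<close>. The new factor binom(j, k) vanishes for j < k, so the range need
      not change.\<close>
    have "(\<Sum>j<J. cs M ((of_int (b + int k + int j) gchoose k) * (of_int (b + int j) gchoose j) * (- 1) ^ j * (- 1) ^ k
          * (of_int (a - int j + int l) gchoose l)) (f (k + l) (j + k))) =
        (\<Sum>j<J. cs M (d j * (of_nat (j choose k) * (of_int a + of_nat (k + l) - of_nat j gchoose l))) (f (k + l) j))" for k l
    proof -
      let ?h = "\<lambda>j. cs M (d j * (of_nat (j choose k) * (of_int a + of_nat (k + l) - of_nat j gchoose l))) (f (k + l) j)"
      have "cs M ((of_int (b + int k + int j) gchoose k) * (of_int (b + int j) gchoose j) * (- 1) ^ j * (- 1) ^ k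
          * (of_int (a - int j + int l) gchoose l)) (f (k + l) (j + k)) = ?h (j + k)" for j
      proof -
        have "(of_int (b + int k + int j) gchoose k) * (of_int (b + int j) gchoose j) =
            (of_int (b + int (j + k)) gchoose (j + k)) * (of_nat ((j + k) choose k) :: complex)"
          using gbinomial_revision[of k "j + k" "of_int b"] by (simp add: algebra_simps)
        moreover have "(of_int (a - int j + int l) :: complex) = of_int a + of_nat (k + l) - of_nat (j + k)"
          by simp
        ultimately show ?thesis unfolding d_def by (simp only: power_add mult_ac)
      qed
      then have "(\<Sum>j<J. cs M ((of_int (b + int k + int j) gchoose k) * (of_int (b + int j) gchoose j) * (- 1) ^ j * (- 1) ^ k
          * (of_int (a - int j + int l) gchoose l)) (f (k + l) (j + k))) = (\<Sum>j<J. ?h (j + k))" by (simp only:)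
      also have "\<dots> = (\<Sum>j<J. if k \<le> j then ?h j else 0)"
        by (rule sum_shift) (simp add: f_0)
      also have "\<dots> = (\<Sum>j<J. ?h j)"
        by (rule sum.cong) (auto simp: binomial_eq_0)
      finally show ?thesis .
    qed
    note shift = this
    define G where "G = (\<lambda>k l j. cs M (d j * (of_nat (j choose k) * (of_int a + of_nat (k + l) - of_nat j gchoose l))) (f (k + l) j))"
    have "(\<Sum>k<3. \<Sum>l<3. G k l j) = (\<Sum>m<3. cs M ((of_int (a + int m) gchoose m) * d j) (f m j))" for j
    proof -
      \<comment> \<open>Total powers \<nu>^3 and \<nu>^4. The other terms are grouped by m = k + l
        and summed by Vandermonde's identity.\<close>
      have z: "G 1 2 j = 0" "G 2 1 j = 0" "G 2 2 j = 0" by (simp_all add: G_def f_0)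
      have "(\<Sum>k<3. \<Sum>l<3. G k l j) = G 0 0 j + (G 0 1 j + G 1 0 j) + (G 0 2 j + G 1 1 j + G 2 0 j)"
        unfolding sum_lessThan_3 z by simp
      moreover have "G 0 0 j = cs M ((of_int (a + int 0) gchoose 0) * d j) (f 0 j)" by (simp add: G_def)
      moreover have "G 0 1 j + G 1 0 j = cs M ((of_int (a + int 1) gchoose 1) * d j) (f 1 j)"
      proof -
        have "(of_int (a + int 1) gchoose 1) * d j = d j * (of_nat (j choose 0) * (of_int a + of_nat (0 + 1) - of_nat j gchoose 1))
            + d j * (of_nat (j choose 1) * (of_int a + of_nat (1 + 0) - of_nat j gchoose 0))"
          using gbinomial_vandermonde_2(1)[of "of_int a" j] by (simp add: algebra_simps)
        then show ?thesis unfolding G_def by (simp only: cs_add_left f_carr) simp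
      qed
      moreover have "G 0 2 j + G 1 1 j + G 2 0 j = cs M ((of_int (a + int 2) gchoose 2) * d j) (f 2 j)"
      proof -
        have "(of_int (a + int 2) gchoose 2) = (of_int a + 2 gchoose 2 :: complex)" by simp
        then have "(of_int (a + int 2) gchoose 2) * d j = d j * (of_nat (j choose 0) * (of_int a + of_nat (0 + 2) - of_nat j gchoose 2))
            + d j * (of_nat (j choose 1) * (of_int a + of_nat (1 + 1) - of_nat j gchoose 1))
            + d j * (of_nat (j choose 2) * (of_int a + of_nat (2 + 0) - of_nat j gchoose 0))"
          unfolding gbinomial_vandermonde_2(2)[of "of_int a" j, symmetric]
          by (simp add: algebra_simps numeral_2_eq_2[symmetric] del: gbinomial_1 gbinomial_Suc0)
        moreover have "(0::nat) + 2 = 2" "(1::nat) + 1 = 2" "(2::nat) + 0 = 2" by simp_all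
        ultimately show ?thesis unfolding G_def by (simp only: cs_add_left f_carr)
      qed
      ultimately have "(\<Sum>k<3. \<Sum>l<3. G k l j) = cs M ((of_int (a + int 0) gchoose 0) * d j) (f 0 j)
          + cs M ((of_int (a + int 1) gchoose 1) * d j) (f 1 j) + cs M ((of_int (a + int 2) gchoose 2) * d j) (f 2 j)"
        by (simp only:)
      also have "\<dots> = (\<Sum>m<3. cs M ((of_int (a + int m) gchoose m) * d j) (f m j))"
        by (simp only: sum_lessThan_3)
      finally show ?thesis .
    qed
    note comb = this
    have "(\<Sum>k<3. \<Sum>j<J. \<Sum>l<3. cs M ((of_int (b + int k + int j) gchoose k) * (of_int (b + int j) gchoose j) * (- 1) ^ j * (- 1) ^ k
          * (of_int (a - int j + int l) gchoose l)) (f (k + l) (j + k))) =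
        (\<Sum>k<3. \<Sum>l<3. \<Sum>j<J. G k l j)"
      unfolding G_def shift[symmetric] by (intro sum.cong refl sum.swap)
    also have "\<dots> = (\<Sum>k<3. \<Sum>j<J. \<Sum>l<3. G k l j)" by (intro sum.cong refl sum.swap)
    also have "\<dots> = (\<Sum>j<J. \<Sum>k<3. \<Sum>l<3. G k l j)" by (rule sum.swap)
    also have "\<dots> = (\<Sum>m<3. \<Sum>j<J. cs M ((of_int (a + int m) gchoose m) * d j) (f m j))"
      unfolding comb by (rule sum.swap)
    finally show ?thesis unfolding lhs rhs by simp
  qed
qed

lemma vertex_axioms_lift: "vertex_axioms {0, 1} (nu g) L"
  using prevertex_lift jacobi_lift
  unfolding vertex_axioms_iff prevertex_def prevertex_axioms_def gmodule_def by blast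

end

section \<open>Equivalence of the objects\<close>

definition g_pm :: "nat \<Rightarrow> nat \<Rightarrow> complex" where "g_pm i j = (if i = j then 0 else 1)"
definition g_12 :: "nat \<Rightarrow> nat \<Rightarrow> complex" where "g_12 i j = (if i = j then 1 else 0)"
text \<open>Degenerate on purpose: with one odd variable the second derivation is taken to be zero
  in the lift, while D^(2) stays separate data.\<close>

definition g_1 :: "nat \<Rightarrow> nat \<Rightarrow> complex" where "g_1 i j = (if i = 0 \<and> j = 0 then 1 else 0)"

lemma g_simps [simp]:
  "g_pm 0 0 = 0" "g_pm 0 (Suc 0) = 1" "g_pm (Suc 0) 0 = 1" "g_pm (Suc 0) (Suc 0) = 0"
  "g_12 0 0 = 1" "g_12 0 (Suc 0) = 0" "g_12 (Suc 0) 0 = 0" "g_12 (Suc 0) (Suc 0) = 1"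
  "g_1 0 0 = 1" "g_1 0 (Suc 0) = 0" "g_1 (Suc 0) 0 = 0" "g_1 (Suc 0) (Suc 0) = 0"
  by (simp_all add: g_pm_def g_12_def g_1_def)

lemma nu_eqs: "nu_pm = nu g_pm" "nu_12 = nu g_12" "nu_1 = nu g_1"
  by (simp_all add: nu_def nu_pm_def nu_12_def nu_1_def gconst_simps)

lemma supervertexI: "vertex_axioms {0, 1} (nu g) M \<Longrightarrow> supervertex M g"
  by unfold_locales (simp_all add: vertex_axioms_iff)

lemma forget_super:
  assumes "vertex_axioms {0, 1} (nu g) M" "g 1 0 = g 0 1"
  shows "vertex_axioms {} 0 (forget M)" "susy g (dop M 0) (dop M 1) (forget M)"
    "lift g (dop M 0) (dop M 1) (forget M) = M"
proof -
  interpret supervertex M g using assms(1) by (rule supervertexI)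
  show "vertex_axioms {} 0 (forget M)" using vertex_base_forget by (simp add: vertex_base_def)
  show "susy g (dop M 0) (dop M 1) (forget M)" using assms(2) by (rule susy_forget)
  show "lift g (dop M 0) (dop M 1) (forget M) = M" by (rule lift_forget)
qed

lemma (in susy_base) forget_lift: "forget L = M"
proof -
  have "Ymode (forget L) = Ymode M"
    by (intro ext) (simp add: Y_nonempty)
  moreover have "forget L = M\<lparr>Ymode := Ymode (forget L)\<rparr>"
    by (simp add: lift_def forget_def)
  ultimately show ?thesis by (metis vsa_eqI)
qed

lemma (in susy_base) dop_lift: "dop L 0 = D0" "dop L 1 = D1"
proof -
  have "dop L 0 v = D0 v" "dop L 1 v = D1 v" for v
    unfolding dop_def Y_lift by (simp_all add: creation)
  then show "dop L 0 = D0" "dop L 1 = D1" by (simp_all add: fun_eq_iff)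
qed

lemma susy_baseI:
  "vertex_axioms {} 0 M \<Longrightarrow> g 1 0 = g 0 1 \<Longrightarrow> susy g D0 D1 M \<Longrightarrow> susy_base M g D0 D1"
  by unfold_locales

lemma scomm_11: "scomm 1 1 A B v = A (B v) + B (A v)"
  by (simp add: scomm_def)

text \<open>The nonhomogeneous counterpart of \<open>is_vsa_0\<close>; both the settings
  (\<phi>^(1), \<phi>^(2)) and (\<phi>) reduce to it.\<close>

definition is_base_12 :: "'v::ab_group_add vsa \<times> ('v \<Rightarrow> 'v) \<times> ('v \<Rightarrow> 'v) \<Rightarrow> bool" where
  "is_base_12 = (\<lambda>(M, D1, D2). vertex_axioms {} 0 M \<and> susy g_12 D1 D2 M)"

lemma (in gmodule) half_eq:
  assumes "v \<in> carr M" "w \<in> carr M" "v + v = cs M 2 w"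
  shows "v = w"
  using assms cs_cancel[of v w 2] by (simp add: cs_2)

lemma is_vsa_0_iff:
  "is_vsa_0 (M, Dp, Dm) \<longleftrightarrow> vertex_axioms {} 0 M \<and> susy g_pm Dp Dm M"
proof (cases "vertex_axioms {} 0 M \<and> endo M 1 Dp \<and> endo M 1 Dm")
  case True
  then interpret vertex_base M by unfold_locales blast
  have "v + v = 0 \<longleftrightarrow> v = 0" if "v \<in> carr M" for v
    using half_eq[OF that carr_0] by auto
  moreover have "Dp (Dp v) \<in> carr M" "Dm (Dm v) \<in> carr M" if "v \<in> carr M" for v
    using that True endoD(1)[of 1 Dp] endoD(1)[of 1 Dm] by blast+
  ultimately have "(\<forall>v\<in>carr M. scomm 1 1 Dp Dm v = cs M 2 (transl M v) \<and> scomm 1 1 Dp Dp v = 0 \<and> scomm 1 1 Dm Dm v = 0) \<longleftrightarrow>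
      (\<forall>v\<in>carr M. Dp (Dp v) = 0 \<and> Dm (Dm v) = 0 \<and> Dp (Dm v) + Dm (Dp v) = cs M 2 (transl M v))"
    unfolding scomm_11 by (intro ball_cong refl) auto
  then show ?thesis
    unfolding is_vsa_0_def susy_def transl_def Let_def using True by simp
qed (auto simp: is_vsa_0_def susy_def)

lemma is_vsa_pm_forget:
  assumes "is_vsa_pm M"
  shows "is_vsa_0 (forget M, dop M 0, dop M 1)" "lift g_pm (dop M 0) (dop M 1) (forget M) = M"
proof -
  have "vertex_axioms {0, 1} (nu g_pm) M" using assms by (simp add: is_vsa_pm_def nu_eqs)
  from forget_super[OF this] show "is_vsa_0 (forget M, dop M 0, dop M 1)"
    "lift g_pm (dop M 0) (dop M 1) (forget M) = M" by (simp_all add: is_vsa_0_iff)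
qed

lemma is_vsa_12_forget:
  assumes "is_vsa_12 M"
  shows "is_base_12 (forget M, dop M 0, dop M 1)" "lift g_12 (dop M 0) (dop M 1) (forget M) = M"
proof -
  have "vertex_axioms {0, 1} (nu g_12) M" using assms by (simp add: is_vsa_12_def nu_eqs)
  from forget_super[OF this] show "is_base_12 (forget M, dop M 0, dop M 1)"
    "lift g_12 (dop M 0) (dop M 1) (forget M) = M" by (simp_all add: is_base_12_def)
qed

lemma is_vsa_0_susy_base: "is_vsa_0 (M, Dp, Dm) \<Longrightarrow> susy_base M g_pm Dp Dm"
  by (rule susy_baseI) (simp_all add: is_vsa_0_iff)

lemma is_base_12_susy_base: "is_base_12 (M, D1, D2) \<Longrightarrow> susy_base M g_12 D1 D2"
  by (rule susy_baseI) (simp_all add: is_base_12_def)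

lemma is_vsa_0_lift:
  assumes "is_vsa_0 (M, Dp, Dm)"
  shows "is_vsa_pm (lift g_pm Dp Dm M)" "forget (lift g_pm Dp Dm M) = M"
    "dop (lift g_pm Dp Dm M) 0 = Dp" "dop (lift g_pm Dp Dm M) 1 = Dm"
proof -
  interpret susy_base M g_pm Dp Dm using assms by (rule is_vsa_0_susy_base)
  show "is_vsa_pm L" using vertex_axioms_lift by (simp add: is_vsa_pm_def nu_eqs)
  show "forget L = M" "dop L 0 = Dp" "dop L 1 = Dm" by (rule forget_lift dop_lift)+
qed

lemma is_base_12_lift:
  assumes "is_base_12 (M, D1, D2)"
  shows "is_vsa_12 (lift g_12 D1 D2 M)" "forget (lift g_12 D1 D2 M) = M"
    "dop (lift g_12 D1 D2 M) 0 = D1" "dop (lift g_12 D1 D2 M) 1 = D2"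
proof -
  interpret susy_base M g_12 D1 D2 using assms by (rule is_base_12_susy_base)
  show "is_vsa_12 L" using vertex_axioms_lift by (simp add: is_vsa_12_def nu_eqs)
  show "forget L = M" "dop L 0 = D1" "dop L 1 = D2" by (rule forget_lift dop_lift)+
qed

abbreviation zero_op :: "'v \<Rightarrow> 'v::ab_group_add" where "zero_op \<equiv> \<lambda>_. 0"

text \<open>The vertex operators yield D^(1) as the first derivation and zero as the second. The
  relations for D^(2) are stated for supercommutators and have to be halved.\<close>

lemma is_vsa_1_forget:
  assumes "is_vsa_1 (M, D1, D2)"
  shows "is_base_12 (forget M, D1, D2)" "lift g_1 D1 zero_op (forget M) = M"
proof -
  have ax: "vertex_axioms {0} nu_1 M" and zo: "zero_outside M D1" "zero_outside M D2"
    and D1: "\<And>v. v \<in> carr M \<Longrightarrow> D1 v = Ymode M v (- 1) {0} (vac M)" and D2: "endo M 1 D2"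
    and rel: "\<And>v. v \<in> carr M \<Longrightarrow> scomm 1 1 D2 D2 v = cs M 2 (D1 (D1 v)) \<and>
         scomm 1 1 D1 D2 v = 0 \<and> scomm 1 1 D2 D1 v = 0"
    and com: "commutes_with_Y {0} M D2"
    using assms unfolding is_vsa_1_def Let_def by auto
  have ax': "vertex_axioms {0, 1} (nu g_1) M" and van: "\<And>v n S w. \<not> S \<subseteq> {0} \<Longrightarrow> Ymode M v n S w = 0"
    using ax vertex_axioms_extend[of "{0}" nu_1 M] by (auto simp: nu_eqs)
  interpret supervertex M g_1 using ax' by (rule supervertexI)
  have d0: "dop M 0 = D1"
    using D1 zo(1) Dop_outside[of _ 0] unfolding dop_def zero_outside_def by (intro ext) metis
  have d1: "dop M 1 = zero_op" by (intro ext) (simp add: dop_def van)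
  have S: "susy g_1 D1 zero_op (forget M)" and "lift g_1 D1 zero_op (forget M) = M"
    and v: "vertex_axioms {} 0 (forget M)"
    using forget_super[OF ax'] unfolding d0 d1 by simp_all
  then show "lift g_1 D1 zero_op (forget M) = M" by simp
  have D11: "D1 (D1 v) = transl M v" if "v \<in> carr M" for v
    using S that unfolding susy_def by simp
  have "D2 (D2 v) = transl M v" if "v \<in> carr M" for v
    by (rule half_eq) (use that rel[OF that] endoD(1)[OF D2] in \<open>simp_all add: scomm_11[simplified] D11\<close>)
  moreover have "D1 (D2 v) + D2 (D1 v) = 0" if "v \<in> carr M" for v
    using rel[OF that] by (simp add: scomm_11[simplified])
  moreover have "commutes_with_Y {} (forget M) D2"
    unfolding commutes_with_Y_def
  proof (intro allI ballI impI)
    fix p v n and S :: "nat set" and w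
    assume *: "v \<in> gr (forget M) p" "w \<in> carr (forget M)" "S \<subseteq> {}"
    then have "S = {}" by simp
    moreover have "\<forall>S\<subseteq>{0}. sg (card S) (D2 (Ymode M v n S w)) - sg p (Ymode M v n S (D2 w)) = Ymode M (D2 v) n S w"
      using com *(1,2) unfolding commutes_with_Y_def forget_simps by blast
    from this[rule_format, of "{}"]
    have "D2 (Ymode M v n {} w) - sg p (Ymode M v n {} (D2 w)) = Ymode M (D2 v) n {} w" by simp
    ultimately show "sg (card S) (D2 (Ymode (forget M) v n S w)) - sg p (Ymode (forget M) v n S (D2 w)) =
        Ymode (forget M) (D2 v) n S w" by simp
  qed
  ultimately show "is_base_12 (forget M, D1, D2)"
    using S v zo D2 D11 unfolding is_base_12_def susy_def by simp
qed

lemma (in prevertex) Bop_zero: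
  "S \<noteq> {} \<Longrightarrow> S \<noteq> {0} \<Longrightarrow> Bop g_1 D1 zero_op M S v = 0"
  by (simp add: Bop_def)

text \<open>That D^(2) commutes with the lifted operators has to be checked at S = {0} as well:
  there the mode is one of D^(1) v, and D^(2) D^(1) = - D^(1) D^(2) supplies the sign.\<close>

lemma is_base_12_lift_1:
  assumes "is_base_12 (M, D1, D2)"
  shows "is_vsa_1 (lift g_1 D1 zero_op M, D1, D2)" "forget (lift g_1 D1 zero_op M) = M"
    "susy_base M g_1 D1 zero_op"
proof -
  interpret vertex_base M using assms by unfold_locales (simp add: is_base_12_def)
  interpret B: susy_base M g_12 D1 D2 using assms by (rule is_base_12_susy_base)
  have "susy g_1 D1 zero_op M"
    using B.susy unfolding susy_def
    by (simp add: endo_zero zero_outside_def commutes_with_Y_def B.D_linear)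
  then show sb: "susy_base M g_1 D1 zero_op" using axioms by (intro susy_baseI) simp_all
  interpret susy_base M g_1 D1 zero_op by (rule sb)
  show "forget L = M" by (rule forget_lift)
  have van: "Ymode L v n S w = 0" if "\<not> S \<subseteq> {0}" for v n S w
  proof -
    have "S \<noteq> {}" "S \<noteq> {0}" using that by auto
    then have "Bop g_1 D1 zero_op M S v = 0" by (rule Bop_zero)
    then show ?thesis by (simp only: Y_lift Y_zero_left if_cancel)
  qed
  have "vertex_axioms {0} nu_1 L"
    using vertex_axioms_lift van vertex_axioms_extend[of "{0}" nu_1 L] by (auto simp: nu_eqs)
  moreover have "commutes_with_Y {0} L D2"
    unfolding commutes_with_Y_def
  proof (intro allI ballI impI)
    fix p v n and S :: "nat set" and w
    assume *: "v \<in> gr L p" "w \<in> carr L" "S \<subseteq> {0}"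
    then have v: "v \<in> gr M p" and w: "w \<in> carr M" by simp_all
    have vc: "v \<in> carr M" using v by (rule gr_carr)
    have D21: "D2 (D1 v) = - D1 (D2 v)"
      using B.D0_D1[OF vc] by simp
    from *(3) have "S = {} \<or> S = {0}" by auto
    then show "sg (card S) (D2 (Ymode L v n S w)) - sg p (Ymode L v n S (D2 w)) = Ymode L (D2 v) n S w"
      using B.D_derivation(2)[OF v w] B.D_derivation(2)[OF B.D_parity(1)[OF v] w] B.D_parity(1)[OF v]
      by (auto simp: Y_lift B.D_linear D21 Y_minus_left sg_Suc)
  qed
  moreover have "D2 (D1 v) = - D1 (D2 v)" if "v \<in> carr M" for v
    using B.D0_D1[OF that] by simp
  ultimately show "is_vsa_1 (L, D1, D2)"
    using B.susy dop_lift(1) B.D_endo B.D_carr unfolding is_vsa_1_def susy_def dop_def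
    by (simp add: Let_def scomm_11[simplified] fun_eq_iff cs_2)
qed

text \<open>\<open>D\<^sup>(\<^sup>1\<^sup>) = (D\<^sup>+ + D\<^sup>-) / \<surd>2\<close> and \<open>D\<^sup>(\<^sup>2\<^sup>) = i (D\<^sup>+ - D\<^sup>-) / \<surd>2\<close>.\<close>

definition isq :: complex where "isq = of_real (1 / sqrt 2)"

lemma isq_sq: "isq * isq = 1 / 2"
  unfolding isq_def of_real_mult[symmetric] by simp

text \<open>The argument type is left open, so that the same combinations apply to operators and,
  through constant functions, to single vectors.\<close>

definition lc :: "'v::ab_group_add vsa \<Rightarrow> complex \<Rightarrow> complex \<Rightarrow> ('b \<Rightarrow> 'v) \<Rightarrow> ('b \<Rightarrow> 'v) \<Rightarrow> 'b \<Rightarrow> 'v" where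
  "lc M z z' A A' v = cs M z (A v) + cs M z' (A' v)"

definition rot1 where "rot1 M Dp Dm = lc M isq isq Dp Dm"
definition rot2 where "rot2 M Dp Dm = lc M (\<i> * isq) (- \<i> * isq) Dp Dm"
definition rotp where "rotp M D1 D2 = lc M isq (- \<i> * isq) D1 D2"
definition rotm where "rotm M D1 D2 = lc M isq (\<i> * isq) D1 D2"

lemmas rot_defs = rot1_def rot2_def rotp_def rotm_def

section \<open>Linear change between homogeneous and nonhomogeneous odd operators\<close>

context gmodule begin

lemma lc_lc:
  assumes "A v \<in> carr M" "A' v \<in> carr M"
  shows "lc M a b (lc M z z' A A') (lc M y y' A A') v = lc M (a * z + b * y) (a * z' + b * y') A A' v"
  using assms by (simp add: lc_def cs_add cs_cs cs_add_left)

lemma isq_mult: "isq * (\<i> * isq) = \<i> / 2" "\<i> * isq * isq = \<i> / 2" "\<i> * isq * (\<i> * isq) = - 1 / 2"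
  "isq * isq = 1 / 2"
proof -
  show "isq * isq = 1 / 2" by (rule isq_sq)
  then show "isq * (\<i> * isq) = \<i> / 2" "\<i> * isq * isq = \<i> / 2" by (simp_all add: algebra_simps)
  have "\<i> * isq * (\<i> * isq) = (\<i> * \<i>) * (isq * isq)" by (simp only: mult_ac)
  then show "\<i> * isq * (\<i> * isq) = - 1 / 2" by (simp add: isq_sq)
qed

text \<open>The coefficient matrix of \<open>rot1\<close>, \<open>rot2\<close> is unitary, and
  \<open>rotp\<close>, \<open>rotm\<close> are formed with its adjoint.\<close>

lemma rot_rot:
  assumes "A v \<in> carr M" "A' v \<in> carr M"
  shows "rotp M (rot1 M A A') (rot2 M A A') v = A v"
    "rotm M (rot1 M A A') (rot2 M A A') v = A' v"
    "rot1 M (rotp M A A') (rotm M A A') v = A v"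
    "rot2 M (rotp M A A') (rotm M A A') v = A' v"
  unfolding rot_defs lc_lc[where A = A and A' = A' and v = v, OF assms] using assms by (simp_all add: lc_def isq_mult)

lemma lc_endo:
  assumes "endo M p A" "endo M p A'"
  shows "endo M p (lc M z z' A A')"
  unfolding endo_def
proof (intro conjI allI ballI impI)
  fix r a v assume a: "a \<in> Lambda (lev M)" "v \<in> carr M" "has_parity r a"
  then show "lc M z z' A A' (scal M a v) = sg (p * r) (scal M a (lc M z z' A A' v))"
    using a endoD(1)[OF assms(1)] endoD(1)[OF assms(2)] endoD(4)[OF assms(1) a] endoD(4)[OF assms(2) a]
    by (simp add: lc_def cs_sg scal_add sg_add cs_scal)
next
  fix q v assume v: "v \<in> gr M q"
  show "lc M z z' A A' v \<in> gr M (p + q)"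
    unfolding lc_def by (intro gr_add gr_cs endoD(3)[OF assms(1) v] endoD(3)[OF assms(2) v])
qed (use endoD(1)[OF assms(1)] endoD(1)[OF assms(2)] endoD(2)[OF assms(1)] endoD(2)[OF assms(2)] in
  \<open>simp_all add: lc_def cs_add\<close>)

lemma lc_comp:
  assumes "endo M 1 A" "endo M 1 A'" and v: "v \<in> carr M"
  shows "lc M a b A A' (lc M c d A A' v) =
    cs M (a * c) (A (A v)) + cs M (a * d) (A (A' v)) + (cs M (b * c) (A' (A v)) + cs M (b * d) (A' (A' v)))"
proof -
  note c = endoD(1)[OF assms(1)] endoD(1)[OF assms(2)]
  note e = endoD(2)[OF assms(1)] endoD(2)[OF assms(2)] endo_additive(5)[OF assms(1)] endo_additive(5)[OF assms(2)]
  show ?thesis by (simp add: lc_def c v e cs_add cs_cs)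
qed

end

lemma (in prevertex) lc_commutes:
  assumes "commutes_with_Y {} M A" "commutes_with_Y {} M A'" "endo M 1 A" "endo M 1 A'"
  shows "commutes_with_Y {} M (lc M z z' A A')"
  unfolding commutes_with_Y_def
proof (intro allI ballI impI)
  fix p v n and S :: "nat set" and w
  assume *: "v \<in> gr M p" "w \<in> carr M" "S \<subseteq> {}"
  then have S: "S = {}" by simp
  have vc: "v \<in> carr M" using *(1) by (rule gr_carr)
  have 1: "A (Ymode M v n {} w) = Ymode M (A v) n {} w + sg p (Ymode M v n {} (A w))"
    "A' (Ymode M v n {} w) = Ymode M (A' v) n {} w + sg p (Ymode M v n {} (A' w))"
    using assms(1,2) * unfolding commutes_with_Y_def S by (force simp: algebra_simps)+
  show "sg (card S) (lc M z z' A A' (Ymode M v n S w)) - sg p (Ymode M v n S (lc M z z' A A' w)) =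
      Ymode M (lc M z z' A A' v) n S w"
    using endoD(1)[OF assms(3)] endoD(1)[OF assms(4)] vc *(2)
    unfolding S lc_def 1
    by (simp add: Y_add_left Y_add_right Y_cs_left Y_cs_right cs_add cs_sg sg_add)
qed

lemma zero_outside_lc:
  assumes "gmodule M" "zero_outside M A" "zero_outside M A'"
  shows "zero_outside M (lc M z z' A A')"
proof -
  interpret gmodule M by fact
  show ?thesis using assms by (simp add: zero_outside_def lc_def)
qed

text \<open>The squares of D^+ and D^- vanish, so in both squares of the new operators only the
  anticommutator 2 T, with factor 1/2, is left; in the mixed anticommutator its two occurrences
  cancel.\<close>

lemma rot_objects:
  assumes "is_vsa_0 (M, Dp, Dm)"
  shows "is_base_12 (M, rot1 M Dp Dm, rot2 M Dp Dm)"
    "rotp M (rot1 M Dp Dm) (rot2 M Dp Dm) = Dp" "rotm M (rot1 M Dp Dm) (rot2 M Dp Dm) = Dm"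
proof -
  interpret susy_base M g_pm Dp Dm using assms by (rule is_vsa_0_susy_base)
  have r: "Dp (Dm v) = T v + T v - Dm (Dp v)" "Dp (Dp v) = 0" "Dm (Dm v) = 0" if "v \<in> carr M" for v
    using D0_D1[OF that] D_square[OF that] by (simp_all add: cs_2)
  have h: "cs M (1 / 2) x + cs M (1 / 2) x = x" if "x \<in> carr M" for x
    using cs_add_left[OF that, of "1 / 2" "1 / 2"] that by simp
  have i: "\<i> * isq * isq = \<i> / 2" "isq * (\<i> * isq) = \<i> / 2" by (rule isq_mult)+
  have R: "rot1 M Dp Dm (rot1 M Dp Dm v) = T v" "rot2 M Dp Dm (rot2 M Dp Dm v) = T v"
    "rot1 M Dp Dm (rot2 M Dp Dm v) + rot2 M Dp Dm (rot1 M Dp Dm v) = 0" if v: "v \<in> carr M" for v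
  proof -
    show "rot1 M Dp Dm (rot1 M Dp Dm v) = T v" "rot2 M Dp Dm (rot2 M Dp Dm v) = T v"
      unfolding rot_defs lc_comp[OF D_endo v]
      using r[OF v] v by (simp_all add: isq_mult cs_add cs_diff h)
    have "lc M isq isq Dp Dm (lc M (\<i> * isq) (- \<i> * isq) Dp Dm v) = cs M (\<i> / 2) (Dm (Dp v)) - cs M (\<i> / 2) (Dp (Dm v))"
      unfolding lc_comp[OF D_endo v] by (simp add: r(2,3)[OF v] i cs_minus_left)
    moreover have "lc M (\<i> * isq) (- \<i> * isq) Dp Dm (lc M isq isq Dp Dm v) = cs M (\<i> / 2) (Dp (Dm v)) - cs M (\<i> / 2) (Dm (Dp v))"
      unfolding lc_comp[OF D_endo v] by (simp add: r(2,3)[OF v] i cs_minus_left)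
    ultimately show "rot1 M Dp Dm (rot2 M Dp Dm v) + rot2 M Dp Dm (rot1 M Dp Dm v) = 0"
      by (simp only: rot_defs) simp
  qed
  have "susy g_12 (rot1 M Dp Dm) (rot2 M Dp Dm) M"
    unfolding susy_def
  proof (intro conjI ballI)
    show "zero_outside M (rot1 M Dp Dm)" "zero_outside M (rot2 M Dp Dm)"
      unfolding rot_defs using susy gmodule_axioms by (intro zero_outside_lc; simp add: susy_def)+
    show "endo M 1 (rot1 M Dp Dm)" "endo M 1 (rot2 M Dp Dm)"
      unfolding rot_defs by (intro lc_endo D_endo)+
    show "commutes_with_Y {} M (rot1 M Dp Dm)" "commutes_with_Y {} M (rot2 M Dp Dm)"
      unfolding rot_defs using susy by (intro lc_commutes D_endo; simp add: susy_def)+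
  qed (simp_all add: R)
  then show "is_base_12 (M, rot1 M Dp Dm, rot2 M Dp Dm)"
    using axioms by (simp add: is_base_12_def)
  show "rotp M (rot1 M Dp Dm) (rot2 M Dp Dm) = Dp" "rotm M (rot1 M Dp Dm) (rot2 M Dp Dm) = Dm"
    by (intro ext rot_rot D_carr)+
qed

lemma rot_objects_inverse:
  assumes "is_base_12 (M, D1, D2)"
  shows "is_vsa_0 (M, rotp M D1 D2, rotm M D1 D2)"
    "rot1 M (rotp M D1 D2) (rotm M D1 D2) = D1" "rot2 M (rotp M D1 D2) (rotm M D1 D2) = D2"
proof -
  interpret susy_base M g_12 D1 D2 using assms by (rule is_base_12_susy_base)
  have r: "D1 (D2 v) = - D2 (D1 v)" "D1 (D1 v) = T v" "D2 (D2 v) = T v" if "v \<in> carr M" for v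
    using D0_D1[OF that] D_square[OF that] by simp_all
  have h: "cs M (1 / 2) x + cs M (1 / 2) x = x" if "x \<in> carr M" for x
    using cs_add_left[OF that, of "1 / 2" "1 / 2"] that by simp
  have i: "\<i> * isq * isq = \<i> / 2" "isq * (\<i> * isq) = \<i> / 2" by (rule isq_mult)+
  have R: "rotp M D1 D2 (rotp M D1 D2 v) = 0" "rotm M D1 D2 (rotm M D1 D2 v) = 0"
    "rotp M D1 D2 (rotm M D1 D2 v) + rotm M D1 D2 (rotp M D1 D2 v) = cs M 2 (T v)" if v: "v \<in> carr M" for v
  proof -
    show "rotp M D1 D2 (rotp M D1 D2 v) = 0" "rotm M D1 D2 (rotm M D1 D2 v) = 0"
      unfolding rot_defs lc_comp[OF D_endo v]
      using r[OF v] v isq_mult(3) by (simp_all add: isq_mult cs_minus cs_minus_left)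
    have s: "isq * isq = 1 / 2" "isq * (\<i> * isq) = \<i> / 2" "isq * (- \<i> * isq) = - \<i> / 2"
      "- \<i> * isq * isq = - \<i> / 2" "\<i> * isq * isq = \<i> / 2" "- \<i> * isq * (\<i> * isq) = 1 / 2" "\<i> * isq * (- \<i> * isq) = 1 / 2"
      using isq_mult by simp_all
    show "rotp M D1 D2 (rotm M D1 D2 v) + rotm M D1 D2 (rotp M D1 D2 v) = cs M 2 (T v)"
      unfolding rot_defs lc_comp[OF D_endo v] s
      using r[OF v] v h[of "T v"] by (simp add: cs_2 cs_minus cs_minus_left)
  qed
  have "susy g_pm (rotp M D1 D2) (rotm M D1 D2) M"
    unfolding susy_def
  proof (intro conjI ballI)
    show "zero_outside M (rotp M D1 D2)" "zero_outside M (rotm M D1 D2)"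
      unfolding rot_defs using susy gmodule_axioms by (intro zero_outside_lc; simp add: susy_def)+
    show "endo M 1 (rotp M D1 D2)" "endo M 1 (rotm M D1 D2)"
      unfolding rot_defs by (intro lc_endo D_endo)+
    show "commutes_with_Y {} M (rotp M D1 D2)" "commutes_with_Y {} M (rotm M D1 D2)"
      unfolding rot_defs using susy by (intro lc_commutes D_endo; simp add: susy_def)+
  qed (simp_all add: R)
  then show "is_vsa_0 (M, rotp M D1 D2, rotm M D1 D2)"
    using axioms by (simp add: is_vsa_0_iff)
  show "rot1 M (rotp M D1 D2) (rotm M D1 D2) = D1" "rot2 M (rotp M D1 D2) (rotm M D1 D2) = D2"
    by (intro ext rot_rot D_carr)+
qed

section \<open>Morphisms\<close>

lemma ext_update [simp]:
  "carr (ext_scalars (M\<lparr>Ymode := f\<rparr>)) = carr (ext_scalars M)"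
  "Ev (ext_scalars (M\<lparr>Ymode := f\<rparr>)) = Ev (ext_scalars M)"
  "Od (ext_scalars (M\<lparr>Ymode := f\<rparr>)) = Od (ext_scalars M)"
  "scal (ext_scalars (M\<lparr>Ymode := f\<rparr>)) = scal (ext_scalars M)"
  "vac (ext_scalars (M\<lparr>Ymode := f\<rparr>)) = vac (ext_scalars M)"
  for M :: "'v::ab_group_add vsa"
  by (simp_all add: ext_scalars_def Let_def cong: if_cong)

lemma ext_lift [simp]:
  "carr (ext_scalars (lift g D0 D1 M)) = carr (ext_scalars M)"
  "Ev (ext_scalars (lift g D0 D1 M)) = Ev (ext_scalars M)"
  "Od (ext_scalars (lift g D0 D1 M)) = Od (ext_scalars M)"
  "scal (ext_scalars (lift g D0 D1 M)) = scal (ext_scalars M)"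
  "vac (ext_scalars (lift g D0 D1 M)) = vac (ext_scalars M)"
  by (simp_all add: lift_def)

lemma intertwines_update [simp]:
  "intertwines (M\<lparr>Ymode := f\<rparr>) = intertwines M"
  by (simp add: fun_eq_iff intertwines_def)

lemma intertwines_lift [simp]: "intertwines (lift g D0 D1 M) = intertwines M"
  by (simp add: lift_def)

context gmodule begin

abbreviation E where "E \<equiv> ext_scalars M"

definition monomial :: "nat set \<Rightarrow> bool" where
  "monomial T \<longleftrightarrow> finite T \<and> T \<inter> inner_gens (lev M) = {}"

lemma E_carr: "F \<in> carr E \<longleftrightarrow> (\<forall>T. F T \<in> carr M) \<and> (\<forall>T. F T \<noteq> 0 \<longrightarrow> monomial T) \<and> finite {T. F T \<noteq> 0}"
  by (simp add: ext_scalars_def Let_def monomial_def)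

lemma E_carrD:
  assumes "F \<in> carr E"
  shows "F T \<in> carr M" "\<not> monomial T \<Longrightarrow> F T = 0" "finite {T. F T \<noteq> 0}"
  using assms unfolding E_carr by auto

lemma E_gr_subset: "Ev E \<subseteq> carr E" "Od E \<subseteq> carr E"
  using gr_subset_carr by (auto simp: ext_scalars_def Let_def)

lemma E_map:
  assumes "F \<in> carr E" "\<And>T v. v \<in> carr M \<Longrightarrow> f T v \<in> carr M" "\<And>T. f T 0 = 0"
  shows "(\<lambda>T. f T (F T)) \<in> carr E"
  unfolding E_carr
proof (intro conjI allI impI)
  show "f T (F T) \<in> carr M" for T using assms(2) E_carrD(1)[OF assms(1)] by blast
  show "monomial T" if "f T (F T) \<noteq> 0" for T
    using that E_carrD(2)[OF assms(1), of T] assms(3) by metis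
  show "finite {T. f T (F T) \<noteq> 0}"
    by (rule finite_subset[OF _ E_carrD(3)[OF assms(1)]]) (use assms(3) in auto)
qed

lemma E_add:
  assumes "F \<in> carr E" "G \<in> carr E"
  shows "F + G \<in> carr E"
  unfolding E_carr
proof (intro conjI allI impI)
  show "(F + G) T \<in> carr M" for T using E_carrD(1) assms by simp
  show "monomial T" if "(F + G) T \<noteq> 0" for T using that E_carrD(2)[OF assms(1), of T] E_carrD(2)[OF assms(2), of T] by (cases "monomial T") auto
  show "finite {T. (F + G) T \<noteq> 0}"
    by (rule finite_subset[of _ "{T. F T \<noteq> 0} \<union> {T. G T \<noteq> 0}"]) (use assms E_carrD(3) in auto)
qed

lemma E_zero: "0 \<in> carr E"
  by (simp add: E_carr)

lemma E_uminus: "F \<in> carr E \<Longrightarrow> - F \<in> carr E"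
  using E_map[of F "\<lambda>_ v. - v"] by (simp add: fun_Compl_def)

lemma E_diff: "F \<in> carr E \<Longrightarrow> G \<in> carr E \<Longrightarrow> F - G \<in> carr E"
  using E_add[of F "- G"] by (simp add: E_uminus)

lemma ext_odd_carr:
  assumes "endo M 1 D" "F \<in> carr E"
  shows "ext_odd D F \<in> carr E"
proof -
  have "(\<lambda>T. sg (card T) (D (F T))) \<in> carr E"
    by (rule E_map[OF assms(2)]) (use endoD(1)[OF assms(1)] endo_additive(1)[OF assms(1)] in auto)
  then show ?thesis by (simp add: ext_odd_def[abs_def])
qed

lemma ext_vec_carr: "v \<in> carr M \<Longrightarrow> ext_vec v \<in> carr E"
  unfolding E_carr ext_vec_def monomial_def
  by (auto intro: finite_subset[of _ "{{}}"])

lemma vac_E: "vac E = ext_vec (vac M)"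
  by (simp add: ext_scalars_def Let_def ext_vec_def fun_eq_iff)

lemma scal_E: "scal E a F R = (if monomial R then
    (\<Sum>U\<in>Pow R. sg (inversions (R - U) U) (scal M (inner_part (lev M) (R - U) (card R) a) (F U))) else 0)"
  by (simp add: ext_scalars_def Let_def monomial_def)

lemma inner_part_Lambda: "inner_part L T k a \<in> Lambda L"
  unfolding Lambda_def by (auto simp: inner_part.rep_eq)

lemma Lambda_0 [simp]: "0 \<in> Lambda L"
  by (simp add: Lambda_def zero_grassmann.rep_eq)

lemma scal_0_left: "v \<in> carr M \<Longrightarrow> scal M 0 v = 0"
  using scal_add_left[of 0 0 v] by simp

lemma scal_E_carr:
  assumes F: "F \<in> carr E"
  shows "scal E a F \<in> carr E"
  unfolding E_carr
proof (intro conjI allI impI)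
  show "scal E a F R \<in> carr M" for R
    unfolding scal_E using E_carrD(1)[OF F] inner_part_Lambda by simp
  show "monomial R" if "scal E a F R \<noteq> 0" for R
    using that unfolding scal_E by (auto split: if_splits)
  have "{R. scal E a F R \<noteq> 0} \<subseteq> (\<Union>S\<in>{S. coeff a S \<noteq> 0}. \<Union>U\<in>{U. F U \<noteq> 0}. (\<lambda>T. T \<union> U) ` Pow S)"
  proof
    fix R assume "R \<in> {R. scal E a F R \<noteq> 0}"
    then have "scal E a F R \<noteq> 0" by simp
    then obtain U where U: "U \<subseteq> R" "scal M (inner_part (lev M) (R - U) (card R) a) (F U) \<noteq> 0"
      unfolding scal_E by (metis (no_types, lifting) PowD sg_zero sum.neutral)
    then have "F U \<noteq> 0" using inner_part_Lambda by auto
    moreover have "inner_part (lev M) (R - U) (card R) a \<noteq> 0"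
      using U scal_0_left E_carrD(1)[OF F] by metis
    then obtain S where "coeff (inner_part (lev M) (R - U) (card R) a) S \<noteq> 0"
      by (metis coeff_inject ext zero_grassmann.rep_eq)
    then have "coeff a (S \<union> (R - U)) \<noteq> 0" by (auto simp: inner_part.rep_eq split: if_splits)
    moreover have "R = (R - U) \<union> U" using U by blast
    ultimately show "R \<in> (\<Union>S\<in>{S. coeff a S \<noteq> 0}. \<Union>U\<in>{U. F U \<noteq> 0}. (\<lambda>T. T \<union> U) ` Pow S)"
      by blast
  qed
  moreover have "finite (\<Union>S\<in>{S. coeff a S \<noteq> 0}. \<Union>U\<in>{U. F U \<noteq> 0}. (\<lambda>T. T \<union> U) ` Pow S)"
    using E_carrD(3)[OF F] coeff[of a] by (intro finite_UN_I) auto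
  ultimately show "finite {R. scal E a F R \<noteq> 0}" by (rule finite_subset)
qed

lemma scal_E_gconst:
  assumes F: "F \<in> carr E"
  shows "scal E (gconst z) F = (\<lambda>R. cs M z (F R))"
proof
  fix R
  show "scal E (gconst z) F R = cs M z (F R)"
  proof (cases "monomial R")
    case True
    then have fin: "finite R" by (simp add: monomial_def)
    have "inner_part (lev M) T k (gconst z) = (if T = {} then gconst z else 0)" for T k
      by (auto simp: coeff_inject[symmetric] fun_eq_iff inner_part.rep_eq gconst.rep_eq zero_grassmann.rep_eq)
    then have "scal E (gconst z) F R = (\<Sum>U\<in>Pow R. if U = R then cs M z (F R) else 0)"
      unfolding scal_E using True E_carrD(1)[OF F]
      by (simp, intro sum.cong refl) (auto simp: cs_def scal_0_left)
    then show ?thesis using fin by (simp add: sum.delta)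
  next
    case False
    then show ?thesis using E_carrD(2)[OF F] by (simp add: scal_E)
  qed
qed

lemma pinv_eq:
  assumes "v0 \<in> gr M 0" "v1 \<in> gr M 1"
  shows "pinv M k (v0 + v1) = v0 + sg k v1"
  unfolding pinv_def
proof (rule the_equality)
  show "\<exists>w0\<in>Ev M. \<exists>w1\<in>Od M. v0 + v1 = w0 + w1 \<and> v0 + sg k v1 = w0 + sg k w1"
    using assms unfolding gr_def by auto
  fix v' assume "\<exists>w0\<in>Ev M. \<exists>w1\<in>Od M. v0 + v1 = w0 + w1 \<and> v' = w0 + sg k w1"
  then obtain w0 w1 where w: "w0 \<in> gr M 0" "w1 \<in> gr M 1" "v0 + v1 = w0 + w1" "v' = w0 + sg k w1"
    unfolding gr_def by auto
  then show "v' = v0 + sg k v1" using gr_decompose_unique[OF assms w(1,2,3)] by simp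
qed

lemma pinv_homogeneous:
  assumes "v \<in> gr M q"
  shows "pinv M k v = sg (k * q) v"
proof (cases "even q")
  case True
  then have "v \<in> gr M 0" using assms by (simp add: gr_def)
  then show ?thesis using pinv_eq[of v 0 k] True by (simp add: sg_even)
next
  case False
  then have "v \<in> gr M 1" using assms by (simp add: gr_def)
  then show ?thesis using pinv_eq[of 0 v k] False by (simp add: sg_def)
qed

lemma pinv_add:
  assumes "v \<in> carr M" "w \<in> carr M"
  shows "pinv M k (v + w) = pinv M k v + pinv M k w"
proof -
  obtain v0 v1 where v: "v0 \<in> gr M 0" "v1 \<in> gr M 1" "v = v0 + v1" using gr_decomposeE[OF assms(1)] .
  obtain w0 w1 where w: "w0 \<in> gr M 0" "w1 \<in> gr M 1" "w = w0 + w1" using gr_decomposeE[OF assms(2)] .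
  have e: "v + w = (v0 + w0) + (v1 + w1)" using v w by simp
  have "pinv M k (v + w) = (v0 + w0) + sg k (v1 + w1)"
    unfolding e using v w by (intro pinv_eq gr_add)
  then show ?thesis
    using pinv_eq[OF v(1,2), of k] pinv_eq[OF w(1,2), of k] v(3) w(3) by (simp add: sg_add)
qed

lemma pinv_carr [simp]: "v \<in> carr M \<Longrightarrow> pinv M k v \<in> carr M"
proof -
  assume "v \<in> carr M"
  then obtain v0 v1 where v: "v0 \<in> gr M 0" "v1 \<in> gr M 1" "v = v0 + v1" by (rule gr_decomposeE)
  then show ?thesis using gr_carr by (simp add: pinv_eq)
qed

lemma pinv_0 [simp]: "pinv M k 0 = 0"
  using pinv_homogeneous[of 0 0 k] by simp

lemma pinv_0_left [simp]: "v \<in> carr M \<Longrightarrow> pinv M 0 v = v"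
  by (induction v rule: gr_induct) (simp_all add: pinv_homogeneous pinv_add)

lemma pinv_minus: "v \<in> carr M \<Longrightarrow> pinv M k (- v) = - pinv M k v"
  using pinv_add[of v "- v" k] by (simp add: add_eq_0_iff)

lemma pinv_sg: "v \<in> carr M \<Longrightarrow> pinv M k (sg j v) = sg j (pinv M k v)"
  by (simp add: sg_def pinv_minus)

text \<open>\<open>pinv M k\<close> is the k-th power of the parity involution, and an operator of
  parity \<open>p\<close> commutes with the involution up to (-1)^p.\<close>

lemma pinv_endo:
  assumes "\<And>v q. v \<in> gr M q \<Longrightarrow> A v \<in> gr M (p + q)"
    "\<And>v w. v \<in> carr M \<Longrightarrow> w \<in> carr M \<Longrightarrow> A (v + w) = A v + A w" "v \<in> carr M"
  shows "A (pinv M k v) = sg (p * k) (pinv M k (A v))"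
  using assms(3)
proof (induction v rule: gr_induct)
  case (homogeneous q v)
  have v: "v \<in> carr M" using homogeneous by (rule gr_carr)
  have A0: "A 0 = 0" using assms(2)[of 0 0] by simp
  have "A (- v) = - A v" using assms(2)[of v "- v"] v A0 by (simp add: add_eq_0_iff)
  then have "A (sg j v) = sg j (A v)" for j by (simp add: sg_def)
  then show ?case
    by (simp add: pinv_homogeneous[OF homogeneous] pinv_homogeneous[OF assms(1)[OF homogeneous]] sg_sg)
      (rule sg_cong, auto)
next
  case (add v w)
  have "A v \<in> carr M" if "v \<in> carr M" for v
    using that
  proof (induction v rule: gr_induct)
    case (homogeneous q v)
    then show ?case using assms(1) gr_carr by blast
  qed (simp add: assms(2))
  with add show ?case by (simp add: pinv_add assms(2) sg_add)
qed

lemma Ymode_E: "Ymode E F n S G R = (if monomial R then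
    (\<Sum>T\<in>Pow R. sg (inversions T (R - T) + card R * card S)
       (Ymode M (pinv M (card (R - T)) (F T)) n S (G (R - T)))) else 0)"
  by (simp add: ext_scalars_def Let_def monomial_def)

end

context prevertex begin

lemma Ymode_E_carr:
  assumes F: "F \<in> carr E" and G: "G \<in> carr E"
  shows "Ymode E F n S G \<in> carr E"
  unfolding E_carr
proof (intro conjI allI impI)
  show "Ymode E F n S G R \<in> carr M" for R unfolding Ymode_E by simp
  show "monomial R" if "Ymode E F n S G R \<noteq> 0" for R
    using that unfolding Ymode_E by (auto split: if_splits)
  have "{R. Ymode E F n S G R \<noteq> 0} \<subseteq> (\<lambda>(T, U). T \<union> U) ` ({T. F T \<noteq> 0} \<times> {U. G U \<noteq> 0})"
  proof
    fix R assume "R \<in> {R. Ymode E F n S G R \<noteq> 0}"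
    then have "Ymode E F n S G R \<noteq> 0" by simp
    then obtain T where T: "T \<subseteq> R" "Ymode M (pinv M (card (R - T)) (F T)) n S (G (R - T)) \<noteq> 0"
      unfolding Ymode_E by (metis (no_types, lifting) PowD sg_zero sum.neutral)
    then have "F T \<noteq> 0" "G (R - T) \<noteq> 0" by auto
    moreover have "R = T \<union> (R - T)" using T by blast
    ultimately show "R \<in> (\<lambda>(T, U). T \<union> U) ` ({T. F T \<noteq> 0} \<times> {U. G U \<noteq> 0})" by blast
  qed
  then show "finite {R. Ymode E F n S G R \<noteq> 0}"
    by (rule finite_subset) (use E_carrD(3)[OF F] E_carrD(3)[OF G] in blast)
qed

text \<open>The argument is supported at the empty monomial, so only the summand T = R remains.
  Evaluating on the extended vacuum will recover vectors from modes.\<close>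

lemma Ymode_E_vec:
  assumes F: "F \<in> carr E" and v: "v \<in> carr M"
  shows "Ymode E F n S (ext_vec v) = (\<lambda>R. sg (card R * card S) (Ymode M (F R) n S v))"
proof
  fix R
  show "Ymode E F n S (ext_vec v) R = sg (card R * card S) (Ymode M (F R) n S v)"
  proof (cases "monomial R")
    case True
    then have fin: "finite R" by (simp add: monomial_def)
    have "Ymode E F n S (ext_vec v) R =
        (\<Sum>T\<in>Pow R. if T = R then sg (card R * card S) (Ymode M (F R) n S v) else 0)"
      unfolding Ymode_E using True E_carrD(1)[OF F]
      by (simp, intro sum.cong refl) (auto simp: ext_vec_def)
    then show ?thesis using fin by (simp add: sum.delta)
  next
    case False
    then show ?thesis using E_carrD(2)[OF F] by (simp add: Ymode_E)
  qed
qed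

end

lemma (in gmodule) ext_vec_simps:
  "v \<in> carr M \<Longrightarrow> scal E (gconst z) (ext_vec v) = ext_vec (cs M z v)"
  "endo M 1 D \<Longrightarrow> ext_odd D (ext_vec v) = ext_vec (D v)"
  "- ext_vec v = ext_vec (- v)"
  by (auto simp: scal_E_gconst ext_vec_carr ext_odd_def ext_vec_def fun_eq_iff endo_additive(1))

lemma (in prevertex) Ymode_E_vec_vec:
  "u \<in> carr M \<Longrightarrow> v \<in> carr M \<Longrightarrow> Ymode E (ext_vec u) n {} (ext_vec v) = ext_vec (Ymode M u n {} v)"
  by (simp add: Ymode_E_vec ext_vec_carr) (simp add: ext_vec_def fun_eq_iff)

section \<open>Extension of scalars for lifted operators; morphisms between lifts\<close>

context susy_base begin

text \<open>The extension to \<And>_\<infinity> of the operator \<open>BS S\<close> of parity |S|;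
  the sign moves it past the outer monomial.\<close>

definition eop :: "nat set \<Rightarrow> (nat set \<Rightarrow> 'a) \<Rightarrow> nat set \<Rightarrow> 'a" where
  "eop S F = (\<lambda>T. sg (card S * card T) (BS S (F T)))"

text \<open>Extending scalars commutes with lifting. Of the sign |R| |S| in the extended mode, the
  part |R - T| |S| is consumed by \<open>pinv_endo\<close>, and the rest |T| |S| is the sign in
  \<open>eop\<close>.\<close>

lemma Ymode_ext_lift:
  assumes S: "S \<subseteq> {0, 1}" and F: "F \<in> carr E"
  shows "Ymode (ext_scalars L) F n S G = Ymode E (eop S F) n {} G"
proof
  fix R
  have mL: "gmodule.monomial L = monomial"
    using gmodule.monomial_def[of L] graded by (simp add: gmodule_def fun_eq_iff monomial_def)
  have pL: "pinv L = pinv M" by (simp add: fun_eq_iff pinv_def)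
  have gL: "gmodule L" using graded by (simp add: gmodule_def)
  show "Ymode (ext_scalars L) F n S G R = Ymode E (eop S F) n {} G R"
  proof (cases "monomial R")
    case True
    then have fin: "finite R" by (simp add: monomial_def)
    have "sg (inversions T (R - T) + card R * card S) (Y (BS S (pinv M (card (R - T)) (F T))) n (G (R - T))) =
      sg (inversions T (R - T)) (Y (pinv M (card (R - T)) (eop S F T)) n (G (R - T)))" if T: "T \<subseteq> R" for T
    proof -
      have FT: "F T \<in> carr M" using E_carrD(1)[OF F] .
      have c: "card R = card T + card (R - T)"
        using fin T by (metis card_Diff_subset card_mono finite_subset le_add_diff_inverse)
      have "BS S (pinv M (card (R - T)) (F T)) = sg (card S * card (R - T)) (pinv M (card (R - T)) (BS S (F T)))"
        by (rule pinv_endo) (use BS_parity[OF S] BS_add FT in \<open>auto simp: add.commute\<close>)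
      then show ?thesis
        unfolding eop_def c using FT
        by (simp add: pinv_sg Y_sg_left sg_sg) (rule sg_cong, auto)
    qed
    then show ?thesis
      unfolding gmodule.Ymode_E[OF gL] Ymode_E mL pL using True S
      by (simp add: Y_lift)
  next
    case False
    then show ?thesis unfolding gmodule.Ymode_E[OF gL] Ymode_E mL by simp
  qed
qed

text \<open>Expresses the extended operators through what a morphism respects: extended odd
  operators, scalars, and the mode -2 on the vacuum, which is translation.\<close>

lemma eop_simps:
  assumes F: "F \<in> carr E"
  shows "eop {} F = F" "eop {0} F = ext_odd D0 F" "eop {Suc 0} F = ext_odd D1 F"
    "eop {0, Suc 0} F = ext_odd D1 (ext_odd D0 F) - scal E (gconst (g 0 1)) (Ymode E F (- 2) {} (vac E))"
proof -
  show "eop {} F = F" "eop {0} F = ext_odd D0 F" "eop {Suc 0} F = ext_odd D1 F"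
    by (simp_all add: eop_def ext_odd_def fun_eq_iff)
  have T: "Ymode E F (- 2) {} (vac E) = (\<lambda>R. T (F R))"
    by (simp add: vac_E Ymode_E_vec[OF F] transl_def)
  have "Ymode E F (- 2) {} (vac E) \<in> carr E"
    by (rule Ymode_E_carr[OF F]) (simp add: vac_E ext_vec_carr)
  then have "scal E (gconst (g 0 1)) (Ymode E F (- 2) {} (vac E)) = (\<lambda>R. cs M (g 0 1) (T (F R)))"
    unfolding T by (rule scal_E_gconst)
  then show "eop {0, Suc 0} F = ext_odd D1 (ext_odd D0 F) - scal E (gconst (g 0 1)) (Ymode E F (- 2) {} (vac E))"
    using E_carrD(1)[OF F]
    by (simp add: eop_def ext_odd_def fun_eq_iff B_def D_linear sg_sg sg_even)
qed

lemma eop_carr: "S \<subseteq> {0, 1} \<Longrightarrow> F \<in> carr E \<Longrightarrow> eop S F \<in> carr E"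
proof (erule subset_01_cases)
  assume F: "F \<in> carr E"
  have "vac E \<in> carr E" by (simp add: vac_E ext_vec_carr)
  then show "eop S F \<in> carr E" if "S = {0, 1}"
    using F that by (simp add: eop_simps E_diff scal_E_carr Ymode_E_carr ext_odd_carr[OF D_endo(1)] ext_odd_carr[OF D_endo(2)])
qed (simp_all add: eop_simps ext_odd_carr[OF D_endo(1)] ext_odd_carr[OF D_endo(2)])

end

lemma vsa_homD:
  assumes "\<gamma> \<in> vsa_hom K M1 M2"
  shows "\<gamma> \<in> extensional (carr (ext_scalars M1))"
    "v \<in> carr (ext_scalars M1) \<Longrightarrow> \<gamma> v \<in> carr (ext_scalars M2)"
    "v \<in> carr (ext_scalars M1) \<Longrightarrow> w \<in> carr (ext_scalars M1) \<Longrightarrow> \<gamma> (v + w) = \<gamma> v + \<gamma> w"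
    "v \<in> carr (ext_scalars M1) \<Longrightarrow> \<gamma> (scal (ext_scalars M1) a v) = scal (ext_scalars M2) a (\<gamma> v)"
    "u \<in> carr (ext_scalars M1) \<Longrightarrow> v \<in> carr (ext_scalars M1) \<Longrightarrow> S \<subseteq> K \<Longrightarrow>
      \<gamma> (Ymode (ext_scalars M1) u n S v) = Ymode (ext_scalars M2) (\<gamma> u) n S (\<gamma> v)"
    "\<gamma> (vac (ext_scalars M1)) = vac (ext_scalars M2)"
    "\<gamma> ` Ev (ext_scalars M1) \<subseteq> Ev (ext_scalars M2)" "\<gamma> ` Od (ext_scalars M1) \<subseteq> Od (ext_scalars M2)"
proof -
  note A = assms[unfolded vsa_hom_def Let_def mem_Collect_eq]
  show "\<gamma> \<in> extensional (carr (ext_scalars M1))" using A by (rule conjunct1)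
  note A = A[THEN conjunct2]
  show "v \<in> carr (ext_scalars M1) \<Longrightarrow> \<gamma> v \<in> carr (ext_scalars M2)" using A[THEN conjunct1] by blast
  note A = A[THEN conjunct2]
  show "v \<in> carr (ext_scalars M1) \<Longrightarrow> w \<in> carr (ext_scalars M1) \<Longrightarrow> \<gamma> (v + w) = \<gamma> v + \<gamma> w"
    using A[THEN conjunct1] by blast
  note A = A[THEN conjunct2]
  show "v \<in> carr (ext_scalars M1) \<Longrightarrow> \<gamma> (scal (ext_scalars M1) a v) = scal (ext_scalars M2) a (\<gamma> v)"
    using A[THEN conjunct1] by blast
  note A = A[THEN conjunct2]
  show "\<gamma> ` Ev (ext_scalars M1) \<subseteq> Ev (ext_scalars M2)" using A by (rule conjunct1)
  note A = A[THEN conjunct2]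
  show "\<gamma> ` Od (ext_scalars M1) \<subseteq> Od (ext_scalars M2)" using A by (rule conjunct1)
  note A = A[THEN conjunct2]
  show "u \<in> carr (ext_scalars M1) \<Longrightarrow> v \<in> carr (ext_scalars M1) \<Longrightarrow> S \<subseteq> K \<Longrightarrow>
      \<gamma> (Ymode (ext_scalars M1) u n S v) = Ymode (ext_scalars M2) (\<gamma> u) n S (\<gamma> v)"
    using A[THEN conjunct1] by blast
  show "\<gamma> (vac (ext_scalars M1)) = vac (ext_scalars M2)" using A by (rule conjunct2)
qed

lemma vsa_homI:
  assumes "\<gamma> \<in> extensional (carr (ext_scalars M1))"
    "\<And>v. v \<in> carr (ext_scalars M1) \<Longrightarrow> \<gamma> v \<in> carr (ext_scalars M2)"
    "\<And>v w. v \<in> carr (ext_scalars M1) \<Longrightarrow> w \<in> carr (ext_scalars M1) \<Longrightarrow> \<gamma> (v + w) = \<gamma> v + \<gamma> w"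
    "\<And>v a. v \<in> carr (ext_scalars M1) \<Longrightarrow> \<gamma> (scal (ext_scalars M1) a v) = scal (ext_scalars M2) a (\<gamma> v)"
    "\<And>u v S n. u \<in> carr (ext_scalars M1) \<Longrightarrow> v \<in> carr (ext_scalars M1) \<Longrightarrow> S \<subseteq> K \<Longrightarrow>
      \<gamma> (Ymode (ext_scalars M1) u n S v) = Ymode (ext_scalars M2) (\<gamma> u) n S (\<gamma> v)"
    "\<gamma> (vac (ext_scalars M1)) = vac (ext_scalars M2)"
    "\<gamma> ` Ev (ext_scalars M1) \<subseteq> Ev (ext_scalars M2)" "\<gamma> ` Od (ext_scalars M1) \<subseteq> Od (ext_scalars M2)"
  shows "\<gamma> \<in> vsa_hom K M1 M2"
  unfolding vsa_hom_def Let_def mem_Collect_eq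
  by (intro conjI allI ballI impI image_subsetI; (rule assms; assumption)?)
    (use assms(2,7,8) in blast)+

lemma vsa_hom_diff:
  assumes "\<gamma> \<in> vsa_hom K M1 M2" "gmodule M1" "v \<in> carr (ext_scalars M1)" "w \<in> carr (ext_scalars M1)"
  shows "\<gamma> (v - w) = \<gamma> v - \<gamma> w"
proof -
  interpret gmodule M1 by fact
  show ?thesis
    using vsa_homD(3)[OF assms(1) E_diff[OF assms(3,4)] assms(4)] by (simp add: algebra_simps)
qed

text \<open>An odd mode {i} at -1 on the vacuum is the extended D_i, so preserving it forces
  intertwining. Conversely \<open>eop S\<close> is built from intertwined operators. The
  implications are kept apart because K = {0} gives information about the first operator
  only.\<close>

lemma vsa_hom_lift_iff:
  assumes M1: "susy_base M1 g A0 A1" and M2: "susy_base M2 g B0 B1" and K: "K \<subseteq> {0, 1}"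
  shows "\<gamma> \<in> vsa_hom K (lift g A0 A1 M1) (lift g B0 B1 M2) \<Longrightarrow> \<gamma> \<in> vsa_hom {} M1 M2"
    and "\<gamma> \<in> vsa_hom K (lift g A0 A1 M1) (lift g B0 B1 M2) \<Longrightarrow> 0 \<in> K \<Longrightarrow> intertwines M1 \<gamma> A0 B0"
    and "\<gamma> \<in> vsa_hom K (lift g A0 A1 M1) (lift g B0 B1 M2) \<Longrightarrow> 1 \<in> K \<Longrightarrow> intertwines M1 \<gamma> A1 B1"
    and "\<gamma> \<in> vsa_hom {} M1 M2 \<Longrightarrow> intertwines M1 \<gamma> A0 B0 \<Longrightarrow> intertwines M1 \<gamma> A1 B1 \<Longrightarrow>
      \<gamma> \<in> vsa_hom K (lift g A0 A1 M1) (lift g B0 B1 M2)"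
proof -
  interpret X: susy_base M1 g A0 A1 by fact
  interpret Y: susy_base M2 g B0 B1 by fact
  have vac: "vac X.E \<in> carr X.E" by (simp add: X.vac_E X.ext_vec_carr)
  {
    assume H: "\<gamma> \<in> vsa_hom K X.L Y.L"
    note D = vsa_homD[OF H, unfolded ext_lift]
    have Y0: "\<gamma> (Ymode X.E u n {} v) = Ymode Y.E (\<gamma> u) n {} (\<gamma> v)" if "u \<in> carr X.E" "v \<in> carr X.E" for u v n
      using D(5)[OF that, of "{}" n] that D(2)
      by (simp add: X.Ymode_ext_lift Y.Ymode_ext_lift X.eop_simps Y.eop_simps)
    show "\<gamma> \<in> vsa_hom {} M1 M2"
      by (rule vsa_homI) (use D Y0 in auto)
    have odd: "\<gamma> (X.eop {i} F) = Y.eop {i} (\<gamma> F)" if "i \<in> K" "F \<in> carr X.E" for i F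
    proof -
      have i: "{i} \<subseteq> {0, 1}" using that K by auto
      have "\<gamma> (X.eop {i} F) = \<gamma> (Ymode X.E (X.eop {i} F) (- 1) {} (vac X.E))"
        using X.E_carrD(1)[OF X.eop_carr[OF i that(2)]]
        by (simp add: X.vac_E X.Ymode_E_vec X.eop_carr[OF i that(2)] X.creation)
      also have "\<dots> = Ymode Y.E (Y.eop {i} (\<gamma> F)) (- 1) {} (vac Y.E)"
        using D(5)[OF that(2) vac, of "{i}" "- 1"] that D(2)[OF that(2)] D(6) i
        by (simp add: X.Ymode_ext_lift Y.Ymode_ext_lift)
      also have "\<dots> = Y.eop {i} (\<gamma> F)"
        using Y.E_carrD(1)[OF Y.eop_carr[OF i D(2)[OF that(2)]]]
        by (simp add: Y.vac_E Y.Ymode_E_vec Y.eop_carr[OF i D(2)[OF that(2)]] Y.creation)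
      finally show ?thesis .
    qed
    show "intertwines M1 \<gamma> A0 B0" if "0 \<in> K"
      unfolding intertwines_def using odd[OF that] D(2) by (simp add: X.eop_simps Y.eop_simps)
    show "intertwines M1 \<gamma> A1 B1" if "1 \<in> K"
      unfolding intertwines_def using odd[OF that] D(2) by (simp add: X.eop_simps Y.eop_simps)
  }
  assume H: "\<gamma> \<in> vsa_hom {} M1 M2" and I: "intertwines M1 \<gamma> A0 B0" "intertwines M1 \<gamma> A1 B1"
  note D = vsa_homD[OF H]
  note c = X.ext_odd_carr[OF X.D_endo(1)] X.ext_odd_carr[OF X.D_endo(2)]
  have odd: "\<gamma> (ext_odd A0 F) = ext_odd B0 (\<gamma> F)" "\<gamma> (ext_odd A1 F) = ext_odd B1 (\<gamma> F)"
    if "F \<in> carr X.E" for F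
    using I that unfolding intertwines_def by blast+
  have eop: "\<gamma> (X.eop S F) = Y.eop S (\<gamma> F)" if "S \<subseteq> {0, 1}" and F: "F \<in> carr X.E" for S F
    using that(1)
  proof (cases rule: subset_01_cases)
    case 4
    have "\<gamma> (Ymode X.E F (- 2) {} (vac X.E)) = Ymode Y.E (\<gamma> F) (- 2) {} (vac Y.E)"
      using D(5)[OF F vac, of "{}"] D(6) by simp
    moreover have "Ymode X.E F (- 2) {} (vac X.E) \<in> carr X.E" by (rule X.Ymode_E_carr[OF F vac])
    ultimately show ?thesis
      using 4 F D(2)[OF F] D(4)
      by (simp add: X.eop_simps Y.eop_simps vsa_hom_diff[OF H X.gmodule_axioms] c X.scal_E_carr odd)
  qed (use F D(2)[OF F] odd in \<open>simp_all add: X.eop_simps Y.eop_simps\<close>)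
  show "\<gamma> \<in> vsa_hom K X.L Y.L"
  proof (rule vsa_homI, unfold ext_lift)
    fix u v S n assume u: "u \<in> carr X.E" and v: "v \<in> carr X.E" and S: "S \<subseteq> K"
    have S': "S \<subseteq> {0, 1}" using S K by blast
    show "\<gamma> (Ymode (ext_scalars X.L) u n S v) = Ymode (ext_scalars Y.L) (\<gamma> u) n S (\<gamma> v)"
      unfolding X.Ymode_ext_lift[OF S' u] Y.Ymode_ext_lift[OF S' D(2)[OF u]] eop[OF S' u, symmetric]
      by (rule D(5)[OF X.eop_carr[OF S' u] v]) simp
  qed (use D in auto)
qed

lemma intertwines_lc:
  assumes H: "\<gamma> \<in> vsa_hom {} M1 M2" and M: "gmodule M1" "gmodule M2"
    and e: "endo M1 1 A" "endo M1 1 A'" "endo M2 1 B" "endo M2 1 B'"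
    and I: "intertwines M1 \<gamma> A B" "intertwines M1 \<gamma> A' B'"
  shows "intertwines M1 \<gamma> (lc M1 z z' A A') (lc M2 z z' B B')"
proof -
  interpret X: gmodule M1 by fact
  interpret Y: gmodule M2 by fact
  note D = vsa_homD[OF H]
  have lX: "ext_odd (lc M1 z z' A A') F = scal X.E (gconst z) (ext_odd A F) + scal X.E (gconst z') (ext_odd A' F)"
    if F: "F \<in> carr X.E" for F
    using X.E_carrD(1)[OF F] X.endoD(1)[OF e(1)] X.endoD(1)[OF e(2)]
    by (simp add: X.scal_E_gconst X.ext_odd_carr[OF e(1) F] X.ext_odd_carr[OF e(2) F])
      (simp add: ext_odd_def lc_def fun_eq_iff sg_add X.cs_sg)
  have lY: "ext_odd (lc M2 z z' B B') F = scal Y.E (gconst z) (ext_odd B F) + scal Y.E (gconst z') (ext_odd B' F)"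
    if F: "F \<in> carr Y.E" for F
    using Y.E_carrD(1)[OF F] Y.endoD(1)[OF e(3)] Y.endoD(1)[OF e(4)]
    by (simp add: Y.scal_E_gconst Y.ext_odd_carr[OF e(3) F] Y.ext_odd_carr[OF e(4) F])
      (simp add: ext_odd_def lc_def fun_eq_iff sg_add Y.cs_sg)
  show ?thesis
    unfolding intertwines_def
  proof
    fix F assume F: "F \<in> carr X.E"
    show "\<gamma> (ext_odd (lc M1 z z' A A') F) = ext_odd (lc M2 z z' B B') (\<gamma> F)"
      using I F unfolding intertwines_def
      by (simp add: lX[OF F] lY[OF D(2)[OF F]] D(3,4) X.ext_odd_carr[OF e(1) F] X.ext_odd_carr[OF e(2) F] X.scal_E_carr)
  qed
qed

section \<open>Isomorphisms of categories\<close>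

lemma isomorphic_cats_sym: "isomorphic_cats \<C> \<D> \<Longrightarrow> isomorphic_cats \<D> \<C>"
  unfolding isomorphic_cats_def by blast

lemma is_functor_comp:
  assumes "is_functor \<C> \<D> Fo Fm" "is_functor \<D> \<E> Go Gm"
  shows "is_functor \<C> \<E> (\<lambda>A. Go (Fo A)) (\<lambda>A B f. Gm (Fo A) (Fo B) (Fm A B f))"
  using assms unfolding is_functor_def by (intro conjI ballI) simp_all

lemma isomorphic_cats_trans:
  assumes "isomorphic_cats \<C> \<D>" "isomorphic_cats \<D> \<E>"
  shows "isomorphic_cats \<C> \<E>"
proof -
  obtain Fo Fm Go Gm where F: "is_functor \<C> \<D> Fo Fm" "is_functor \<D> \<C> Go Gm"
      "\<forall>A\<in>Obj \<C>. Go (Fo A) = A" "\<forall>A\<in>Obj \<D>. Fo (Go A) = A"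
      "\<forall>A\<in>Obj \<C>. \<forall>B\<in>Obj \<C>. \<forall>f\<in>Hom \<C> A B. Gm (Fo A) (Fo B) (Fm A B f) = f"
      "\<forall>A\<in>Obj \<D>. \<forall>B\<in>Obj \<D>. \<forall>f\<in>Hom \<D> A B. Fm (Go A) (Go B) (Gm A B f) = f"
    using assms(1) unfolding isomorphic_cats_def by blast
  obtain Fo' Fm' Go' Gm' where F': "is_functor \<D> \<E> Fo' Fm'" "is_functor \<E> \<D> Go' Gm'"
      "\<forall>A\<in>Obj \<D>. Go' (Fo' A) = A" "\<forall>A\<in>Obj \<E>. Fo' (Go' A) = A"
      "\<forall>A\<in>Obj \<D>. \<forall>B\<in>Obj \<D>. \<forall>f\<in>Hom \<D> A B. Gm' (Fo' A) (Fo' B) (Fm' A B f) = f"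
      "\<forall>A\<in>Obj \<E>. \<forall>B\<in>Obj \<E>. \<forall>f\<in>Hom \<E> A B. Fm' (Go' A) (Go' B) (Gm' A B f) = f"
    using assms(2) unfolding isomorphic_cats_def by blast
  have o: "\<And>A. A \<in> Obj \<C> \<Longrightarrow> Fo A \<in> Obj \<D>" "\<And>A. A \<in> Obj \<E> \<Longrightarrow> Go' A \<in> Obj \<D>"
    "\<And>A B f. A \<in> Obj \<C> \<Longrightarrow> B \<in> Obj \<C> \<Longrightarrow> f \<in> Hom \<C> A B \<Longrightarrow> Fm A B f \<in> Hom \<D> (Fo A) (Fo B)"
    "\<And>A B f. A \<in> Obj \<E> \<Longrightarrow> B \<in> Obj \<E> \<Longrightarrow> f \<in> Hom \<E> A B \<Longrightarrow> Gm' A B f \<in> Hom \<D> (Go' A) (Go' B)"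
    using F(1) F'(2) unfolding is_functor_def by blast+
  show ?thesis
    unfolding isomorphic_cats_def
  proof (intro conjI)
    show "is_category \<C>" "is_category \<E>" using assms unfolding isomorphic_cats_def by blast+
    show "\<exists>Ho Hm Ko Km. is_functor \<C> \<E> Ho Hm \<and> is_functor \<E> \<C> Ko Km \<and>
        (\<forall>A\<in>Obj \<C>. Ko (Ho A) = A) \<and> (\<forall>A\<in>Obj \<E>. Ho (Ko A) = A) \<and>
        (\<forall>A\<in>Obj \<C>. \<forall>B\<in>Obj \<C>. \<forall>f\<in>Hom \<C> A B. Km (Ho A) (Ho B) (Hm A B f) = f) \<and>
        (\<forall>A\<in>Obj \<E>. \<forall>B\<in>Obj \<E>. \<forall>f\<in>Hom \<E> A B. Hm (Ko A) (Ko B) (Km A B f) = f)"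
      by (rule exI[of _ "\<lambda>A. Fo' (Fo A)"], rule exI[of _ "\<lambda>A B f. Fm' (Fo A) (Fo B) (Fm A B f)"],
          rule exI[of _ "\<lambda>A. Go (Go' A)"], rule exI[of _ "\<lambda>A B f. Gm (Go' A) (Go' B) (Gm' A B f)"])
        (use F F' o in \<open>simp add: is_functor_comp[OF F(1) F'(1)] is_functor_comp[OF F'(2) F(2)]\<close>)
  qed
qed

lemma concrete_cat_simps [simp]:
  "Obj (concrete_cat P U H) = {A. P A}" "Hom (concrete_cat P U H) = H"
  "Ident (concrete_cat P U H) A = restrict (\<lambda>v. v) (U A)"
  "Comp (concrete_cat P U H) A B C g f = compose (U A) g f"
  by (simp_all add: concrete_cat_def)

lemma is_category_concrete:
  assumes ext: "\<And>A B f. P A \<Longrightarrow> P B \<Longrightarrow> f \<in> H A B \<Longrightarrow> f \<in> extensional (U A)"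
    and maps: "\<And>A B f x. P A \<Longrightarrow> P B \<Longrightarrow> f \<in> H A B \<Longrightarrow> x \<in> U A \<Longrightarrow> f x \<in> U B"
    and id: "\<And>A. P A \<Longrightarrow> restrict (\<lambda>v. v) (U A) \<in> H A A"
    and comp: "\<And>A B C f g. P A \<Longrightarrow> P B \<Longrightarrow> P C \<Longrightarrow> f \<in> H A B \<Longrightarrow> g \<in> H B C \<Longrightarrow> compose (U A) g f \<in> H A C"
  shows "is_category (concrete_cat P U H)"
  unfolding is_category_def concrete_cat_simps mem_Collect_eq
proof (intro conjI ballI)
  fix A B f assume *: "A \<in> {A. P A}" "B \<in> {A. P A}" "f \<in> H A B"
  then have e: "f \<in> extensional (U A)" and f: "\<And>x. x \<in> U A \<Longrightarrow> f x \<in> U B" using ext maps by auto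
  show "compose (U A) f (restrict (\<lambda>v. v) (U A)) = f"
    "compose (U A) (restrict (\<lambda>v. v) (U B)) f = f"
    using e f by (auto simp: compose_def restrict_def extensional_def fun_eq_iff)
next
  fix A B C D f g h
  assume "A \<in> {A. P A}" "B \<in> {A. P A}" "C \<in> {A. P A}" "D \<in> {A. P A}" "f \<in> H A B" "g \<in> H B C" "h \<in> H C D"
  then show "compose (U A) (compose (U B) h g) f = compose (U A) h (compose (U A) g f)"
    using maps[of A B f] by (auto simp: compose_def restrict_def fun_eq_iff)
qed (use id comp in auto)

text \<open>Both functors are the identity on underlying maps, so a bijection of objects with equal
  underlying sets and equal Hom-sets suffices; the category laws are transported along it.\<close>

lemma concrete_iso:
  assumes cat: "is_category (concrete_cat P U H)"
    and F: "\<And>A. P A \<Longrightarrow> P' (F A)" "\<And>A. P A \<Longrightarrow> G (F A) = A" "\<And>A. P A \<Longrightarrow> U' (F A) = U A"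
    and G: "\<And>B. P' B \<Longrightarrow> P (G B)" "\<And>B. P' B \<Longrightarrow> F (G B) = B"
    and H: "\<And>A B. P A \<Longrightarrow> P B \<Longrightarrow> H' (F A) (F B) = H A B"
  shows "isomorphic_cats (concrete_cat P U H) (concrete_cat P' U' H')"
proof -
  have H': "H' A B = H (G A) (G B)" if "P' A" "P' B" for A B
    using H[OF G(1)[OF that(1)] G(1)[OF that(2)]] G(2) that by simp
  have U': "U' A = U (G A)" if "P' A" for A
    using F(3)[OF G(1)[OF that]] G(2)[OF that] by simp
  have "is_category (concrete_cat P' U' H')"
    unfolding is_category_def concrete_cat_simps mem_Collect_eq
  proof (intro conjI ballI; unfold mem_Collect_eq)
    note C = cat[unfolded is_category_def concrete_cat_simps]
    fix A assume A: "P' A"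
    note pA = G(1)[OF A]
    show "restrict (\<lambda>v. v) (U' A) \<in> H' A A"
      using C[THEN conjunct1] pA by (simp only: H'[OF A A] U'[OF A]) blast
    fix B assume B: "P' B"
    note pB = G(1)[OF B]
    {
      fix f assume "f \<in> H' A B"
      then have "f \<in> H (G A) (G B)" by (simp only: H'[OF A B])
      then show "compose (U' A) f (restrict (\<lambda>v. v) (U' A)) = f" "compose (U' A) (restrict (\<lambda>v. v) (U' B)) f = f"
        using C[THEN conjunct2, THEN conjunct2, THEN conjunct1] pA pB
        by (simp_all only: U'[OF A] U'[OF B]) blast+
    }
    fix C' assume C': "P' C'"
    note pC = G(1)[OF C']
    {
      fix f g assume "f \<in> H' A B" "g \<in> H' B C'"
      then have "f \<in> H (G A) (G B)" "g \<in> H (G B) (G C')" by (simp_all only: H'[OF A B] H'[OF B C'])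
      then show "compose (U' A) g f \<in> H' A C'"
        using C[THEN conjunct2, THEN conjunct1] pA pB pC
        by (simp only: U'[OF A] H'[OF A C']) blast
    }
    fix D f g h assume D: "P' D" and "f \<in> H' A B" "g \<in> H' B C'" "h \<in> H' C' D"
    then have "f \<in> H (G A) (G B)" "g \<in> H (G B) (G C')" "h \<in> H (G C') (G D)"
      by (simp_all only: H'[OF A B] H'[OF B C'] H'[OF C' D])
    then show "compose (U' A) (compose (U' B) h g) f = compose (U' A) h (compose (U' A) g f)"
      using C[THEN conjunct2, THEN conjunct2, THEN conjunct2] pA pB pC G(1)[OF D]
      by (simp only: U'[OF A] U'[OF B]) blast
  qed
  moreover have "is_functor (concrete_cat P U H) (concrete_cat P' U' H') F (\<lambda>_ _ f. f)"
    unfolding is_functor_def using F H by simp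
  moreover have "is_functor (concrete_cat P' U' H') (concrete_cat P U H) G (\<lambda>_ _ f. f)"
    unfolding is_functor_def using G U' H' by simp
  ultimately show ?thesis
    unfolding isomorphic_cats_def using cat F(2) G(2) by auto
qed

section \<open>Hom-sets of the four vertex superalgebra categories\<close>

lemma (in prevertex) vsa_hom_id: "restrict (\<lambda>v. v) (carr E) \<in> vsa_hom K M M"
proof (rule vsa_homI)
  have v: "vac E \<in> carr E" by (simp add: vac_E ext_vec_carr)
  show "restrict (\<lambda>v. v) (carr E) (vac E) = vac E" using v by simp
qed (use E_gr_subset in \<open>auto simp: E_add scal_E_carr Ymode_E_carr\<close>)

lemma (in prevertex) vsa_hom_comp:
  assumes f: "f \<in> vsa_hom K M M'" and g: "g \<in> vsa_hom K M' M''"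
  shows "compose (carr E) g f \<in> vsa_hom K M M''"
proof (rule vsa_homI)
  note F = vsa_homD[OF f] and G = vsa_homD[OF g]
  have v: "vac E \<in> carr E" by (simp add: vac_E ext_vec_carr)
  show "compose (carr E) g f (vac E) = vac (ext_scalars M'')" using v F(6) G(6) by (simp add: compose_eq)
  show "compose (carr E) g f ` Ev E \<subseteq> Ev (ext_scalars M'')" "compose (carr E) g f ` Od E \<subseteq> Od (ext_scalars M'')"
    by (intro image_subsetI; subst compose_eq; use E_gr_subset F(7,8) G(7,8) in blast)+
qed (use vsa_homD[OF f] vsa_homD[OF g] in \<open>auto simp: compose_eq E_add scal_E_carr Ymode_E_carr\<close>)

lemma (in gmodule) intertwines_id:
  "endo M 1 D \<Longrightarrow> intertwines M (restrict (\<lambda>v. v) (carr E)) D D"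
  unfolding intertwines_def using ext_odd_carr by simp

lemma (in gmodule) intertwines_comp:
  assumes f: "f \<in> vsa_hom K M M'" and "endo M 1 D"
    and "intertwines M f D D'" "intertwines M' g D' D''"
  shows "intertwines M (compose (carr E) g f) D D''"
  unfolding intertwines_def
proof
  fix v assume v: "v \<in> carr E"
  then show "compose (carr E) g f (ext_odd D v) = ext_odd D'' (compose (carr E) g f v)"
    using assms(3,4) ext_odd_carr[OF assms(2) v] vsa_homD(2)[OF f v]
    unfolding intertwines_def by (simp add: compose_eq)
qed

lemma is_vsa_0D:
  assumes "is_vsa_0 (M, Dp, Dm)"
  shows "prevertex M" "gmodule M" "endo M 1 Dp" "endo M 1 Dm"
proof -
  interpret susy_base M g_pm Dp Dm using assms by (rule is_vsa_0_susy_base)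
  show "prevertex M" by unfold_locales
  show "gmodule M" by unfold_locales
  show "endo M 1 Dp" "endo M 1 Dm" by (rule D_endo)+
qed

lemma vsa_op_hom_iff:
  "\<gamma> \<in> vsa_op_hom K (M1, A1, B1) (M2, A2, B2) \<longleftrightarrow>
    \<gamma> \<in> vsa_hom K M1 M2 \<and> intertwines M1 \<gamma> A1 A2 \<and> intertwines M1 \<gamma> B1 B2"
  by (simp add: vsa_op_hom_def)

lemma vsa_op_hom_id:
  assumes "is_vsa_0 (M, Dp, Dm)"
  shows "restrict (\<lambda>v. v) (carr (ext_scalars M)) \<in> vsa_op_hom {} (M, Dp, Dm) (M, Dp, Dm)"
  using prevertex.vsa_hom_id[OF is_vsa_0D(1)[OF assms]] gmodule.intertwines_id[OF is_vsa_0D(2)[OF assms]]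
    is_vsa_0D(3,4)[OF assms]
  by (simp add: vsa_op_hom_iff)

lemma vsa_op_hom_comp:
  assumes "is_vsa_0 (M, Dp, Dm)" "f \<in> vsa_op_hom {} (M, Dp, Dm) B" "g \<in> vsa_op_hom {} B C"
  shows "compose (carr (ext_scalars M)) g f \<in> vsa_op_hom {} (M, Dp, Dm) C"
proof -
  obtain M' A' B' M'' A'' B'' where eq: "B = (M', A', B')" "C = (M'', A'', B'')"
    by (metis prod_cases3)
  note D = is_vsa_0D[OF assms(1)]
  show ?thesis
    using assms(2,3) unfolding eq vsa_op_hom_iff
    using prevertex.vsa_hom_comp[OF D(1)] gmodule.intertwines_comp[OF D(2) _ D(3)]
      gmodule.intertwines_comp[OF D(2) _ D(4)] by blast
qed

lemma is_category_VSA_0: "is_category (VSA_0 TYPE('v::ab_group_add))"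
  unfolding VSA_0_def
proof (rule is_category_concrete)
  fix A B :: "'v vsa \<times> ('v \<Rightarrow> 'v) \<times> ('v \<Rightarrow> 'v)" and f x
  assume f: "f \<in> vsa_op_hom {} A B"
  obtain M A' B' M' A'' B'' where eq: "A = (M, A', B')" "B = (M', A'', B'')" by (metis prod_cases3)
  have h: "f \<in> vsa_hom {} M M'" using f unfolding eq vsa_op_hom_iff by blast
  show "f \<in> extensional (case A of (M, _) \<Rightarrow> carr (ext_scalars M))"
    using vsa_homD(1)[OF h] by (simp add: eq)
  show "f x \<in> (case B of (M, _) \<Rightarrow> carr (ext_scalars M))" if "x \<in> (case A of (M, _) \<Rightarrow> carr (ext_scalars M))"
    using vsa_homD(2)[OF h] that by (simp add: eq)
next
  fix A :: "'v vsa \<times> ('v \<Rightarrow> 'v) \<times> ('v \<Rightarrow> 'v)"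
  assume "is_vsa_0 A"
  then show "restrict (\<lambda>v. v) (case A of (M, _) \<Rightarrow> carr (ext_scalars M)) \<in> vsa_op_hom {} A A"
    using vsa_op_hom_id by (cases A) auto
next
  fix A B C :: "'v vsa \<times> ('v \<Rightarrow> 'v) \<times> ('v \<Rightarrow> 'v)" and f g
  assume *: "is_vsa_0 A" "f \<in> vsa_op_hom {} A B" "g \<in> vsa_op_hom {} B C"
  obtain M Dp Dm where A: "A = (M, Dp, Dm)" by (metis prod_cases3)
  from * show "compose (case A of (M, _) \<Rightarrow> carr (ext_scalars M)) g f \<in> vsa_op_hom {} A C"
    unfolding A prod.case by (rule vsa_op_hom_comp)
qed

lemma hom_pm:
  assumes "is_vsa_0 (M, Dp, Dm)" "is_vsa_0 (M', Dp', Dm')"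
  shows "vsa_hom {0, 1} (lift g_pm Dp Dm M) (lift g_pm Dp' Dm' M') =
    vsa_op_hom {} (M, Dp, Dm) (M', Dp', Dm')"
proof -
  have "\<gamma> \<in> vsa_hom {0, 1} (lift g_pm Dp Dm M) (lift g_pm Dp' Dm' M') \<longleftrightarrow>
    \<gamma> \<in> vsa_op_hom {} (M, Dp, Dm) (M', Dp', Dm')" for \<gamma>
    unfolding vsa_op_hom_iff
    using vsa_hom_lift_iff[OF is_vsa_0_susy_base[OF assms(1)] is_vsa_0_susy_base[OF assms(2)], of "{0, 1}" \<gamma>]
    by blast
  then show ?thesis by blast
qed

lemma intertwines_rot:
  assumes "is_vsa_0 (M, Dp, Dm)" "is_vsa_0 (M', Dp', Dm')" "\<gamma> \<in> vsa_hom {} M M'"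
  shows "intertwines M \<gamma> (rot1 M Dp Dm) (rot1 M' Dp' Dm') \<and> intertwines M \<gamma> (rot2 M Dp Dm) (rot2 M' Dp' Dm') \<longleftrightarrow>
    intertwines M \<gamma> Dp Dp' \<and> intertwines M \<gamma> Dm Dm'"
proof -
  note X = is_vsa_0D[OF assms(1)] and Y = is_vsa_0D[OF assms(2)]
  note e = gmodule.lc_endo[OF X(2) X(3,4)] gmodule.lc_endo[OF Y(2) Y(3,4)]
  have "intertwines M \<gamma> Dp Dp' \<and> intertwines M \<gamma> Dm Dm'"
    if I: "intertwines M \<gamma> (rot1 M Dp Dm) (rot1 M' Dp' Dm')" "intertwines M \<gamma> (rot2 M Dp Dm) (rot2 M' Dp' Dm')"
  proof -
    have "intertwines M \<gamma> (lc M z z' (rot1 M Dp Dm) (rot2 M Dp Dm)) (lc M' z z' (rot1 M' Dp' Dm') (rot2 M' Dp' Dm'))" for z z'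
      by (rule intertwines_lc[OF assms(3) X(2) Y(2) _ _ _ _ I]) (simp_all only: rot1_def rot2_def e)
    then have "intertwines M \<gamma> (rotp M (rot1 M Dp Dm) (rot2 M Dp Dm)) (rotp M' (rot1 M' Dp' Dm') (rot2 M' Dp' Dm'))"
      "intertwines M \<gamma> (rotm M (rot1 M Dp Dm) (rot2 M Dp Dm)) (rotm M' (rot1 M' Dp' Dm') (rot2 M' Dp' Dm'))"
      unfolding rotp_def rotm_def by blast+
    then show ?thesis by (simp only: rot_objects(2,3)[OF assms(1)] rot_objects(2,3)[OF assms(2)])
  qed
  then show ?thesis
    using intertwines_lc[OF assms(3) X(2) Y(2) X(3,4) Y(3,4)] unfolding rot1_def rot2_def by blast
qed

lemma hom_12:
  assumes "is_vsa_0 (M, Dp, Dm)" "is_vsa_0 (M', Dp', Dm')"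
  shows "vsa_hom {0, 1} (lift g_12 (rot1 M Dp Dm) (rot2 M Dp Dm) M) (lift g_12 (rot1 M' Dp' Dm') (rot2 M' Dp' Dm') M') =
    vsa_op_hom {} (M, Dp, Dm) (M', Dp', Dm')"
proof -
  have "\<gamma> \<in> vsa_hom {0, 1} (lift g_12 (rot1 M Dp Dm) (rot2 M Dp Dm) M) (lift g_12 (rot1 M' Dp' Dm') (rot2 M' Dp' Dm') M') \<longleftrightarrow>
    \<gamma> \<in> vsa_hom {} M M' \<and> intertwines M \<gamma> (rot1 M Dp Dm) (rot1 M' Dp' Dm') \<and> intertwines M \<gamma> (rot2 M Dp Dm) (rot2 M' Dp' Dm')" for \<gamma>
    using vsa_hom_lift_iff[OF is_base_12_susy_base[OF rot_objects(1)[OF assms(1)]]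
        is_base_12_susy_base[OF rot_objects(1)[OF assms(2)]], of "{0, 1}" \<gamma>] by blast
  moreover have "\<gamma> \<in> vsa_op_hom {} (M, Dp, Dm) (M', Dp', Dm') \<longleftrightarrow>
    \<gamma> \<in> vsa_hom {} M M' \<and> intertwines M \<gamma> (rot1 M Dp Dm) (rot1 M' Dp' Dm') \<and> intertwines M \<gamma> (rot2 M Dp Dm) (rot2 M' Dp' Dm')" for \<gamma>
    unfolding vsa_op_hom_iff using intertwines_rot[OF assms, of \<gamma>] by blast
  ultimately show ?thesis by blast
qed

lemma hom_1:
  assumes "is_vsa_0 (M, Dp, Dm)" "is_vsa_0 (M', Dp', Dm')"
  shows "vsa_op_hom {0} (lift g_1 (rot1 M Dp Dm) zero_op M, rot1 M Dp Dm, rot2 M Dp Dm)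
      (lift g_1 (rot1 M' Dp' Dm') zero_op M', rot1 M' Dp' Dm', rot2 M' Dp' Dm') =
    vsa_op_hom {} (M, Dp, Dm) (M', Dp', Dm')"
proof -
  note L = vsa_hom_lift_iff[OF is_base_12_lift_1(3)[OF rot_objects(1)[OF assms(1)]]
        is_base_12_lift_1(3)[OF rot_objects(1)[OF assms(2)]], of "{0}"]
  \<comment> \<open>Needed because the one-variable lift formally has a second derivation, namely
    zero.\<close>
  have z: "intertwines M \<gamma> zero_op zero_op" if "\<gamma> \<in> vsa_hom {} M M'" for \<gamma>
  proof -
    interpret gmodule M using is_vsa_0D(2)[OF assms(1)] .
    have "\<gamma> 0 = 0" using vsa_homD(3)[OF that E_zero E_zero] by simp
    moreover have "ext_odd zero_op F = 0" for F :: "nat set \<Rightarrow> 'a" by (simp add: ext_odd_def fun_eq_iff)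
    ultimately show ?thesis unfolding intertwines_def by simp
  qed
  have "\<gamma> \<in> vsa_op_hom {0} (lift g_1 (rot1 M Dp Dm) zero_op M, rot1 M Dp Dm, rot2 M Dp Dm)
      (lift g_1 (rot1 M' Dp' Dm') zero_op M', rot1 M' Dp' Dm', rot2 M' Dp' Dm') \<longleftrightarrow>
    \<gamma> \<in> vsa_hom {} M M' \<and> intertwines M \<gamma> (rot1 M Dp Dm) (rot1 M' Dp' Dm') \<and> intertwines M \<gamma> (rot2 M Dp Dm) (rot2 M' Dp' Dm')" for \<gamma>
    unfolding vsa_op_hom_iff intertwines_lift using L[of \<gamma>] z[of \<gamma>] by blast
  moreover have "\<gamma> \<in> vsa_op_hom {} (M, Dp, Dm) (M', Dp', Dm') \<longleftrightarrow>
    \<gamma> \<in> vsa_hom {} M M' \<and> intertwines M \<gamma> (rot1 M Dp Dm) (rot1 M' Dp' Dm') \<and> intertwines M \<gamma> (rot2 M Dp Dm) (rot2 M' Dp' Dm')" for \<gamma>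
    unfolding vsa_op_hom_iff using intertwines_rot[OF assms, of \<gamma>] by blast
  ultimately show ?thesis by blast
qed

section \<open>Object bijections onto the setting without odd variables\<close>

definition to_pm :: "'v::ab_group_add vsa \<times> ('v \<Rightarrow> 'v) \<times> ('v \<Rightarrow> 'v) \<Rightarrow> 'v vsa" where
  "to_pm = (\<lambda>(M, Dp, Dm). lift g_pm Dp Dm M)"

definition from_pm :: "'v::ab_group_add vsa \<Rightarrow> 'v vsa \<times> ('v \<Rightarrow> 'v) \<times> ('v \<Rightarrow> 'v)" where
  "from_pm M = (forget M, dop M 0, dop M 1)"

definition to_12 :: "'v::ab_group_add vsa \<times> ('v \<Rightarrow> 'v) \<times> ('v \<Rightarrow> 'v) \<Rightarrow> 'v vsa" where
  "to_12 = (\<lambda>(M, Dp, Dm). lift g_12 (rot1 M Dp Dm) (rot2 M Dp Dm) M)"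

definition from_12 :: "'v::ab_group_add vsa \<Rightarrow> 'v vsa \<times> ('v \<Rightarrow> 'v) \<times> ('v \<Rightarrow> 'v)" where
  "from_12 M = (forget M, rotp M (dop M 0) (dop M 1), rotm M (dop M 0) (dop M 1))"

definition to_1 :: "'v::ab_group_add vsa \<times> ('v \<Rightarrow> 'v) \<times> ('v \<Rightarrow> 'v) \<Rightarrow> 'v vsa \<times> ('v \<Rightarrow> 'v) \<times> ('v \<Rightarrow> 'v)" where
  "to_1 = (\<lambda>(M, Dp, Dm). (lift g_1 (rot1 M Dp Dm) zero_op M, rot1 M Dp Dm, rot2 M Dp Dm))"

definition from_1 :: "'v::ab_group_add vsa \<times> ('v \<Rightarrow> 'v) \<times> ('v \<Rightarrow> 'v) \<Rightarrow> 'v vsa \<times> ('v \<Rightarrow> 'v) \<times> ('v \<Rightarrow> 'v)" where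
  "from_1 = (\<lambda>(M, D1, D2). (forget M, rotp M D1 D2, rotm M D1 D2))"

lemma rot_cong: "cs M = cs M' \<Longrightarrow> rotp M = rotp M'" "cs M = cs M' \<Longrightarrow> rotm M = rotm M'"
  "cs M = cs M' \<Longrightarrow> rot1 M = rot1 M'" "cs M = cs M' \<Longrightarrow> rot2 M = rot2 M'"
  unfolding rot_defs lc_def[abs_def] by simp_all

lemma rot_forget [simp]: "rotp (forget M) = rotp M" "rotm (forget M) = rotm M"
  "rot1 (forget M) = rot1 M" "rot2 (forget M) = rot2 M"
  by (rule rot_cong, simp)+

lemma rot_lift [simp]: "rotp (lift g A B M) = rotp M" "rotm (lift g A B M) = rotm M"
  "rot1 (lift g A B M) = rot1 M" "rot2 (lift g A B M) = rot2 M"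
  by (rule rot_cong, simp)+

lemma pm_objects:
  "is_vsa_0 A \<Longrightarrow> is_vsa_pm (to_pm A)" "is_vsa_0 A \<Longrightarrow> from_pm (to_pm A) = A"
  "is_vsa_pm M \<Longrightarrow> is_vsa_0 (from_pm M)" "is_vsa_pm M \<Longrightarrow> to_pm (from_pm M) = M"
proof -
  obtain N Dp Dm where A: "A = (N, Dp, Dm)" by (metis prod_cases3)
  {
    assume "is_vsa_0 A"
    note L = is_vsa_0_lift[OF this[unfolded A]]
    show "is_vsa_pm (to_pm A)" "from_pm (to_pm A) = A"
      unfolding A to_pm_def from_pm_def prod.case L(2-4) using L(1) by simp_all
  }
  assume "is_vsa_pm M"
  note F = is_vsa_pm_forget[OF this]
  show "is_vsa_0 (from_pm M)" "to_pm (from_pm M) = M"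
    unfolding to_pm_def from_pm_def prod.case using F by simp_all
qed

lemma objects_12:
  "is_vsa_0 A \<Longrightarrow> is_vsa_12 (to_12 A)" "is_vsa_0 A \<Longrightarrow> from_12 (to_12 A) = A"
  "is_vsa_12 M \<Longrightarrow> is_vsa_0 (from_12 M)" "is_vsa_12 M \<Longrightarrow> to_12 (from_12 M) = M"
proof -
  obtain N Dp Dm where A: "A = (N, Dp, Dm)" by (metis prod_cases3)
  {
    assume "is_vsa_0 A"
    note R = rot_objects[OF this[unfolded A]]
    note L = is_base_12_lift[OF R(1)]
    show "is_vsa_12 (to_12 A)" "from_12 (to_12 A) = A"
      unfolding A to_12_def from_12_def prod.case L(2-4) rot_lift R(2,3) using L(1) by simp_all
  }
  assume "is_vsa_12 M"
  note F = is_vsa_12_forget[OF this]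
  note R = rot_objects_inverse[OF F(1), unfolded rot_forget]
  show "is_vsa_0 (from_12 M)" "to_12 (from_12 M) = M"
    unfolding to_12_def from_12_def prod.case rot_forget R(2,3) using F(2) R(1) by simp_all
qed

lemma objects_1:
  "is_vsa_0 A \<Longrightarrow> is_vsa_1 (to_1 A)" "is_vsa_0 A \<Longrightarrow> from_1 (to_1 A) = A"
  "is_vsa_1 B \<Longrightarrow> is_vsa_0 (from_1 B)" "is_vsa_1 B \<Longrightarrow> to_1 (from_1 B) = B"
proof -
  obtain N Dp Dm where A: "A = (N, Dp, Dm)" by (metis prod_cases3)
  obtain M D1 D2 where B: "B = (M, D1, D2)" by (metis prod_cases3)
  {
    assume "is_vsa_0 A"
    note R = rot_objects[OF this[unfolded A]]
    note L = is_base_12_lift_1[OF R(1)]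
    show "is_vsa_1 (to_1 A)" "from_1 (to_1 A) = A"
      unfolding A to_1_def from_1_def prod.case L(2) rot_lift R(2,3) using L(1) by simp_all
  }
  assume "is_vsa_1 B"
  note F = is_vsa_1_forget[OF this[unfolded B]]
  note R = rot_objects_inverse[OF F(1), unfolded rot_forget]
  show "is_vsa_0 (from_1 B)" "to_1 (from_1 B) = B"
    unfolding B to_1_def from_1_def prod.case rot_forget R(2,3) using F(2) R(1) by simp_all
qed

lemma iso_VSA_pm: "isomorphic_cats (VSA_0 TYPE('v::ab_group_add)) (VSA_pm TYPE('v))"
  unfolding VSA_pm_def VSA_0_def
proof (rule concrete_iso[where F = to_pm and G = from_pm])
  show "is_category (concrete_cat is_vsa_0 (\<lambda>(M :: 'v vsa, _). carr (ext_scalars M)) (vsa_op_hom {}))"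
    using is_category_VSA_0 unfolding VSA_0_def .
  fix A B :: "'v vsa \<times> ('v \<Rightarrow> 'v) \<times> ('v \<Rightarrow> 'v)"
  show "carr (ext_scalars (to_pm A)) = (case A of (M, _) \<Rightarrow> carr (ext_scalars M))"
    by (cases A) (simp add: to_pm_def)
  show "vsa_hom {0, 1} (to_pm A) (to_pm B) = vsa_op_hom {} A B" if "is_vsa_0 A" "is_vsa_0 B"
  proof -
    obtain M Dp Dm M' Dp' Dm' where e: "A = (M, Dp, Dm)" "B = (M', Dp', Dm')" by (metis prod_cases3)
    show ?thesis unfolding e to_pm_def prod.case by (rule hom_pm) (use that e in simp_all)
  qed
qed (rule pm_objects; assumption)+

lemma iso_VSA_12: "isomorphic_cats (VSA_0 TYPE('v::ab_group_add)) (VSA_12 TYPE('v))"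
  unfolding VSA_12_def VSA_0_def
proof (rule concrete_iso[where F = to_12 and G = from_12])
  show "is_category (concrete_cat is_vsa_0 (\<lambda>(M :: 'v vsa, _). carr (ext_scalars M)) (vsa_op_hom {}))"
    using is_category_VSA_0 unfolding VSA_0_def .
  fix A B :: "'v vsa \<times> ('v \<Rightarrow> 'v) \<times> ('v \<Rightarrow> 'v)"
  show "carr (ext_scalars (to_12 A)) = (case A of (M, _) \<Rightarrow> carr (ext_scalars M))"
    by (cases A) (simp add: to_12_def)
  show "vsa_hom {0, 1} (to_12 A) (to_12 B) = vsa_op_hom {} A B" if "is_vsa_0 A" "is_vsa_0 B"
  proof -
    obtain M Dp Dm M' Dp' Dm' where e: "A = (M, Dp, Dm)" "B = (M', Dp', Dm')" by (metis prod_cases3)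
    show ?thesis unfolding e to_12_def prod.case by (rule hom_12) (use that e in simp_all)
  qed
qed (rule objects_12; assumption)+

lemma iso_VSA_1: "isomorphic_cats (VSA_0 TYPE('v::ab_group_add)) (VSA_1 TYPE('v))"
  unfolding VSA_1_def VSA_0_def
proof (rule concrete_iso[where F = to_1 and G = from_1])
  show "is_category (concrete_cat is_vsa_0 (\<lambda>(M :: 'v vsa, _). carr (ext_scalars M)) (vsa_op_hom {}))"
    using is_category_VSA_0 unfolding VSA_0_def .
  fix A B :: "'v vsa \<times> ('v \<Rightarrow> 'v) \<times> ('v \<Rightarrow> 'v)"
  show "(case to_1 A of (M, _) \<Rightarrow> carr (ext_scalars M)) = (case A of (M, _) \<Rightarrow> carr (ext_scalars M))"
    by (cases A) (simp add: to_1_def)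
  show "vsa_op_hom {0} (to_1 A) (to_1 B) = vsa_op_hom {} A B" if "is_vsa_0 A" "is_vsa_0 B"
  proof -
    obtain M Dp Dm M' Dp' Dm' where e: "A = (M, Dp, Dm)" "B = (M', Dp', Dm')" by (metis prod_cases3)
    show ?thesis unfolding e to_1_def prod.case by (rule hom_1) (use that e in simp_all)
  qed
qed (rule objects_1; assumption)+

section \<open>Neveu-Schwarz algebras\<close>

lemma NS_LJ_cong:
  assumes M: "\<And>n v. v \<in> carr M \<Longrightarrow> L n v \<in> carr M" "\<And>n v. v \<in> carr M \<Longrightarrow> J n v \<in> carr M"
    and eq: "\<And>n v. v \<in> carr M \<Longrightarrow> L' n v = L n v" "\<And>n v. v \<in> carr M \<Longrightarrow> J' n v = J n v"
  shows "NS_LJ M c L' J' = NS_LJ M c L J"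
  unfolding NS_LJ_def scomm_def using assms by simp

lemma endo_cong: "(\<And>v. v \<in> carr M \<Longrightarrow> A v = B v) \<Longrightarrow> gmodule M \<Longrightarrow> endo M p A = endo M p B"
proof -
  assume eq: "\<And>v. v \<in> carr M \<Longrightarrow> A v = B v" and "gmodule M"
  interpret gmodule M by fact
  have "a \<in> Lambda (lev M) \<Longrightarrow> v \<in> carr M \<Longrightarrow> A (scal M a v) = B (scal M a v)" for a v
    using eq by simp
  moreover have "v \<in> gr M q \<Longrightarrow> A v = B v" for v q using eq gr_carr by blast
  ultimately show ?thesis unfolding endo_def using eq by simp
qed

lemma NS_pm_cong:
  assumes NS: "NS_pm M c L J Gp Gm" and M: "gmodule M"
    and eq: "\<And>n v. v \<in> carr M \<Longrightarrow> L' n v = L n v" "\<And>n v. v \<in> carr M \<Longrightarrow> J' n v = J n v"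
      "\<And>n v. v \<in> carr M \<Longrightarrow> Gp' n v = Gp n v" "\<And>n v. v \<in> carr M \<Longrightarrow> Gm' n v = Gm n v"
  shows "NS_pm M c L' J' Gp' Gm'"
proof -
  interpret gmodule M by fact
  have e: "endo M 0 (L n)" "endo M 0 (J n)" "endo M 1 (Gp n)" "endo M 1 (Gm n)" for n
    using NS unfolding NS_pm_def by blast+
  note c = e[THEN endoD(1)]
  have e': "endo M 0 (L' n)" "endo M 0 (J' n)" "endo M 1 (Gp' n)" "endo M 1 (Gm' n)" for n
    using e[of n] endo_cong[where A = "L' n" and B = "L n", OF eq(1) M] endo_cong[where A = "J' n" and B = "J n", OF eq(2) M]
      endo_cong[where A = "Gp' n" and B = "Gp n", OF eq(3) M] endo_cong[where A = "Gm' n" and B = "Gm n", OF eq(4) M]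
    by simp_all
  have LJ: "NS_LJ M c L' J'"
    using NS NS_LJ_cong[where L = L and J = J and L' = L' and J' = J' and c = c, OF c(1,2) eq(1,2)]
    unfolding NS_pm_def by simp
  show ?thesis
    unfolding NS_pm_def
  proof (rule conjI, use e' in blast, rule conjI, rule LJ, intro allI ballI, goal_cases)
    case (1 m n v)
    then show ?case
      using NS[unfolded NS_pm_def, THEN conjunct2, THEN conjunct2, THEN spec, THEN spec, THEN bspec, OF 1, of m n]
      by (simp only: scomm_def eq c)
  qed
qed

lemma NS_grading_cong:
  assumes NS: "NS_grading M wt L J"
    and eq: "\<And>n v. v \<in> carr M \<Longrightarrow> L' n v = L n v" "\<And>n v. v \<in> carr M \<Longrightarrow> J' n v = J n v"
  shows "NS_grading M wt L' J'"
proof -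
  have wt: "wt k \<subseteq> carr M" for k using NS unfolding NS_grading_def submod_def by blast
  have "eigenspace M (J' 0) (wt k) = eigenspace M (J 0) (wt k)" for k
    unfolding eigenspace_def using eq(2) wt[of k] by (intro ext Collect_cong) (simp add: subset_iff cong: conj_cong)
  moreover have "v \<in> wt k \<Longrightarrow> L' 0 v = L 0 v \<and> J' 0 v = J 0 v" for v k using eq subsetD[OF wt] by simp
  ultimately show ?thesis
    using NS unfolding NS_grading_def by simp
qed

context gmodule begin

lemma scomm_lc_right:
  assumes X: "endo M p X" and A: "A v \<in> carr M" "A' v \<in> carr M" "A (X v) \<in> carr M" "A' (X v) \<in> carr M"
  shows "scomm p q X (lc M z z' A A') v = cs M z (scomm p q X A v) + cs M z' (scomm p q X A' v)"
  unfolding scomm_def lc_def using A endoD(1,2)[OF X] endo_additive(5)[OF X]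
  by (simp add: cs_diff cs_sg sg_add)

lemma scomm_lc_left:
  assumes X: "endo M q X" and A: "A v \<in> carr M" "A' v \<in> carr M" "A (X v) \<in> carr M" "A' (X v) \<in> carr M"
  shows "scomm p q (lc M z z' A A') X v = cs M z (scomm p q A X v) + cs M z' (scomm p q A' X v)"
  unfolding scomm_def lc_def using A endoD(1,2)[OF X] endo_additive(5)[OF X]
  by (simp add: cs_diff cs_sg sg_add)

lemma scomm_lc_lc:
  assumes "endo M 1 A" "endo M 1 A'" "endo M 1 B" "endo M 1 B'" and v: "v \<in> carr M"
  shows "scomm 1 1 (lc M z z' A A') (lc M y y' B B') v =
    cs M (z * y) (scomm 1 1 A B v) + cs M (z * y') (scomm 1 1 A B' v)
    + (cs M (z' * y) (scomm 1 1 A' B v) + cs M (z' * y') (scomm 1 1 A' B' v))"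
proof -
  note c = assms(1-4)[THEN endoD(1)]
  have [simp]: "scomm 1 1 A B v \<in> carr M" "scomm 1 1 A' B v \<in> carr M" "scomm 1 1 A B' v \<in> carr M" "scomm 1 1 A' B' v \<in> carr M"
    using c v by (simp_all add: scomm_def)
  show ?thesis
    unfolding scomm_lc_left[where A = A and A' = A' and X = "lc M y y' B B'" and v = v,
        OF lc_endo[OF assms(3,4)] c(1)[OF v] c(2)[OF v]
        c(1)[OF endoD(1)[OF lc_endo[OF assms(3,4)] v]] c(2)[OF endoD(1)[OF lc_endo[OF assms(3,4)] v]]]
      scomm_lc_right[where A = B and A' = B' and X = A and v = v, OF assms(1) c(3)[OF v] c(4)[OF v] c(3)[OF c(1)[OF v]] c(4)[OF c(1)[OF v]]]
      scomm_lc_right[where A = B and A' = B' and X = A' and v = v, OF assms(2) c(3)[OF v] c(4)[OF v] c(3)[OF c(2)[OF v]] c(4)[OF c(2)[OF v]]]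
    by (simp add: cs_add cs_cs del: One_nat_def)
qed

lemma half_twice: "2 * (1 / 2) = (1 :: complex)" by simp

lemma cs_sum_pm:
  assumes [simp]: "X \<in> carr M" "K \<in> carr M" "C \<in> carr M"
  shows "cs M z (X + K + C) + cs M z (X - K + C) = cs M (2 * z) (X + C)"
    and "cs M z (X + K + C) + cs M (- z) (X - K + C) = cs M (2 * z) K"
proof -
  have 2: "cs M (2 * z) v = cs M z v + cs M z v" if "v \<in> carr M" for v
    using cs_add_left[OF that, of z z] by (simp only: mult_2)
  show "cs M z (X + K + C) + cs M z (X - K + C) = cs M (2 * z) (X + C)"
    "cs M z (X + K + C) + cs M (- z) (X - K + C) = cs M (2 * z) K"
    by (simp_all add: 2 cs_add cs_diff cs_minus_left)
qed

lemma cs_sum_12: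
  assumes [simp]: "X \<in> carr M" "K \<in> carr M" "C \<in> carr M"
  shows "cs M (1 / 2) (X + C) + cs M (\<i> / 2) (cs M (- \<i>) K)
    + (cs M (- (\<i> / 2)) (- cs M (- \<i>) K) + cs M (1 / 2) (X + C)) = X + K + C"
proof -
  have h: "cs M (1 / 2) v + cs M (1 / 2) v = v" if "v \<in> carr M" for v
    using cs_add_left[OF that, of "1 / 2" "1 / 2"] that by simp
  have "cs M (\<i> / 2) (cs M (- \<i>) K) = cs M (1 / 2) K" "cs M (- (\<i> / 2)) (- cs M (- \<i>) K) = cs M (1 / 2) K"
    by (simp_all add: cs_cs cs_minus cs_minus_left)
  then have "cs M (1 / 2) (X + C) + cs M (\<i> / 2) (cs M (- \<i>) K)
    + (cs M (- (\<i> / 2)) (- cs M (- \<i>) K) + cs M (1 / 2) (X + C)) =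
      (cs M (1 / 2) (X + C) + cs M (1 / 2) (X + C)) + (cs M (1 / 2) K + cs M (1 / 2) K)"
    by (simp only: add_ac)
  also have "\<dots> = X + C + K" by (simp only: h assms carr_add)
  finally show ?thesis by (simp add: add_ac)
qed

lemma scomm_sym: "scomm 1 1 A B v = scomm 1 1 B A v"
  by (simp add: scomm_def)

end

lemma s_mult: "isq * isq = 1 / 2" "isq * (\<i> * isq) = \<i> / 2" "isq * (- \<i> * isq) = - (\<i> / 2)"
  "\<i> * isq * isq = \<i> / 2" "- \<i> * isq * isq = - (\<i> / 2)" "\<i> * isq * (\<i> * isq) = - (1 / 2)"
  "\<i> * isq * (- \<i> * isq) = 1 / 2" "- \<i> * isq * (\<i> * isq) = 1 / 2" "- \<i> * isq * (- \<i> * isq) = - (1 / 2)"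
proof -
  show s: "isq * isq = 1 / 2" by (rule isq_sq)
  have e: "\<i> * isq * (\<i> * isq) = (\<i> * \<i>) * (isq * isq)" "isq * (\<i> * isq) = \<i> * (isq * isq)" "\<i> * isq * isq = \<i> * (isq * isq)"
    by (simp_all only: mult_ac)
  show 1: "isq * (\<i> * isq) = \<i> / 2" and 2: "\<i> * isq * isq = \<i> / 2" and 3: "\<i> * isq * (\<i> * isq) = - (1 / 2)"
    unfolding e s by simp_all
  show "isq * (- \<i> * isq) = - (\<i> / 2)" using 1 by simp
  show "- \<i> * isq * isq = - (\<i> / 2)" using 2 by simp
  show "\<i> * isq * (- \<i> * isq) = 1 / 2" "- \<i> * isq * (\<i> * isq) = 1 / 2" "- \<i> * isq * (- \<i> * isq) = - (1 / 2)"
    using 3 by simp_all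
qed

text \<open>The same-sign brackets of G^+ and G^- vanish, so only the two mixed ones enter. In
  [G^(j), G^(j)] their J-terms cancel; in [G^(1), G^(2)] the L-terms and central terms do.\<close>

lemma NS_pm_imp_NS_12:
  assumes NS: "NS_pm M c L J Gp Gm" and M: "gmodule M"
  shows "NS_12 M c L J (\<lambda>n. rot1 M (Gp n) (Gm n)) (\<lambda>n. rot2 M (Gp n) (Gm n))"
proof -
  interpret gmodule M by fact
  have e: "endo M 0 (L n)" "endo M 0 (J n)" "endo M 1 (Gp n)" "endo M 1 (Gm n)" for n
    using NS unfolding NS_pm_def by blast+
  note c = e[THEN endoD(1)]
  have R: "scomm 0 1 (L m) (Gp n) v = cs M (of_int m / 2 - of_int n - 1 / 2) (Gp (m + n) v)"
    "scomm 0 1 (L m) (Gm n) v = cs M (of_int m / 2 - of_int n - 1 / 2) (Gm (m + n) v)"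
    "scomm 0 1 (J m) (Gp n) v = Gp (m + n) v" "scomm 0 1 (J m) (Gm n) v = - Gm (m + n) v"
    "scomm 1 1 (Gp m) (Gp n) v = 0" "scomm 1 1 (Gm m) (Gm n) v = 0"
    "scomm 1 1 (Gp m) (Gm (n - 1)) v = cs M 2 (L (m + n) v) + cs M (of_int (m - n + 1)) (J (m + n) v)
         + cs M (if m + n = 0 then of_int (m\<^sup>2 + m) / 3 * c else 0) v"
    if "v \<in> carr M" for m n v
    using NS that unfolding NS_pm_def by blast+
  \<comment> \<open>Supercommutators of odd operators are symmetric. Replacing (m, n) by (n - 1, m +
    1) in the given relation negates m - n + 1 and, where m + n = 0, keeps m^2 + m.\<close>
  have MP: "scomm 1 1 (Gm m) (Gp (n - 1)) v = cs M 2 (L (m + n) v) - cs M (of_int (m - n + 1)) (J (m + n) v)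
         + cs M (if m + n = 0 then of_int (m\<^sup>2 + m) / 3 * c else 0) v" if v: "v \<in> carr M" for m n v
  proof -
    have i: "n - 1 + (m + 1) = m + n" "of_int (n - 1 - (m + 1) + 1) = - (of_int (m - n + 1) :: complex)" by simp_all
    have "(n - 1)\<^sup>2 + (n - 1) = m\<^sup>2 + m" if "m + n = 0"
    proof -
      have "n = - m" using that by simp
      then show ?thesis by (simp add: power2_eq_square algebra_simps)
    qed
    then show ?thesis
      using R(7)[OF v, of "n - 1" "m + 1"] v c(2)[OF v]
      unfolding i add_diff_cancel_right' by (subst scomm_sym) (auto simp: cs_minus_left simp del: of_int_add of_int_diff)
  qed
  show ?thesis
    unfolding NS_12_def
  proof (intro conjI allI ballI)
    fix n
    show "endo M 0 (L n)" "endo M 0 (J n)" by (rule e)+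
    show "endo M 1 (rot1 M (Gp n) (Gm n))" "endo M 1 (rot2 M (Gp n) (Gm n))"
      unfolding rot_defs by (intro lc_endo e)+
  next
    show "NS_LJ M c L J" using NS unfolding NS_pm_def by blast
  next
    fix m n v assume v: "v \<in> carr M"
    note cr = c(3)[OF v] c(4)[OF v] c(3)[OF c(1)[OF v]] c(4)[OF c(1)[OF v]] c(3)[OF c(2)[OF v]] c(4)[OF c(2)[OF v]]
    show "scomm 0 1 (L m) (rot1 M (Gp n) (Gm n)) v = cs M (of_int m / 2 - of_int n - 1 / 2) (rot1 M (Gp (m + n)) (Gm (m + n)) v)"
      "scomm 0 1 (L m) (rot2 M (Gp n) (Gm n)) v = cs M (of_int m / 2 - of_int n - 1 / 2) (rot2 M (Gp (m + n)) (Gm (m + n)) v)"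
      unfolding rot_defs
      by (subst scomm_lc_right[where A = "Gp n" and A' = "Gm n" and X = "L m" and v = v, OF e(1) cr(1-4)],
          simp add: R(1,2)[OF v, simplified] lc_def cr cs_add cs_cs mult.commute)+
    show "scomm 0 1 (J m) (rot1 M (Gp n) (Gm n)) v = cs M (- \<i>) (rot2 M (Gp (m + n)) (Gm (m + n)) v)"
      "scomm 0 1 (J m) (rot2 M (Gp n) (Gm n)) v = cs M \<i> (rot1 M (Gp (m + n)) (Gm (m + n)) v)"
      unfolding rot_defs
      by (subst scomm_lc_right[where A = "Gp n" and A' = "Gm n" and X = "J m" and v = v, OF e(2) cr(1,2,5,6)],
          simp add: R(3,4)[OF v, simplified] lc_def c v cs_add cs_diff cs_cs cs_minus cs_minus_left mult.assoc[symmetric])+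
    let ?X = "cs M 2 (L (m + n) v)" and ?K = "cs M (of_int (m - n + 1)) (J (m + n) v)"
      and ?C = "cs M (if m + n = 0 then of_int (m\<^sup>2 + m) / 3 * c else 0) v"
    have k: "?X \<in> carr M" "?K \<in> carr M" "?C \<in> carr M" using c v by simp_all
    show "scomm 1 1 (rot1 M (Gp m) (Gm m)) (rot1 M (Gp (n - 1)) (Gm (n - 1))) v = ?X + ?C"
      "scomm 1 1 (rot2 M (Gp m) (Gm m)) (rot2 M (Gp (n - 1)) (Gm (n - 1))) v = ?X + ?C"
      unfolding rot_defs scomm_lc_lc[OF e(3,4) e(3,4) v] R(5-7)[OF v] MP[OF v] s_mult
        cs_zero add_0_left add_0_right cs_sum_pm(1)[OF k] by (simp_all only: half_twice cs_1 carr_add k)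
    have "scomm 1 1 (rot1 M (Gp m) (Gm m)) (rot2 M (Gp (n - 1)) (Gm (n - 1))) v = cs M (2 * - (\<i> / 2)) ?K"
      unfolding rot_defs scomm_lc_lc[OF e(3,4) e(3,4) v] R(5-7)[OF v] MP[OF v] s_mult
        cs_zero add_0_left add_0_right using cs_sum_pm(2)[OF k, of "- (\<i> / 2)"] by (simp only: minus_minus)
    then show "scomm 1 1 (rot1 M (Gp m) (Gm m)) (rot2 M (Gp (n - 1)) (Gm (n - 1))) v =
        cs M (- \<i> * of_int (m - n + 1)) (J (m + n) v)"
      by (simp only: cs_cs c v) (simp del: of_int_add of_int_diff)
  qed
qed

text \<open>In the same-sign brackets [G^(1), G^(1)] and [G^(2), G^(2)] enter with coefficients 1/2
  and -1/2 and cancel, as do the mixed brackets, which are opposite after reindexing.\<close>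

lemma NS_12_imp_NS_pm:
  assumes NS: "NS_12 M c L J G1 G2" and M: "gmodule M"
  shows "NS_pm M c L J (\<lambda>n. rotp M (G1 n) (G2 n)) (\<lambda>n. rotm M (G1 n) (G2 n))"
proof -
  interpret gmodule M by fact
  have e: "endo M 0 (L n)" "endo M 0 (J n)" "endo M 1 (G1 n)" "endo M 1 (G2 n)" for n
    using NS unfolding NS_12_def by blast+
  note c = e[THEN endoD(1)]
  have R: "scomm 0 1 (L m) (G1 n) v = cs M (of_int m / 2 - of_int n - 1 / 2) (G1 (m + n) v)"
    "scomm 0 1 (L m) (G2 n) v = cs M (of_int m / 2 - of_int n - 1 / 2) (G2 (m + n) v)"
    "scomm 0 1 (J m) (G1 n) v = cs M (- \<i>) (G2 (m + n) v)" "scomm 0 1 (J m) (G2 n) v = cs M \<i> (G1 (m + n) v)"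
    "scomm 1 1 (G1 m) (G1 (n - 1)) v = cs M 2 (L (m + n) v)
         + cs M (if m + n = 0 then of_int (m\<^sup>2 + m) / 3 * c else 0) v"
    "scomm 1 1 (G2 m) (G2 (n - 1)) v = cs M 2 (L (m + n) v)
         + cs M (if m + n = 0 then of_int (m\<^sup>2 + m) / 3 * c else 0) v"
    "scomm 1 1 (G1 m) (G2 (n - 1)) v = cs M (- \<i> * of_int (m - n + 1)) (J (m + n) v)"
    if "v \<in> carr M" for m n v
    using NS that unfolding NS_12_def by blast+
  have R': "scomm 1 1 (G2 m) (G1 (n - 1)) v = - cs M (- \<i> * of_int (m - n + 1)) (J (m + n) v)" if v: "v \<in> carr M" for m n v
  proof -
    have i: "n - 1 + (m + 1) = m + n" "of_int (n - 1 - (m + 1) + 1) = - (of_int (m - n + 1) :: complex)" by simp_all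
    show ?thesis
      using R(7)[OF v, of "n - 1" "m + 1"] v c(2)[OF v]
      unfolding i add_diff_cancel_right' by (subst scomm_sym) (simp add: cs_minus_left del: of_int_add of_int_diff)
  qed
  show ?thesis
    unfolding NS_pm_def
  proof (intro conjI allI ballI)
    fix n
    show "endo M 0 (L n)" "endo M 0 (J n)" by (rule e)+
    show "endo M 1 (rotp M (G1 n) (G2 n))" "endo M 1 (rotm M (G1 n) (G2 n))"
      unfolding rot_defs by (intro lc_endo e)+
  next
    show "NS_LJ M c L J" using NS unfolding NS_12_def by blast
  next
    fix m n v assume v: "v \<in> carr M"
    note cr = c(3)[OF v] c(4)[OF v] c(3)[OF c(1)[OF v]] c(4)[OF c(1)[OF v]] c(3)[OF c(2)[OF v]] c(4)[OF c(2)[OF v]]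
    show "scomm 0 1 (L m) (rotp M (G1 n) (G2 n)) v = cs M (of_int m / 2 - of_int n - 1 / 2) (rotp M (G1 (m + n)) (G2 (m + n)) v)"
      "scomm 0 1 (L m) (rotm M (G1 n) (G2 n)) v = cs M (of_int m / 2 - of_int n - 1 / 2) (rotm M (G1 (m + n)) (G2 (m + n)) v)"
      unfolding rot_defs
      by (subst scomm_lc_right[where A = "G1 n" and A' = "G2 n" and X = "L m" and v = v, OF e(1) cr(1-4)],
          simp add: R(1,2)[OF v, simplified] lc_def cr cs_add cs_cs mult.commute)+
    show "scomm 0 1 (J m) (rotp M (G1 n) (G2 n)) v = rotp M (G1 (m + n)) (G2 (m + n)) v"
      "scomm 0 1 (J m) (rotm M (G1 n) (G2 n)) v = - rotm M (G1 (m + n)) (G2 (m + n)) v"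
      unfolding rot_defs
      by (subst scomm_lc_right[where A = "G1 n" and A' = "G2 n" and X = "J m" and v = v, OF e(2) cr(1,2,5,6)],
          simp add: R(3,4)[OF v, simplified] lc_def c v cs_add cs_diff cs_cs cs_minus cs_minus_left mult_ac)+
    have Z: "scomm 1 1 (rotp M (G1 m) (G2 m)) (rotp M (G1 (n - 1)) (G2 (n - 1))) v = 0"
      "scomm 1 1 (rotm M (G1 m) (G2 m)) (rotm M (G1 (n - 1)) (G2 (n - 1))) v = 0" for n
      unfolding rot_defs scomm_lc_lc[OF e(3,4) e(3,4) v] R(5-7)[OF v] R'[OF v] s_mult
      using c v by (simp_all only: cs_minus_left cs_minus carr_cs carr_add) simp_all
    show "scomm 1 1 (rotp M (G1 m) (G2 m)) (rotp M (G1 n) (G2 n)) v = 0"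
      "scomm 1 1 (rotm M (G1 m) (G2 m)) (rotm M (G1 n) (G2 n)) v = 0"
      using Z[of "n + 1"] by (simp_all only: add_diff_cancel_right')
    let ?X = "cs M 2 (L (m + n) v)" and ?K = "cs M (of_int (m - n + 1)) (J (m + n) v)"
      and ?C = "cs M (if m + n = 0 then of_int (m\<^sup>2 + m) / 3 * c else 0) v"
    have k: "?X \<in> carr M" "?K \<in> carr M" "?C \<in> carr M" using c v by simp_all
    have K: "cs M (- \<i> * of_int (m - n + 1)) (J (m + n) v) = cs M (- \<i>) ?K" by (rule cs_cs[symmetric]) (rule c(2)[OF v])
    show "scomm 1 1 (rotp M (G1 m) (G2 m)) (rotm M (G1 (n - 1)) (G2 (n - 1))) v = ?X + ?K + ?C"
      unfolding rot_defs scomm_lc_lc[OF e(3,4) e(3,4) v] R(5-7)[OF v] R'[OF v] s_mult K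
      by (rule cs_sum_12[OF k])
  qed
qed

section \<open>The conformal vector\<close>

lemma gbinomial_eq_0: "k < j \<Longrightarrow> (of_int (int k) gchoose j :: complex) = 0"
proof -
  assume "k < j"
  moreover have "(of_int (int k) :: complex) = of_nat k" by simp
  ultimately show ?thesis by (simp only: binomial_gbinomial[symmetric]) simp
qed

text \<open>The commutator formula for u_1, from the coefficient of x_0^{-1} x_1^{-2} x_2^{-n-1}.
  The binomials binom(0, j) leave one term in each product on the left.\<close>

lemma (in vertex_base) mode_1_product:
  assumes u: "u \<in> gr M p" and v: "v \<in> gr M q" and w: "w \<in> carr M"
  shows "Ymode M u 1 {} (Ymode M v n {} w) - sg (p * q) (Ymode M v n {} (Ymode M u 1 {} w)) =
    Ymode M (Ymode M u 0 {} v) (n + 1) {} w + Ymode M (Ymode M u 1 {} v) n {} w"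
proof -
  have z: "(0 gchoose j :: complex) = 0" if "j \<noteq> 0" for j
    using that gbinomial_eq_0[of 0 j] by simp
  have "Jprod1 M (\<lambda>b c _. Ymode M u (- b - 1) {} (Ymode M v (- c - 1) {} w)) (- 1) (- 2) (- n - 1) {} =
      Ymode M u 1 {} (Ymode M v n {} w)"
    unfolding Jprod1_def by (subst Sum_any_single[of 0]) (simp_all add: z)
  moreover have "Jprod2 M (\<lambda>b c _. Ymode M v (- c - 1) {} (Ymode M u (- b - 1) {} w)) (- 1) (- 2) (- n - 1) {} =
      Ymode M v n {} (Ymode M u 1 {} w)"
    unfolding Jprod2_def by (subst Sum_any_single[of 0]) (simp_all add: z)
  moreover have "Jprod3 M (\<lambda>a c _. Ymode M (Ymode M u (- a - 1) {} v) (- c - 1) {} w) (- 1) (- 2) (- n - 1) {} =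
      Ymode M (Ymode M u 0 {} v) (n + 1) {} w + Ymode M (Ymode M u 1 {} v) n {} w"
  proof -
    \<comment> \<open>The values at j = 0 and j = 1 are 1 and -1; with the factor (-1)^j they give
      the two terms on the right.\<close>
    have b: "(complex_of_nat j - 2) gchoose j = 0" if "j \<noteq> 0" "j \<noteq> 1" for j
      using that gbinomial_eq_0[of "j - 2" j] by (simp add: of_nat_diff)
    show ?thesis
      unfolding Jprod3_def
    proof (subst Sum_any.expand_superset[of "{0, 1}"], goal_cases)
      case 2
      show ?case
      proof (rule subsetI, rule ccontr)
        fix j assume j: "j \<notin> {0, 1::nat}" and *: "j \<in> {j. cs M ((of_int (- 2 + int j) gchoose j) * (- 1) ^ j)
            (Ymode M (Ymode M u (- (- 1 - int j) - 1) {} v) (- (- n - 1 + - 2 + 1 + int j) - 1) {} w) \<noteq> 0}"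
        show False using * b[of j] j by simp
      qed
    qed (simp_all add: cs_minus_left add.commute)
  qed
  ultimately show ?thesis
    using borcherds u v w unfolding borcherds_def Jlhs_def by (metis card.empty add_0_right)
qed

text \<open>Decompose v into weight components. Both \<open>L 0 v\<close> computed componentwise and
  the multiple of v are weight decompositions of one vector, so by uniqueness components of other
  weights vanish.\<close>

lemma NS_grading_weight:
  assumes M: "gmodule M" and NS: "NS_grading M wt L J" and L: "endo M 0 (L 0)"
    and v: "v \<in> carr M" "L 0 v = cs M (of_int k / 2) v"
  shows "v \<in> wt k"
proof -
  interpret gmodule M by fact
  have ds: "direct_sum (carr M) wt" and sm: "submod M (wt i)" and wt: "x \<in> wt i \<Longrightarrow> L 0 x = cs M (of_int i / 2) x" for i x
    using NS unfolding NS_grading_def by blast+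
  have wc: "x \<in> carr M" if "x \<in> wt i" for i x using sm[of i] that unfolding submod_def by blast
  have cw: "cs M z x \<in> wt i" if "x \<in> wt i" for z i x using sm[of i] that unfolding submod_def cs_def by simp
  obtain f where f: "\<forall>i. f i \<in> wt i" "finite {i. f i \<noteq> 0}" "v = Sum_any f"
    using ds v(1) unfolding direct_sum_def by blast
  have fc: "f i \<in> carr M" for i using f(1) wc by blast
  let ?S = "{i. f i \<noteq> 0}"
  have sum: "v = sum f ?S" using f(3) by (simp add: Sum_any.expand_set)
  have S: "Sum_any (\<lambda>i. cs M (h i) (f i)) = (\<Sum>i\<in>?S. cs M (h i) (f i))"
    "finite {i. cs M (h i) (f i) \<noteq> 0}" for h
    by (rule Sum_any.expand_superset[OF f(2)], force) (rule finite_subset[OF _ f(2)], force)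
  have Ls: "L 0 (sum f A) = (\<Sum>i\<in>A. L 0 (f i))" for A
    by (induction A rule: infinite_finite_induct)
      (simp_all add: endo_additive(1)[OF L] endoD(2)[OF L] fc)
  have "L 0 v = (\<Sum>i\<in>?S. cs M (of_int i / 2) (f i))"
    unfolding sum Ls using f(1) wt by (intro sum.cong) auto
  moreover have "L 0 v = (\<Sum>i\<in>?S. cs M (of_int k / 2) (f i))"
    unfolding v(2) by (subst sum, rule cs_sum, rule fc)
  moreover have "L 0 v \<in> carr M" using endoD(1)[OF L v(1)] .
  then have "\<exists>!h. (\<forall>i. h i \<in> wt i) \<and> finite {i. h i \<noteq> 0} \<and> L 0 v = Sum_any h"
    using ds unfolding direct_sum_def by blast
  then obtain h where h: "\<And>h'. (\<forall>i. h' i \<in> wt i) \<Longrightarrow> finite {i. h' i \<noteq> 0} \<Longrightarrow> L 0 v = Sum_any h' \<Longrightarrow> h' = h"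
    by (elim ex1E) blast
  ultimately have "(\<lambda>i. cs M (of_int i / 2) (f i)) = h" "(\<lambda>i. cs M (of_int k / 2) (f i)) = h"
    using f(1) cw S by (intro h; simp)+
  then have "(\<lambda>i. cs M (of_int i / 2) (f i)) = (\<lambda>i. cs M (of_int k / 2) (f i))" by simp
  then have "cs M (of_int i / 2) (f i) - cs M (of_int k / 2) (f i) = 0" for i
    by (simp add: fun_eq_iff)
  then have "f i = 0" if "i \<noteq> k" for i
    using that cs_diff_left[OF fc, of "of_int i / 2" "of_int k / 2" i] cs_eq_0_iff[OF fc, of "of_int i / 2 - of_int k / 2" i]
    by auto
  then have "v = f k" unfolding f(3) by (rule Sum_any_single)
  then show ?thesis using f(1) by blast
qed

section \<open>Odd derivatives of lifted operators\<close>

context susy_base begin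

text \<open>For a lift, \<partial>/\<partial>\<phi>^i + \<Sum>_j g_ij \<phi>^j
  \<partial>/\<partial>x acts as D_i on v. The off-diagonal matrix pairs different variables, the
  diagonal one equal variables.\<close>

lemma odd_deriv_lift:
  assumes v: "v \<in> carr M" and S: "S \<subseteq> {0, 1}"
  shows "g = g_pm \<Longrightarrow> odd_deriv 0 1 L v n S w = Ymode L (D0 v) n S w"
    "g = g_pm \<Longrightarrow> odd_deriv 1 0 L v n S w = Ymode L (D1 v) n S w"
    "g = g_12 \<Longrightarrow> odd_deriv 0 0 L v n S w = Ymode L (D0 v) n S w"
    "g = g_12 \<Longrightarrow> odd_deriv 1 1 L v n S w = Ymode L (D1 v) n S w"
proof -
  have i: "inversions {0} {Suc 0} = 0" "inversions {Suc 0} {0} = 1"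
  proof -
    have "{(a, b). a \<in> {0} \<and> b \<in> {Suc 0} \<and> b < a} = {}" by auto
    then show "inversions {0} {Suc 0} = 0" unfolding inversions_def by (metis card.empty)
    have "{(a, b). a \<in> {Suc 0} \<and> b \<in> {0} \<and> b < a} = {(Suc 0, 0)}" by auto
    then show "inversions {Suc 0} {0} = 1" unfolding inversions_def by simp
  qed
  have s: "{0, Suc 0} - {0} = {Suc 0}" "{0, Suc 0} - {Suc 0} = {0}" "insert (Suc 0) {0} = {0, Suc 0}" by auto
  note simps = cs_2 Y_add_left D_linear T_D odd_deriv_def Y_lift i s B_relations v D_square Y_T Y_diff_left Y_minus_left B_def D0_D1
    cs_minus_left Y_cs_left
  {
    assume g: "g = g_pm"
    have gv: "g 0 0 = 0" "g 0 (Suc 0) = 1" "g (Suc 0) (Suc 0) = 0" unfolding g by simp_all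
    show "odd_deriv 0 1 L v n S w = Ymode L (D0 v) n S w"
      by (rule subset_01_cases[OF S]) (simp_all add: simps gv)
    show "odd_deriv 1 0 L v n S w = Ymode L (D1 v) n S w"
      by (rule subset_01_cases[OF S]) (simp_all add: simps gv)
  }
  {
    assume g: "g = g_12"
    have gv: "g 0 0 = 1" "g 0 (Suc 0) = 0" "g (Suc 0) (Suc 0) = 1" unfolding g by simp_all
    show "odd_deriv 0 0 L v n S w = Ymode L (D0 v) n S w"
      by (rule subset_01_cases[OF S]) (simp_all add: simps gv)
    show "odd_deriv 1 1 L v n S w = Ymode L (D1 v) n S w"
      by (rule subset_01_cases[OF S]) (simp_all add: simps gv)
  }
qed

text \<open>By creation the component S = {}, n = -1 on the vacuum determines the vector. So the
  derivative axiom says exactly that the mode G(-1/2) agrees with the derivation.\<close>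

lemma odd_deriv_property_lift:
  assumes D: "\<And>v n S w. v \<in> carr M \<Longrightarrow> S \<subseteq> {0, 1} \<Longrightarrow> odd_deriv i j L v n S w = Ymode L (D v) n S w"
    and c: "\<And>v. v \<in> carr M \<Longrightarrow> G v \<in> carr M" "\<And>v. v \<in> carr M \<Longrightarrow> D v \<in> carr M"
  shows "odd_deriv_property i j L G \<longleftrightarrow> (\<forall>v\<in>carr M. G v = D v)"
proof
  assume "\<forall>v\<in>carr M. G v = D v"
  then show "odd_deriv_property i j L G" using D unfolding odd_deriv_property_def by simp
next
  assume o: "odd_deriv_property i j L G"
  show "\<forall>v\<in>carr M. G v = D v"
  proof
    fix v assume v: "v \<in> carr M"
    then have "odd_deriv i j L v (- 1) {} (vac M) = Ymode L (G v) (- 1) {} (vac M)"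
      using o vac_carr unfolding odd_deriv_property_def by (metis empty_subsetI lift_simps(1))
    then have "Ymode L (D v) (- 1) {} (vac M) = Ymode L (G v) (- 1) {} (vac M)" using D[OF v] by simp
    then show "G v = D v" using c v by (simp add: creation)
  qed
qed

end

text \<open>
  The common form of the four kinds of vertex operator superalgebras: the vertex superalgebra has no
  odd variables, and the distinguished vector is \<open>\<mu>\<close>.
\<close>

definition is_core :: "complex \<Rightarrow>
    ('v::ab_group_add vsa \<times> ('v \<Rightarrow> 'v) \<times> ('v \<Rightarrow> 'v)) \<times> (int \<Rightarrow> 'v set) \<times> 'v \<Rightarrow> bool" where
  "is_core c = (\<lambda>((M, Dp, Dm), wt, \<mu>). is_vsa_0 (M, Dp, Dm) \<and> \<mu> \<in> wt 2 \<inter> Ev M \<and>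
     (let J = (\<lambda>n. Ymode M \<mu> n {});
          Gp = (\<lambda>n v. - Ymode M (Dp \<mu>) (n + 1) {} v);
          Gm = (\<lambda>n. Ymode M (Dm \<mu>) (n + 1) {});
          L = (\<lambda>n v. cs M (- 1 / 2) (Ymode M (Bop g_pm Dp Dm M {0, 1} \<mu>) (n + 1) {} v))
      in NS_pm M c L J Gp Gm \<and> NS_grading M wt L J \<and>
         (\<forall>v\<in>carr M. Gp (- 1) v = Dp v \<and> Gm (- 1) v = Dm v)))"

lemma NS_lift [simp]:
  "NS_pm (lift g A B M) = NS_pm M" "NS_12 (lift g A B M) = NS_12 M" "NS_grading (lift g A B M) = NS_grading M"
  for M :: "'v::ab_group_add vsa"
  by (simp_all add: lift_def)

lemma core_pm:
  assumes "is_vsa_0 A"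
  shows "is_vosa_pm c (to_pm A, wt, \<mu>) \<longleftrightarrow> is_core c (A, wt, \<mu>)"
proof -
  obtain M Dp Dm where A: "A = (M, Dp, Dm)" by (metis prod_cases3)
  interpret susy_base M g_pm Dp Dm using assms is_vsa_0_susy_base unfolding A by blast
  have Y: "Ymode L \<mu> n {} = Ymode M \<mu> n {}" "Ymode L \<mu> n {0} = Ymode M (Dp \<mu>) n {}"
    "Ymode L \<mu> n {1} = Ymode M (Dm \<mu>) n {}" "Ymode L \<mu> n {0, 1} = Ymode M (BS {0, 1} \<mu>) n {}" for n
    by (rule ext, simp only: Y_lift, simp)+
  have o: "odd_deriv_property 0 1 L (\<lambda>v. - Y (Dp \<mu>) n v) \<longleftrightarrow> (\<forall>v\<in>carr M. - Y (Dp \<mu>) n v = Dp v)"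
    "odd_deriv_property 1 0 L (Y (Dm \<mu>) n) \<longleftrightarrow> (\<forall>v\<in>carr M. Y (Dm \<mu>) n v = Dm v)" for n
    by (rule odd_deriv_property_lift, rule odd_deriv_lift; simp)+
  have "is_vsa_pm L" using is_vsa_0_lift assms unfolding A by blast
  then show ?thesis
    using assms unfolding A is_vosa_pm_def is_core_def to_pm_def prod.case Let_def Y o lift_simps(1-13) NS_lift by blast
qed

text \<open>Fixes an even vector \<mu>; the operators below are its modes in the homogeneous
  normalization, with the odd modes rewritten as even modes of Dp \<mu>, Dm \<mu> and B
  \<mu>.\<close>

locale pointed_base = susy_base M g_pm Dp Dm for M :: "'a::ab_group_add vsa" and Dp Dm +
  fixes \<mu> :: 'a
  assumes mu_even: "\<mu> \<in> gr M 0"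
begin

abbreviation "cJ \<equiv> \<lambda>n. Ymode M \<mu> n {}"
abbreviation "cGp \<equiv> \<lambda>n v. - Ymode M (Dp \<mu>) (n + 1) {} v"
abbreviation "cGm \<equiv> \<lambda>n. Ymode M (Dm \<mu>) (n + 1) {}"
abbreviation "cL \<equiv> \<lambda>n v. cs M (- 1 / 2) (Ymode M (BS {0, 1} \<mu>) (n + 1) {} v)"
abbreviation "R1 \<equiv> rot1 M Dp Dm"
abbreviation "R2 \<equiv> rot2 M Dp Dm"

lemma mu_carr [simp]: "\<mu> \<in> carr M"
  using mu_even by (rule gr_carr)

lemma R2_R1: "R2 (R1 \<mu>) = cs M (- \<i>) (B \<mu>)"
proof -
  have i: "\<i> * isq * isq = \<i> / 2" "- \<i> * isq * isq = - (\<i> / 2)" by (rule s_mult)+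
  have h: "cs M (\<i> / 2) (cs M 2 x) = cs M \<i> x" if "x \<in> carr M" for x using that by (simp add: cs_cs)
  have d: "cs M \<i> x = cs M (\<i> / 2) x + cs M (\<i> / 2) x" if "x \<in> carr M" for x
    using cs_add_left[OF that, of "\<i> / 2" "\<i> / 2"] by simp
  have "R2 (R1 \<mu>) = cs M (\<i> / 2) (Dp (Dm \<mu>)) - cs M (\<i> / 2) (Dm (Dp \<mu>))"
    unfolding rot_defs lc_comp[OF D_endo mu_carr] i by (simp add: D_square cs_minus_left)
  also have "\<dots> = cs M \<i> (T \<mu>) - cs M \<i> (Dm (Dp \<mu>))"
    by (simp add: D0_D1 cs_diff h) (simp add: d)
  also have "\<dots> = cs M (- \<i>) (B \<mu>)" by (simp add: B_def cs_diff cs_minus_left)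
  finally show ?thesis .
qed

lemma R1_R1: "R1 (R1 \<mu>) = T \<mu>"
  unfolding rot_defs lc_comp[OF D_endo mu_carr] s_mult
  by (simp add: D_square D0_D1 cs_diff cs_cs)

lemma R1_R2: "R1 (R2 \<mu>) = cs M \<i> (B \<mu>)"
proof -
  have i: "isq * (\<i> * isq) = \<i> / 2" "isq * (- \<i> * isq) = - (\<i> / 2)" by (rule s_mult)+
  have j: "\<i> * isq * isq = \<i> / 2" "- \<i> * isq * isq = - (\<i> / 2)" by (rule s_mult)+
  have "R1 (R2 \<mu>) = - R2 (R1 \<mu>)"
    unfolding rot_defs lc_comp[OF D_endo mu_carr] i j by (simp add: D_square cs_minus_left)
  then show ?thesis by (simp add: R2_R1 cs_minus_left)
qed

text \<open>The nonhomogeneous normalization i G^(2), -i G^(1), 2 i L of the modes of \<mu> amounts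
  to rotating the homogeneous G's, with the same L and J.\<close>

lemma rot_modes:
  "(\<lambda>n v. cs M (1 / \<i>) (Y (R1 \<mu>) (n + 1) v)) = (\<lambda>n. rot2 M (cGp n) (cGm n))"
  "(\<lambda>n v. cs M (- 1 / \<i>) (Y (R2 \<mu>) (n + 1) v)) = (\<lambda>n. rot1 M (cGp n) (cGm n))"
  "(\<lambda>n v. cs M (1 / (2 * \<i>)) (Y (R2 (R1 \<mu>)) (n + 1) v)) = cL"
proof -
  have i: "\<i> * (\<i> * isq) = - isq" by (simp add: mult.assoc[symmetric])
  show "(\<lambda>n v. cs M (1 / \<i>) (Y (R1 \<mu>) (n + 1) v)) = (\<lambda>n. rot2 M (cGp n) (cGm n))"
    "(\<lambda>n v. cs M (- 1 / \<i>) (Y (R2 \<mu>) (n + 1) v)) = (\<lambda>n. rot1 M (cGp n) (cGm n))"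
    unfolding rot_defs lc_def
    by (simp_all add: fun_eq_iff Y_add_left Y_diff_left Y_cs_left cs_add cs_diff cs_cs cs_minus cs_minus_left i)
  have "1 / (2 * \<i>) * - \<i> = - 1 / 2" by (simp add: divide_simps)
  then show "(\<lambda>n v. cs M (1 / (2 * \<i>)) (Y (R2 (R1 \<mu>)) (n + 1) v)) = cL"
    unfolding R2_R1 Y_cs_left[OF B_carr[OF mu_carr]] cs_cs[OF Y_carr] by simp
qed

lemma rot_modes_inverse:
  "(\<lambda>n. rotp M (rot1 M (cGp n) (cGm n)) (rot2 M (cGp n) (cGm n))) = cGp"
  "(\<lambda>n. rotm M (rot1 M (cGp n) (cGm n)) (rot2 M (cGp n) (cGm n))) = cGm"
  by (intro ext, rule rot_rot, simp, simp)+

lemma NS_12_iff: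
  "NS_12 M c cL cJ (\<lambda>n. rot1 M (cGp n) (cGm n)) (\<lambda>n. rot2 M (cGp n) (cGm n)) \<longleftrightarrow> NS_pm M c cL cJ cGp cGm"
  using NS_12_imp_NS_pm[OF _ gmodule_axioms, where L = cL and J = cJ and c = c and
      ?G1.0 = "\<lambda>n. rot1 M (cGp n) (cGm n)" and ?G2.0 = "\<lambda>n. rot2 M (cGp n) (cGm n)"]
    NS_pm_imp_NS_12[OF _ gmodule_axioms, where L = cL and J = cJ and c = c and Gp = cGp and Gm = cGm]
  unfolding rot_modes_inverse by blast

lemma rot_iff:
  "(\<forall>v\<in>carr M. rot1 M (cGp n) (cGm n) v = R1 v \<and> rot2 M (cGp n) (cGm n) v = R2 v) \<longleftrightarrow>
    (\<forall>v\<in>carr M. cGp n v = Dp v \<and> cGm n v = Dm v)" (is "?l \<longleftrightarrow> ?r")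
proof
  assume ?r then show ?l by (simp add: rot_defs lc_def)
next
  assume l: ?l
  show ?r
  proof
    fix v assume v: "v \<in> carr M"
    have e: "rot1 M (cGp n) (cGm n) v = R1 v" "rot2 M (cGp n) (cGm n) v = R2 v" using l v by blast+
    have "cGp n v = rotp M (rot1 M (cGp n) (cGm n)) (rot2 M (cGp n) (cGm n)) v"
      "cGm n v = rotm M (rot1 M (cGp n) (cGm n)) (rot2 M (cGp n) (cGm n)) v"
      by (rule rot_rot[symmetric]; simp)+
    moreover have "Dp v = rotp M R1 R2 v" "Dm v = rotm M R1 R2 v"
      by (rule rot_rot[symmetric]; simp)+
    ultimately show "cGp n v = Dp v \<and> cGm n v = Dm v"
      using e unfolding rotp_def rotm_def lc_def by simp
  qed
qed

end

lemma core_12: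
  assumes "is_vsa_0 A"
  shows "is_vosa_12 c (to_12 A, wt, \<mu>) \<longleftrightarrow> is_core c (A, wt, \<mu>)"
proof -
  obtain M Dp Dm where A: "A = (M, Dp, Dm)" by (metis prod_cases3)
  interpret P: susy_base M g_pm Dp Dm using assms is_vsa_0_susy_base unfolding A by blast
  let ?R1 = "rot1 M Dp Dm" and ?R2 = "rot2 M Dp Dm"
  have b: "is_base_12 (M, ?R1, ?R2)" by (rule rot_objects) (use assms A in simp)
  interpret R: susy_base M g_12 ?R1 ?R2 using b by (rule is_base_12_susy_base)
  have "is_vsa_12 R.L" using is_base_12_lift(1)[OF b] .
  moreover have "is_vosa_12 c (R.L, wt, \<mu>) \<longleftrightarrow> is_core c (A, wt, \<mu>)" if v: "is_vsa_12 R.L" and e: "\<mu> \<in> Ev M"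
  proof -
    interpret pointed_base M Dp Dm \<mu> by unfold_locales (use e in \<open>simp add: gr_def\<close>)
    have B: "R.B \<mu> = R2 (R1 \<mu>)" by (simp add: R.B_def)
    have Y: "Ymode R.L \<mu> n {} = Ymode M \<mu> n {}" "Ymode R.L \<mu> n {0} = Ymode M (R1 \<mu>) n {}"
      "Ymode R.L \<mu> n {1} = Ymode M (R2 \<mu>) n {}" "Ymode R.L \<mu> n {0, 1} = Ymode M (R2 (R1 \<mu>)) n {}" for n
      unfolding B[symmetric] by (rule ext, simp only: R.Y_lift, simp)+
    have o: "odd_deriv_property 0 0 R.L (rot1 M (cGp n) (cGm n)) \<longleftrightarrow> (\<forall>v\<in>carr M. rot1 M (cGp n) (cGm n) v = R1 v)"
      "odd_deriv_property 1 1 R.L (rot2 M (cGp n) (cGm n)) \<longleftrightarrow> (\<forall>v\<in>carr M. rot2 M (cGp n) (cGm n) v = R2 v)" for n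
      by (rule R.odd_deriv_property_lift, rule R.odd_deriv_lift; simp add: rot_defs lc_def)+
    have rm: "(\<lambda>v. cs M (1 / \<i>) (P.Y (R1 \<mu>) (n + 1) v)) = rot2 M (cGp n) (cGm n)"
      "(\<lambda>v. cs M (- 1 / \<i>) (P.Y (R2 \<mu>) (n + 1) v)) = rot1 M (cGp n) (cGm n)" for n
      using fun_cong[OF rot_modes(1), of n] fun_cong[OF rot_modes(2), of n] by blast+
    have "is_vosa_12 c (R.L, wt, \<mu>) \<longleftrightarrow> \<mu> \<in> wt 2 \<inter> Ev M \<and>
        NS_12 M c cL cJ (\<lambda>n. rot1 M (cGp n) (cGm n)) (\<lambda>n. rot2 M (cGp n) (cGm n)) \<and> NS_grading M wt cL cJ \<and>
        (\<forall>v\<in>carr M. rot1 M (cGp (- 1)) (cGm (- 1)) v = R1 v \<and> rot2 M (cGp (- 1)) (cGm (- 1)) v = R2 v)"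
      using v unfolding is_vosa_12_def prod.case Let_def Y lift_simps(1-13) NS_lift rot_modes rm o by blast
    then show ?thesis
      using assms unfolding NS_12_iff rot_iff A is_core_def prod.case Let_def by blast
  qed
  \<comment> \<open>Discharges the evenness of \<mu> under which the equivalence was obtained: each
    side implies it.\<close>
  moreover have "is_vosa_12 c (R.L, wt, \<mu>) \<Longrightarrow> \<mu> \<in> Ev M" "is_core c (A, wt, \<mu>) \<Longrightarrow> \<mu> \<in> Ev M"
    unfolding is_vosa_12_def is_core_def A prod.case lift_simps(1-13) by blast+
  ultimately show ?thesis unfolding A to_12_def prod.case by blast
qed

text \<open>Brackets in which one factor is G(-1/2) or G(1/2): the central coefficient m^2 + m
  vanishes at m = -1 and m = 0, and in the last bracket it could only occur at s = 0.\<close>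

lemma NS_pm_mode_0:
  assumes NS: "NS_pm M c L J Gp Gm" and M: "gmodule M" and v: "v \<in> carr M"
  shows "scomm 1 1 (Gp (- 1)) (Gm s) v = cs M 2 (L s v) + cs M (of_int (- 1 - s)) (J s v)"
    and "scomm 1 1 (Gp 0) (Gm (s - 1)) v = cs M 2 (L s v) + cs M (of_int (1 - s)) (J s v)"
    and "scomm 1 1 (Gm (- 1)) (Gp s) v = cs M 2 (L s v) + cs M (of_int (s + 1)) (J s v)"
proof -
  interpret gmodule M by fact
  have G: "scomm 1 1 (Gp m) (Gm (n - 1)) v = cs M 2 (L (m + n) v) + cs M (of_int (m - n + 1)) (J (m + n) v)
         + cs M (if m + n = 0 then of_int (m\<^sup>2 + m) / 3 * c else 0) v" for m n
    using NS v unfolding NS_pm_def by blast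
  have i: "- 1 + (s + 1) = s" "- 1 - (s + 1) + 1 = - 1 - s" "0 + s = s" "0 - s + 1 = 1 - s" "s + 0 = s" "s - 0 + 1 = s + 1"
    "(- 1)\<^sup>2 + - 1 = (0 :: int)" "0\<^sup>2 = (0 :: int)" by simp_all
  have 0: "(if P then of_int 0 / 3 * c else 0) = (0 :: complex)" for P by simp
  show "scomm 1 1 (Gp (- 1)) (Gm s) v = cs M 2 (L s v) + cs M (of_int (- 1 - s)) (J s v)"
    using G[of "- 1" "s + 1"] unfolding i add_diff_cancel_right' 0 cs_0[OF v] add_0_right .
  show "scomm 1 1 (Gp 0) (Gm (s - 1)) v = cs M 2 (L s v) + cs M (of_int (1 - s)) (J s v)"
    using G[of 0 s] unfolding i 0 cs_0[OF v] add_0_right .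
  have "(if s = 0 then of_int (s\<^sup>2 + s) / 3 * c else 0) = (0 :: complex)" by simp
  then show "scomm 1 1 (Gm (- 1)) (Gp s) v = cs M 2 (L s v) + cs M (of_int (s + 1)) (J s v)"
    using G[of s 0] cs_0[OF v] unfolding i diff_0 by (subst scomm_sym) (simp only: add_0_right)
qed

section \<open>Recovering \<mu> and all Neveu-Schwarz modes from \<tau>^(+) and \<tau>^(-)\<close>

locale tau_base = susy_base M g_pm Dp Dm for M :: "'a::ab_group_add vsa" and Dp Dm +
  fixes tp tm :: 'a and c :: complex and J L Gp Gm
  assumes tau_odd: "tp \<in> gr M 1" "tm \<in> gr M 1"
    and NS: "NS_pm M c L J Gp Gm"
    and Gp: "v \<in> carr M \<Longrightarrow> Ymode M tp (n + 1) {} v = Gp n v"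
    and Gm: "v \<in> carr M \<Longrightarrow> Ymode M tm (n + 1) {} v = Gm n v"
    and Gp_D: "v \<in> carr M \<Longrightarrow> Gp (- 1) v = Dp v"
    and Gm_D: "v \<in> carr M \<Longrightarrow> Gm (- 1) v = Dm v"
begin

lemma tau_carr [simp]: "tp \<in> carr M" "tm \<in> carr M"
  using tau_odd gr_carr by blast+

lemma NS_endo: "endo M 0 (L n)" "endo M 0 (J n)" "endo M 1 (Gp n)" "endo M 1 (Gm n)"
  using NS unfolding NS_pm_def by blast+

lemmas NS_carr [simp] = NS_endo[THEN endoD(1)]

definition mu where "mu = cs M (1 / 2) (Y tp 1 tm)"

text \<open>As D^+ and D^- are the modes G(-1/2), the derivation rule expresses these fields as
  brackets of G^+ with G^-.\<close>

lemma Y_D_tau: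
  assumes w: "w \<in> carr M"
  shows "Y (Dp tm) (s + 1) w = cs M 2 (L s w) + cs M (of_int (- 1 - s)) (J s w)"
    and "Y (Dm tp) (s + 1) w = cs M 2 (L s w) + cs M (of_int (s + 1)) (J s w)"
proof -
  have "Y (Dp tm) (s + 1) w = scomm 1 1 (Gp (- 1)) (Gm s) w" "Y (Dm tp) (s + 1) w = scomm 1 1 (Gm (- 1)) (Gp s) w"
    using D_derivation(1)[OF tau_odd(2) w, of "s + 1"] D_derivation(2)[OF tau_odd(1) w, of "s + 1"] w
    by (simp_all add: scomm_def Gp Gm Gp_D Gm_D del: One_nat_def)
  then show "Y (Dp tm) (s + 1) w = cs M 2 (L s w) + cs M (of_int (- 1 - s)) (J s w)"
    "Y (Dm tp) (s + 1) w = cs M 2 (L s w) + cs M (of_int (s + 1)) (J s w)"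
    by (simp_all only: NS_pm_mode_0[OF NS gmodule_axioms w])
qed

lemma mu_even: "mu \<in> gr M 0"
proof -
  have "Y tp 1 tm \<in> gr M (1 + card ({} :: nat set) + 1)" by (rule Y_parity[OF tau_odd])
  then show ?thesis unfolding mu_def by (intro gr_cs) (simp add: gr_def)
qed

sublocale pointed_base M Dp Dm mu
  by unfold_locales (rule mu_even)

text \<open>The factor \<open>1/2\<close> in \<open>\<mu>\<close> comes from \<open>[G\<^sup>+(1/2), G\<^sup>-(s - 1/2)] - [G\<^sup>+(-1/2), G\<^sup>-(s + 1/2)] = 2 J(s)\<close>.\<close>

lemma Y_mu:
  assumes w: "w \<in> carr M"
  shows "Y mu s w = J s w"
proof -
  have t0: "Y tp 0 tm = Dp tm" using Gp[of tm "- 1"] Gp_D by simp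
  have "Y tp 1 (Y tm s w) - sg (1 * 1) (Y tm s (Y tp 1 w)) = scomm 1 1 (Gp 0) (Gm (s - 1)) w"
    using Gp[of _ 0] Gm[of _ "s - 1"] w by (simp add: scomm_def)
  also have "\<dots> = cs M 2 (L s w) + cs M (of_int (1 - s)) (J s w)"
    by (rule NS_pm_mode_0[OF NS gmodule_axioms w])
  finally have "cs M 2 (L s w) + cs M (of_int (1 - s)) (J s w) =
      cs M 2 (L s w) + cs M (of_int (- 1 - s)) (J s w) + Y (Y tp 1 tm) s w"
    using mode_1_product[OF tau_odd w, of s] unfolding t0 Y_D_tau(1)[OF w] by (simp only:)
  then have "Y (Y tp 1 tm) s w = cs M (of_int (1 - s)) (J s w) - cs M (of_int (- 1 - s)) (J s w)"
    by (simp only: add.assoc add_left_cancel) (simp add: algebra_simps)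
  also have "\<dots> = cs M (of_int (1 - s) - of_int (- 1 - s)) (J s w)"
    using w by (simp only: cs_diff_left NS_carr)
  also have "of_int (1 - s) - of_int (- 1 - s) = (2 :: complex)" by simp
  finally show ?thesis
    using w by (simp add: mu_def Y_cs_left cs_cs)
qed

text \<open>The derivation rule turns these modes into [D, J(n + 1)], and [J, G] reproduces G up to
  sign.\<close>

lemma Y_D_mu:
  assumes w: "w \<in> carr M"
  shows "Y (Dp mu) (n + 1) w = - Gp n w" "Y (Dm mu) (n + 1) w = Gm n w"
proof -
  have "scomm 0 1 (J (n + 1)) (Gp (- 1)) w = Gp (n + 1 + - 1) w" "scomm 0 1 (J (n + 1)) (Gm (- 1)) w = - Gm (n + 1 + - 1) w"
    using NS w unfolding NS_pm_def by blast+
  then have s: "J (n + 1) (Dp w) - Dp (J (n + 1) w) = Gp n w" "J (n + 1) (Dm w) - Dm (J (n + 1) w) = - Gm n w"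
    using w by (simp_all add: scomm_def Gp_D Gm_D)
  show "Y (Dp mu) (n + 1) w = - Gp n w" "Y (Dm mu) (n + 1) w = Gm n w"
    using D_derivation[OF mu_even w, of "n + 1"] s w by (simp_all add: Y_mu algebra_simps) (metis minus_minus)
qed

lemma D_mu: "- Dp mu = tp" "Dm mu = tm"
  \<comment> \<open>Index -2 corresponds to the mode -1 on the vacuum, which returns the vector
    itself.\<close>
  using Y_D_mu[OF vac_carr, of "- 2"] Gp[OF vac_carr, of "- 2"] Gm[OF vac_carr, of "- 2"]
  by (simp_all add: creation)

text \<open>Since Dp \<mu> = - \<tau>^(+), B \<mu> = - Dm \<tau>^(+) - T \<mu>; the J-terms of the
  two fields cancel and -2 L remains.\<close>

lemma Y_B_mu:
  assumes w: "w \<in> carr M"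
  shows "Y (B mu) (n + 1) w = cs M (- 2) (L n w)"
proof -
  have "Dp mu = - tp" using D_mu(1) by (metis minus_minus)
  then have "B mu = - Dm tp - T mu" by (simp add: B_def D_linear)
  moreover have "cs M (of_int (- (n + 1))) (J n w) = - cs M (of_int (n + 1)) (J n w)"
    using w by (simp only: of_int_minus cs_minus_left NS_carr)
  ultimately have "Y (B mu) (n + 1) w = - (cs M 2 (L n w) + cs M (of_int (n + 1)) (J n w)) + cs M (of_int (n + 1)) (J n w)"
    using w by (simp only: Y_diff_left Y_minus_left Y_D_tau(2)[OF w] Y_T D_carr carr_minus transl_carr)
      (simp only: add_diff_cancel_right' Y_mu[OF w], simp)
  then show ?thesis using w by (simp add: cs_minus_left)
qed

text \<open>Hence the existentially quantified Neveu-Schwarz operators are determined on V by the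
  distinguished vectors.\<close>

lemma canonical:
  assumes w: "w \<in> carr M"
  shows "cJ n w = J n w" "cGp n w = Gp n w" "cGm n w = Gm n w" "cL n w = L n w"
  using Y_mu[OF w] Y_D_mu[OF w] Y_B_mu[OF w] w by (simp_all add: cs_cs)

lemma NS_canonical: "NS_pm M c cL cJ cGp cGm"
  by (rule NS_pm_cong[OF NS gmodule_axioms]) (rule canonical, assumption)+

text \<open>L(0) is a multiple of the mode (B \<mu>)_1, and nonnegative modes annihilate the vacuum.
  The weights of \<mu> and of the \<tau>'s then follow from brackets with L(0) on the
  vacuum.\<close>

lemma vac_weight: "L 0 (vac M) = 0"
proof -
  have "Y (B mu) (0 + 1) (vac M) = 0" by (rule creation_0) simp
  then show ?thesis using Y_B_mu[OF vac_carr, of 0] by (simp add: cs_eq_0_iff)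
qed

lemma mu_weight: "L 0 mu = cs M (of_int 2 / 2) mu"
proof -
  have "scomm 0 0 (L 0) (J (- 1)) (vac M) = cs M (of_int (- (- 1))) (J (0 + - 1) (vac M))"
    using NS vac_carr unfolding NS_pm_def NS_LJ_def by blast
  moreover have "J (- 1) (vac M) = mu" using Y_mu[OF vac_carr, of "- 1"] by (simp add: creation)
  ultimately show ?thesis by (simp add: scomm_def vac_weight endo_additive(1)[OF NS_endo(2)])
qed

lemma tau_weight: "L 0 tp = cs M (of_int 3 / 2) tp" "L 0 tm = cs M (of_int 3 / 2) tm"
proof -
  have "scomm 0 1 (L 0) (Gp (- 2)) (vac M) = cs M (of_int 0 / 2 - of_int (- 2) - 1 / 2) (Gp (0 + - 2) (vac M))"
    "scomm 0 1 (L 0) (Gm (- 2)) (vac M) = cs M (of_int 0 / 2 - of_int (- 2) - 1 / 2) (Gm (0 + - 2) (vac M))"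
    using NS vac_carr unfolding NS_pm_def by blast+
  moreover have "Gp (- 2) (vac M) = tp" "Gm (- 2) (vac M) = tm"
    using Gp[OF vac_carr, of "- 2"] Gm[OF vac_carr, of "- 2"] by (simp_all add: creation)
  ultimately show "L 0 tp = cs M (of_int 3 / 2) tp" "L 0 tm = cs M (of_int 3 / 2) tm"
    by (simp_all add: scomm_def vac_weight endo_additive(1)[OF NS_endo(3)] endo_additive(1)[OF NS_endo(4)])
qed

end

lemma core_of_0:
  assumes "is_vosa_0 c ((M, Dp, Dm), wt, tp, tm)"
  defines "\<mu> \<equiv> cs M (1 / 2) (Ymode M tp 1 {} tm)"
  shows "is_core c ((M, Dp, Dm), wt, \<mu>)" "- Dp \<mu> = tp" "Dm \<mu> = tm"
proof -
  have v: "is_vsa_0 (M, Dp, Dm)" and t: "tp \<in> Od M" "tm \<in> Od M" using assms(1) unfolding is_vosa_0_def by auto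
  obtain L J Gp Gm where N: "NS_pm M c L J Gp Gm" "NS_grading M wt L J"
    and G: "\<forall>n. \<forall>v\<in>carr M. Ymode M tp (n + 1) {} v = Gp n v \<and> Ymode M tm (n + 1) {} v = Gm n v"
      "\<forall>v\<in>carr M. Gp (- 1) v = Dp v \<and> Gm (- 1) v = Dm v"
    using assms(1) unfolding is_vosa_0_def prod.case by blast
  interpret susy_base M g_pm Dp Dm using v by (rule is_vsa_0_susy_base)
  interpret tau_base M Dp Dm tp tm c J L Gp Gm
    by unfold_locales (use t N G in \<open>simp_all add: gr_def\<close>)
  have mu: "mu = \<mu>" by (simp add: mu_def \<mu>_def)
  show "- Dp \<mu> = tp" "Dm \<mu> = tm" using D_mu unfolding mu .
  have "mu \<in> wt 2"
    by (rule NS_grading_weight[OF gmodule_axioms N(2) NS_endo(1) mu_carr mu_weight])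
  moreover have "NS_grading M wt cL cJ"
    by (rule NS_grading_cong[OF N(2)]) (rule canonical, assumption)+
  moreover have "\<forall>v\<in>carr M. cGp (- 1) v = Dp v \<and> cGm (- 1) v = Dm v"
    using canonical(2,3)[of _ "- 1"] Gp_D Gm_D by simp
  ultimately have "is_core c ((M, Dp, Dm), wt, mu)"
    using v mu_even NS_canonical unfolding is_core_def prod.case Let_def gr_def by simp
  then show "is_core c ((M, Dp, Dm), wt, \<mu>)" unfolding mu .
qed

lemma core_tau:
  assumes "is_core c ((M, Dp, Dm), wt, \<mu>)"
  defines "J \<equiv> \<lambda>n. Ymode M \<mu> n {}" and "L \<equiv> \<lambda>n v. cs M (- 1 / 2) (Ymode M (Bop g_pm Dp Dm M {0, 1} \<mu>) (n + 1) {} v)"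
    and "Gp \<equiv> \<lambda>n v. - Ymode M (Dp \<mu>) (n + 1) {} v" and "Gm \<equiv> \<lambda>n. Ymode M (Dm \<mu>) (n + 1) {}"
  shows "tau_base M Dp Dm (- Dp \<mu>) (Dm \<mu>) c J L Gp Gm" "NS_grading M wt L J" "is_vsa_0 (M, Dp, Dm)"
    "\<mu> \<in> gr M 0"
proof -
  have v: "is_vsa_0 (M, Dp, Dm)" and mu: "\<mu> \<in> gr M 0" and NS: "NS_pm M c L J Gp Gm" "NS_grading M wt L J"
    and G: "\<forall>v\<in>carr M. Gp (- 1) v = Dp v \<and> Gm (- 1) v = Dm v"
    using assms(1) unfolding is_core_def prod.case Let_def J_def L_def Gp_def Gm_def gr_def by auto
  show "NS_grading M wt L J" "is_vsa_0 (M, Dp, Dm)" "\<mu> \<in> gr M 0" by fact+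
  interpret susy_base M g_pm Dp Dm using v by (rule is_vsa_0_susy_base)
  have m: "\<mu> \<in> carr M" using mu by (rule gr_carr)
  have d: "Dp \<mu> \<in> gr M (1 + 0)" "Dm \<mu> \<in> gr M (1 + 0)" by (rule D_parity[OF mu])+
  show "tau_base M Dp Dm (- Dp \<mu>) (Dm \<mu>) c J L Gp Gm"
  proof
    show "- Dp \<mu> \<in> gr M 1" "Dm \<mu> \<in> gr M 1" using d gr_minus[of "Dp \<mu>" 1] by simp_all
    show "NS_pm M c L J Gp Gm" by fact
  qed (use G m in \<open>simp_all add: Gp_def Gm_def Y_minus_left\<close>)
qed

lemma core_to_0:
  assumes "is_core c ((M, Dp, Dm), wt, \<mu>)"
  shows "is_vosa_0 c ((M, Dp, Dm), wt, - Dp \<mu>, Dm \<mu>)"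
    and "cs M (1 / 2) (Ymode M (- Dp \<mu>) 1 {} (Dm \<mu>)) = \<mu>"
proof -
  note C = core_tau[OF assms]
  interpret tau_base M Dp Dm "- Dp \<mu>" "Dm \<mu>" c "\<lambda>n. Ymode M \<mu> n {}"
    "\<lambda>n v. cs M (- 1 / 2) (Ymode M (Bop g_pm Dp Dm M {0, 1} \<mu>) (n + 1) {} v)"
    "\<lambda>n v. - Ymode M (Dp \<mu>) (n + 1) {} v" "\<lambda>n. Ymode M (Dm \<mu>) (n + 1) {}"
    by (rule C(1))
  have m: "\<mu> \<in> carr M" using C(4) by (rule gr_carr)
  have "mu = \<mu>" using Y_mu[OF vac_carr, of "- 1"] m by (simp add: creation)
  then show "cs M (1 / 2) (Ymode M (- Dp \<mu>) 1 {} (Dm \<mu>)) = \<mu>" by (simp add: mu_def)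
  have w: "- Dp \<mu> \<in> wt 3" "Dm \<mu> \<in> wt 3"
    by (rule NS_grading_weight[OF gmodule_axioms C(2) NS_endo(1)], rule tau_carr, rule tau_weight)+
  show "is_vosa_0 c ((M, Dp, Dm), wt, - Dp \<mu>, Dm \<mu>)"
    unfolding is_vosa_0_def prod.case
    apply (intro conjI C(3) IntI w)
      apply (use tau_odd in \<open>simp_all add: gr_def\<close>)[2]
    apply (intro exI conjI, rule NS, rule C(2))
    using Gp Gm Gp_D Gm_D by blast+
qed

section \<open>Vertex operator superalgebras with one odd variable\<close>

lemma NS_forget [simp]:
  "NS_pm (forget M) = NS_pm M" "NS_12 (forget M) = NS_12 M" "NS_grading (forget M) = NS_grading M"
  for M :: "'v::ab_group_add vsa"
  by (simp_all add: forget_def)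

text \<open>The distinguished vectors undergo the same rotation as the operators; as
  \<open>rot1\<close> and \<open>rot2\<close> act on functions, a vector is passed as a constant
  function on \<open>unit\<close>.\<close>

definition to_vosa_1 where
  "to_vosa_1 = (\<lambda>((M :: 'v::ab_group_add vsa, Dp, Dm), wt :: int \<Rightarrow> 'v set, tp, tm).
     (to_1 (M, Dp, Dm), wt, rot1 M (\<lambda>_::unit. tp) (\<lambda>_. tm) (), rot2 M (\<lambda>_::unit. tp) (\<lambda>_. tm) ()))"

definition from_vosa_1 where
  "from_vosa_1 = (\<lambda>((M :: 'v::ab_group_add vsa, D1, D2), wt :: int \<Rightarrow> 'v set, t1, t2).
     (from_1 (M, D1, D2), wt, rotp M (\<lambda>_::unit. t1) (\<lambda>_. t2) (), rotm M (\<lambda>_::unit. t1) (\<lambda>_. t2) ()))"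

lemma (in gmodule) NS_grading_lc:
  assumes "NS_grading M wt L J" "A u \<in> wt k" "A' u \<in> wt k"
  shows "lc M z z' A A' u \<in> wt k"
proof -
  have "submod M (wt k)" using assms(1) unfolding NS_grading_def by blast
  then show ?thesis using assms(2,3) unfolding submod_def subgrp_def lc_def cs_def by simp
qed

lemma (in gmodule) gr_lc: "A u \<in> gr M p \<Longrightarrow> A' u \<in> gr M p \<Longrightarrow> lc M z z' A A' u \<in> gr M p"
  unfolding lc_def by (intro gr_add gr_cs)

lemma (in prevertex) Y_lc_left:
  assumes "A u \<in> carr M" "A' u \<in> carr M"
  shows "Ymode M (lc M z z' A A' u) n S w = lc M z z' (\<lambda>w. Ymode M (A u) n S w) (\<lambda>w. Ymode M (A' u) n S w) w"
  using assms by (simp add: lc_def Y_add_left Y_cs_left)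

lemma (in tau_base) rot_tau:
  "rot1 M (\<lambda>_. tp) (\<lambda>_. tm) u = cs M \<i> (R2 mu)" "rot2 M (\<lambda>_. tp) (\<lambda>_. tm) u = cs M (- \<i>) (R1 mu)"
proof -
  have D: "Dp mu = - tp" "Dm mu = tm" using D_mu by (metis minus_minus)+
  have i: "\<i> * (\<i> * isq) = - isq" by (simp add: mult.assoc[symmetric])
  show "rot1 M (\<lambda>_. tp) (\<lambda>_. tm) u = cs M \<i> (R2 mu)" "rot2 M (\<lambda>_. tp) (\<lambda>_. tm) u = cs M (- \<i>) (R1 mu)"
    by (simp_all add: rot_defs lc_def D cs_add cs_diff cs_cs cs_minus cs_minus_left i)
qed

text \<open>The \<phi>-modes of \<tau>^1, \<tau>^2 in the lift are modes of D^(1) \<tau>^1 and D^(1)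
  \<tau>^2. These vectors are - B \<mu> and - i T \<mu>, whose fields carry 2 L(n) and i (n + 1)
  J(n).\<close>

lemma vosa_1_of_0:
  assumes "is_vosa_0 c ((M, Dp, Dm), wt, tp, tm)"
  shows "is_vosa_1 c (to_vosa_1 ((M, Dp, Dm), wt, tp, tm))"
proof -
  have v: "is_vsa_0 (M, Dp, Dm)" and t: "tp \<in> Od M" "tm \<in> Od M" "tp \<in> wt 3" "tm \<in> wt 3"
    using assms unfolding is_vosa_0_def by auto
  obtain L J Gp Gm where N: "NS_pm M c L J Gp Gm" "NS_grading M wt L J"
    and G: "\<forall>n. \<forall>v\<in>carr M. Ymode M tp (n + 1) {} v = Gp n v \<and> Ymode M tm (n + 1) {} v = Gm n v"
      "\<forall>v\<in>carr M. Gp (- 1) v = Dp v \<and> Gm (- 1) v = Dm v"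
    using assms unfolding is_vosa_0_def prod.case by blast
  interpret susy_base M g_pm Dp Dm using v by (rule is_vsa_0_susy_base)
  interpret tau_base M Dp Dm tp tm c J L Gp Gm
    by unfold_locales (use t N G in \<open>simp_all add: gr_def\<close>)
  let ?t1 = "rot1 M (\<lambda>_::unit. tp) (\<lambda>_. tm) ()" and ?t2 = "rot2 M (\<lambda>_::unit. tp) (\<lambda>_. tm) ()"
  let ?L = "lift g_1 R1 zero_op M"
  have "is_vsa_1 (?L, R1, R2)" using objects_1(1)[OF v] by (simp add: to_1_def)
  moreover have "?t1 \<in> wt 3" "?t2 \<in> wt 3"
    unfolding rot_defs by (rule NS_grading_lc[OF N(2)]; rule t)+
  moreover have "?t1 \<in> gr M 1" "?t2 \<in> gr M 1"
    unfolding rot_defs by (rule gr_lc; rule tau_odd)+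
  then have "?t1 \<in> Od M" "?t2 \<in> Od M" by (simp_all add: gr_def)
  moreover have "NS_12 M c L J (\<lambda>n. rot1 M (Gp n) (Gm n)) (\<lambda>n. rot2 M (Gp n) (Gm n))"
    by (rule NS_pm_imp_NS_12[OF N(1) gmodule_axioms])
  moreover have "Y ?t1 (n + 1) v = rot1 M (Gp n) (Gm n) v \<and> Y (R1 ?t1) (n + 1) v = cs M 2 (L n v) \<and>
      Y ?t2 (n + 1) v = rot2 M (Gp n) (Gm n) v \<and> Y (R1 ?t2) (n + 1) v = cs M (\<i> * of_int (n + 1)) (J n v)"
    if v: "v \<in> carr M" for n v
  proof (intro conjI)
    show "Y ?t1 (n + 1) v = rot1 M (Gp n) (Gm n) v" "Y ?t2 (n + 1) v = rot2 M (Gp n) (Gm n) v"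
      using v tau_base_axioms unfolding rot_defs by (simp_all add: Y_lc_left) (simp_all add: lc_def tau_base.Gp tau_base.Gm)
    have z: "- (\<i> * (- complex_of_int n - 1)) = \<i> * (of_int n + 1)" by (simp add: algebra_simps)
    have e: "endo M 1 R1" unfolding rot_defs by (rule lc_endo[OF D_endo])
    have c: "R1 mu \<in> carr M" "R2 mu \<in> carr M" by (simp_all add: rot_defs lc_def)
    have "R1 ?t1 = cs M \<i> (cs M \<i> (B mu))" "R1 ?t2 = cs M (- \<i>) (T mu)"
      unfolding rot_tau by (simp_all only: endo_additive(5)[OF e] c R1_R2 R1_R1)
    then show "Y (R1 ?t1) (n + 1) v = cs M 2 (L n v)" "Y (R1 ?t2) (n + 1) v = cs M (\<i> * of_int (n + 1)) (J n v)"
      using v by (simp_all add: Y_cs_left cs_cs Y_B_mu Y_mu Y_T z)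
  qed
  moreover have "rot1 M (Gp (- 1)) (Gm (- 1)) v = R1 v \<and> rot2 M (Gp (- 1)) (Gm (- 1)) v = R2 v" if "v \<in> carr M" for v
    using G(2) that by (simp add: rot_defs lc_def)
  ultimately show ?thesis
    using N(2) unfolding to_vosa_1_def to_1_def is_vosa_1_def prod.case
    by (intro conjI exI[of _ L] exI[of _ J] exI[of _ "\<lambda>n. rot1 M (Gp n) (Gm n)"] exI[of _ "\<lambda>n. rot2 M (Gp n) (Gm n)"])
      simp_all
qed

lemma vosa_0_of_1:
  assumes "is_vosa_1 c ((M, D1, D2), wt, t1, t2)"
  shows "is_vosa_0 c (from_vosa_1 ((M, D1, D2), wt, t1, t2))"
proof -
  have v: "is_vsa_1 (M, D1, D2)" and t: "t1 \<in> Od M" "t2 \<in> Od M" "t1 \<in> wt 3" "t2 \<in> wt 3"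
    using assms unfolding is_vosa_1_def by auto
  obtain L J G1 G2 where N: "NS_12 M c L J G1 G2" "NS_grading M wt L J"
    and G: "\<And>n v. v \<in> carr M \<Longrightarrow> Ymode M t1 (n + 1) {} v = G1 n v" "\<And>n v. v \<in> carr M \<Longrightarrow> Ymode M t2 (n + 1) {} v = G2 n v"
      "\<And>v. v \<in> carr M \<Longrightarrow> G1 (- 1) v = D1 v" "\<And>v. v \<in> carr M \<Longrightarrow> G2 (- 1) v = D2 v"
    using assms unfolding is_vosa_1_def prod.case by blast
  have v0: "is_vsa_0 (forget M, rotp M D1 D2, rotm M D1 D2)"
    using objects_1(3)[OF v] by (simp add: from_1_def)
  interpret susy_base "forget M" g_pm "rotp M D1 D2" "rotm M D1 D2"
    using v0 by (rule is_vsa_0_susy_base)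
  interpret M: gmodule M using graded by unfold_locales simp
  let ?tp = "rotp M (\<lambda>_::unit. t1) (\<lambda>_. t2) ()" and ?tm = "rotm M (\<lambda>_::unit. t1) (\<lambda>_. t2) ()"
  have o: "t1 \<in> gr M 1" "t2 \<in> gr M 1" using t by (simp_all add: gr_def)
  then have tc: "t1 \<in> carr M" "t2 \<in> carr M" using M.gr_carr by blast+
  have "?tp \<in> wt 3" "?tm \<in> wt 3"
    unfolding rot_defs by (rule M.NS_grading_lc[OF N(2)]; rule t)+
  moreover have "?tp \<in> gr M 1" "?tm \<in> gr M 1"
    unfolding rot_defs by (rule M.gr_lc; rule o)+
  then have "?tp \<in> Od M" "?tm \<in> Od M" by (simp_all add: gr_def)
  moreover have "NS_pm M c L J (\<lambda>n. rotp M (G1 n) (G2 n)) (\<lambda>n. rotm M (G1 n) (G2 n))"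
    by (rule NS_12_imp_NS_pm[OF N(1) M.gmodule_axioms])
  moreover have "Ymode (forget M) ?tp (n + 1) {} v = rotp M (G1 n) (G2 n) v \<and>
      Ymode (forget M) ?tm (n + 1) {} v = rotm M (G1 n) (G2 n) v" if "v \<in> carr M" for n v
  proof -
    have lc: "lc M = lc (forget M)" by (intro ext) (simp add: lc_def)
    have "Ymode (forget M) (lc M z z' (\<lambda>_::unit. t1) (\<lambda>_. t2) ()) (n + 1) {} v = lc M z z' (G1 n) (G2 n) v" for z z'
      unfolding lc using that tc by (subst Y_lc_left) (simp_all add: lc_def G)
    then show ?thesis unfolding rot_defs by blast
  qed
  moreover have "rotp M (G1 (- 1)) (G2 (- 1)) v = rotp M D1 D2 v \<and> rotm M (G1 (- 1)) (G2 (- 1)) v = rotm M D1 D2 v" if "v \<in> carr M" for v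
    using G that by (simp add: rot_defs lc_def)
  ultimately show ?thesis
    using N(2) v0 unfolding from_vosa_1_def from_1_def is_vosa_0_def prod.case
    by (intro conjI exI[of _ L] exI[of _ J] exI[of _ "\<lambda>n. rotp M (G1 n) (G2 n)"] exI[of _ "\<lambda>n. rotm M (G1 n) (G2 n)"])
      simp_all
qed

lemma vosa_1_inverse:
  assumes "gmodule M" "tp \<in> carr M" "tm \<in> carr M"
  shows "rotp M (\<lambda>_::unit. rot1 M (\<lambda>_::unit. tp) (\<lambda>_. tm) ()) (\<lambda>_. rot2 M (\<lambda>_::unit. tp) (\<lambda>_. tm) ()) () = tp"
    "rotm M (\<lambda>_::unit. rot1 M (\<lambda>_::unit. tp) (\<lambda>_. tm) ()) (\<lambda>_. rot2 M (\<lambda>_::unit. tp) (\<lambda>_. tm) ()) () = tm"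
    "rot1 M (\<lambda>_::unit. rotp M (\<lambda>_::unit. tp) (\<lambda>_. tm) ()) (\<lambda>_. rotm M (\<lambda>_::unit. tp) (\<lambda>_. tm) ()) () = tp"
    "rot2 M (\<lambda>_::unit. rotp M (\<lambda>_::unit. tp) (\<lambda>_. tm) ()) (\<lambda>_. rotm M (\<lambda>_::unit. tp) (\<lambda>_. tm) ()) () = tm"
proof -
  interpret gmodule M by fact
  have u: "(\<lambda>_::unit. f ()) = f" for f :: "unit \<Rightarrow> 'a" by (simp add: fun_eq_iff)
  show "rotp M (\<lambda>_::unit. rot1 M (\<lambda>_::unit. tp) (\<lambda>_. tm) ()) (\<lambda>_. rot2 M (\<lambda>_::unit. tp) (\<lambda>_. tm) ()) () = tp"
    "rotm M (\<lambda>_::unit. rot1 M (\<lambda>_::unit. tp) (\<lambda>_. tm) ()) (\<lambda>_. rot2 M (\<lambda>_::unit. tp) (\<lambda>_. tm) ()) () = tm"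
    "rot1 M (\<lambda>_::unit. rotp M (\<lambda>_::unit. tp) (\<lambda>_. tm) ()) (\<lambda>_. rotm M (\<lambda>_::unit. tp) (\<lambda>_. tm) ()) () = tp"
    "rot2 M (\<lambda>_::unit. rotp M (\<lambda>_::unit. tp) (\<lambda>_. tm) ()) (\<lambda>_. rotm M (\<lambda>_::unit. tp) (\<lambda>_. tm) ()) () = tm"
    unfolding u by (rule rot_rot; use assms in simp)+
qed

lemma vosa_1_objects:
  "is_vosa_0 c A \<Longrightarrow> is_vosa_1 c (to_vosa_1 A)" "is_vosa_0 c A \<Longrightarrow> from_vosa_1 (to_vosa_1 A) = A"
  "is_vosa_1 c B \<Longrightarrow> is_vosa_0 c (from_vosa_1 B)" "is_vosa_1 c B \<Longrightarrow> to_vosa_1 (from_vosa_1 B) = B"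
proof -
  obtain M Dp Dm wt tp tm where A: "A = ((M, Dp, Dm), wt, tp, tm)" by (metis prod_cases3)
  obtain N D1 D2 wt' t1 t2 where B: "B = ((N, D1, D2), wt', t1, t2)" by (metis prod_cases3)
  {
    assume a: "is_vosa_0 c A"
    show "is_vosa_1 c (to_vosa_1 A)" using vosa_1_of_0 a unfolding A by blast
    have v: "is_vsa_0 (M, Dp, Dm)" and t: "tp \<in> gr M 1" "tm \<in> gr M 1"
      using a unfolding A is_vosa_0_def gr_def by auto
    have M: "gmodule M" using v by (rule is_vsa_0D)
    note I = vosa_1_inverse[OF M t[THEN gmodule.gr_carr[OF M]]]
    show "from_vosa_1 (to_vosa_1 A) = A"
      using objects_1(2)[OF v] I(1,2) unfolding A to_vosa_1_def from_vosa_1_def to_1_def by simp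
  }
  assume b: "is_vosa_1 c B"
  show "is_vosa_0 c (from_vosa_1 B)" using vosa_0_of_1 b unfolding B by blast
  have v: "is_vsa_1 (N, D1, D2)" and t: "t1 \<in> gr N 1" "t2 \<in> gr N 1"
    using b unfolding B is_vosa_1_def gr_def by auto
  have "gmodule (forget N)" using is_vsa_0D(2) objects_1(3)[OF v] unfolding from_1_def by simp
  then have M: "gmodule N" by (simp add: gmodule_def)
  note I = vosa_1_inverse[OF M t[THEN gmodule.gr_carr[OF M]]]
  show "to_vosa_1 (from_vosa_1 B) = B"
    using objects_1(4)[OF v] I(3,4) unfolding B to_vosa_1_def from_vosa_1_def from_1_def by simp
qed

text \<open>The settings with two odd variables keep \<mu> unchanged under the object bijections, so
  keeping it in the hub as well leaves one translation of distinguished vectors, to the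
  \<tau>'s.\<close>

definition VOSA_core :: "'v::ab_group_add itself \<Rightarrow> complex \<Rightarrow>
    (('v vsa \<times> ('v \<Rightarrow> 'v) \<times> ('v \<Rightarrow> 'v)) \<times> (int \<Rightarrow> 'v set) \<times> 'v,
     (nat set \<Rightarrow> 'v) \<Rightarrow> (nat set \<Rightarrow> 'v)) cat" where
  "VOSA_core _ c = concrete_cat (is_core c) (\<lambda>((M, _), _). carr (ext_scalars M))
     (\<lambda>(A1, _, \<mu>1) (A2, _, \<mu>2). {\<gamma> \<in> vsa_op_hom {} A1 A2. \<gamma> (ext_vec \<mu>1) = ext_vec \<mu>2})"

lemma is_coreD:
  assumes "is_core c (A, wt, \<mu>)"
  shows "is_vsa_0 A" "\<mu> \<in> carr (fst A)"
proof -
  obtain M Dp Dm where A: "A = (M, Dp, Dm)" by (metis prod_cases3)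
  show v: "is_vsa_0 A" using assms unfolding A is_core_def by auto
  have "\<mu> \<in> gr M 0" using assms unfolding A is_core_def gr_def by auto
  then show "\<mu> \<in> carr (fst A)" using gmodule.gr_carr[OF is_vsa_0D(2)] v unfolding A by auto
qed

lemma is_category_VOSA_core: "is_category (VOSA_core TYPE('v::ab_group_add) c)"
  unfolding VOSA_core_def
proof (rule is_category_concrete)
  fix A B :: "('v vsa \<times> ('v \<Rightarrow> 'v) \<times> ('v \<Rightarrow> 'v)) \<times> (int \<Rightarrow> 'v set) \<times> 'v" and f x
  assume f: "f \<in> (case A of (A1, _, \<mu>1) \<Rightarrow> \<lambda>(A2, _, \<mu>2). {\<gamma> \<in> vsa_op_hom {} A1 A2. \<gamma> (ext_vec \<mu>1) = ext_vec \<mu>2}) B"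
  obtain M Dp Dm wt \<mu> where A: "A = ((M, Dp, Dm), wt, \<mu>)" by (metis prod_cases3)
  obtain M' Dp' Dm' wt' \<mu>' where B: "B = ((M', Dp', Dm'), wt', \<mu>')" by (metis prod_cases3)
  have h: "f \<in> vsa_hom {} M M'" using f unfolding A B by (simp add: vsa_op_hom_iff)
  show "f \<in> extensional ((\<lambda>((M, _), _). carr (ext_scalars M)) A)"
    using vsa_homD(1)[OF h] by (simp add: A)
  show "f x \<in> ((\<lambda>((M, _), _). carr (ext_scalars M)) B)" if "x \<in> ((\<lambda>((M, _), _). carr (ext_scalars M)) A)"
    using vsa_homD(2)[OF h] that by (simp add: A B)
next
  fix A :: "('v vsa \<times> ('v \<Rightarrow> 'v) \<times> ('v \<Rightarrow> 'v)) \<times> (int \<Rightarrow> 'v set) \<times> 'v"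
  assume a: "is_core c A"
  obtain M Dp Dm wt \<mu> where A: "A = ((M, Dp, Dm), wt, \<mu>)" by (metis prod_cases3)
  note C = is_coreD[OF a[unfolded A], simplified]
  have "ext_vec \<mu> \<in> carr (ext_scalars M)" by (rule gmodule.ext_vec_carr[OF is_vsa_0D(2)[OF C(1)] C(2)])
  then show "restrict (\<lambda>v. v) ((\<lambda>((M, _), _). carr (ext_scalars M)) A) \<in>
      (case A of (A1, _, \<mu>1) \<Rightarrow> \<lambda>(A2, _, \<mu>2). {\<gamma> \<in> vsa_op_hom {} A1 A2. \<gamma> (ext_vec \<mu>1) = ext_vec \<mu>2}) A"
    using vsa_op_hom_id[OF C(1)] by (simp add: A)
next
  fix A B C :: "('v vsa \<times> ('v \<Rightarrow> 'v) \<times> ('v \<Rightarrow> 'v)) \<times> (int \<Rightarrow> 'v set) \<times> 'v" and f g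
  obtain M Dp Dm wt \<mu> where A: "A = ((M, Dp, Dm), wt, \<mu>)" by (metis prod_cases3)
  obtain B1 wt' \<mu>' where B: "B = (B1, wt', \<mu>')" by (metis prod_cases3)
  obtain C1 wt'' \<mu>'' where C: "C = (C1, wt'', \<mu>'')" by (metis prod_cases3)
  assume "is_core c A" and
    "f \<in> (case A of (A1, _, \<mu>1) \<Rightarrow> \<lambda>(A2, _, \<mu>2). {\<gamma> \<in> vsa_op_hom {} A1 A2. \<gamma> (ext_vec \<mu>1) = ext_vec \<mu>2}) B"
    "g \<in> (case B of (A1, _, \<mu>1) \<Rightarrow> \<lambda>(A2, _, \<mu>2). {\<gamma> \<in> vsa_op_hom {} A1 A2. \<gamma> (ext_vec \<mu>1) = ext_vec \<mu>2}) C"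
  then have a: "is_core c ((M, Dp, Dm), wt, \<mu>)" and f: "f \<in> vsa_op_hom {} (M, Dp, Dm) B1" "f (ext_vec \<mu>) = ext_vec \<mu>'"
    and g: "g \<in> vsa_op_hom {} B1 C1" "g (ext_vec \<mu>') = ext_vec \<mu>''"
    unfolding A B C by simp_all
  note K = is_coreD[OF a, simplified]
  have "ext_vec \<mu> \<in> carr (ext_scalars M)" by (rule gmodule.ext_vec_carr[OF is_vsa_0D(2)[OF K(1)] K(2)])
  then show "compose ((\<lambda>((M, _), _). carr (ext_scalars M)) A) g f \<in>
      (case A of (A1, _, \<mu>1) \<Rightarrow> \<lambda>(A2, _, \<mu>2). {\<gamma> \<in> vsa_op_hom {} A1 A2. \<gamma> (ext_vec \<mu>1) = ext_vec \<mu>2}) C"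
    using vsa_op_hom_comp[OF K(1) f(1) g(1)] f(2) g(2) unfolding A C by (simp add: compose_eq)
qed

section \<open>Isomorphisms of the vertex operator categories\<close>

lemma hom_to_pm: "is_vsa_0 A \<Longrightarrow> is_vsa_0 B \<Longrightarrow> vsa_hom {0, 1} (to_pm A) (to_pm B) = vsa_op_hom {} A B"
  by (cases A; cases B) (simp only: to_pm_def prod.case hom_pm)

lemma hom_to_12: "is_vsa_0 A \<Longrightarrow> is_vsa_0 B \<Longrightarrow> vsa_hom {0, 1} (to_12 A) (to_12 B) = vsa_op_hom {} A B"
  by (cases A; cases B) (simp only: to_12_def prod.case hom_12)

lemma hom_to_1: "is_vsa_0 A \<Longrightarrow> is_vsa_0 B \<Longrightarrow> vsa_op_hom {0} (to_1 A) (to_1 B) = vsa_op_hom {} A B"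
  by (cases A; cases B) (simp only: to_1_def prod.case hom_1)

lemma iso_VOSA_pm: "isomorphic_cats (VOSA_core TYPE('v::ab_group_add) c) (VOSA_pm TYPE('v) c)"
  unfolding VOSA_core_def VOSA_pm_def
proof (rule concrete_iso[where F = "\<lambda>(A, wt, \<mu>). (to_pm A, wt, \<mu>)" and G = "\<lambda>(M, wt, \<mu>). (from_pm M, wt, \<mu>)"],
    rule is_category_VOSA_core[unfolded VOSA_core_def])
  fix X Y :: "('v vsa \<times> ('v \<Rightarrow> 'v) \<times> ('v \<Rightarrow> 'v)) \<times> (int \<Rightarrow> 'v set) \<times> 'v"
  obtain M Dp Dm wt \<mu> where X: "X = ((M, Dp, Dm), wt, \<mu>)" by (metis prod_cases3)
  obtain B wt' \<mu>' where Y: "Y = (B, wt', \<mu>')" by (metis prod_cases3)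
  assume c: "is_core c X"
  note v = is_coreD(1)[OF c[unfolded X]]
  show "is_vosa_pm c (case X of (A, wt, \<mu>) \<Rightarrow> (to_pm A, wt, \<mu>))"
    using c core_pm[OF v] unfolding X by simp
  show "(case case X of (A, wt, \<mu>) \<Rightarrow> (to_pm A, wt, \<mu>) of (M, wt, \<mu>) \<Rightarrow> (from_pm M, wt, \<mu>)) = X"
    using pm_objects(2)[OF v] by (simp add: X)
  show "(case case X of (A, wt, \<mu>) \<Rightarrow> (to_pm A, wt, \<mu>) of (M, _) \<Rightarrow> carr (ext_scalars M)) =
      ((\<lambda>((M, _), _). carr (ext_scalars M)) X)"
    by (simp add: X to_pm_def)
  assume d: "is_core c Y"
  show "(case case X of (A, wt, \<mu>) \<Rightarrow> (to_pm A, wt, \<mu>) of (M1, _, \<mu>1) \<Rightarrow>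
      \<lambda>(M2, _, \<mu>2). {\<gamma> \<in> vsa_hom {0, 1} M1 M2. \<gamma> (ext_vec \<mu>1) = ext_vec \<mu>2})
      (case Y of (A, wt, \<mu>) \<Rightarrow> (to_pm A, wt, \<mu>)) =
    (case X of (A1, _, \<mu>1) \<Rightarrow> \<lambda>(A2, _, \<mu>2). {\<gamma> \<in> vsa_op_hom {} A1 A2. \<gamma> (ext_vec \<mu>1) = ext_vec \<mu>2}) Y"
    using hom_to_pm[OF v is_coreD(1)[OF d[unfolded Y]]] unfolding X Y prod.case by simp
next
  fix X :: "'v vsa \<times> (int \<Rightarrow> 'v set) \<times> 'v"
  obtain M wt \<mu> where X: "X = (M, wt, \<mu>)" by (metis prod_cases3)
  assume c: "is_vosa_pm c X"
  then have v: "is_vsa_pm M" unfolding X is_vosa_pm_def by simp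
  show "(case case X of (M, wt, \<mu>) \<Rightarrow> (from_pm M, wt, \<mu>) of (A, wt, \<mu>) \<Rightarrow> (to_pm A, wt, \<mu>)) = X"
    using pm_objects(4)[OF v] by (simp add: X)
  show "is_core c (case X of (M, wt, \<mu>) \<Rightarrow> (from_pm M, wt, \<mu>))"
    using c core_pm[OF pm_objects(3)[OF v], of c wt \<mu>] unfolding X pm_objects(4)[OF v] prod.case by blast
qed

lemma iso_VOSA_12: "isomorphic_cats (VOSA_core TYPE('v::ab_group_add) c) (VOSA_12 TYPE('v) c)"
  unfolding VOSA_core_def VOSA_12_def
proof (rule concrete_iso[where F = "\<lambda>(A, wt, \<mu>). (to_12 A, wt, \<mu>)" and G = "\<lambda>(M, wt, \<mu>). (from_12 M, wt, \<mu>)"],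
    rule is_category_VOSA_core[unfolded VOSA_core_def])
  fix X Y :: "('v vsa \<times> ('v \<Rightarrow> 'v) \<times> ('v \<Rightarrow> 'v)) \<times> (int \<Rightarrow> 'v set) \<times> 'v"
  obtain M Dp Dm wt \<mu> where X: "X = ((M, Dp, Dm), wt, \<mu>)" by (metis prod_cases3)
  obtain B wt' \<mu>' where Y: "Y = (B, wt', \<mu>')" by (metis prod_cases3)
  assume c: "is_core c X"
  note v = is_coreD(1)[OF c[unfolded X]]
  show "is_vosa_12 c (case X of (A, wt, \<mu>) \<Rightarrow> (to_12 A, wt, \<mu>))"
    using c core_12[OF v] unfolding X by simp
  show "(case case X of (A, wt, \<mu>) \<Rightarrow> (to_12 A, wt, \<mu>) of (M, wt, \<mu>) \<Rightarrow> (from_12 M, wt, \<mu>)) = X"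
    using objects_12(2)[OF v] by (simp add: X)
  show "(case case X of (A, wt, \<mu>) \<Rightarrow> (to_12 A, wt, \<mu>) of (M, _) \<Rightarrow> carr (ext_scalars M)) =
      ((\<lambda>((M, _), _). carr (ext_scalars M)) X)"
    by (simp add: X to_12_def)
  assume d: "is_core c Y"
  show "(case case X of (A, wt, \<mu>) \<Rightarrow> (to_12 A, wt, \<mu>) of (M1, _, \<mu>1) \<Rightarrow>
      \<lambda>(M2, _, \<mu>2). {\<gamma> \<in> vsa_hom {0, 1} M1 M2. \<gamma> (ext_vec \<mu>1) = ext_vec \<mu>2})
      (case Y of (A, wt, \<mu>) \<Rightarrow> (to_12 A, wt, \<mu>)) =
    (case X of (A1, _, \<mu>1) \<Rightarrow> \<lambda>(A2, _, \<mu>2). {\<gamma> \<in> vsa_op_hom {} A1 A2. \<gamma> (ext_vec \<mu>1) = ext_vec \<mu>2}) Y"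
    using hom_to_12[OF v is_coreD(1)[OF d[unfolded Y]]] unfolding X Y prod.case by simp
next
  fix X :: "'v vsa \<times> (int \<Rightarrow> 'v set) \<times> 'v"
  obtain M wt \<mu> where X: "X = (M, wt, \<mu>)" by (metis prod_cases3)
  assume c: "is_vosa_12 c X"
  then have v: "is_vsa_12 M" unfolding X is_vosa_12_def by simp
  show "(case case X of (M, wt, \<mu>) \<Rightarrow> (from_12 M, wt, \<mu>) of (A, wt, \<mu>) \<Rightarrow> (to_12 A, wt, \<mu>)) = X"
    using objects_12(4)[OF v] by (simp add: X)
  show "is_core c (case X of (M, wt, \<mu>) \<Rightarrow> (from_12 M, wt, \<mu>))"
    using c core_12[OF objects_12(3)[OF v], of c wt \<mu>] unfolding X objects_12(4)[OF v] prod.case by blast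
qed

lemma vsa_hom_ext_vec:
  assumes \<gamma>: "\<gamma> \<in> vsa_hom {} M M'" and M: "prevertex M" "prevertex M'"
    and u: "u \<in> carr M" "u' \<in> carr M'" "\<gamma> (ext_vec u) = ext_vec u'"
  shows "\<gamma> (ext_vec (cs M z u)) = ext_vec (cs M' z u')"
    and "endo M 1 D \<Longrightarrow> endo M' 1 D' \<Longrightarrow> intertwines M \<gamma> D D' \<Longrightarrow> \<gamma> (ext_vec (D u)) = ext_vec (D' u')"
    and "v \<in> carr M \<Longrightarrow> v' \<in> carr M' \<Longrightarrow> \<gamma> (ext_vec v) = ext_vec v' \<Longrightarrow> \<gamma> (ext_vec (u + v)) = ext_vec (u' + v')"
    and "v \<in> carr M \<Longrightarrow> v' \<in> carr M' \<Longrightarrow> \<gamma> (ext_vec v) = ext_vec v' \<Longrightarrow>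
      \<gamma> (ext_vec (Ymode M u n {} v)) = ext_vec (Ymode M' u' n {} v')"
proof -
  interpret X: prevertex M by fact
  interpret X': prevertex M' by fact
  note c = X.ext_vec_carr[OF u(1)]
  show "\<gamma> (ext_vec (cs M z u)) = ext_vec (cs M' z u')"
    using vsa_homD(4)[OF \<gamma> c, of "gconst z"] u by (simp add: X.ext_vec_simps X'.ext_vec_simps)
  show "\<gamma> (ext_vec (D u)) = ext_vec (D' u')" if "endo M 1 D" "endo M' 1 D'" "intertwines M \<gamma> D D'"
    using that(3) c u(3) unfolding intertwines_def
    by (metis X.ext_vec_simps(2)[OF that(1)] X'.ext_vec_simps(2)[OF that(2)])
  assume v: "v \<in> carr M" "v' \<in> carr M'" "\<gamma> (ext_vec v) = ext_vec v'"
  note d = X.ext_vec_carr[OF v(1)]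
  have a: "ext_vec (x + y) = ext_vec x + ext_vec y" for x y :: 'a by (simp add: ext_vec_def fun_eq_iff)
  show "\<gamma> (ext_vec (u + v)) = ext_vec (u' + v')"
    unfolding a using vsa_homD(3)[OF \<gamma> c d] u v by simp
  show "\<gamma> (ext_vec (Ymode M u n {} v)) = ext_vec (Ymode M' u' n {} v')"
    using vsa_homD(5)[OF \<gamma> c d empty_subsetI, of n] u v
    by (simp add: X.Ymode_E_vec_vec X'.Ymode_E_vec_vec)
qed

lemma vsa_hom_ext_vec_lc:
  assumes \<gamma>: "\<gamma> \<in> vsa_hom {} M M'" and M: "prevertex M" "prevertex M'"
    and u: "u \<in> carr M" "u' \<in> carr M'" "\<gamma> (ext_vec u) = ext_vec u'"
    and v: "v \<in> carr M" "v' \<in> carr M'" "\<gamma> (ext_vec v) = ext_vec v'"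
  shows "\<gamma> (ext_vec (lc M z y (\<lambda>_. u) (\<lambda>_. v) x)) = ext_vec (lc M' z y (\<lambda>_. u') (\<lambda>_. v') x)"
proof -
  interpret X: prevertex M by fact
  interpret X': prevertex M' by fact
  show ?thesis
    unfolding lc_def
    by (rule vsa_hom_ext_vec(3)[OF \<gamma> M _ _ vsa_hom_ext_vec(1)[OF \<gamma> M u] _ _ vsa_hom_ext_vec(1)[OF \<gamma> M v]])
      (use u v in simp_all)
qed

text \<open>Intertwining D^+ and D^- carries \<mu> to the \<tau>'s; conversely \<mu> is half a mode
  of one \<tau> applied to the other, which any morphism preserves.\<close>

lemma core_hom:
  assumes X: "is_core c ((M, Dp, Dm), wt, \<mu>)" and Y: "is_core c ((M', Dp', Dm'), wt', \<mu>')"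
    and h: "\<gamma> \<in> vsa_op_hom {} (M, Dp, Dm) (M', Dp', Dm')"
  shows "\<gamma> (ext_vec (- Dp \<mu>)) = ext_vec (- Dp' \<mu>') \<and> \<gamma> (ext_vec (Dm \<mu>)) = ext_vec (Dm' \<mu>') \<longleftrightarrow>
    \<gamma> (ext_vec \<mu>) = ext_vec \<mu>'"
proof -
  note C = is_coreD[OF X, simplified] and C' = is_coreD[OF Y, simplified]
  note V = is_vsa_0D[OF C(1)] and V' = is_vsa_0D[OF C'(1)]
  interpret prevertex M by (rule V(1))
  interpret M': prevertex M' by (rule V'(1))
  have \<gamma>: "\<gamma> \<in> vsa_hom {} M M'" and I: "intertwines M \<gamma> Dp Dp'" "intertwines M \<gamma> Dm Dm'"
    using h by (simp_all add: vsa_op_hom_iff)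
  note H = vsa_hom_ext_vec[OF \<gamma> V(1) V'(1)]
  have c: "Dp \<mu> \<in> carr M" "Dm \<mu> \<in> carr M" "Dp' \<mu>' \<in> carr M'" "Dm' \<mu>' \<in> carr M'"
    using C(2) C'(2) endoD(1)[OF V(3)] endoD(1)[OF V(4)] M'.endoD(1)[OF V'(3)] M'.endoD(1)[OF V'(4)] by blast+
  have m: "- x = cs M (- 1) x" if "x \<in> carr M" for x using cs_minus_left[OF that, of 1] that by simp
  have m': "- x = cs M' (- 1) x" if "x \<in> carr M'" for x using M'.cs_minus_left[OF that, of 1] that by simp
  show ?thesis
  proof
    assume g: "\<gamma> (ext_vec \<mu>) = ext_vec \<mu>'"
    show "\<gamma> (ext_vec (- Dp \<mu>)) = ext_vec (- Dp' \<mu>') \<and> \<gamma> (ext_vec (Dm \<mu>)) = ext_vec (Dm' \<mu>')"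
      unfolding m[OF c(1)] m'[OF c(3)]
      using H(1)[OF c(1,3) H(2)[OF C(2) C'(2) g V(3) V'(3) I(1)], of "- 1"] H(2)[OF C(2) C'(2) g V(4) V'(4) I(2)] by blast
  next
    assume g: "\<gamma> (ext_vec (- Dp \<mu>)) = ext_vec (- Dp' \<mu>') \<and> \<gamma> (ext_vec (Dm \<mu>)) = ext_vec (Dm' \<mu>')"
    have "\<gamma> (ext_vec (Ymode M (- Dp \<mu>) 1 {} (Dm \<mu>))) = ext_vec (Ymode M' (- Dp' \<mu>') 1 {} (Dm' \<mu>'))"
      by (rule H(4)) (use g c in simp_all)
    from H(1)[OF Y_carr M'.Y_carr this, of "1 / 2"] show "\<gamma> (ext_vec \<mu>) = ext_vec \<mu>'"
      by (simp only: core_to_0(2)[OF X] core_to_0(2)[OF Y])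
  qed
qed

lemma iso_VOSA_0: "isomorphic_cats (VOSA_core TYPE('v::ab_group_add) c) (VOSA_0 TYPE('v) c)"
  unfolding VOSA_core_def VOSA_0_def
proof (rule concrete_iso[where F = "\<lambda>((M, Dp, Dm), wt, \<mu>). ((M, Dp, Dm), wt, - Dp \<mu>, Dm \<mu>)" and
      G = "\<lambda>((M, Dp, Dm), wt, tp, tm). ((M, Dp, Dm), wt, cs M (1 / 2) (Ymode M tp 1 {} tm))"],
    rule is_category_VOSA_core[unfolded VOSA_core_def])
  fix X Y :: "('v vsa \<times> ('v \<Rightarrow> 'v) \<times> ('v \<Rightarrow> 'v)) \<times> (int \<Rightarrow> 'v set) \<times> 'v"
  obtain M Dp Dm wt \<mu> where X: "X = ((M, Dp, Dm), wt, \<mu>)" by (metis prod_cases3)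
  obtain M' Dp' Dm' wt' \<mu>' where Y: "Y = ((M', Dp', Dm'), wt', \<mu>')" by (metis prod_cases3)
  assume c: "is_core c X"
  note C = core_to_0[OF c[unfolded X]]
  show "is_vosa_0 c ((\<lambda>((M, Dp, Dm), wt, \<mu>). ((M, Dp, Dm), wt, - Dp \<mu>, Dm \<mu>)) X)"
    using C(1) by (simp add: X)
  show "(\<lambda>((M, Dp, Dm), wt, tp, tm). ((M, Dp, Dm), wt, cs M (1 / 2) (Ymode M tp 1 {} tm)))
      ((\<lambda>((M, Dp, Dm), wt, \<mu>). ((M, Dp, Dm), wt, - Dp \<mu>, Dm \<mu>)) X) = X"
    using C(2) unfolding X prod.case by blast
  show "(\<lambda>((M, _), _). carr (ext_scalars M)) ((\<lambda>((M, Dp, Dm), wt, \<mu>). ((M, Dp, Dm), wt, - Dp \<mu>, Dm \<mu>)) X) =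
      ((\<lambda>((M, _), _). carr (ext_scalars M)) X)"
    by (simp add: X)
  assume d: "is_core c Y"
  show "(\<lambda>(A1, _, \<sigma>1, \<tau>1) (A2, _, \<sigma>2, \<tau>2). {\<gamma> \<in> vsa_op_hom {} A1 A2. \<gamma> (ext_vec \<sigma>1) = ext_vec \<sigma>2 \<and> \<gamma> (ext_vec \<tau>1) = ext_vec \<tau>2})
      ((\<lambda>((M, Dp, Dm), wt, \<mu>). ((M, Dp, Dm), wt, - Dp \<mu>, Dm \<mu>)) X)
      ((\<lambda>((M, Dp, Dm), wt, \<mu>). ((M, Dp, Dm), wt, - Dp \<mu>, Dm \<mu>)) Y) =
    (case X of (A1, _, \<mu>1) \<Rightarrow> \<lambda>(A2, _, \<mu>2). {\<gamma> \<in> vsa_op_hom {} A1 A2. \<gamma> (ext_vec \<mu>1) = ext_vec \<mu>2}) Y"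
    using core_hom[OF c[unfolded X] d[unfolded Y]] unfolding X Y prod.case by blast
next
  fix X :: "('v vsa \<times> ('v \<Rightarrow> 'v) \<times> ('v \<Rightarrow> 'v)) \<times> (int \<Rightarrow> 'v set) \<times> 'v \<times> 'v"
  obtain M Dp Dm wt tp tm where X: "X = ((M, Dp, Dm), wt, tp, tm)" by (metis prod_cases3)
  assume c: "is_vosa_0 c X"
  note C = core_of_0[OF c[unfolded X]]
  show "is_core c ((\<lambda>((M, Dp, Dm), wt, tp, tm). ((M, Dp, Dm), wt, cs M (1 / 2) (Ymode M tp 1 {} tm))) X)"
    using C(1) unfolding X prod.case .
  show "(\<lambda>((M, Dp, Dm), wt, \<mu>). ((M, Dp, Dm), wt, - Dp \<mu>, Dm \<mu>))
      ((\<lambda>((M, Dp, Dm), wt, tp, tm). ((M, Dp, Dm), wt, cs M (1 / 2) (Ymode M tp 1 {} tm))) X) = X"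
    unfolding X prod.case C(2,3) ..
qed

text \<open>Each pair of vectors consists of complex linear combinations of the other, and morphisms
  are linear.\<close>

lemma vosa_1_hom:
  assumes M: "prevertex M" "prevertex M'" and t: "tp \<in> carr M" "tm \<in> carr M" "tp' \<in> carr M'" "tm' \<in> carr M'"
    and \<gamma>: "\<gamma> \<in> vsa_hom {} M M'"
  shows "\<gamma> (ext_vec (rot1 M (\<lambda>_::unit. tp) (\<lambda>_. tm) ())) = ext_vec (rot1 M' (\<lambda>_::unit. tp') (\<lambda>_. tm') ()) \<and>
      \<gamma> (ext_vec (rot2 M (\<lambda>_::unit. tp) (\<lambda>_. tm) ())) = ext_vec (rot2 M' (\<lambda>_::unit. tp') (\<lambda>_. tm') ()) \<longleftrightarrow>
    \<gamma> (ext_vec tp) = ext_vec tp' \<and> \<gamma> (ext_vec tm) = ext_vec tm'" (is "?l \<longleftrightarrow> ?r")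
proof
  assume ?r
  then have r: "\<gamma> (ext_vec tp) = ext_vec tp'" "\<gamma> (ext_vec tm) = ext_vec tm'" by blast+
  show ?l
    unfolding rot_defs by (intro conjI vsa_hom_ext_vec_lc[OF \<gamma> M t(1) t(3) r(1) t(2) t(4) r(2)])
next
  assume l: ?l
  interpret prevertex M by fact
  interpret M': prevertex M' by fact
  let ?t1 = "rot1 M (\<lambda>_::unit. tp) (\<lambda>_. tm) ()" and ?t2 = "rot2 M (\<lambda>_::unit. tp) (\<lambda>_. tm) ()"
  let ?t1' = "rot1 M' (\<lambda>_::unit. tp') (\<lambda>_. tm') ()" and ?t2' = "rot2 M' (\<lambda>_::unit. tp') (\<lambda>_. tm') ()"
  have c: "?t1 \<in> carr M" "?t2 \<in> carr M" "?t1' \<in> carr M'" "?t2' \<in> carr M'"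
    using t by (simp_all add: rot_defs lc_def)
  note I = vosa_1_inverse[OF gmodule_axioms t(1,2)] vosa_1_inverse[OF M'.gmodule_axioms t(3,4)]
  have "\<gamma> (ext_vec (rotp M (\<lambda>_::unit. ?t1) (\<lambda>_. ?t2) ())) = ext_vec (rotp M' (\<lambda>_::unit. ?t1') (\<lambda>_. ?t2') ())"
    "\<gamma> (ext_vec (rotm M (\<lambda>_::unit. ?t1) (\<lambda>_. ?t2) ())) = ext_vec (rotm M' (\<lambda>_::unit. ?t1') (\<lambda>_. ?t2') ())"
    unfolding rotp_def rotm_def
    by (rule vsa_hom_ext_vec_lc[OF \<gamma> M c(1) c(3) conjunct1[OF l] c(2) c(4) conjunct2[OF l]])+
  then show ?r unfolding I by blast
qed

text \<open>That the source is a category is taken from \<open>iso_VOSA_0\<close>, where the laws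
  were transported from the hub.\<close>

lemma iso_VOSA_1: "isomorphic_cats (VOSA_0 TYPE('v::ab_group_add) c) (VOSA_1 TYPE('v) c)"
  unfolding VOSA_0_def VOSA_1_def
proof (rule concrete_iso[where F = to_vosa_1 and G = from_vosa_1])
  show "is_category (concrete_cat (is_vosa_0 c) (\<lambda>((M :: 'v vsa, _), _). carr (ext_scalars M))
     (\<lambda>(A1, _, \<sigma>1, \<tau>1) (A2, _, \<sigma>2, \<tau>2). {\<gamma> \<in> vsa_op_hom {} A1 A2.
        \<gamma> (ext_vec \<sigma>1) = ext_vec \<sigma>2 \<and> \<gamma> (ext_vec \<tau>1) = ext_vec \<tau>2}))"
    using iso_VOSA_0 unfolding isomorphic_cats_def VOSA_0_def by blast
  fix X Y :: "('v vsa \<times> ('v \<Rightarrow> 'v) \<times> ('v \<Rightarrow> 'v)) \<times> (int \<Rightarrow> 'v set) \<times> 'v \<times> 'v"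
  obtain M Dp Dm wt tp tm where X: "X = ((M, Dp, Dm), wt, tp, tm)" by (metis prod_cases3)
  obtain M' Dp' Dm' wt' tp' tm' where Y: "Y = ((M', Dp', Dm'), wt', tp', tm')" by (metis prod_cases3)
  show "(\<lambda>((M, _), _). carr (ext_scalars M)) (to_vosa_1 X) = ((\<lambda>((M, _), _). carr (ext_scalars M)) X)"
    by (simp add: X to_vosa_1_def to_1_def)
  assume "is_vosa_0 c X" "is_vosa_0 c Y"
  then have v: "is_vsa_0 (M, Dp, Dm)" "is_vsa_0 (M', Dp', Dm')"
    and t: "tp \<in> gr M 1" "tm \<in> gr M 1" "tp' \<in> gr M' 1" "tm' \<in> gr M' 1"
    unfolding X Y is_vosa_0_def gr_def by auto
  note V = is_vsa_0D[OF v(1)] and V' = is_vsa_0D[OF v(2)]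
  note c = t(1,2)[THEN gmodule.gr_carr[OF V(2)]] t(3,4)[THEN gmodule.gr_carr[OF V'(2)]]
  have h: "\<gamma> \<in> vsa_hom {} M M'" if "\<gamma> \<in> vsa_op_hom {} (M, Dp, Dm) (M', Dp', Dm')" for \<gamma>
    using that by (simp add: vsa_op_hom_iff)
  show "(case to_vosa_1 X of (A1, _, \<sigma>1, \<tau>1) \<Rightarrow> \<lambda>(A2, _, \<sigma>2, \<tau>2). {\<gamma> \<in> vsa_op_hom {0} A1 A2.
        \<gamma> (ext_vec \<sigma>1) = ext_vec \<sigma>2 \<and> \<gamma> (ext_vec \<tau>1) = ext_vec \<tau>2}) (to_vosa_1 Y) =
    (case X of (A1, _, \<sigma>1, \<tau>1) \<Rightarrow> \<lambda>(A2, _, \<sigma>2, \<tau>2). {\<gamma> \<in> vsa_op_hom {} A1 A2.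
        \<gamma> (ext_vec \<sigma>1) = ext_vec \<sigma>2 \<and> \<gamma> (ext_vec \<tau>1) = ext_vec \<tau>2}) Y"
    using vosa_1_hom[OF V(1) V'(1) c h] unfolding X Y to_vosa_1_def prod.case hom_to_1[OF v] by blast
qed (rule vosa_1_objects; assumption)+

theorem theorem6p31:
  shows
    "isomorphic_cats (VSA_pm TYPE('v::ab_group_add)) (VSA_12 TYPE('v)) \<and>
     isomorphic_cats (VSA_pm TYPE('v)) (VSA_1 TYPE('v)) \<and>
     isomorphic_cats (VSA_pm TYPE('v)) (VSA_0 TYPE('v)) \<and>
     isomorphic_cats (VSA_12 TYPE('v)) (VSA_1 TYPE('v)) \<and>
     isomorphic_cats (VSA_12 TYPE('v)) (VSA_0 TYPE('v)) \<and>
     isomorphic_cats (VSA_1 TYPE('v)) (VSA_0 TYPE('v)) \<and>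
     (\<forall>c :: complex.
       isomorphic_cats (VOSA_pm TYPE('v) c) (VOSA_12 TYPE('v) c) \<and>
       isomorphic_cats (VOSA_pm TYPE('v) c) (VOSA_1 TYPE('v) c) \<and>
       isomorphic_cats (VOSA_pm TYPE('v) c) (VOSA_0 TYPE('v) c) \<and>
       isomorphic_cats (VOSA_12 TYPE('v) c) (VOSA_1 TYPE('v) c) \<and>
       isomorphic_cats (VOSA_12 TYPE('v) c) (VOSA_0 TYPE('v) c) \<and>
       isomorphic_cats (VOSA_1 TYPE('v) c) (VOSA_0 TYPE('v) c))"
proof -
  note V = iso_VSA_pm[where 'v = 'v] iso_VSA_12[where 'v = 'v] iso_VSA_1[where 'v = 'v]
  note V' = V[THEN isomorphic_cats_sym]
  have O: "isomorphic_cats (VOSA_pm TYPE('v) c) (VOSA_0 TYPE('v) c)"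
    "isomorphic_cats (VOSA_12 TYPE('v) c) (VOSA_0 TYPE('v) c)"
    "isomorphic_cats (VOSA_1 TYPE('v) c) (VOSA_0 TYPE('v) c)" for c
    by (rule isomorphic_cats_trans[OF isomorphic_cats_sym iso_VOSA_0], rule iso_VOSA_pm iso_VOSA_12)+
      (rule isomorphic_cats_sym, rule iso_VOSA_1)
  note O' = O[THEN isomorphic_cats_sym]
  show ?thesis
    by (intro conjI allI V' O isomorphic_cats_trans[OF V'(1) V(2)] isomorphic_cats_trans[OF V'(1) V(3)]
        isomorphic_cats_trans[OF V'(2) V(3)] isomorphic_cats_trans[OF O(1) O'(2)] isomorphic_cats_trans[OF O(1) O'(3)]
        isomorphic_cats_trans[OF O(2) O'(3)])
qed

end
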